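(* Let $j$ be a QS flow on $\mathsf A$, let $Y=Y^{j,F}$, where $F\in B(\widehat{\mathsf k})\,\overline\otimes\,\mathsf A$, and let $\beta\in\mathbb R$. (a) The following are equivalent: (i) $\big(e^{-\beta t/2}Y_t\big)_{t\ge0}$ is contractive; (ii) $F\in\mathfrak{qc}_\beta(\mathsf k,\mathsf A)$. Thus $Y$ is quasicontractive if and only if $F\in\mathfrak{qc}(\mathsf k,\mathsf A)$. (b) The following are equivalent: (i) $Y$ is isometric; (ii) $q(F)=0$. (c) If $Y$ is coisometric then $q(F^* )=0$.
   Context: All Hilbert spaces are complex, with inner products linear in the second argument. $\mathsf A$ is a von Neumann algebra acting faithfully on a Hilbert space $\mathfrak h$; $\mathsf k$ is a Hilbert space and $\widehat{\mathsf k}:=\mathbb C\oplus\mathsf k$; $\widehat c:=(1,c)$ for $c\in\mathsf k$, $\widehat f(s):=\widehat{f(s)}$. $\underline\otimes$ and $\overline\otimes$ denote algebraic and ultraweak tensor products. $\Delta:=\begin{bmatrix}0&0\\0&I_{\mathsf k}\end{bmatrix}\in B(\widehat{\mathsf k})$, $\Delta^\perp:=I-\Delta$; their ampliations are denoted in the same way. For $F\in B(\widehat{\mathsf k})\overline\otimes\mathsf A$, $q(F):=F^*+F+F^*\Delta F$; $\mathfrak{qc}_\beta(\mathsf k,\mathsf A):=\{F\in B(\widehat{\mathsf k})\overline\otimes\mathsf A: q(F)\le\beta\Delta^\perp\}$ and $\mathfrak{qc}(\mathsf k,\mathsf A):=\bigcup_{\beta\in\mathbb R}\mathfrak{qc}_\beta(\mathsf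 k,\mathsf A)$. Fock space: for a subinterval $J$ of $\mathbb R_+$, $\mathcal F_J$ is the symmetric Fock space over $L^2(J;\mathsf k)$, $\mathsf N_J:=B(\mathcal F_J)$, $I_J$ is the identity on $\mathcal F_J$; subscripts are omitted for $J=\mathbb R_+$; $\mathcal F=\mathcal F_{[0,t[}\otimes\mathcal F_{[t,\infty[}$. $\mathbb S$ is the space of right-continuous step functions in $L^2(\mathbb R_+;\mathsf k)$; $f_J$ equals $f$ on $J$ and $0$ elsewhere; $\varpi(f):=e^{-\|f\|^2/2}\big((n!)^{-1/2}f^{\otimes n}\big)_{n\ge0}$; $\mathcal E$ is the linear span of $\{\varpi(f):f\in\mathbb S\}$. $E_u$ denotes $|u\rangle$ tensored with identity operators (e.g. $E_{\varpi(f)}:\mathfrak h\to\mathfrak h\otimes\mathcal F$, $v\mapsto v\otimes\varpi(f)$) and $E^u:=(E_u)^*$. Processes: an (operator) process on $\mathfrak h$ is a family $X=(X_t)_{t\ge0}$ of (possibly unbounded) operators on $\mathfrak h\otimes\mathcal F$ with domain $\mathfrak h\underline\otimes\mathcal E$ that is weakly measurable in $t$ and adapted: $E^{\varpi(f)}X_tE_{\varpi(g)}=\langle\varpi(f_{[t,\infty[}),\varpi(g_{[t,\infty[})\rangle E^{\varpi(f_{[0,t[})}X_tE_{\varpi(g_{[0,t[})}$ for $f,g\in\mathbb S$; it is a process in $\mathsf A$ if $E^{\varpi(f)}X_tE_{\varpi(g)}\in\mathsf A$ for all $f,g,t$, and is bounded if each $X_t$ is bounded (then identified with its extension to $\mathfrak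 h\otimes\mathcal F$); it is contractive, isometric or coisometric if each $X_t$ is, and quasicontractive if there is $\omega\in\mathbb R$ with $e^{-\omega t}\|X_t\|\le1$ for all $t\ge0$. A (mapping) process on $\mathsf A$ is a family $k=(k_t)_{t\ge0}$ of linear maps on $\mathsf A$ with $(k_t(a))_{t\ge0}$ a process in $\mathsf A$ for each $a$. If $k$ is normal and completely bounded (i.e. each $k_t$ is), then $k_r(a)=k_{r)}(a)\otimes I_{[r,\infty[}$ with $k_{r)}:\mathsf A\to\mathsf A\overline\otimes\mathsf N_{[0,r[}$; put $\widehat k_r:=k_{r)}\overline\otimes\operatorname{id}_{\mathsf N_{[r,\infty[}}$ and $\widetilde k_t:=\operatorname{id}_{B(\widehat{\mathsf k})}\overline\otimes k_t$. Let $T_r:\mathcal F\to\mathcal F_{[r,\infty[}$ be the unitary with $\varpi(f)\mapsto\varpi(f_r)$, $f_r(s)=f(s-r)$, and $\sigma_r:\mathsf A\overline\otimes\mathsf N\to\mathsf A\overline\otimes\mathsf N_{[r,\infty[}$ the normal *-isomorphism with $a\otimes z\mapsto a\otimes T_rzT_r^*$. $k$ is a QS cocycle if $k_0(a)=a\otimes I_{\mathcal F}$ and $k_{r+t}=\widehat k_r\circ\sigma_r\circ k_t$ for all $r,t\ge0$; it is a QS flow if moreover it is pointwise ultraweakly continuous in $t$, *-homomorphic and unital. QS integrals: for an operator process $X$, $\widetilde X_t:=I_{\widehat{\mathsf k}}\underline\otimes X_t$. $\widehat\nabla_s$ is the linear operator with domain $\mathfrak h\underline\otimes\mathcal E$,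 $\widehat\nabla_s(u\varpi(f))=\widehat f(s)u\varpi(f)$. A family $G=(G_t)_{t\ge0}$ of operators on $\widehat{\mathsf k}\otimes\mathfrak h\otimes\mathcal F$ is QS integrable if, for all $\zeta\in\mathfrak h\underline\otimes\mathcal E$: $\widehat\nabla_t\zeta\in\operatorname{Dom}G_t$ for all $t$; $s\mapsto\Delta^\perp G_s\widehat\nabla_s\zeta$ is locally integrable; $s\mapsto\Delta G_s\widehat\nabla_s\zeta$ is locally square-integrable; and $E^{\varpi(f)}G_t\widehat\nabla_tE_{\varpi(g)}=\langle\varpi(f_{[t,\infty[}),\varpi(g_{[t,\infty[})\rangle E^{\widehat f(t)\varpi(f_{[0,t[})}G_tE_{\widehat g(t)\varpi(g_{[0,t[})}$ for $f,g\in\mathbb S$. Its QS integral is the continuous operator process determined by $\langle\zeta',\int_0^tG_s\,d\Lambda_s\,\zeta\rangle=\int_0^t\langle\widehat\nabla_s\zeta',G_s\widehat\nabla_s\zeta\rangle\,ds$ for $\zeta,\zeta'\in\mathfrak h\underline\otimes\mathcal E$. Perturbation processes: for $F\in B(\widehat{\mathsf k})\overline\otimes\mathsf A$, $Y^{j,F}$ denotes the unique strong solution of $Y_0=I$, $dY_t=\widetilde\jmath_t(F)\widetilde Y_t\,d\Lambda_t$, i.e. the unique operator process $Y$ such that $(\widetilde\jmath_t(F)\widetilde Y_t)_{t\ge0}$ is QS integrable and $Y_t=I+\int_0^t\widetilde\jmath_s(F)\widetilde Y_s\,d\Lambda_s$ for all $t$ (it exists for every $F$). *)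

theory Defs
  imports "HOL-Analysis.Analysis" "HOL-Library.Poly_Mapping"
begin

class scaleC =
  fixes scaleC :: "complex \<Rightarrow> 'a \<Rightarrow> 'a" (infixr \<open>*\<^sub>C\<close> 75)

class complex_vector = real_vector + scaleC +
  assumes scaleC_add_right: "c *\<^sub>C (x + y) = c *\<^sub>C x + c *\<^sub>C y"
    and scaleC_add_left: "(c + d) *\<^sub>C x = c *\<^sub>C x + d *\<^sub>C x"
    and scaleC_scaleC [simp]: "c *\<^sub>C d *\<^sub>C x = (c * d) *\<^sub>C x"
    and scaleC_one [simp]: "1 *\<^sub>C x = x"
    and scaleR_scaleC: "r *\<^sub>R x = complex_of_real r *\<^sub>C x"

global_interpretation complex_vector: vector_space "scaleC :: complex \<Rightarrow> 'a \<Rightarrow> 'a::complex_vector"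
  defines cspan = complex_vector.span
  by standard (auto simp: scaleC_add_right scaleC_add_left)

text \<open>The inner product is linear in the second argument. The real inner product inherited from
  \<open>real_inner\<close> is its real part, so norm and topology are those of the library.\<close>

class complex_inner = complex_vector + real_inner +
  fixes cinner :: "'a \<Rightarrow> 'a \<Rightarrow> complex"
  assumes cinner_commute: "cinner x y = cnj (cinner y x)"
    and cinner_add_right: "cinner x (y + z) = cinner x y + cinner x z"
    and cinner_scaleC_right [simp]: "cinner x (c *\<^sub>C y) = c * cinner x y"
    and inner_cinner: "inner x y = Re (cinner x y)"

class chilbert_space = complex_inner + complete_space
begin
subclass banach ..
end

lemma cinner_add_left: "cinner (x + y) z = cinner x z + cinner (y::'a::complex_inner) z"
  by (metis cinner_commute cinner_add_right complex_cnj_add)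

lemma cinner_scaleC_left [simp]: "cinner (c *\<^sub>C x) y = cnj c * cinner (x::'a::complex_inner) y"
  by (metis cinner_commute cinner_scaleC_right complex_cnj_mult)

lemma cinner_zero [simp]: "cinner (0::'a::complex_inner) x = 0" "cinner x (0::'a::complex_inner) = 0"
  using cinner_add_right[of x 0 0] cinner_add_left[of 0 0 x] by auto

lemma cinner_self: "cinner (x::'a::complex_inner) x = complex_of_real ((norm x)\<^sup>2)"
proof -
  have "Im (cinner x x) = 0"
    using arg_cong[OF cinner_commute[of x x], of Im] by simp
  moreover have "Re (cinner x x) = (norm x)\<^sup>2"
    by (simp add: inner_cinner[symmetric] power2_norm_eq_inner)
  ultimately show ?thesis by (simp add: complex_eq_iff)
qed

lemma norm_scaleC [simp]: "norm (c *\<^sub>C (x::'a::complex_inner)) = cmod c * norm x"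
proof -
  have "cinner (c *\<^sub>C x) (c *\<^sub>C x) = (c * cnj c) * cinner x x"
    by (simp add: mult_ac)
  also have "\<dots> = (cmod c * norm x)\<^sup>2"
    by (simp add: cinner_self power_mult_distrib flip: complex_norm_square)
  finally have "(norm (c *\<^sub>C x))\<^sup>2 = (cmod c * norm x)\<^sup>2"
    by (simp only: cinner_self of_real_eq_iff)
  then show ?thesis by (simp add: power2_eq_iff_nonneg)
qed

lemma cmod_cinner_le: "cmod (cinner (x::'a::complex_inner) y) \<le> norm x * norm y"
proof (cases "cinner x y = 0")
  case False
  define c where "c = cnj (cinner x y) / cmod (cinner x y)"
  have "cmod c = 1" using False by (simp add: c_def norm_divide)
  have "cinner x (c *\<^sub>C y) = cmod (cinner x y)"
    using False by (simp add: c_def field_simps power2_eq_square flip: complex_norm_square)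
  then have "cmod (cinner x y) = inner x (c *\<^sub>C y)" by (simp add: inner_cinner)
  also have "\<dots> \<le> norm x * norm (c *\<^sub>C y)" by (rule norm_cauchy_schwarz)
  finally show ?thesis using \<open>cmod c = 1\<close> by simp
qed simp

lemma bounded_bilinear_cinner: "bounded_bilinear (cinner :: 'a::complex_inner \<Rightarrow> _)"
proof
  show "\<exists>K. \<forall>a b::'a. cmod (cinner a b) \<le> norm a * norm b * K"
    using cmod_cinner_le by (intro exI[of _ 1]) auto
qed (auto simp: cinner_add_left cinner_add_right scaleR_scaleC scaleR_conv_of_real)

lemmas tendsto_cinner [tendsto_intros] =
  bounded_bilinear.tendsto[OF bounded_bilinear_cinner]

instantiation complex :: chilbert_space
begin
definition scaleC_complex :: "complex \<Rightarrow> complex \<Rightarrow> complex" where "c *\<^sub>C z = c * z"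
definition cinner_complex :: "complex \<Rightarrow> complex \<Rightarrow> complex" where "cinner w z = cnj w * z"
instance
  by standard (auto simp: scaleC_complex_def cinner_complex_def algebra_simps scaleR_conv_of_real
      inner_complex_def)
end

instantiation prod :: (complex_vector, complex_vector) complex_vector
begin
definition scaleC_prod :: "complex \<Rightarrow> 'a \<times> 'b \<Rightarrow> 'a \<times> 'b" where
  "c *\<^sub>C p = (c *\<^sub>C fst p, c *\<^sub>C snd p)"
instance
  by standard (auto simp: scaleC_prod_def scaleC_add_right scaleC_add_left scaleR_scaleC prod_eq_iff)
end

instantiation prod :: (complex_inner, complex_inner) complex_inner
begin
definition cinner_prod :: "'a \<times> 'b \<Rightarrow> 'a \<times> 'b \<Rightarrow> complex" where
  "cinner p q = cinner (fst p) (fst q) + cinner (snd p) (snd q)"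
instance
proof
  fix x y z :: "'a \<times> 'b" and c :: complex
  show "cinner x y = cnj (cinner y x)"
    unfolding cinner_prod_def by (metis cinner_commute complex_cnj_add)
qed (auto simp: cinner_prod_def scaleC_prod_def cinner_add_right algebra_simps inner_prod_def inner_cinner)
end

instance prod :: (chilbert_space, chilbert_space) chilbert_space ..

instantiation blinfun :: (real_normed_vector, complex_inner) complex_vector
begin
lift_definition scaleC_blinfun :: "complex \<Rightarrow> 'a \<Rightarrow>\<^sub>L 'b \<Rightarrow> 'a \<Rightarrow>\<^sub>L 'b" is "\<lambda>c T x. c *\<^sub>C T x"
proof -
  fix c and T :: "'a \<Rightarrow> 'b" assume "bounded_linear T"
  then interpret bounded_linear T .
  from bounded obtain K where K: "\<And>x. norm (T x) \<le> norm x * K" by blast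
  show "bounded_linear (\<lambda>x. c *\<^sub>C T x)"
  proof (rule bounded_linear_intro)
    show "norm (c *\<^sub>C T x) \<le> norm x * (cmod c * K)" for x
      using mult_left_mono[OF K[of x], of "cmod c"] by (simp add: mult_ac)
  qed (auto simp: add scaleR scaleC_add_right scaleR_scaleC mult.commute)
qed
instance
  by standard (transfer, auto simp: scaleC_add_right scaleC_add_left scaleR_scaleC)+
end

text \<open>\<open>'x hcompl\<close> is the Hilbert space generated by a set \<open>'x\<close> with a positive semidefinite kernel: the
  completion (Cauchy sequences modulo null sequences) of the free complex vector space on \<open>'x\<close>
  with the semi-inner product extending the kernel. The generator given by \<open>x\<close> is \<open>kvec x\<close>.\<close>

class pd_kernel =
  fixes kern :: "'a \<Rightarrow> 'a \<Rightarrow> complex"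
  assumes kern_commute: "kern x y = cnj (kern y x)"
    and kern_pos: "finite A \<Longrightarrow> 0 \<le> Re (\<Sum>x\<in>A. \<Sum>y\<in>A. cnj (c x) * c y * kern x y)"

definition kform :: "('x::pd_kernel \<Rightarrow>\<^sub>0 complex) \<Rightarrow> ('x \<Rightarrow>\<^sub>0 complex) \<Rightarrow> complex" where
  "kform p q = (\<Sum>x\<in>Poly_Mapping.keys p. \<Sum>y\<in>Poly_Mapping.keys q.
     cnj (poly_mapping.lookup p x) * poly_mapping.lookup q y * kern x y)"

definition kscale :: "complex \<Rightarrow> ('x \<Rightarrow>\<^sub>0 complex) \<Rightarrow> ('x \<Rightarrow>\<^sub>0 complex)" where
  "kscale c = Poly_Mapping.map ((*) c)"

definition ksem :: "('x::pd_kernel \<Rightarrow>\<^sub>0 complex) \<Rightarrow> real" where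
  "ksem p = sqrt (Re (kform p p))"

lemma lookup_kscale [simp]: "poly_mapping.lookup (kscale c p) x = c * poly_mapping.lookup p x"
  by (auto simp: kscale_def Poly_Mapping.map.rep_eq when_def)

lemma kform_superset:
  assumes "finite A" "finite B" "Poly_Mapping.keys p \<subseteq> A" "Poly_Mapping.keys q \<subseteq> B"
  shows "kform p q = (\<Sum>x\<in>A. \<Sum>y\<in>B. cnj (poly_mapping.lookup p x) * poly_mapping.lookup q y * kern x y)"
proof -
  have "kform p q = (\<Sum>x\<in>Poly_Mapping.keys p. \<Sum>y\<in>B. cnj (poly_mapping.lookup p x) * poly_mapping.lookup q y * kern x y)"
    unfolding kform_def
    by (intro sum.cong sum.mono_neutral_left assms refl) (auto simp: in_keys_iff)
  also have "\<dots> = (\<Sum>x\<in>A. \<Sum>y\<in>B. cnj (poly_mapping.lookup p x) * poly_mapping.lookup q y * kern x y)"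
    by (intro sum.mono_neutral_left assms) (auto simp: in_keys_iff)
  finally show ?thesis .
qed

lemma kform_commute: "kform p q = cnj (kform q p)"
proof -
  have "cnj (kform q p) = (\<Sum>x\<in>Poly_Mapping.keys q. \<Sum>y\<in>Poly_Mapping.keys p.
     poly_mapping.lookup q x * cnj (poly_mapping.lookup p y) * kern y x)"
    unfolding kform_def by (simp flip: kern_commute)
  also have "\<dots> = kform p q"
    unfolding kform_def by (subst sum.swap) (simp add: mult_ac)
  finally show ?thesis ..
qed

lemma kform_add_right: "kform p (q + r) = kform p q + kform p r"
proof -
  let ?A = "Poly_Mapping.keys p" and ?B = "Poly_Mapping.keys q \<union> Poly_Mapping.keys r"
  have "Poly_Mapping.keys (q + r) \<subseteq> ?B" by (rule keys_add)
  then show ?thesis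
    by (simp add: kform_superset[of ?A ?B] lookup_add algebra_simps sum.distrib)
qed

lemma kform_scale_right [simp]: "kform p (kscale c q) = c * kform p q"
proof -
  have "Poly_Mapping.keys (kscale c q) \<subseteq> Poly_Mapping.keys q" by (auto simp: in_keys_iff)
  then show ?thesis
    by (simp add: kform_superset[of "Poly_Mapping.keys p" "Poly_Mapping.keys q"]
        sum_distrib_left mult_ac)
qed

lemma kform_add_left: "kform (p + q) r = kform p r + kform q r"
  by (metis kform_commute kform_add_right complex_cnj_add)

lemma kform_scale_left [simp]: "kform (kscale c p) q = cnj c * kform p q"
  by (metis kform_commute kform_scale_right complex_cnj_mult)

lemma kform_zero [simp]: "kform 0 p = 0" "kform p 0 = 0"
  by (simp_all add: kform_def)

lemma kform_diff_right: "kform p (q - r) = kform p q - kform p r"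
  using kform_add_right[of p "q - r" r] by simp

lemma kform_diff_left: "kform (p - q) r = kform p r - kform q r"
  using kform_add_left[of "p - q" q r] by simp

lemma kform_minus [simp]: "kform p (- q) = - kform p q" "kform (- p) q = - kform p q"
  using kform_diff_right[of p 0 q] kform_diff_left[of 0 p q] by auto

lemma kform_pos: "0 \<le> Re (kform p p)"
  unfolding kform_def by (rule kern_pos) simp

lemma Im_kform_self [simp]: "Im (kform p p) = 0"
  using arg_cong[OF kform_commute[of p p], of Im] by simp

lemma ksem_nonneg [simp]: "0 \<le> ksem p" by (simp add: ksem_def kform_pos)

lemma ksem_power2: "(ksem p)\<^sup>2 = Re (kform p p)" by (simp add: ksem_def kform_pos)

lemma ksem_zero [simp]: "ksem 0 = 0" by (simp add: ksem_def)

lemma ksem_minus [simp]: "ksem (- p) = ksem p" by (simp add: ksem_def)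

lemma ksem_diff_commute: "ksem (p - q) = ksem (q - p)"
  using ksem_minus[of "p - q"] by simp

lemma ksem_scale [simp]: "ksem (kscale c p) = cmod c * ksem p"
proof -
  have "Re (kform (kscale c p) (kscale c p)) = (cmod c)\<^sup>2 * Re (kform p p)"
    by (simp add: cmod_power2) (simp add: power2_eq_square algebra_simps)
  then show ?thesis by (simp add: ksem_def real_sqrt_mult)
qed

lemma kform_cauchy_schwarz: "Re (kform p q) \<le> ksem p * ksem q"
proof -
  let ?a = "ksem p" and ?b = "ksem q" and ?r = "Re (kform p q)"
  have rr: "Re (kform q p) = ?r" using kform_commute[of p q] by simp
  have *: "0 \<le> s\<^sup>2 * ?a\<^sup>2 - 2 * s * t * ?r + t\<^sup>2 * ?b\<^sup>2" for s t :: real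
  proof -
    have "0 \<le> Re (kform (kscale s p - kscale t q) (kscale s p - kscale t q))" by (rule kform_pos)
    then show ?thesis
      by (simp add: kform_diff_left kform_diff_right rr ksem_power2)
        (simp add: power2_eq_square algebra_simps)
  qed
  show ?thesis
  proof (cases "?a * ?b = 0")
    case False
    then have "0 < 2 * (?a * ?b)" by (simp add: order_less_le)
    moreover have "2 * (?a * ?b) * ?r \<le> 2 * (?a * ?b) * (?a * ?b)"
      using *[of ?b ?a] by (simp add: power2_eq_square algebra_simps)
    ultimately show ?thesis by (simp only: mult_le_cancel_left_pos)
  next
    case True
    have "?r \<le> 0"
    proof (rule ccontr)
      assume r: "\<not> ?r \<le> 0"
      from True consider "?a = 0" | "?b = 0" by auto
      then show False
      proof cases
        case 1
        define s where "s = (?b\<^sup>2 + 1) / ?r"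
        have "s * ?r = ?b\<^sup>2 + 1" using r by (simp add: s_def)
        then show False using *[of s 1] 1 by (simp add: mult.assoc) (smt (verit) zero_le_power2)
      next
        case 2
        define s where "s = (?a\<^sup>2 + 1) / ?r"
        have "s * ?r = ?a\<^sup>2 + 1" using r by (simp add: s_def)
        then show False using *[of 1 s] 2 by (simp add: mult.assoc) (smt (verit) zero_le_power2)
      qed
    qed
    then show ?thesis using mult_nonneg_nonneg[of ?a ?b] by (simp add: order_trans)
  qed
qed

lemma ksem_triangle: "ksem (p + q) \<le> ksem p + ksem q"
proof -
  have rr: "Re (kform q p) = Re (kform p q)" using kform_commute[of p q] by simp
  have "(ksem (p + q))\<^sup>2 \<le> (ksem p + ksem q)\<^sup>2"
    using kform_cauchy_schwarz[of p q]
    by (simp add: ksem_power2 kform_add_left kform_add_right rr power2_sum)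
  then show ?thesis by (rule power2_le_imp_le) simp
qed

lemma ksem_triangle_diff: "ksem (p - r) \<le> ksem (p - q) + ksem (q - r)"
  using ksem_triangle[of "p - q" "q - r"] by simp

lemma ksem_diff_abs: "\<bar>ksem p - ksem q\<bar> \<le> ksem (p - q)"
  using ksem_triangle[of "p - q" q] ksem_triangle[of "q - p" p] ksem_diff_commute[of p q] by simp

definition kcauchy :: "(nat \<Rightarrow> ('x::pd_kernel \<Rightarrow>\<^sub>0 complex)) \<Rightarrow> bool" where
  "kcauchy X \<longleftrightarrow> (\<forall>e>0. \<exists>N. \<forall>m\<ge>N. \<forall>n\<ge>N. ksem (X m - X n) < e)"

definition krel :: "(nat \<Rightarrow> ('x::pd_kernel \<Rightarrow>\<^sub>0 complex)) \<Rightarrow> (nat \<Rightarrow> ('x \<Rightarrow>\<^sub>0 complex)) \<Rightarrow> bool" where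
  "krel X Y \<longleftrightarrow> kcauchy X \<and> kcauchy Y \<and> (\<lambda>n. ksem (X n - Y n)) \<longlonglongrightarrow> 0"

lemma kcauchy_const [simp]: "kcauchy (\<lambda>_. p)" by (simp add: kcauchy_def)

lemma kcauchy_add:
  assumes "kcauchy X" "kcauchy Y" shows "kcauchy (\<lambda>n. X n + Y n)"
  unfolding kcauchy_def
proof (intro allI impI)
  fix e :: real assume "e > 0"
  then obtain M N where M: "\<forall>m\<ge>M. \<forall>n\<ge>M. ksem (X m - X n) < e / 2"
    and N: "\<forall>m\<ge>N. \<forall>n\<ge>N. ksem (Y m - Y n) < e / 2"
    using assms unfolding kcauchy_def by (meson half_gt_zero)
  show "\<exists>K. \<forall>m\<ge>K. \<forall>n\<ge>K. ksem (X m + Y m - (X n + Y n)) < e"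
  proof (intro exI[of _ "max M N"] allI impI)
    fix m n assume "max M N \<le> m" "max M N \<le> n"
    then have "ksem (X m - X n) < e / 2" "ksem (Y m - Y n) < e / 2" using M N by auto
    then show "ksem (X m + Y m - (X n + Y n)) < e"
      using ksem_triangle[of "X m - X n" "Y m - Y n"] by (simp add: algebra_simps)
  qed
qed

lemma kscale_diff: "kscale c p - kscale c q = kscale c (p - q)"
  by (rule poly_mapping_eqI) (simp add: lookup_minus algebra_simps)

lemma kcauchy_scale:
  assumes "kcauchy X" shows "kcauchy (\<lambda>n. kscale c (X n))"
  unfolding kcauchy_def kscale_diff ksem_scale
proof (intro allI impI)
  fix e :: real assume "e > 0"
  then have "e / (cmod c + 1) > 0" by (simp add: add_nonneg_pos)
  then obtain N where N: "\<forall>m\<ge>N. \<forall>n\<ge>N. ksem (X m - X n) < e / (cmod c + 1)"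
    using assms unfolding kcauchy_def by meson
  have "cmod c * ksem (X m - X n) < e" if "m \<ge> N" "n \<ge> N" for m n
  proof -
    have "ksem (X m - X n) * (cmod c + 1) < e"
      using N that by (simp add: pos_less_divide_eq add_nonneg_pos)
    moreover have "cmod c * ksem (X m - X n) \<le> ksem (X m - X n) * (cmod c + 1)"
      by (simp add: algebra_simps)
    ultimately show ?thesis by linarith
  qed
  then show "\<exists>N. \<forall>m\<ge>N. \<forall>n\<ge>N. cmod c * ksem (X m - X n) < e" by blast
qed

lemma kscale_minus_one: "kscale (-1) p = - p"
  by (rule poly_mapping_eqI) simp

lemma kcauchy_minus: "kcauchy X \<Longrightarrow> kcauchy (\<lambda>n. - X n)"
  using kcauchy_scale[of X "-1"] by (simp add: kscale_minus_one)

lemma kcauchy_diff: "kcauchy X \<Longrightarrow> kcauchy Y \<Longrightarrow> kcauchy (\<lambda>n. X n - Y n)"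
  using kcauchy_add[of X "\<lambda>n. - Y n"] by (simp add: kcauchy_minus)

lemma tendsto_zero_le:
  fixes f g :: "nat \<Rightarrow> real"
  assumes "g \<longlonglongrightarrow> 0" "\<And>n. 0 \<le> f n" "\<And>n. f n \<le> g n"
  shows "f \<longlonglongrightarrow> 0"
  by (rule real_tendsto_sandwich[OF _ _ tendsto_const assms(1)]) (use assms in auto)

lemma krel_refl: "krel X X \<longleftrightarrow> kcauchy X" by (simp add: krel_def)

lemma krel_sym: "krel X Y \<Longrightarrow> krel Y X"
  by (simp add: krel_def ksem_diff_commute[of "Y _" "X _"])

lemma krel_trans:
  assumes "krel X Y" "krel Y Z" shows "krel X Z"
proof -
  have "(\<lambda>n. ksem (X n - Y n) + ksem (Y n - Z n)) \<longlonglongrightarrow> 0 + 0"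
    using assms unfolding krel_def by (intro tendsto_add) auto
  then have "(\<lambda>n. ksem (X n - Z n)) \<longlonglongrightarrow> 0"
    by (rule tendsto_zero_le[OF tendsto_eq_rhs]) (simp_all add: ksem_triangle_diff)
  then show ?thesis using assms by (simp add: krel_def)
qed

lemma kcauchy_ksem_convergent: "kcauchy X \<Longrightarrow> convergent (\<lambda>n. ksem (X n))"
proof (rule Cauchy_convergent, unfold Cauchy_def, intro allI impI)
  fix e :: real assume "kcauchy X" "e > 0"
  then obtain N where N: "\<forall>m\<ge>N. \<forall>n\<ge>N. ksem (X m - X n) < e" unfolding kcauchy_def by blast
  have "dist (ksem (X m)) (ksem (X n)) < e" if "m \<ge> N" "n \<ge> N" for m n

  proof -
    have "ksem (X m - X n) < e" using N that by blast
    then show ?thesis using ksem_diff_abs[of "X m" "X n"] by (simp add: dist_real_def)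
  qed
  then show "\<exists>M. \<forall>m\<ge>M. \<forall>n\<ge>M. dist (ksem (X m)) (ksem (X n)) < e" by blast
qed

lemma krel_ksem_diff:
  assumes "krel X Y" shows "(\<lambda>n. ksem (X n) - ksem (Y n)) \<longlonglongrightarrow> 0"
proof (rule tendsto_rabs_zero_cancel, rule tendsto_zero_le)
  show "(\<lambda>n. ksem (X n - Y n)) \<longlonglongrightarrow> 0" using assms by (simp add: krel_def)
qed (simp_all add: ksem_diff_abs)

lemma kform_polar:
  "kform p q = complex_of_real (((ksem (p + q))\<^sup>2 - (ksem p)\<^sup>2 - (ksem q)\<^sup>2) / 2)
     + \<i> * complex_of_real (((ksem (p + kscale (-\<i>) q))\<^sup>2 - (ksem p)\<^sup>2 - (ksem (kscale (-\<i>) q))\<^sup>2) / 2)"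
proof -
  have rr: "kform q p = cnj (kform p q)" by (rule kform_commute)
  show ?thesis
    unfolding ksem_power2
    by (rule complex_eqI) (simp_all add: kform_add_left kform_add_right rr del: ksem_scale)
qed

lemma kform_tendsto:
  assumes "kcauchy X" "kcauchy Y" shows "convergent (\<lambda>n. kform (X n) (Y n))"
proof -
  have *: "(\<lambda>n. ksem (Z n)) \<longlonglongrightarrow> lim (\<lambda>n. ksem (Z n))" if "kcauchy Z"
    for Z :: "nat \<Rightarrow> ('a \<Rightarrow>\<^sub>0 complex)"
    using kcauchy_ksem_convergent[OF that] by (simp add: convergent_LIMSEQ_iff)
  note l = *[OF assms(1)] *[OF assms(2)] *[OF kcauchy_add[OF assms]]
    *[OF kcauchy_scale[OF assms(2), of "- \<i>"]]
    *[OF kcauchy_add[OF assms(1) kcauchy_scale[OF assms(2), of "- \<i>"]]]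
  have eq: "(\<lambda>n. kform (X n) (Y n)) = (\<lambda>n. complex_of_real (((ksem (X n + Y n))\<^sup>2 - (ksem (X n))\<^sup>2 - (ksem (Y n))\<^sup>2) / 2)
     + \<i> * complex_of_real (((ksem (X n + kscale (-\<i>) (Y n)))\<^sup>2 - (ksem (X n))\<^sup>2 - (ksem (kscale (-\<i>) (Y n)))\<^sup>2) / 2))"
    by (rule ext) (rule kform_polar)
  have "(\<lambda>n. complex_of_real (((A n)\<^sup>2 - (B n)\<^sup>2 - (C n)\<^sup>2) / 2)
      + \<i> * complex_of_real (((D n)\<^sup>2 - (B n)\<^sup>2 - (E n)\<^sup>2) / 2)) \<longlonglongrightarrow>
      complex_of_real ((a\<^sup>2 - b\<^sup>2 - c\<^sup>2) / 2) + \<i> * complex_of_real ((d\<^sup>2 - b\<^sup>2 - e\<^sup>2) / 2)"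
    if "A \<longlonglongrightarrow> a" "B \<longlonglongrightarrow> b" "C \<longlonglongrightarrow> c" "D \<longlonglongrightarrow> d" "E \<longlonglongrightarrow> e"
    for A B C D E :: "nat \<Rightarrow> real" and a b c d e
    by (intro tendsto_add tendsto_mult tendsto_const tendsto_of_real tendsto_divide
        tendsto_diff tendsto_power that) simp_all
  from this[OF l(3) l(1) l(2) l(5) l(4)] show ?thesis
    unfolding eq convergent_def by (rule exI)
qed

lemma krel_add:
  assumes "krel X X'" "krel Y Y'" shows "krel (\<lambda>n. X n + Y n) (\<lambda>n. X' n + Y' n)"
proof -
  have "(\<lambda>n. ksem (X n - X' n) + ksem (Y n - Y' n)) \<longlonglongrightarrow> 0 + 0"
    using assms unfolding krel_def by (intro tendsto_add) auto
  then have "(\<lambda>n. ksem (X n - X' n) + ksem (Y n - Y' n)) \<longlonglongrightarrow> 0" by simp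
  moreover have "ksem (X n + Y n - (X' n + Y' n)) \<le> ksem (X n - X' n) + ksem (Y n - Y' n)" for n
    using ksem_triangle[of "X n - X' n" "Y n - Y' n"] by (simp add: algebra_simps)
  ultimately have "(\<lambda>n. ksem (X n + Y n - (X' n + Y' n))) \<longlonglongrightarrow> 0"
    using tendsto_zero_le[of "\<lambda>n. ksem (X n - X' n) + ksem (Y n - Y' n)"] by simp
  then show ?thesis using assms by (simp add: krel_def kcauchy_add)
qed

lemma krel_scale:
  assumes "krel X X'" shows "krel (\<lambda>n. kscale c (X n)) (\<lambda>n. kscale c (X' n))"
proof -
  have "(\<lambda>n. cmod c * ksem (X n - X' n)) \<longlonglongrightarrow> cmod c * 0"
    using assms unfolding krel_def by (intro tendsto_mult) auto
  then show ?thesis using assms by (simp add: krel_def kcauchy_scale kscale_diff)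
qed

lemma krel_minus: "krel X X' \<Longrightarrow> krel (\<lambda>n. - X n) (\<lambda>n. - X' n)"
  using krel_scale[of X X' "-1"] by (simp add: kscale_minus_one)

lemma krel_diff: "krel X X' \<Longrightarrow> krel Y Y' \<Longrightarrow> krel (\<lambda>n. X n - Y n) (\<lambda>n. X' n - Y' n)"
  using krel_add[of X X' "\<lambda>n. - Y n" "\<lambda>n. - Y' n"] by (simp add: krel_minus)

definition klim :: "(nat \<Rightarrow> ('x::pd_kernel \<Rightarrow>\<^sub>0 complex)) \<Rightarrow> (nat \<Rightarrow> ('x \<Rightarrow>\<^sub>0 complex)) \<Rightarrow> complex" where
  "klim X Y = lim (\<lambda>n. kform (X n) (Y n))"

lemma klim: "kcauchy X \<Longrightarrow> kcauchy Y \<Longrightarrow> (\<lambda>n. kform (X n) (Y n)) \<longlonglongrightarrow> klim X Y"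
  unfolding klim_def using kform_tendsto convergent_LIMSEQ_iff by blast

lemma klim_eqI:
  "kcauchy X \<Longrightarrow> kcauchy Y \<Longrightarrow> (\<lambda>n. kform (X n) (Y n)) \<longlonglongrightarrow> l \<Longrightarrow> klim X Y = l"
  using klim LIMSEQ_unique by blast

lemma krel_klim:
  assumes "krel X X'" "krel Y Y'" shows "klim X Y = klim X' Y'"
proof -
  have sq: "(\<lambda>n. (ksem (Z n))\<^sup>2 - (ksem (Z' n))\<^sup>2) \<longlonglongrightarrow> 0" if "krel Z Z'"
    for Z Z' :: "nat \<Rightarrow> ('a \<Rightarrow>\<^sub>0 complex)"
  proof -
    have "kcauchy Z" "kcauchy Z'" using that by (auto simp: krel_def)
    then obtain a b where a: "(\<lambda>n. ksem (Z n)) \<longlonglongrightarrow> a" and b: "(\<lambda>n. ksem (Z' n)) \<longlonglongrightarrow> b"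
      using kcauchy_ksem_convergent by (metis convergent_def)
    have "(\<lambda>n. (ksem (Z n) - ksem (Z' n)) * (ksem (Z n) + ksem (Z' n))) \<longlonglongrightarrow> 0 * (a + b)"
      using krel_ksem_diff[OF that] by (intro tendsto_mult tendsto_add a b)
    then show ?thesis by (simp add: power2_eq_square algebra_simps)
  qed
  let ?Y = "\<lambda>n. kscale (-\<i>) (Y n)" and ?Y' = "\<lambda>n. kscale (-\<i>) (Y' n)"
  let ?q = "\<lambda>Z n. (ksem (Z n))\<^sup>2"
  have s: "krel ?Y ?Y'" by (rule krel_scale[OF assms(2)])
  have "(\<lambda>n. complex_of_real (((?q (\<lambda>n. X n + Y n) n - ?q (\<lambda>n. X' n + Y' n) n)
         - (?q X n - ?q X' n) - (?q Y n - ?q Y' n)) / 2)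
      + \<i> * complex_of_real (((?q (\<lambda>n. X n + ?Y n) n - ?q (\<lambda>n. X' n + ?Y' n) n)
         - (?q X n - ?q X' n) - (?q ?Y n - ?q ?Y' n)) / 2)) \<longlonglongrightarrow>
      complex_of_real ((0 - 0 - 0) / 2) + \<i> * complex_of_real ((0 - 0 - 0) / 2)"
    by (intro tendsto_intros sq assms krel_add s) simp_all
  also have "(\<lambda>n. complex_of_real (((?q (\<lambda>n. X n + Y n) n - ?q (\<lambda>n. X' n + Y' n) n)
         - (?q X n - ?q X' n) - (?q Y n - ?q Y' n)) / 2)
      + \<i> * complex_of_real (((?q (\<lambda>n. X n + ?Y n) n - ?q (\<lambda>n. X' n + ?Y' n) n)
         - (?q X n - ?q X' n) - (?q ?Y n - ?q ?Y' n)) / 2))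
      = (\<lambda>n. kform (X n) (Y n) - kform (X' n) (Y' n))"
    unfolding kform_polar[of "X _" "Y _"] kform_polar[of "X' _" "Y' _"]
    by (simp add: fun_eq_iff field_simps)
  finally have 0: "(\<lambda>n. kform (X n) (Y n) - kform (X' n) (Y' n)) \<longlonglongrightarrow> 0" by simp
  have c: "kcauchy X" "kcauchy X'" "kcauchy Y" "kcauchy Y'" using assms by (auto simp: krel_def)
  have "(\<lambda>n. kform (X n) (Y n) - kform (X' n) (Y' n)) \<longlonglongrightarrow> klim X Y - klim X' Y'"
    by (intro tendsto_diff klim c)
  from LIMSEQ_unique[OF 0 this] show ?thesis by simp
qed

quotient_type (overloaded) 'x hcompl = "nat \<Rightarrow> ('x::pd_kernel \<Rightarrow>\<^sub>0 complex)" / partial: krel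
proof (rule part_equivpI)
  show "\<exists>X. krel X X" using krel_refl kcauchy_const by blast
  show "symp krel" by (simp add: sympI krel_sym)
  show "transp krel" using krel_trans by (blast intro: transpI)
qed

instantiation hcompl :: (pd_kernel) complex_inner
begin

lift_definition zero_hcompl :: "'a hcompl" is "\<lambda>_. 0" by (simp add: krel_refl)
lift_definition plus_hcompl :: "'a hcompl \<Rightarrow> 'a hcompl \<Rightarrow> 'a hcompl" is "\<lambda>X Y n. X n + Y n"
  by (rule krel_add)
lift_definition minus_hcompl :: "'a hcompl \<Rightarrow> 'a hcompl \<Rightarrow> 'a hcompl" is "\<lambda>X Y n. X n - Y n"
  by (rule krel_diff)
lift_definition uminus_hcompl :: "'a hcompl \<Rightarrow> 'a hcompl" is "\<lambda>X n. - X n"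
  by (rule krel_minus)
lift_definition scaleC_hcompl :: "complex \<Rightarrow> 'a hcompl \<Rightarrow> 'a hcompl" is "\<lambda>c X n. kscale c (X n)"
  by (rule krel_scale)
lift_definition cinner_hcompl :: "'a hcompl \<Rightarrow> 'a hcompl \<Rightarrow> complex" is klim
  by (rule krel_klim)
definition scaleR_hcompl :: "real \<Rightarrow> 'a hcompl \<Rightarrow> 'a hcompl" where
  "scaleR_hcompl r x = complex_of_real r *\<^sub>C x"
definition inner_hcompl :: "'a hcompl \<Rightarrow> 'a hcompl \<Rightarrow> real" where "inner_hcompl x y = Re (cinner x y)"
definition norm_hcompl :: "'a hcompl \<Rightarrow> real" where "norm_hcompl x = sqrt (inner x x)"
definition dist_hcompl :: "'a hcompl \<Rightarrow> 'a hcompl \<Rightarrow> real" where "dist_hcompl x y = norm (x - y)"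
definition sgn_hcompl :: "'a hcompl \<Rightarrow> 'a hcompl" where "sgn_hcompl x = complex_of_real (inverse (norm x)) *\<^sub>C x"
definition uniformity_hcompl :: "('a hcompl \<times> 'a hcompl) filter" where
  "uniformity_hcompl = (INF e\<in>{0<..}. principal {(x, y). dist x y < e})"
definition open_hcompl :: "'a hcompl set \<Rightarrow> bool" where
  "open_hcompl U = (\<forall>x\<in>U. \<forall>\<^sub>F (x', y) in uniformity. x' = x \<longrightarrow> y \<in> U)"

lemma hcompl_exhaust:
  obtains X where "kcauchy X" "x = abs_hcompl X"
  using Quotient3_rep_reflp[OF Quotient3_hcompl, of x] Quotient3_abs_rep[OF Quotient3_hcompl, of x]
  by (metis krel_refl)

lemma hcompl_eq_iff: "kcauchy X \<Longrightarrow> kcauchy Y \<Longrightarrow> abs_hcompl X = abs_hcompl Y \<longleftrightarrow> krel X Y"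
  using Quotient3_rel[OF Quotient3_hcompl, of X Y] by (auto simp: krel_refl)

lemmas hcompl_abs = plus_hcompl.abs_eq minus_hcompl.abs_eq uminus_hcompl.abs_eq
  scaleC_hcompl.abs_eq cinner_hcompl.abs_eq

lemmas hcompl_simps = hcompl_abs zero_hcompl_def
  krel_refl kcauchy_add kcauchy_scale kcauchy_minus kcauchy_diff hcompl_eq_iff

lemma hcompl_commute: "cinner x y = cnj (cinner y (x::'a hcompl))"
proof -
  obtain X Y where c: "kcauchy X" "x = abs_hcompl X" "kcauchy Y" "y = abs_hcompl Y"
    by (metis hcompl_exhaust)
  have "(\<lambda>n. cnj (kform (Y n) (X n))) \<longlonglongrightarrow> cnj (klim Y X)"
    by (intro tendsto_cnj klim c)
  then have "klim X Y = cnj (klim Y X)"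
    by (intro klim_eqI c) (simp add: kform_commute[of "X _" "Y _"])
  then show ?thesis using c by (simp add: hcompl_simps)
qed

lemma hcompl_add_right: "cinner x (y + z) = cinner x y + cinner (x::'a hcompl) z"
proof -
  obtain X Y Z where c: "kcauchy X" "x = abs_hcompl X" "kcauchy Y" "y = abs_hcompl Y"
    "kcauchy Z" "z = abs_hcompl Z" by (metis hcompl_exhaust)
  then have "klim X (\<lambda>n. Y n + Z n) = klim X Y + klim X Z"
    by (intro klim_eqI kcauchy_add) (simp_all add: kform_add_right tendsto_add klim)
  then show ?thesis using c by (simp add: hcompl_simps)
qed

lemma hcompl_scale_right: "cinner x (c *\<^sub>C y) = c * cinner (x::'a hcompl) y"
proof -
  obtain X Y where c: "kcauchy X" "x = abs_hcompl X" "kcauchy Y" "y = abs_hcompl Y"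
    by (metis hcompl_exhaust)
  then have "klim X (\<lambda>n. kscale c (Y n)) = c * klim X Y"
    by (intro klim_eqI kcauchy_scale) (simp_all add: tendsto_mult klim)
  then show ?thesis using c by (simp add: hcompl_simps)
qed

lemma hcompl_pos: "0 \<le> Re (cinner (x::'a hcompl) x)"
proof -
  obtain X where X: "kcauchy X" "x = abs_hcompl X" by (metis hcompl_exhaust)
  then have "(\<lambda>n. Re (kform (X n) (X n))) \<longlonglongrightarrow> Re (klim X X)" by (intro tendsto_Re klim)
  then have "0 \<le> Re (klim X X)" by (rule LIMSEQ_le_const) (auto simp: kform_pos)
  then show ?thesis using X by (simp add: hcompl_simps)
qed

lemma hcompl_eq_zero: "Re (cinner (x::'a hcompl) x) = 0 \<longleftrightarrow> x = 0"
proof -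
  obtain X where X: "kcauchy X" "x = abs_hcompl X" by (metis hcompl_exhaust)
  then have l: "(\<lambda>n. (ksem (X n))\<^sup>2) \<longlonglongrightarrow> Re (klim X X)"
    unfolding ksem_power2 by (intro tendsto_Re klim)
  have "(Re (klim X X) = 0) = krel X (\<lambda>_. 0)"
  proof
    assume "Re (klim X X) = 0"
    then have "(\<lambda>n. sqrt ((ksem (X n))\<^sup>2)) \<longlonglongrightarrow> sqrt 0" using l by (intro tendsto_real_sqrt) simp
    then show "krel X (\<lambda>_. 0)" using X by (simp add: krel_def)
  next
    assume "krel X (\<lambda>_. 0)"
    then have "(\<lambda>n. ksem (X n)) \<longlonglongrightarrow> 0" by (simp add: krel_def)
    from tendsto_power[OF this, of 2] show "Re (klim X X) = 0" using LIMSEQ_unique[OF l] by simp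
  qed
  then show ?thesis using X by (simp add: hcompl_simps)
qed

instance
proof
  have kadd: "kscale (c + d) p = kscale c p + kscale d p" "kscale c (p + q) = kscale c p + kscale c q"
    "kscale c (kscale d p) = kscale (c * d) p" "kscale 1 p = p" for c d and p q :: "'a \<Rightarrow>\<^sub>0 complex"
    by (rule poly_mapping_eqI, simp add: lookup_add algebra_simps)+
  have 1: "c *\<^sub>C (x + y) = c *\<^sub>C x + c *\<^sub>C y" and 2: "(c + d) *\<^sub>C x = c *\<^sub>C x + d *\<^sub>C x"
    and 3: "c *\<^sub>C d *\<^sub>C x = (c * d) *\<^sub>C x" and 4: "1 *\<^sub>C x = x" for c d and x y :: "'a hcompl"
    by (cases x rule: hcompl_exhaust, cases y rule: hcompl_exhaust, simp add: hcompl_simps kadd)+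
  fix x y z :: "'a hcompl" and c d :: complex and r s :: real
  show "x + y + z = x + (y + z)"
    by (cases x rule: hcompl_exhaust, cases y rule: hcompl_exhaust, cases z rule: hcompl_exhaust)
      (simp add: hcompl_simps add.assoc)
  show "x + y = y + x"
    by (cases x rule: hcompl_exhaust, cases y rule: hcompl_exhaust) (simp add: hcompl_simps add.commute)
  show "0 + x = x" "- x + x = 0" by (cases x rule: hcompl_exhaust, simp add: hcompl_simps)+
  show "x - y = x + - y"
    by (cases x rule: hcompl_exhaust, cases y rule: hcompl_exhaust) (simp add: hcompl_simps)
  show "c *\<^sub>C (x + y) = c *\<^sub>C x + c *\<^sub>C y" "(c + d) *\<^sub>C x = c *\<^sub>C x + d *\<^sub>C x"
    "c *\<^sub>C d *\<^sub>C x = (c * d) *\<^sub>C x" "1 *\<^sub>C x = x" by (fact 1 2 3 4)+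
  show "r *\<^sub>R x = complex_of_real r *\<^sub>C x" by (simp add: scaleR_hcompl_def)
  show "r *\<^sub>R (x + y) = r *\<^sub>R x + r *\<^sub>R y" "(r + s) *\<^sub>R x = r *\<^sub>R x + s *\<^sub>R x"
    "r *\<^sub>R s *\<^sub>R x = (r * s) *\<^sub>R x" "1 *\<^sub>R x = x"
    by (simp_all add: scaleR_hcompl_def 1 2 3 4)
  show "dist x y = norm (x - y)" "sgn x = scaleR (inverse (norm x)) x" "norm x = sqrt (inner x x)"
    "inner x y = Re (cinner x y)"
    by (simp_all add: dist_hcompl_def sgn_hcompl_def scaleR_hcompl_def norm_hcompl_def inner_hcompl_def)
  show "uniformity = (INF e\<in>{0<..}. principal {(x, y :: 'a hcompl). dist x y < e})"
    by (simp add: uniformity_hcompl_def)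
  show "open U = (\<forall>x\<in>U. \<forall>\<^sub>F (x', y) in uniformity. x' = x \<longrightarrow> y \<in> U)" for U :: "'a hcompl set"
    by (simp add: open_hcompl_def)
  show "cinner x y = cnj (cinner y x)" by (rule hcompl_commute)
  show "inner x y = inner y x" by (simp add: inner_hcompl_def hcompl_commute[of y x])
  show "cinner x (y + z) = cinner x y + cinner x z" by (rule hcompl_add_right)
  show "inner (x + y) z = inner x z + inner y z"
    by (simp add: inner_hcompl_def hcompl_commute[of _ z] hcompl_add_right)
  show "cinner x (c *\<^sub>C y) = c * cinner x y" by (rule hcompl_scale_right)
  show "inner (r *\<^sub>R x) y = r * inner x y"
    by (simp add: inner_hcompl_def scaleR_hcompl_def hcompl_commute[of _ y] hcompl_scale_right)
  show "0 \<le> inner x x" "(inner x x = 0) = (x = 0)"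
    by (simp_all add: inner_hcompl_def hcompl_pos hcompl_eq_zero)
qed

end

definition kconst :: "('x::pd_kernel \<Rightarrow>\<^sub>0 complex) \<Rightarrow> 'x hcompl" where
  "kconst p = abs_hcompl (\<lambda>_. p)"

lemma dist_kconst: "kcauchy X \<Longrightarrow> (\<lambda>n. ksem (X n - p)) \<longlonglongrightarrow> dist (abs_hcompl X) (kconst p)"
proof -
  assume c: "kcauchy X"
  have "cinner (abs_hcompl X - kconst p) (abs_hcompl X - kconst p) = klim (\<lambda>n. X n - p) (\<lambda>n. X n - p)"
    using c by (simp add: kconst_def hcompl_simps)
  moreover have "(\<lambda>n. Re (kform (X n - p) (X n - p))) \<longlonglongrightarrow> Re (klim (\<lambda>n. X n - p) (\<lambda>n. X n - p))"
    by (intro tendsto_Re klim kcauchy_diff c kcauchy_const)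
  ultimately show ?thesis
    unfolding dist_hcompl_def norm_hcompl_def inner_hcompl_def ksem_def
    by (auto intro: tendsto_real_sqrt)
qed

lemma ex_kconst_near:
  fixes x :: "'x::pd_kernel hcompl"
  assumes "e > 0" shows "\<exists>p. dist x (kconst p) < e"
proof -
  obtain X where X: "kcauchy X" "x = abs_hcompl X" by (metis hcompl_exhaust)
  from X(1) assms obtain N where N: "\<forall>m\<ge>N. \<forall>n\<ge>N. ksem (X m - X n) < e / 2"
    unfolding kcauchy_def by (meson half_gt_zero)
  have "(\<lambda>n. ksem (X n - X N)) \<longlonglongrightarrow> dist x (kconst (X N))" using dist_kconst X by simp
  then have "dist x (kconst (X N)) \<le> e / 2"
    by (rule LIMSEQ_le_const2) (use N in \<open>auto intro!: exI[of _ N] less_imp_le\<close>)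
  then show ?thesis using assms by (intro exI[of _ "X N"]) linarith
qed

lemma dist_kconst_kconst: "dist (kconst p) (kconst q) = ksem (p - q)"
proof -
  have "(\<lambda>n. ksem (p - q)) \<longlonglongrightarrow> dist (abs_hcompl (\<lambda>_. p)) (kconst q)"
    by (rule dist_kconst) simp
  then show ?thesis by (simp add: kconst_def LIMSEQ_const_iff)
qed

instance hcompl :: (pd_kernel) chilbert_space
proof
  fix S :: "nat \<Rightarrow> 'a hcompl" assume S: "Cauchy S"
  have "\<forall>n. \<exists>p. dist (S n) (kconst p) < inverse (real (Suc n))"
    by (intro allI ex_kconst_near) simp
  then obtain Z where Z: "\<And>n. dist (S n) (kconst (Z n)) < inverse (real (Suc n))" by metis
  have Z0: "(\<lambda>n. dist (S n) (kconst (Z n))) \<longlonglongrightarrow> 0"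
    by (rule tendsto_zero_le[OF LIMSEQ_inverse_real_of_nat]) (simp_all add: less_imp_le[OF Z] del: of_nat_Suc)
  have "kcauchy Z"
    unfolding kcauchy_def
  proof (intro allI impI)
    fix e :: real assume e: "e > 0"
    then obtain M where M: "\<forall>m\<ge>M. \<forall>n\<ge>M. dist (S m) (S n) < e / 3"
      using S unfolding Cauchy_def by (meson divide_pos_pos zero_less_numeral)
    from e LIMSEQ_D[OF Z0, of "e / 3"] obtain N
      where N: "\<forall>n\<ge>N. dist (S n) (kconst (Z n)) < e / 3" by auto
    have "ksem (Z m - Z n) < e" if "m \<ge> max M N" "n \<ge> max M N" for m n
    proof -
      have "dist (kconst (Z m)) (kconst (Z n))
          \<le> dist (S m) (kconst (Z m)) + dist (S m) (S n) + dist (S n) (kconst (Z n))"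
        using dist_triangle2[of "kconst (Z m)" "kconst (Z n)" "S n"]
          dist_triangle[of "kconst (Z m)" "S n" "S m"]
        using dist_commute[of "S m" "kconst (Z m)"] dist_commute[of "S m" "S n"]
          dist_commute[of "S n" "kconst (Z n)"] by linarith
      also have "\<dots> < e"
      proof -
        have "dist (S m) (kconst (Z m)) < e / 3" "dist (S m) (S n) < e / 3"
          "dist (S n) (kconst (Z n)) < e / 3"
          using M[rule_format, of m n] N[rule_format, of m] N[rule_format, of n] that by simp_all
        then show ?thesis by simp
      qed
      finally show ?thesis by (simp add: dist_kconst_kconst)
    qed
    then show "\<exists>N. \<forall>m\<ge>N. \<forall>n\<ge>N. ksem (Z m - Z n) < e" by blast
  qed
  define x where "x = abs_hcompl Z"
  have "(\<lambda>n. dist x (kconst (Z n))) \<longlonglongrightarrow> 0"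
  proof (rule LIMSEQ_I)
    fix e :: real assume e: "e > 0"
    then obtain N where N: "\<forall>m\<ge>N. \<forall>n\<ge>N. ksem (Z m - Z n) < e / 2"
      using \<open>kcauchy Z\<close> unfolding kcauchy_def by (meson half_gt_zero)
    have "dist x (kconst (Z n)) \<le> e / 2" if "n \<ge> N" for n
      using dist_kconst[OF \<open>kcauchy Z\<close>, of "Z n"] unfolding x_def
      by (rule LIMSEQ_le_const2) (use N that in \<open>auto intro!: exI[of _ N] less_imp_le\<close>)
    then have "norm (dist x (kconst (Z n)) - 0) < e" if "n \<ge> N" for n using e that by fastforce
    then show "\<exists>N. \<forall>n\<ge>N. norm (dist x (kconst (Z n)) - 0) < e" by blast
  qed
  from tendsto_add[OF Z0 this]
  have z: "(\<lambda>n. dist (S n) (kconst (Z n)) + dist x (kconst (Z n))) \<longlonglongrightarrow> 0" by simp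
  have "(\<lambda>n. dist (S n) x) \<longlonglongrightarrow> 0"
    by (rule tendsto_zero_le[OF z zero_le_dist dist_triangle2])
  then have "S \<longlonglongrightarrow> x" by (subst tendsto_dist_iff)
  then show "convergent S" by (auto simp: convergent_def)
qed

definition kvec :: "'x::pd_kernel \<Rightarrow> 'x hcompl" where
  "kvec x = kconst (Poly_Mapping.single x 1)"

lemma cinner_kconst: "cinner (kconst p) (kconst q) = kform p q"
  by (simp add: kconst_def cinner_hcompl.abs_eq krel_refl klim_def)

lemma cinner_kvec [simp]: "cinner (kvec x) (kvec y) = kern x y"
  by (simp add: kvec_def cinner_kconst kform_def)

lemma kconst_add: "kconst (p + q) = kconst p + kconst q"
  by (simp add: kconst_def plus_hcompl.abs_eq krel_refl)

lemma kconst_scale: "kconst (kscale c p) = c *\<^sub>C kconst p"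
  by (simp add: kconst_def scaleC_hcompl.abs_eq krel_refl)

lemma kconst_in_span: "kconst p \<in> cspan (range kvec)"
proof -
  have "kconst (\<Sum>x\<in>A. kscale (f x) (Poly_Mapping.single x 1)) \<in> cspan (range kvec)" if "finite A"
    for A :: "'a set" and f
    using that
  proof induction
    case empty
    have "kconst (kscale 0 0) = 0 *\<^sub>C kconst (0 :: 'a \<Rightarrow>\<^sub>0 complex)" by (rule kconst_scale)
    moreover have "kscale 0 0 = (0 :: 'a \<Rightarrow>\<^sub>0 complex)" by (rule poly_mapping_eqI) simp
    ultimately show ?case by (simp add: complex_vector.span_zero)
  next
    case (insert x A)
    then show ?case
      by (auto simp: kconst_add kconst_scale simp flip: kvec_def
          intro!: complex_vector.span_add complex_vector.span_scale intro: complex_vector.span_base)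
  qed
  moreover have "p = (\<Sum>x\<in>Poly_Mapping.keys p. kscale (poly_mapping.lookup p x) (Poly_Mapping.single x 1))"
  proof (rule poly_mapping_eqI)
    fix k
    have "(\<Sum>x\<in>Poly_Mapping.keys p. poly_mapping.lookup p x * poly_mapping.lookup (Poly_Mapping.single x 1) k)
       = (\<Sum>x\<in>Poly_Mapping.keys p. if x = k then poly_mapping.lookup p k else 0)"
      by (intro sum.cong) (auto simp: lookup_single)
    then show "poly_mapping.lookup p k =
      poly_mapping.lookup (\<Sum>x\<in>Poly_Mapping.keys p. kscale (poly_mapping.lookup p x) (Poly_Mapping.single x 1)) k"
      by (simp add: lookup_sum in_keys_iff)
  qed
  ultimately show ?thesis by (metis finite_keys)
qed

lemma kvec_total: "closure (cspan (range kvec)) = (UNIV :: 'x::pd_kernel hcompl set)"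
proof -
  have "x \<in> closure (cspan (range kvec))" for x :: "'x hcompl"
    unfolding closure_approachable
  proof (intro allI impI)
    fix e :: real assume "e > 0"
    then obtain p where "dist x (kconst p) < e" using ex_kconst_near by blast
    then show "\<exists>y\<in>cspan (range kvec). dist y x < e"
      by (intro bexI[of _ "kconst p"] kconst_in_span) (simp add: dist_commute)
  qed
  then show ?thesis by auto
qed

definition psd_on :: "'i set \<Rightarrow> ('i \<Rightarrow> 'i \<Rightarrow> complex) \<Rightarrow> bool" where
  "psd_on A M \<longleftrightarrow> (\<forall>c. 0 \<le> Re (\<Sum>i\<in>A. \<Sum>j\<in>A. cnj (c i) * c j * M i j))"

lemma cinner_sum_right: "cinner x (\<Sum>i\<in>A. f i) = (\<Sum>i\<in>A. cinner x (f i :: 'a::complex_inner))"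
  by (induction A rule: infinite_finite_induct) (auto simp: cinner_add_right)

lemma cinner_sum_left: "cinner (\<Sum>i\<in>A. f i) x = (\<Sum>i\<in>A. cinner (f i :: 'a::complex_inner) x)"
  by (induction A rule: infinite_finite_induct) (auto simp: cinner_add_left)

lemma cinner_diff_right: "cinner x (y - z) = cinner x y - cinner (x :: 'a::complex_inner) z"
  using cinner_add_right[of x "y - z" z] by simp

lemma finite_orthonormal_expansion:
  fixes V :: "'a::complex_inner set"
  assumes "finite V"
  shows "\<exists>E. finite E \<and> (\<forall>e\<in>E. \<forall>f\<in>E. cinner e f = (if e = f then 1 else 0))
    \<and> (\<forall>x\<in>V. x = (\<Sum>e\<in>E. cinner e x *\<^sub>C e))"
  using assms
proof induction
  case empty
  then show ?case by (intro exI[of _ "{}"]) auto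
next
  case (insert v V)
  then obtain E where E: "finite E" "\<And>e f. e \<in> E \<Longrightarrow> f \<in> E \<Longrightarrow> cinner e f = (if e = f then 1 else 0)"
    and V: "\<And>x. x \<in> V \<Longrightarrow> x = (\<Sum>e\<in>E. cinner e x *\<^sub>C e)" by blast
  define w where "w = v - (\<Sum>e\<in>E. cinner e v *\<^sub>C e)"
  have perp: "cinner e w = 0" if "e \<in> E" for e
  proof -
    have "(\<Sum>f\<in>E. cinner f v * cinner e f) = (\<Sum>f\<in>E. if f = e then cinner e v else 0)"
      using that E(2) by (intro sum.cong) auto
    also have "\<dots> = cinner e v" using that E(1) by simp
    finally show ?thesis by (simp add: w_def cinner_diff_right cinner_sum_right)
  qed
  show ?case
  proof (cases "w = 0")
    case True
    then have "v = (\<Sum>e\<in>E. cinner e v *\<^sub>C e)" by (simp add: w_def)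
    then show ?thesis using E V by (intro exI[of _ E]) auto
  next
    case False
    define u where "u = complex_of_real (inverse (norm w)) *\<^sub>C w"
    have uu: "cinner u u = 1"
    proof -
      have "norm u = 1" using False by (simp add: u_def norm_inverse)
      then show ?thesis by (simp add: cinner_self)
    qed
    have eu: "cinner e u = 0" if "e \<in> E" for e using perp[OF that] by (simp add: u_def)
    have ue: "cinner u e = 0" if "e \<in> E" for e
      using eu[OF that] cinner_commute[of u e] by simp
    have "u \<notin> E" using eu uu by force
    have "cinner u v *\<^sub>C u = w"
    proof -
      have "cinner u v = cinner u w + (\<Sum>e\<in>E. cinner e v * cinner u e)"
        unfolding w_def by (simp add: cinner_diff_right cinner_sum_right)
      also have "(\<Sum>e\<in>E. cinner e v * cinner u e) = 0" by (intro sum.neutral) (simp add: ue)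
      finally have "cinner u v = complex_of_real (inverse (norm w)) * cinner w w"
        by (simp add: u_def)
      then have "cinner u v *\<^sub>C u = complex_of_real (norm w * inverse (norm w)) *\<^sub>C w"
        using False by (simp add: u_def cinner_self power2_eq_square field_simps)
      then show ?thesis using False by simp
    qed
    moreover have "x = (\<Sum>e\<in>insert u E. cinner e x *\<^sub>C e)" if "x \<in> V" for x
    proof -
      have "cinner u x = (\<Sum>e\<in>E. cinner e x * cinner u e)"
        by (subst V[OF that]) (simp add: cinner_sum_right)
      also have "\<dots> = 0" by (intro sum.neutral) (simp add: ue)
      finally have "cinner u x = 0" .
      then show ?thesis using \<open>u \<notin> E\<close> E(1) V[OF that] by simp
    qed
    moreover have "v = w + (\<Sum>e\<in>E. cinner e v *\<^sub>C e)" by (simp add: w_def)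
    ultimately show ?thesis
      using E uu eu ue \<open>u \<notin> E\<close> by (intro exI[of _ "insert u E"]) auto
  qed
qed

lemma sum_rotate3: "(\<Sum>i\<in>A. \<Sum>j\<in>B. \<Sum>e\<in>E. f i j e) = (\<Sum>e\<in>E. \<Sum>i\<in>A. \<Sum>j\<in>B. f i j e)"
proof -
  have "(\<Sum>i\<in>A. \<Sum>j\<in>B. \<Sum>e\<in>E. f i j e) = (\<Sum>i\<in>A. \<Sum>e\<in>E. \<Sum>j\<in>B. f i j e)"
    by (rule sum.cong[OF refl]) (rule sum.swap)
  also have "\<dots> = (\<Sum>e\<in>E. \<Sum>i\<in>A. \<Sum>j\<in>B. f i j e)" by (rule sum.swap)
  finally show ?thesis .
qed

lemma psd_on_schur:
  fixes a :: "'i \<Rightarrow> 'a::complex_inner"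
  assumes "finite A" "psd_on A M"
  shows "psd_on A (\<lambda>i j. cinner (a i) (a j) * M i j)"
  unfolding psd_on_def
proof
  fix c :: "'i \<Rightarrow> complex"
  from finite_orthonormal_expansion[OF finite_imageI[OF assms(1)], of a] obtain E
    where "finite E" and E: "\<forall>x\<in>a ` A. x = (\<Sum>e\<in>E. cinner e x *\<^sub>C e)"
    by (elim exE conjE)
  have gram: "cinner (a i) (a j) = (\<Sum>e\<in>E. cnj (cinner e (a i)) * cinner e (a j))" if "i \<in> A" for i j
  proof -
    have "cinner (a i) (a j) = cinner (\<Sum>e\<in>E. cinner e (a i) *\<^sub>C e) (a j)"
      by (rule arg_cong[where f = "\<lambda>x. cinner x (a j)"], rule bspec[OF E]) (use that in simp)
    then show ?thesis by (simp add: cinner_sum_left)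
  qed
  have "(\<Sum>i\<in>A. \<Sum>j\<in>A. cnj (c i) * c j * (cinner (a i) (a j) * M i j))
    = (\<Sum>i\<in>A. \<Sum>j\<in>A. \<Sum>e\<in>E. cnj (c i * cinner e (a i)) * (c j * cinner e (a j)) * M i j)"
  proof (intro sum.cong refl)
    fix i j assume "i \<in> A"
    then show "cnj (c i) * c j * (cinner (a i) (a j) * M i j)
      = (\<Sum>e\<in>E. cnj (c i * cinner e (a i)) * (c j * cinner e (a j)) * M i j)"
      by (simp only: gram sum_distrib_left sum_distrib_right complex_cnj_mult) (simp only: mult_ac)
  qed
  also have "\<dots> = (\<Sum>e\<in>E. \<Sum>i\<in>A. \<Sum>j\<in>A. cnj (c i * cinner e (a i)) * (c j * cinner e (a j)) * M i j)"
    by (rule sum_rotate3)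
  finally have eq: "(\<Sum>i\<in>A. \<Sum>j\<in>A. cnj (c i) * c j * (cinner (a i) (a j) * M i j))
    = (\<Sum>e\<in>E. \<Sum>i\<in>A. \<Sum>j\<in>A. cnj (c i * cinner e (a i)) * (c j * cinner e (a j)) * M i j)" .
  show "0 \<le> Re (\<Sum>i\<in>A. \<Sum>j\<in>A. cnj (c i) * c j * (cinner (a i) (a j) * M i j))"
    unfolding eq
    by (subst Re_sum, rule sum_nonneg) (rule assms(2)[unfolded psd_on_def, rule_format])
qed

lemma psd_on_one: "psd_on A (\<lambda>_ _. 1)"
  unfolding psd_on_def
proof
  fix c :: "'a \<Rightarrow> complex"
  have "(\<Sum>i\<in>A. \<Sum>j\<in>A. cnj (c i) * c j * 1) = cnj (\<Sum>i\<in>A. c i) * (\<Sum>j\<in>A. c j)"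
    by (simp add: sum_product)
  moreover have "0 \<le> Re (cnj z * z)" for z by simp
  ultimately show "0 \<le> Re (\<Sum>i\<in>A. \<Sum>j\<in>A. cnj (c i) * c j * 1)" by (simp only:)
qed

lemma psd_on_gram: "finite A \<Longrightarrow> psd_on A (\<lambda>i j. cinner (a i) (a j :: 'a::complex_inner))"
  using psd_on_schur[OF _ psd_on_one, of A a] by simp

lemma psd_on_gram_power:
  "finite A \<Longrightarrow> psd_on A (\<lambda>i j. cinner (a i) (a j :: 'a::complex_inner) ^ n)"
  by (induction n) (simp_all add: psd_on_one psd_on_schur)

text \<open>The Hilbert space tensor product: the completion of the algebraic tensor product for
  \<open>\<langle>x \<otimes> y, x' \<otimes> y'\<rangle> = \<langle>x, x'\<rangle> \<langle>y, y'\<rangle>\<close>.\<close>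

datatype ('a, 'b) elem_tensor = ElemTensor 'a 'b

fun et_kern :: "('a::complex_inner, 'b::complex_inner) elem_tensor \<Rightarrow> ('a, 'b) elem_tensor \<Rightarrow> complex" where
  "et_kern (ElemTensor x y) (ElemTensor x' y') = cinner x x' * cinner y y'"

instantiation elem_tensor :: (complex_inner, complex_inner) pd_kernel
begin
definition kern_elem_tensor :: "('a, 'b) elem_tensor \<Rightarrow> ('a, 'b) elem_tensor \<Rightarrow> complex" where
  "kern_elem_tensor = et_kern"
instance
proof
  fix s t :: "('a, 'b) elem_tensor" and A :: "('a, 'b) elem_tensor set" and c
  show "kern s t = cnj (kern t s)"
    by (cases s; cases t) (simp add: kern_elem_tensor_def flip: cinner_commute)
  assume "finite A"
  define l r where "l = (\<lambda>t :: ('a, 'b) elem_tensor. case t of ElemTensor x y \<Rightarrow> x)"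
    and "r = (\<lambda>t :: ('a, 'b) elem_tensor. case t of ElemTensor x y \<Rightarrow> y)"
  have "kern = (\<lambda>s t. cinner (l s) (l t) * cinner (r s) (r t))"
    by (intro ext) (simp add: kern_elem_tensor_def l_def r_def split: elem_tensor.split)
  then show "0 \<le> Re (\<Sum>s\<in>A. \<Sum>t\<in>A. cnj (c s) * c t * kern s t)"
    using psd_on_schur[OF \<open>finite A\<close> psd_on_gram[OF \<open>finite A\<close>], of l r] by (simp add: psd_on_def)
qed
end

type_synonym ('a, 'b) htensor = "('a, 'b) elem_tensor hcompl"

definition tensor :: "'a::complex_inner \<Rightarrow> 'b::complex_inner \<Rightarrow> ('a, 'b) htensor"
    (infixr \<open>\<otimes>\<close> 75) where
  "x \<otimes> y = kvec (ElemTensor x y)"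

lemma cinner_tensor [simp]: "cinner (x \<otimes> y) (x' \<otimes> y') = cinner x x' * cinner y y'"
  by (simp add: tensor_def kern_elem_tensor_def)

lemma tensor_total: "closure (cspan {x \<otimes> y |x y. True})
    = (UNIV :: ('a::complex_inner, 'b::complex_inner) htensor set)"
proof -
  have "{x \<otimes> y |x y. True} = range (kvec :: ('a, 'b) elem_tensor \<Rightarrow> _)"
    by (auto simp: tensor_def) (metis elem_tensor.exhaust)
  then show ?thesis by (simp add: kvec_total)
qed

text \<open>The symmetric Fock space: the direct sum over \<open>n\<close> of the symmetric tensor powers. By polarisation
  the \<open>n\<close>-th power is generated by the vectors \<open>sympow f n\<close>, i.e. \<open>f \<otimes> \<dots> \<otimes> f\<close> (\<open>n\<close> factors), for which
  \<open>\<langle>f\<^sup>\<otimes>\<^sup>n, g\<^sup>\<otimes>\<^sup>n\<rangle> = \<langle>f, g\<rangle>\<^sup>n\<close>; powers of different degree are orthogonal.\<close>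

datatype 'a sym_power = SymPower 'a nat

fun sp_kern :: "'a::complex_inner sym_power \<Rightarrow> 'a sym_power \<Rightarrow> complex" where
  "sp_kern (SymPower f m) (SymPower g n) = (if m = n then cinner f g ^ n else 0)"

instantiation sym_power :: (complex_inner) pd_kernel
begin
definition kern_sym_power :: "'a sym_power \<Rightarrow> 'a sym_power \<Rightarrow> complex" where
  "kern_sym_power = sp_kern"
instance
proof
  fix s t :: "'a sym_power" and A :: "'a sym_power set"
    and c :: "'a sym_power \<Rightarrow> complex"
  show "kern s t = cnj (kern t s)"
    by (cases s; cases t) (simp add: kern_sym_power_def flip: cinner_commute)
  assume fin: "finite A"
  define v d where "v = (\<lambda>t :: 'a sym_power. case t of SymPower f n \<Rightarrow> f)"
    and "d = (\<lambda>t :: 'a sym_power. case t of SymPower f n \<Rightarrow> n)"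
  define c' where "c' = (\<lambda>n s. if d s = n then c s else 0)"
  have kern: "kern = (\<lambda>s t. if d s = d t then cinner (v s) (v t) ^ d t else 0)"
    by (intro ext) (simp add: kern_sym_power_def v_def d_def split: sym_power.split)
  have "(\<Sum>s\<in>A. \<Sum>t\<in>A. cnj (c s) * c t * kern s t)
    = (\<Sum>s\<in>A. \<Sum>t\<in>A. \<Sum>n\<in>d ` A. cnj (c' n s) * c' n t * cinner (v s) (v t) ^ n)"
  proof (intro sum.cong refl)
    fix s t assume "s \<in> A" "t \<in> A"
    have "(\<Sum>n\<in>d ` A. cnj (c' n s) * c' n t * cinner (v s) (v t) ^ n)
      = (\<Sum>n\<in>d ` A. if n = d t then (if d s = d t then cnj (c s) * c t * cinner (v s) (v t) ^ d t else 0) else 0)"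
      by (intro sum.cong) (auto simp: c'_def)
    also have "\<dots> = cnj (c s) * c t * kern s t" using fin \<open>t \<in> A\<close> by (simp add: kern)
    finally show "cnj (c s) * c t * kern s t
      = (\<Sum>n\<in>d ` A. cnj (c' n s) * c' n t * cinner (v s) (v t) ^ n)" ..
  qed
  also have "\<dots> = (\<Sum>n\<in>d ` A. \<Sum>s\<in>A. \<Sum>t\<in>A. cnj (c' n s) * c' n t * cinner (v s) (v t) ^ n)"
    by (rule sum_rotate3)
  finally show "0 \<le> Re (\<Sum>s\<in>A. \<Sum>t\<in>A. cnj (c s) * c t * kern s t)"
    by (simp only: Re_sum[of _ "d ` A"])
      (intro sum_nonneg psd_on_gram_power[OF fin, of v, unfolded psd_on_def, rule_format])
qed
end

type_synonym 'a fock = "'a sym_power hcompl"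

definition sympow :: "'a::complex_inner \<Rightarrow> nat \<Rightarrow> 'a fock" where
  "sympow f n = kvec (SymPower f n)"

lemma cinner_sympow [simp]:
  "cinner (sympow f m) (sympow g n) = (if m = n then cinner f g ^ n else 0)"
  by (simp add: sympow_def kern_sym_power_def)

lemma sympow_total: "closure (cspan {sympow f n |f n. True}) = (UNIV :: 'a::complex_inner fock set)"
proof -
  have "{sympow f n |f n. True} = range (kvec :: 'a sym_power \<Rightarrow> _)"
    by (auto simp: sympow_def) (metis sym_power.exhaust)
  then show ?thesis by (simp add: kvec_total)
qed

text \<open>Bochner (strong) measurability. No separability of the target space is assumed, so Borel
  measurability would be too weak.\<close>

definition strongly_measurable :: "'s measure \<Rightarrow> ('s \<Rightarrow> 'b::topological_space) \<Rightarrow> bool" where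
  "strongly_measurable M f \<longleftrightarrow>
     (\<exists>s. (\<forall>n. simple_function M (s n)) \<and> (\<forall>x\<in>space M. (\<lambda>n. s n x) \<longlonglongrightarrow> f x))"

definition square_integrable :: "(real \<Rightarrow> 'k::complex_inner) \<Rightarrow> bool" where
  "square_integrable f \<longleftrightarrow> strongly_measurable (lebesgue_on {0..}) f
     \<and> integrable (lebesgue_on {0..}) (\<lambda>s. (norm (f s))\<^sup>2)"

definition l2rel :: "(real \<Rightarrow> 'k::complex_inner) \<Rightarrow> (real \<Rightarrow> 'k) \<Rightarrow> bool" where
  "l2rel f g \<longleftrightarrow> square_integrable f \<and> square_integrable g
     \<and> (AE s in lebesgue_on {0..}. f s = g s)"

lemma strongly_measurable_compose2:
  assumes "strongly_measurable M f" "strongly_measurable M g"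
    and "\<And>X Y x y. X \<longlonglongrightarrow> x \<Longrightarrow> Y \<longlonglongrightarrow> y \<Longrightarrow> (\<lambda>n. h (X n) (Y n)) \<longlonglongrightarrow> h x y"
  shows "strongly_measurable M (\<lambda>x. h (f x) (g x))"
proof -
  obtain s t where s: "\<forall>n. simple_function M (s n)" "\<forall>x\<in>space M. (\<lambda>n. s n x) \<longlonglongrightarrow> f x"
    and t: "\<forall>n. simple_function M (t n)" "\<forall>x\<in>space M. (\<lambda>n. t n x) \<longlonglongrightarrow> g x"
    using assms(1,2) unfolding strongly_measurable_def by blast
  show ?thesis
    unfolding strongly_measurable_def
  proof (intro exI[of _ "\<lambda>n x. h (s n x) (t n x)"] conjI allI ballI)
    show "simple_function M (\<lambda>x. h (s n x) (t n x))" for n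
      by (rule simple_function_compose2) (use s t in auto)
    show "(\<lambda>n. h (s n x) (t n x)) \<longlonglongrightarrow> h (f x) (g x)" if "x \<in> space M" for x
      by (rule assms(3)) (use s t that in auto)
  qed
qed

lemma strongly_measurable_const: "strongly_measurable M (\<lambda>_. c)"
  unfolding strongly_measurable_def by (intro exI[of _ "\<lambda>_ _. c"]) auto

lemma borel_measurable_strongly:
  fixes f :: "'s \<Rightarrow> 'b::metric_space"
  assumes "strongly_measurable M f" shows "f \<in> borel_measurable M"
proof -
  obtain s where s: "\<forall>n. simple_function M (s n)" "\<forall>x\<in>space M. (\<lambda>n. s n x) \<longlonglongrightarrow> f x"
    using assms unfolding strongly_measurable_def by blast
  show ?thesis
    by (rule borel_measurable_LIMSEQ_metric[of s]) (use s in \<open>auto intro: borel_measurable_simple_function\<close>)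
qed

lemma square_integrable_add:
  assumes "square_integrable f" "square_integrable g" shows "square_integrable (\<lambda>s. f s + g s)"
proof -
  let ?M = "lebesgue_on {0::real..}"
  have m: "strongly_measurable ?M (\<lambda>s. f s + g s)"
    by (rule strongly_measurable_compose2[OF _ _ tendsto_add])
      (use assms in \<open>simp_all add: square_integrable_def\<close>)
  have "integrable ?M (\<lambda>s. (norm (f s + g s))\<^sup>2)"
  proof (rule Bochner_Integration.integrable_bound)
    show "integrable ?M (\<lambda>s. 2 * (norm (f s))\<^sup>2 + 2 * (norm (g s))\<^sup>2)"
      using assms by (simp add: square_integrable_def)
    have "(norm (x + y))\<^sup>2 \<le> 2 * (norm x)\<^sup>2 + 2 * (norm y)\<^sup>2" for x y :: 'a
    proof -
      have "(norm (x + y))\<^sup>2 \<le> (norm x + norm y)\<^sup>2" by (intro power_mono norm_triangle_ineq) simp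
      also have "\<dots> \<le> 2 * (norm x)\<^sup>2 + 2 * (norm y)\<^sup>2"
        using zero_le_power2[of "norm x - norm y"] by (simp add: power2_sum power2_diff)
      finally show ?thesis .
    qed
    then show "AE s in ?M. norm ((norm (f s + g s))\<^sup>2) \<le> norm (2 * (norm (f s))\<^sup>2 + 2 * (norm (g s))\<^sup>2)"
      by (intro AE_I2) (simp add: add_nonneg_nonneg)
  qed (rule borel_measurable_power[OF measurable_compose[OF borel_measurable_strongly[OF m] borel_measurable_norm]])
  then show ?thesis using m by (simp add: square_integrable_def)
qed

lemma square_integrable_scale:
  assumes "square_integrable f" shows "square_integrable (\<lambda>s. c *\<^sub>C f s)"
proof -
  have "strongly_measurable (lebesgue_on {0..}) (\<lambda>s. c *\<^sub>C f s)"
  proof (rule strongly_measurable_compose2[of _ f f "\<lambda>x _. c *\<^sub>C x"])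
    fix X Y :: "nat \<Rightarrow> 'a" and x y assume "X \<longlonglongrightarrow> x"
    then have "(\<lambda>n. norm (X n - x)) \<longlonglongrightarrow> 0" by (simp add: LIM_zero tendsto_norm_zero)
    then have "(\<lambda>n. cmod c * norm (X n - x)) \<longlonglongrightarrow> cmod c * 0" by (intro tendsto_mult_left)
    then have "(\<lambda>n. norm (c *\<^sub>C (X n - x))) \<longlonglongrightarrow> 0" by simp
    from tendsto_norm_zero_cancel[OF this]
    have "(\<lambda>n. c *\<^sub>C X n - c *\<^sub>C x) \<longlonglongrightarrow> 0"
      by (simp only: complex_vector.scale_right_diff_distrib)
    then show "(\<lambda>n. c *\<^sub>C X n) \<longlonglongrightarrow> c *\<^sub>C x" by (rule LIM_zero_cancel)
  qed (use assms in \<open>auto simp: square_integrable_def\<close>)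
  then show ?thesis using assms by (simp add: square_integrable_def power_mult_distrib)
qed

lemma square_integrable_zero: "square_integrable (\<lambda>_. 0)"
  by (simp add: square_integrable_def strongly_measurable_const)

lemma square_integrable_minus: "square_integrable f \<Longrightarrow> square_integrable (\<lambda>s. - f s)"
  using square_integrable_scale[of f "-1"] by (simp add: complex_vector.scale_minus_left)

lemma square_integrable_diff:
  "square_integrable f \<Longrightarrow> square_integrable g \<Longrightarrow> square_integrable (\<lambda>s. f s - g s)"
  using square_integrable_add[of f "\<lambda>s. - g s"] by (simp add: square_integrable_minus)

lemma integrable_cinner:
  assumes "square_integrable f" "square_integrable g"
  shows "integrable (lebesgue_on {0..}) (\<lambda>s. cinner (f s) (g s))"
proof (rule Bochner_Integration.integrable_bound)
  let ?M = "lebesgue_on {0::real..}"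
  show "integrable ?M (\<lambda>s. (norm (f s))\<^sup>2 + (norm (g s))\<^sup>2)"
    using assms by (simp add: square_integrable_def)
  have "strongly_measurable ?M (\<lambda>s. cinner (f s) (g s))"
    by (rule strongly_measurable_compose2[OF _ _ tendsto_cinner])
      (use assms in \<open>simp_all add: square_integrable_def\<close>)
  then show "(\<lambda>s. cinner (f s) (g s)) \<in> borel_measurable ?M" by (rule borel_measurable_strongly)
  have "cmod (cinner x y) \<le> (norm x)\<^sup>2 + (norm y)\<^sup>2" for x y :: 'a
  proof -
    have "norm x * norm y \<le> (norm x)\<^sup>2 + (norm y)\<^sup>2"
      using zero_le_power2[of "norm x - norm y"] mult_nonneg_nonneg[OF norm_ge_zero norm_ge_zero, of x y]
      unfolding power2_diff by linarith
    then show ?thesis using cmod_cinner_le[of x y] by linarith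
  qed
  then show "AE s in ?M. norm (cinner (f s) (g s)) \<le> norm ((norm (f s))\<^sup>2 + (norm (g s))\<^sup>2)"
    by (intro AE_I2) (simp add: add_nonneg_nonneg)
qed

text \<open>\<open>L\<^sup>2(\<real>\<^sub>+; k)\<close>: square-integrable functions modulo equality almost everywhere on the half-line.\<close>

quotient_type (overloaded) 'k L2 = "real \<Rightarrow> 'k::complex_inner" / partial: l2rel
proof (rule part_equivpI)
  show "\<exists>f :: real \<Rightarrow> 'k. l2rel f f" using square_integrable_zero by (auto simp: l2rel_def)
qed (auto simp: l2rel_def intro!: sympI transpI)

lemma L2_exhaust:
  obtains f where "square_integrable f" "x = abs_L2 f"
  using Quotient3_rep_reflp[OF Quotient3_L2, of x] Quotient3_abs_rep[OF Quotient3_L2, of x]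
  by (metis l2rel_def)

lemma L2_eq_iff: "square_integrable f \<Longrightarrow> square_integrable g \<Longrightarrow>
    abs_L2 f = abs_L2 g \<longleftrightarrow> (AE s in lebesgue_on {0..}. f s = g s)"
  using Quotient3_rel[OF Quotient3_L2, of f g] by (auto simp: l2rel_def)

instantiation L2 :: (complex_inner) complex_inner
begin

lift_definition zero_L2 :: "'a L2" is "\<lambda>_. 0"
  by (simp add: l2rel_def square_integrable_zero)
lift_definition plus_L2 :: "'a L2 \<Rightarrow> 'a L2 \<Rightarrow> 'a L2" is "\<lambda>f g s. f s + g s"
  by (auto simp: l2rel_def square_integrable_add)
lift_definition minus_L2 :: "'a L2 \<Rightarrow> 'a L2 \<Rightarrow> 'a L2" is "\<lambda>f g s. f s - g s"
  by (auto simp: l2rel_def square_integrable_diff)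
lift_definition uminus_L2 :: "'a L2 \<Rightarrow> 'a L2" is "\<lambda>f s. - f s"
  by (auto simp: l2rel_def square_integrable_minus)
lift_definition scaleC_L2 :: "complex \<Rightarrow> 'a L2 \<Rightarrow> 'a L2" is "\<lambda>c f s. c *\<^sub>C f s"
  by (auto simp: l2rel_def square_integrable_scale)
lift_definition cinner_L2 :: "'a L2 \<Rightarrow> 'a L2 \<Rightarrow> complex" is
    "\<lambda>f g. \<integral>s. cinner (f s) (g s) \<partial>lebesgue_on {0..}"
  unfolding l2rel_def
  by (intro integral_cong_AE borel_measurable_integrable integrable_cinner) auto
definition scaleR_L2 :: "real \<Rightarrow> 'a L2 \<Rightarrow> 'a L2" where
  "scaleR_L2 r x = complex_of_real r *\<^sub>C x"
definition inner_L2 :: "'a L2 \<Rightarrow> 'a L2 \<Rightarrow> real" where "inner_L2 x y = Re (cinner x y)"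
definition norm_L2 :: "'a L2 \<Rightarrow> real" where "norm_L2 x = sqrt (inner x x)"
definition dist_L2 :: "'a L2 \<Rightarrow> 'a L2 \<Rightarrow> real" where "dist_L2 x y = norm (x - y)"
definition sgn_L2 :: "'a L2 \<Rightarrow> 'a L2" where "sgn_L2 x = complex_of_real (inverse (norm x)) *\<^sub>C x"
definition uniformity_L2 :: "('a L2 \<times> 'a L2) filter" where
  "uniformity_L2 = (INF e\<in>{0<..}. principal {(x, y). dist x y < e})"
definition open_L2 :: "'a L2 set \<Rightarrow> bool" where
  "open_L2 U = (\<forall>x\<in>U. \<forall>\<^sub>F (x', y) in uniformity. x' = x \<longrightarrow> y \<in> U)"

lemma l2rel_refl: "l2rel f f \<longleftrightarrow> square_integrable f" by (simp add: l2rel_def)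

lemmas L2_simps = plus_L2.abs_eq minus_L2.abs_eq uminus_L2.abs_eq scaleC_L2.abs_eq
  cinner_L2.abs_eq zero_L2_def l2rel_refl L2_eq_iff integrable_cinner
  square_integrable_add square_integrable_diff square_integrable_minus square_integrable_scale
  square_integrable_zero

lemma L2_commute: "cinner x y = cnj (cinner y (x::'a L2))"
proof -
  obtain f g where "square_integrable f" "x = abs_L2 f" "square_integrable g" "y = abs_L2 g"
    by (metis L2_exhaust)
  moreover have "(\<integral>s. cinner (f s) (g s) \<partial>lebesgue_on {0..})
      = (\<integral>s. cnj (cinner (g s) (f s)) \<partial>lebesgue_on {0..})"
    by (simp flip: cinner_commute)
  ultimately show ?thesis by (simp add: L2_simps)
qed

lemma L2_add_right: "cinner x (y + z) = cinner x y + cinner (x::'a L2) z"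
  by (cases x rule: L2_exhaust; cases y rule: L2_exhaust; cases z rule: L2_exhaust)
    (simp add: L2_simps cinner_add_right)

lemma L2_scale_right: "cinner x (c *\<^sub>C y) = c * cinner (x::'a L2) y"
  by (cases x rule: L2_exhaust; cases y rule: L2_exhaust) (simp add: L2_simps)

lemma L2_self:
  assumes "square_integrable f"
  shows "Re (cinner (abs_L2 f) (abs_L2 f)) = (\<integral>s. (norm (f s))\<^sup>2 \<partial>lebesgue_on {0..})"
  using assms by (simp add: L2_simps cinner_self del: of_real_power)

instance
proof
  have 1: "c *\<^sub>C (x + y) = c *\<^sub>C x + c *\<^sub>C y" and 2: "(c + d) *\<^sub>C x = c *\<^sub>C x + d *\<^sub>C x"
    and 3: "c *\<^sub>C d *\<^sub>C x = (c * d) *\<^sub>C x" and 4: "1 *\<^sub>C x = x" for c d and x y :: "'a L2"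
    by (cases x rule: L2_exhaust, cases y rule: L2_exhaust,
        simp add: L2_simps scaleC_add_left scaleC_add_right)+
  fix x y z :: "'a L2" and c d :: complex and r s :: real
  show "x + y + z = x + (y + z)"
    by (cases x rule: L2_exhaust, cases y rule: L2_exhaust, cases z rule: L2_exhaust)
      (simp add: L2_simps add.assoc)
  show "x + y = y + x"
    by (cases x rule: L2_exhaust, cases y rule: L2_exhaust) (simp add: L2_simps add.commute)
  show "0 + x = x" "- x + x = 0" by (cases x rule: L2_exhaust, simp add: L2_simps)+
  show "x - y = x + - y"
    by (cases x rule: L2_exhaust, cases y rule: L2_exhaust) (simp add: L2_simps)
  show "c *\<^sub>C (x + y) = c *\<^sub>C x + c *\<^sub>C y" "(c + d) *\<^sub>C x = c *\<^sub>C x + d *\<^sub>C x"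
    "c *\<^sub>C d *\<^sub>C x = (c * d) *\<^sub>C x" "1 *\<^sub>C x = x" by (fact 1 2 3 4)+
  show "r *\<^sub>R x = complex_of_real r *\<^sub>C x" by (simp add: scaleR_L2_def)
  show "r *\<^sub>R (x + y) = r *\<^sub>R x + r *\<^sub>R y" "(r + s) *\<^sub>R x = r *\<^sub>R x + s *\<^sub>R x"
    "r *\<^sub>R s *\<^sub>R x = (r * s) *\<^sub>R x" "1 *\<^sub>R x = x"
    by (simp_all add: scaleR_L2_def 1 2 3 4)
  show "dist x y = norm (x - y)" "sgn x = scaleR (inverse (norm x)) x" "norm x = sqrt (inner x x)"
    "inner x y = Re (cinner x y)"
    by (simp_all add: dist_L2_def sgn_L2_def scaleR_L2_def norm_L2_def inner_L2_def)
  show "uniformity = (INF e\<in>{0<..}. principal {(x, y :: 'a L2). dist x y < e})"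
    by (simp add: uniformity_L2_def)
  show "open U = (\<forall>x\<in>U. \<forall>\<^sub>F (x', y) in uniformity. x' = x \<longrightarrow> y \<in> U)" for U :: "'a L2 set"
    by (simp add: open_L2_def)
  show "cinner x y = cnj (cinner y x)" by (rule L2_commute)
  show "inner x y = inner y x" by (simp add: inner_L2_def L2_commute[of y x])
  show "cinner x (y + z) = cinner x y + cinner x z" by (rule L2_add_right)
  show "inner (x + y) z = inner x z + inner y z"
    by (simp add: inner_L2_def L2_commute[of _ z] L2_add_right)
  show "cinner x (c *\<^sub>C y) = c * cinner x y" by (rule L2_scale_right)
  show "inner (r *\<^sub>R x) y = r * inner x y"
    by (simp add: inner_L2_def scaleR_L2_def L2_commute[of _ y] L2_scale_right)
  obtain f where f: "square_integrable f" "x = abs_L2 f" by (rule L2_exhaust)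
  show "0 \<le> inner x x" using L2_self[OF f(1)] f(2) by (simp add: inner_L2_def)
  have "(\<integral>s. (norm (f s))\<^sup>2 \<partial>lebesgue_on {0..}) = 0 \<longleftrightarrow> (AE s in lebesgue_on {0..}. f s = 0)"
    using f(1) by (subst integral_nonneg_eq_0_iff_AE) (auto simp: square_integrable_def)
  then show "(inner x x = 0) = (x = 0)"
    using L2_self[OF f(1)] f by (simp add: inner_L2_def L2_simps)
qed

end

lemma cinner_diff_left: "cinner (x - y) z = cinner x z - cinner (y :: 'a::complex_inner) z"
  using cinner_add_left[of "x - y" y z] by simp

lemma cinner_eq_zero_iff: "cinner x x = 0 \<longleftrightarrow> (x :: 'a::complex_inner) = 0"
  by (simp add: cinner_self)

lemma tensor_add_left: "(x + y) \<otimes> z = x \<otimes> z + y \<otimes> z"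
proof -
  let ?d = "(x + y) \<otimes> z - x \<otimes> z - y \<otimes> z"
  have "cinner ?d ?d = 0"
    by (simp add: cinner_diff_left cinner_diff_right cinner_add_left cinner_add_right algebra_simps)
  then show ?thesis by (simp add: cinner_eq_zero_iff algebra_simps)
qed

lemma tensor_add_right: "x \<otimes> (y + z) = x \<otimes> y + x \<otimes> z"
proof -
  let ?d = "x \<otimes> (y + z) - x \<otimes> y - x \<otimes> z"
  have "cinner ?d ?d = 0"
    by (simp add: cinner_diff_left cinner_diff_right cinner_add_left cinner_add_right algebra_simps)
  then show ?thesis by (simp add: cinner_eq_zero_iff algebra_simps)
qed

lemma tensor_scale_left: "(c *\<^sub>C x) \<otimes> y = c *\<^sub>C (x \<otimes> y)"
proof -
  let ?d = "(c *\<^sub>C x) \<otimes> y - c *\<^sub>C (x \<otimes> y)"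
  have "cinner ?d ?d = 0" by (simp add: cinner_diff_left cinner_diff_right)
  then show ?thesis by (simp add: cinner_eq_zero_iff)
qed

lemma tensor_scale_right: "x \<otimes> (c *\<^sub>C y) = c *\<^sub>C (x \<otimes> y)"
proof -
  let ?d = "x \<otimes> (c *\<^sub>C y) - c *\<^sub>C (x \<otimes> y)"
  have "cinner ?d ?d = 0" by (simp add: cinner_diff_left cinner_diff_right)
  then show ?thesis by (simp add: cinner_eq_zero_iff)
qed

lemma norm_tensor: "norm (x \<otimes> y) = norm x * norm y"
proof -
  have "complex_of_real ((norm (x \<otimes> y))\<^sup>2) = complex_of_real ((norm x * norm y)\<^sup>2)"
    by (simp add: cinner_self power_mult_distrib flip: cinner_self of_real_power)
  then have "(norm (x \<otimes> y))\<^sup>2 = (norm x * norm y)\<^sup>2" by (simp only: of_real_eq_iff)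
  then show ?thesis by (simp add: power2_eq_iff_nonneg)
qed

lemma bounded_bilinear_tensor: "bounded_bilinear (\<otimes>)"
  by standard (auto simp: tensor_add_left tensor_add_right tensor_scale_left tensor_scale_right
      scaleR_scaleC norm_tensor intro: exI[of _ 1])

text \<open>The vector \<open>exp(- \<parallel>f\<parallel>\<^sup>2 / 2) ((n!)\<^sup>-\<^sup>1\<^sup>/\<^sup>2 f\<^sup>\<otimes>\<^sup>n)\<^sub>n\<close>, the sequence in the direct sum being written as a series.\<close>

definition nexp :: "'a::complex_inner \<Rightarrow> 'a fock" where
  "nexp f = exp (- (norm f)\<^sup>2 / 2) *\<^sub>R suminf (\<lambda>n. (1 / sqrt (fact n)) *\<^sub>R sympow f n)"

lemma norm_sympow: "norm (sympow f n) = norm f ^ n"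
proof -
  have "complex_of_real ((norm (sympow f n))\<^sup>2) = complex_of_real ((norm f ^ n)\<^sup>2)"
    by (simp flip: cinner_self of_real_power) (simp add: cinner_self power_even_eq power2_eq_square power_mult_distrib)
  then have "(norm (sympow f n))\<^sup>2 = (norm f ^ n)\<^sup>2" by (simp only: of_real_eq_iff)
  then show ?thesis by (simp add: power2_eq_iff_nonneg)
qed

lemma summable_nexp: "summable (\<lambda>n. (1 / sqrt (fact n)) *\<^sub>R sympow f n)"
proof (rule summable_norm_cancel)
  obtain N :: nat where N: "4 * (norm f)\<^sup>2 \<le> real N" using real_arch_simple by blast
  have "norm (norm ((1 / sqrt (fact (Suc n))) *\<^sub>R sympow f (Suc n)))
      \<le> 1 / 2 * norm (norm ((1 / sqrt (fact n)) *\<^sub>R sympow f n))" if "n \<ge> N" for n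
  proof -
    have "(2 * norm f)\<^sup>2 \<le> real (Suc n)" using N that by (simp add: power_mult_distrib)
    then have "2 * norm f \<le> sqrt (real (Suc n))" by (rule real_le_rsqrt)
    then have le: "norm f / sqrt (real (Suc n)) \<le> 1 / 2" by (simp add: divide_simps del: of_nat_Suc)
    have "norm (norm ((1 / sqrt (fact (Suc n))) *\<^sub>R sympow f (Suc n)))
      = (norm f / sqrt (real (Suc n))) * (norm f ^ n / sqrt (fact n))"
      by (simp add: norm_sympow real_sqrt_mult del: of_nat_Suc)
    also have "\<dots> \<le> 1 / 2 * (norm f ^ n / sqrt (fact n))"
      by (intro mult_right_mono le) simp
    finally show ?thesis by (simp add: norm_sympow)
  qed
  then show "summable (\<lambda>n. norm ((1 / sqrt (fact n)) *\<^sub>R sympow f n))"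
    by (intro summable_ratio_test[where c = "1 / 2" and N = N]) simp_all
qed

lemma cinner_nexp:
  "cinner (nexp f) (nexp g) = exp (cinner f g - (norm f)\<^sup>2 / 2 - (norm g)\<^sup>2 / 2)"
proof -
  let ?F = "\<lambda>f n. (1 / sqrt (fact n)) *\<^sub>R sympow f n"
  have 1: "cinner (?F f m) (suminf (?F g)) = cinner f g ^ m /\<^sub>R fact m / 1 * (sqrt (fact m) / sqrt (fact m))" for m
  proof -
    have "cinner (?F f m) (suminf (?F g)) = suminf (\<lambda>n. cinner (?F f m) (?F g n))"
      by (rule bounded_linear.suminf[OF bounded_bilinear.bounded_linear_right[OF bounded_bilinear_cinner] summable_nexp])
    also have "\<dots> = (\<Sum>n\<in>{m}. cinner (?F f m) (?F g n))"
      by (rule suminf_finite) (auto simp: scaleR_scaleC)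
    also have "\<dots> = cinner f g ^ m /\<^sub>R fact m"
    proof -
      have "complex_of_real (sqrt (fact m)) * complex_of_real (sqrt (fact m)) = fact m"
        by (simp flip: of_real_mult)
      then show ?thesis by (simp add: scaleR_scaleC scaleR_conv_of_real divide_inverse flip: mult.assoc) (simp add: scaleC_complex_def divide_simps)
    qed
    finally show ?thesis by simp
  qed
  have "cinner (suminf (?F f)) (suminf (?F g)) = suminf (\<lambda>m. cinner (?F f m) (suminf (?F g)))"
    by (rule bounded_linear.suminf[OF bounded_bilinear.bounded_linear_left[OF bounded_bilinear_cinner] summable_nexp])
  also have "\<dots> = exp (cinner f g)" by (simp add: 1 exp_def)
  finally have "cinner (nexp f) (nexp g)
      = complex_of_real (exp (- (norm f)\<^sup>2 / 2)) * (complex_of_real (exp (- (norm g)\<^sup>2 / 2)) * exp (cinner f g))"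
    by (simp add: nexp_def scaleR_scaleC)
  also have "\<dots> = exp (cinner f g - (norm f)\<^sup>2 / 2 - (norm g)\<^sup>2 / 2)"
    by (simp add: exp_of_real[symmetric] flip: exp_add) (simp add: algebra_simps)
  finally show ?thesis .
qed

text \<open>\<open>'a \<Rightarrow>\<^sub>L 'b\<close> is the library type of bounded real-linear maps;
  \<open>bops\<close> is the space \<open>B(H, K)\<close> of those that are complex-linear.\<close>

definition bops :: "('a::complex_inner \<Rightarrow>\<^sub>L 'b::complex_inner) set" where
  "bops = {T. \<forall>c x. blinfun_apply T (c *\<^sub>C x) = c *\<^sub>C blinfun_apply T x}"

definition adj :: "('a::complex_inner \<Rightarrow>\<^sub>L 'b::complex_inner) \<Rightarrow> ('b \<Rightarrow>\<^sub>L 'a)" where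
  "adj T = (THE S. S \<in> bops \<and>
     (\<forall>x y. cinner (blinfun_apply S y) x = cinner y (blinfun_apply T x)))"

definition pos_op :: "('a::complex_inner \<Rightarrow>\<^sub>L 'a) \<Rightarrow> bool" where
  "pos_op T \<longleftrightarrow> T \<in> bops \<and> (\<forall>x. Im (cinner x (blinfun_apply T x)) = 0
     \<and> 0 \<le> Re (cinner x (blinfun_apply T x)))"

definition op_le :: "('a::complex_inner \<Rightarrow>\<^sub>L 'a) \<Rightarrow> ('a \<Rightarrow>\<^sub>L 'a) \<Rightarrow> bool" where
  "op_le S T \<longleftrightarrow> pos_op (T - S)"

definition ultraweak :: "('a::complex_inner \<Rightarrow>\<^sub>L 'a) topology" where
  "ultraweak = topology_generated_by
     {{T. suminf (\<lambda>n. cinner (u n) (blinfun_apply T (v n))) \<in> U} | u v U.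
        summable (\<lambda>n::nat. (norm (u n))\<^sup>2) \<and> summable (\<lambda>n. (norm (v n))\<^sup>2) \<and> open U}"

definition commutant :: "('a::complex_inner \<Rightarrow>\<^sub>L 'a) set \<Rightarrow> ('a \<Rightarrow>\<^sub>L 'a) set" where
  "commutant M = {T \<in> bops. \<forall>S\<in>M. T o\<^sub>L S = S o\<^sub>L T}"

definition von_neumann_algebra :: "('a::chilbert_space \<Rightarrow>\<^sub>L 'a) set \<Rightarrow> bool" where
  "von_neumann_algebra M \<longleftrightarrow> M \<subseteq> bops \<and> (\<forall>a\<in>M. adj a \<in> M) \<and> commutant (commutant M) = M"

text \<open>Linearity of a map on a subspace; outside \<open>S\<close> the values of \<open>f\<close> are irrelevant.
  An unbounded operator with domain \<open>S\<close> is represented by such a map.\<close>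

definition clinear_on :: "'a::complex_vector set \<Rightarrow> ('a \<Rightarrow> 'b::complex_vector) \<Rightarrow> bool" where
  "clinear_on S f \<longleftrightarrow> (\<forall>x\<in>S. \<forall>y\<in>S. f (x + y) = f x + f y)
     \<and> (\<forall>c. \<forall>x\<in>S. f (c *\<^sub>C x) = c *\<^sub>C f x)"

definition normal_on ::
    "('a::complex_inner \<Rightarrow>\<^sub>L 'a) set \<Rightarrow> (('a \<Rightarrow>\<^sub>L 'a) \<Rightarrow> ('b::complex_inner \<Rightarrow>\<^sub>L 'b)) \<Rightarrow> bool" where
  "normal_on M \<Phi> \<longleftrightarrow> continuous_map (subtopology ultraweak M) ultraweak \<Phi>"

text \<open>\<open>matrix_norm_le n a C\<close>: the operator matrix \<open>(a i j)\<close>, acting on the direct sum of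
  \<open>n\<close> copies of the Hilbert space, has norm at most \<open>C\<close>.\<close>

definition matrix_norm_le :: "nat \<Rightarrow> (nat \<Rightarrow> nat \<Rightarrow> 'a::complex_inner \<Rightarrow>\<^sub>L 'a) \<Rightarrow> real \<Rightarrow> bool" where
  "matrix_norm_le n a C \<longleftrightarrow> 0 \<le> C \<and> (\<forall>x.
     (\<Sum>i<n. (norm (\<Sum>j<n. blinfun_apply (a i j) (x j)))\<^sup>2) \<le> C\<^sup>2 * (\<Sum>j<n. (norm (x j))\<^sup>2))"

definition completely_bounded_on ::
    "('a::complex_inner \<Rightarrow>\<^sub>L 'a) set \<Rightarrow> (('a \<Rightarrow>\<^sub>L 'a) \<Rightarrow> ('b::complex_inner \<Rightarrow>\<^sub>L 'b)) \<Rightarrow> bool" where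
  "completely_bounded_on M \<Phi> \<longleftrightarrow> (\<exists>K\<ge>0. \<forall>n a C. (\<forall>i<n. \<forall>j<n. a i j \<in> M) \<and> matrix_norm_le n a C
     \<longrightarrow> matrix_norm_le n (\<lambda>i j. \<Phi> (a i j)) (K * C))"

definition op_tensor :: "('a::complex_inner \<Rightarrow>\<^sub>L 'a) \<Rightarrow> ('b::complex_inner \<Rightarrow>\<^sub>L 'b) \<Rightarrow>
    (('a, 'b) htensor \<Rightarrow>\<^sub>L ('a, 'b) htensor)" (infixr \<open>\<otimes>\<^sub>o\<close> 75) where
  "S \<otimes>\<^sub>o T = (THE R. R \<in> bops \<and>
     (\<forall>x y. blinfun_apply R (x \<otimes> y) = blinfun_apply S x \<otimes> blinfun_apply T y))"

definition uw_tensor :: "('a::complex_inner \<Rightarrow>\<^sub>L 'a) set \<Rightarrow> ('b::complex_inner \<Rightarrow>\<^sub>L 'b) set \<Rightarrow>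
    (('a, 'b) htensor \<Rightarrow>\<^sub>L ('a, 'b) htensor) set" (infixr \<open>\<otimes>\<^sub>u\<^sub>w\<close> 75) where
  "M \<otimes>\<^sub>u\<^sub>w N = ultraweak closure_of cspan {S \<otimes>\<^sub>o T |S T. S \<in> M \<and> T \<in> N}"

text \<open>The ultraweak tensor product of normal maps \<open>\<Phi>\<close> on \<open>M\<close> and \<open>\<Psi>\<close> on \<open>N\<close>: the normal
  linear map on \<open>M \<otimes>\<^sub>u\<^sub>w N\<close> extending \<open>S \<otimes> T \<mapsto> \<Phi> S \<otimes> \<Psi> T\<close>. It is unique on
  \<open>M \<otimes>\<^sub>u\<^sub>w N\<close> by density; its values elsewhere are irrelevant.\<close>

definition map_tensor :: "('a::complex_inner \<Rightarrow>\<^sub>L 'a) set \<Rightarrow> ('b::complex_inner \<Rightarrow>\<^sub>L 'b) set \<Rightarrow>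
    (('a \<Rightarrow>\<^sub>L 'a) \<Rightarrow> ('c::complex_inner \<Rightarrow>\<^sub>L 'c)) \<Rightarrow> (('b \<Rightarrow>\<^sub>L 'b) \<Rightarrow> ('d::complex_inner \<Rightarrow>\<^sub>L 'd)) \<Rightarrow>
    (('a, 'b) htensor \<Rightarrow>\<^sub>L ('a, 'b) htensor) \<Rightarrow> (('c, 'd) htensor \<Rightarrow>\<^sub>L ('c, 'd) htensor)" where
  "map_tensor M N \<Phi> \<Psi> = (SOME \<Theta>. clinear_on (M \<otimes>\<^sub>u\<^sub>w N) \<Theta> \<and> normal_on (M \<otimes>\<^sub>u\<^sub>w N) \<Theta>
     \<and> (\<forall>S\<in>M. \<forall>T\<in>N. \<Theta> (S \<otimes>\<^sub>o T) = \<Phi> S \<otimes>\<^sub>o \<Psi> T))"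

text \<open>Functions on the half-line are represented by functions on the reals;
  step functions are normalised to vanish on the negative half-line.\<close>

definition step_funs :: "(real \<Rightarrow> 'k::complex_inner) set" where
  "step_funs = {f. \<exists>(n::nat) a b c. (\<forall>i<n. 0 \<le> a i) \<and>
     f = (\<lambda>s. \<Sum>i<n. indicator {a i..<b i} s *\<^sub>R c i)}"

lemma square_integrable_step:
  assumes "f \<in> step_funs" shows "square_integrable (f :: real \<Rightarrow> 'k::complex_inner)"
proof -
  let ?M = "lebesgue_on {0::real..}"
  have 1: "square_integrable (\<lambda>s. indicator {a..<b} s *\<^sub>R c)" for a b :: real and c :: 'k
  proof -
    have sets: "{a..<b} \<inter> space ?M \<in> sets ?M"
      by (auto simp: sets_restrict_space space_restrict_space intro!: image_eqI[of _ _ "{a..<b}"])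
    have "simple_function ?M (indicator {a..<b} :: real \<Rightarrow> real)"
      using simple_function_indicator[OF sets]
      by (rule simple_function_cong[THEN iffD1, rotated]) (auto simp: indicator_def)
    then have "simple_function ?M (\<lambda>s. indicator {a..<b} s *\<^sub>R c)"
      by (rule simple_function_compose1[of _ _ "\<lambda>x. x *\<^sub>R c"])
    then have "strongly_measurable ?M (\<lambda>s. indicator {a..<b} s *\<^sub>R c)"
      unfolding strongly_measurable_def
      by (intro exI[of _ "\<lambda>_ s. indicator {a..<b} s *\<^sub>R c"]) auto
    moreover have "integrable ?M (\<lambda>s. (norm (indicator {a..<b} s *\<^sub>R c))\<^sup>2)"
    proof -
      have "integrable lebesgue (\<lambda>s. indicator ({0..} \<inter> {a..<b}) s * (norm c)\<^sup>2)"
      proof (intro integrable_mult_left integrable_real_indicator)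
        show "{0..} \<inter> {a..<b} \<in> sets lebesgue" by simp
        have "emeasure lebesgue ({0..} \<inter> {a..<b}) \<le> emeasure lebesgue {a..b}"
          by (rule emeasure_mono) auto
        also have "\<dots> < \<infinity>" using emeasure_lborel_cbox_finite[of a b] by simp
        finally show "emeasure lebesgue ({0..} \<inter> {a..<b}) < \<infinity>" .
      qed
      then have "integrable lebesgue (\<lambda>s. indicator {0..} s *\<^sub>R (norm (indicator {a..<b} s *\<^sub>R c))\<^sup>2)"
        by (rule Bochner_Integration.integrable_cong[THEN iffD1, rotated 2])
          (auto simp: indicator_def)
      then show ?thesis by (subst integrable_restrict_space) auto
    qed
    ultimately show ?thesis by (simp add: square_integrable_def)
  qed
  have "square_integrable (\<lambda>s. \<Sum>i<n. indicator {a i..<b i} s *\<^sub>R c i)"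
    for n :: nat and a b and c :: "nat \<Rightarrow> 'k"
  proof (induction n)
    case (Suc n)
    from square_integrable_add[OF this 1] show ?case by (simp only: sum.lessThan_Suc)
  qed (simp add: square_integrable_zero)
  then show ?thesis using assms by (auto simp: step_funs_def)
qed

definition restr :: "real set \<Rightarrow> (real \<Rightarrow> 'k::zero) \<Rightarrow> real \<Rightarrow> 'k" where
  "restr J f = (\<lambda>s. if s \<in> J then f s else 0)"

definition expvec :: "(real \<Rightarrow> 'k::complex_inner) \<Rightarrow> 'k L2 fock" (\<open>\<varpi>\<close>) where
  "\<varpi> f = nexp (abs_L2 f)"

type_synonym ('h, 'k) hF = "('h, 'k L2 fock) htensor"
type_synonym ('h, 'k) khF = "(complex \<times> 'k, ('h, 'k) hF) htensor"

definition alg_tensor :: "'a::complex_inner set \<Rightarrow> 'b::complex_inner set \<Rightarrow> ('a, 'b) htensor set"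
    (infixr \<open>\<otimes>\<^sub>a\<close> 75) where
  "V \<otimes>\<^sub>a W = cspan {v \<otimes> w |v w. v \<in> V \<and> w \<in> W}"

definition exp_space :: "'k::complex_inner L2 fock set" where
  "exp_space = cspan (\<varpi> ` step_funs)"

definition exp_dom :: "('h::complex_inner, 'k::complex_inner) hF set" where
  "exp_dom = UNIV \<otimes>\<^sub>a exp_space"

text \<open>\<open>ket w\<close> and \<open>bra w\<close> are \<open>E\<^sub>w\<close> and \<open>E\<^sup>w\<close> for \<open>w\<close> in the right-hand factor;
  \<open>ket2 c w\<close> and \<open>bra2 c w\<close> are \<open>E\<close> with the vector \<open>c \<otimes> w\<close> in the two outer factors of
  a threefold tensor product.\<close>

definition ket :: "'w::complex_inner \<Rightarrow> 'h::complex_inner \<Rightarrow>\<^sub>L ('h, 'w) htensor" where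
  "ket w = Blinfun (\<lambda>v. v \<otimes> w)"

definition bra :: "'w::complex_inner \<Rightarrow> ('h::complex_inner, 'w) htensor \<Rightarrow>\<^sub>L 'h" where
  "bra w = adj (ket w)"

definition ket2 :: "'c::complex_inner \<Rightarrow> 'w::complex_inner \<Rightarrow>
    'h::complex_inner \<Rightarrow>\<^sub>L ('c, ('h, 'w) htensor) htensor" where
  "ket2 c w = Blinfun (\<lambda>v. c \<otimes> (v \<otimes> w))"

definition bra2 :: "'c::complex_inner \<Rightarrow> 'w::complex_inner \<Rightarrow>
    ('c, ('h::complex_inner, 'w) htensor) htensor \<Rightarrow>\<^sub>L 'h" where
  "bra2 c w = adj (ket2 c w)"

lemma ket_apply [simp]: "blinfun_apply (ket w) v = v \<otimes> w"
  unfolding ket_def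
  by (subst bounded_linear_Blinfun_apply)
    (auto intro: bounded_bilinear.bounded_linear_left[OF bounded_bilinear_tensor])

lemma ket2_apply [simp]: "blinfun_apply (ket2 c w) v = c \<otimes> (v \<otimes> w)"
  unfolding ket2_def
  by (subst bounded_linear_Blinfun_apply)
    (auto intro!: bounded_linear_compose[OF
      bounded_bilinear.bounded_linear_right[OF bounded_bilinear_tensor]
      bounded_bilinear.bounded_linear_left[OF bounded_bilinear_tensor]])

text \<open>\<open>L\<^sup>2(J; k)\<close> is a closed subspace of \<open>L\<^sup>2(\<real>\<^sub>+; k)\<close>, so the symmetric Fock space over it is
  the closed subspace \<open>fock_sub J\<close> of the full one, and \<open>B(fock_sub J)\<close> is represented by the
  corner \<open>bops_sub J\<close> of operators that vanish on the orthogonal complement of \<open>fock_sub J\<close> and have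
  range in it. Its unit is the orthogonal projection \<open>id_sub J\<close>.\<close>

definition fock_sub :: "real set \<Rightarrow> 'k::complex_inner L2 fock set" where
  "fock_sub J = closure (cspan {sympow (abs_L2 f) n |f n.
     square_integrable f \<and> (\<forall>s. s \<notin> J \<longrightarrow> f s = 0)})"

definition bops_sub :: "real set \<Rightarrow> ('k::complex_inner L2 fock \<Rightarrow>\<^sub>L 'k L2 fock) set" where
  "bops_sub J = {Z \<in> bops. range (blinfun_apply Z) \<subseteq> fock_sub J
     \<and> (\<forall>x. (\<forall>y\<in>fock_sub J. cinner y x = 0) \<longrightarrow> blinfun_apply Z x = 0)}"

definition id_sub :: "real set \<Rightarrow> ('k::complex_inner L2 fock \<Rightarrow>\<^sub>L 'k L2 fock)" where
  "id_sub J = (THE P. P \<in> bops_sub J \<and> (\<forall>x\<in>fock_sub J. blinfun_apply P x = x))"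

text \<open>\<open>T\<^sub>r\<close>, followed by the inclusion of the Fock space over \<open>[r,\<infinity>)\<close>; hence an isometry.\<close>

definition fock_shift :: "real \<Rightarrow> 'k::complex_inner L2 fock \<Rightarrow>\<^sub>L 'k L2 fock" where
  "fock_shift r = (THE T. T \<in> bops \<and> (\<forall>f\<in>step_funs. blinfun_apply T (\<varpi> f) = \<varpi> (\<lambda>s. f (s - r))))"

text \<open>The identification of \<open>h \<otimes> F\<close> with \<open>(h \<otimes> F\<^bsub>[0,r)\<^esub>) \<otimes> F\<^bsub>[r,\<infinity>)\<^esub>\<close>, as an isometry into
  \<open>(h \<otimes> F) \<otimes> F\<close>.\<close>

definition fock_split :: "real \<Rightarrow> ('h::complex_inner, 'k::complex_inner) hF \<Rightarrow>\<^sub>L (('h, 'k) hF, 'k L2 fock) htensor"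
  where "fock_split r = (THE W. W \<in> bops \<and> (\<forall>u. \<forall>f\<in>step_funs.
     blinfun_apply W (u \<otimes> \<varpi> f) = (u \<otimes> \<varpi> (restr {0..<r} f)) \<otimes> \<varpi> (restr {r..} f)))"

definition unsplit :: "real \<Rightarrow> ((('h::complex_inner, 'k::complex_inner) hF, 'k L2 fock) htensor \<Rightarrow>\<^sub>L
    (('h, 'k) hF, 'k L2 fock) htensor) \<Rightarrow> (('h, 'k) hF \<Rightarrow>\<^sub>L ('h, 'k) hF)" where
  "unsplit r X = adj (fock_split r) o\<^sub>L X o\<^sub>L fock_split r"

definition process ::
    "(real \<Rightarrow> ('h::complex_inner, 'k::complex_inner) hF \<Rightarrow> ('h, 'k) hF) \<Rightarrow> bool" where
  "process X \<longleftrightarrow>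
     (\<forall>t\<ge>0. clinear_on exp_dom (X t)) \<and>
     (\<forall>\<eta>. \<forall>\<zeta>\<in>exp_dom. (\<lambda>t. cinner \<eta> (X t \<zeta>)) \<in> borel_measurable (lebesgue_on {0..})) \<and>
     (\<forall>f\<in>step_funs. \<forall>g\<in>step_funs. \<forall>t\<ge>0. \<forall>v.
        blinfun_apply (bra (\<varpi> f)) (X t (blinfun_apply (ket (\<varpi> g)) v))
        = cinner (\<varpi> (restr {t..} f)) (\<varpi> (restr {t..} g)) *\<^sub>C
          blinfun_apply (bra (\<varpi> (restr {0..<t} f)))
            (X t (blinfun_apply (ket (\<varpi> (restr {0..<t} g))) v)))"

definition process_in :: "('h::complex_inner \<Rightarrow>\<^sub>L 'h) set \<Rightarrow>
    (real \<Rightarrow> ('h, 'k::complex_inner) hF \<Rightarrow> ('h, 'k) hF) \<Rightarrow> bool" where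
  "process_in A X \<longleftrightarrow> process X \<and>
     (\<forall>f\<in>step_funs. \<forall>g\<in>step_funs. \<forall>t\<ge>0. \<exists>a\<in>A. \<forall>v.
        blinfun_apply (bra (\<varpi> f)) (X t (blinfun_apply (ket (\<varpi> g)) v)) = blinfun_apply a v)"

text \<open>\<open>X\<^sub>t\<close> is bounded with \<open>B\<close> as its (by density unique) continuous extension.\<close>

definition bdd_ext :: "(('h::complex_inner, 'k::complex_inner) hF \<Rightarrow> ('h, 'k) hF) \<Rightarrow>
    (('h, 'k) hF \<Rightarrow>\<^sub>L ('h, 'k) hF) \<Rightarrow> bool" where
  "bdd_ext X B \<longleftrightarrow> B \<in> bops \<and> (\<forall>\<zeta>\<in>exp_dom. blinfun_apply B \<zeta> = X \<zeta>)"

definition contractive ::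
    "(real \<Rightarrow> ('h::complex_inner, 'k::complex_inner) hF \<Rightarrow> ('h, 'k) hF) \<Rightarrow> bool" where
  "contractive X \<longleftrightarrow> (\<forall>t\<ge>0. \<exists>B. bdd_ext (X t) B \<and> norm B \<le> 1)"

definition isometric ::
    "(real \<Rightarrow> ('h::complex_inner, 'k::complex_inner) hF \<Rightarrow> ('h, 'k) hF) \<Rightarrow> bool" where
  "isometric X \<longleftrightarrow> (\<forall>t\<ge>0. \<exists>B. bdd_ext (X t) B \<and> adj B o\<^sub>L B = id_blinfun)"

definition coisometric ::
    "(real \<Rightarrow> ('h::complex_inner, 'k::complex_inner) hF \<Rightarrow> ('h, 'k) hF) \<Rightarrow> bool" where
  "coisometric X \<longleftrightarrow> (\<forall>t\<ge>0. \<exists>B. bdd_ext (X t) B \<and> B o\<^sub>L adj B = id_blinfun)"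

definition quasicontractive ::
    "(real \<Rightarrow> ('h::complex_inner, 'k::complex_inner) hF \<Rightarrow> ('h, 'k) hF) \<Rightarrow> bool" where
  "quasicontractive X \<longleftrightarrow>
     (\<exists>\<omega>::real. \<forall>t\<ge>0. \<exists>B. bdd_ext (X t) B \<and> exp (- \<omega> * t) * norm B \<le> 1)"

text \<open>\<open>past A r k\<close> is \<open>k\<^bsub>r)\<^esub>\<close>: the map with \<open>k\<^sub>r(a) = k\<^bsub>r)\<^esub>(a) \<otimes> I\<^bsub>[r,\<infinity>)\<^esub>\<close>.\<close>

definition past :: "('h::complex_inner \<Rightarrow>\<^sub>L 'h) set \<Rightarrow> real \<Rightarrow>
    (real \<Rightarrow> ('h \<Rightarrow>\<^sub>L 'h) \<Rightarrow> (('h, 'k::complex_inner) hF \<Rightarrow>\<^sub>L ('h, 'k) hF)) \<Rightarrow>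
    ('h \<Rightarrow>\<^sub>L 'h) \<Rightarrow> (('h, 'k) hF \<Rightarrow>\<^sub>L ('h, 'k) hF)" where
  "past A r k a = (THE X. X \<in> A \<otimes>\<^sub>u\<^sub>w bops_sub {0..<r} \<and> k r a = unsplit r (X \<otimes>\<^sub>o id_sub {r..}))"

definition khat :: "('h::complex_inner \<Rightarrow>\<^sub>L 'h) set \<Rightarrow>
    (real \<Rightarrow> ('h \<Rightarrow>\<^sub>L 'h) \<Rightarrow> (('h, 'k::complex_inner) hF \<Rightarrow>\<^sub>L ('h, 'k) hF)) \<Rightarrow> real \<Rightarrow>
    (('h, 'k) hF \<Rightarrow>\<^sub>L ('h, 'k) hF) \<Rightarrow> (('h, 'k) hF \<Rightarrow>\<^sub>L ('h, 'k) hF)" where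
  "khat A k r X = unsplit r (map_tensor A (bops_sub {r..}) (past A r k) (\<lambda>Z. Z) X)"

definition ktilde :: "('h::complex_inner \<Rightarrow>\<^sub>L 'h) set \<Rightarrow>
    (real \<Rightarrow> ('h \<Rightarrow>\<^sub>L 'h) \<Rightarrow> (('h, 'k::complex_inner) hF \<Rightarrow>\<^sub>L ('h, 'k) hF)) \<Rightarrow> real \<Rightarrow>
    ((complex \<times> 'k, 'h) htensor \<Rightarrow>\<^sub>L (complex \<times> 'k, 'h) htensor) \<Rightarrow> (('h, 'k) khF \<Rightarrow>\<^sub>L ('h, 'k) khF)" where
  "ktilde A k t = map_tensor bops A (\<lambda>Z. Z) (k t)"

definition sigma :: "real \<Rightarrow> (('h::complex_inner, 'k::complex_inner) hF \<Rightarrow>\<^sub>L ('h, 'k) hF) \<Rightarrow>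
    (('h, 'k) hF \<Rightarrow>\<^sub>L ('h, 'k) hF)" where
  "sigma r X = (id_blinfun \<otimes>\<^sub>o fock_shift r) o\<^sub>L X o\<^sub>L adj (id_blinfun \<otimes>\<^sub>o fock_shift r)"

definition mapping_process :: "('h::complex_inner \<Rightarrow>\<^sub>L 'h) set \<Rightarrow>
    (real \<Rightarrow> ('h \<Rightarrow>\<^sub>L 'h) \<Rightarrow> (('h, 'k::complex_inner) hF \<Rightarrow>\<^sub>L ('h, 'k) hF)) \<Rightarrow> bool" where
  "mapping_process A k \<longleftrightarrow>
     (\<forall>t\<ge>0. clinear_on A (k t) \<and> k t ` A \<subseteq> bops) \<and>
     (\<forall>a\<in>A. process_in A (\<lambda>t. blinfun_apply (k t a)))"

definition qs_cocycle :: "('h::complex_inner \<Rightarrow>\<^sub>L 'h) set \<Rightarrow>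
    (real \<Rightarrow> ('h \<Rightarrow>\<^sub>L 'h) \<Rightarrow> (('h, 'k::complex_inner) hF \<Rightarrow>\<^sub>L ('h, 'k) hF)) \<Rightarrow> bool" where
  "qs_cocycle A k \<longleftrightarrow> mapping_process A k \<and>
     (\<forall>t\<ge>0. normal_on A (k t) \<and> completely_bounded_on A (k t)) \<and>
     (\<forall>a\<in>A. k 0 a = a \<otimes>\<^sub>o id_blinfun) \<and>
     (\<forall>r\<ge>0. \<forall>t\<ge>0. \<forall>a\<in>A. k (r + t) a = khat A k r (sigma r (k t a)))"

definition qs_flow :: "('h::complex_inner \<Rightarrow>\<^sub>L 'h) set \<Rightarrow>
    (real \<Rightarrow> ('h \<Rightarrow>\<^sub>L 'h) \<Rightarrow> (('h, 'k::complex_inner) hF \<Rightarrow>\<^sub>L ('h, 'k) hF)) \<Rightarrow> bool" where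
  "qs_flow A k \<longleftrightarrow> qs_cocycle A k \<and>
     (\<forall>a\<in>A. continuous_map (top_of_set {0..}) ultraweak (\<lambda>t. k t a)) \<and>
     (\<forall>t\<ge>0. (\<forall>a\<in>A. \<forall>b\<in>A. k t (a o\<^sub>L b) = k t a o\<^sub>L k t b) \<and>
        (\<forall>a\<in>A. k t (adj a) = adj (k t a)) \<and> k t id_blinfun = id_blinfun)"

definition hat :: "'k \<Rightarrow> complex \<times> 'k" where
  "hat c = (1, c)"

definition Delta :: "(complex \<times> 'k::complex_inner) \<Rightarrow>\<^sub>L (complex \<times> 'k)" where
  "Delta = Blinfun (\<lambda>p. (0, snd p))"

definition Delta_perp :: "(complex \<times> 'k::complex_inner) \<Rightarrow>\<^sub>L (complex \<times> 'k)" where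
  "Delta_perp = id_blinfun - Delta"

lemma Delta_apply [simp]: "blinfun_apply Delta p = (0, snd p)"
  unfolding Delta_def
  by (subst bounded_linear_Blinfun_apply)
    (auto intro: bounded_linear_Pair bounded_linear_zero bounded_linear_snd)

definition nabla_hat ::
    "real \<Rightarrow> ('h::complex_inner, 'k::complex_inner) hF \<Rightarrow> ('h, 'k) khF" where
  "nabla_hat s = (SOME N. clinear_on exp_dom N \<and>
     (\<forall>u. \<forall>f\<in>step_funs. N (u \<otimes> \<varpi> f) = hat (f s) \<otimes> (u \<otimes> \<varpi> f)))"

text \<open>\<open>\<parallel>f\<parallel>\<^sup>p\<close> is (Bochner) integrable over every \<open>[0,T]\<close>.\<close>

definition locally_integrable :: "nat \<Rightarrow> (real \<Rightarrow> 'b::real_normed_vector) \<Rightarrow> bool" where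
  "locally_integrable p f \<longleftrightarrow> (\<forall>T\<ge>0. \<exists>g. strongly_measurable (lebesgue_on {0..T}) g
     \<and> integrable (lebesgue_on {0..T}) (\<lambda>s. norm (g s) ^ p)
     \<and> (AE s in lebesgue_on {0..T}. f s = g s))"

text \<open>A family of operators \<open>G t\<close> with domains \<open>Dm t\<close>.\<close>

definition qs_integrable :: "(real \<Rightarrow> ('h::complex_inner, 'k::complex_inner) khF set) \<Rightarrow>
    (real \<Rightarrow> ('h, 'k) khF \<Rightarrow> ('h, 'k) khF) \<Rightarrow> bool" where
  "qs_integrable Dm G \<longleftrightarrow>
     (\<forall>t\<ge>0. complex_vector.subspace (Dm t) \<and> clinear_on (Dm t) (G t)) \<and>
     (\<forall>\<zeta>\<in>exp_dom. (\<forall>t\<ge>0. nabla_hat t \<zeta> \<in> Dm t) \<and>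
        locally_integrable 1
          (\<lambda>s. blinfun_apply (Delta_perp \<otimes>\<^sub>o id_blinfun) (G s (nabla_hat s \<zeta>))) \<and>
        locally_integrable 2
          (\<lambda>s. blinfun_apply (Delta \<otimes>\<^sub>o id_blinfun) (G s (nabla_hat s \<zeta>)))) \<and>
     (\<forall>f\<in>step_funs. \<forall>g\<in>step_funs. \<forall>t\<ge>0. \<forall>v.
        blinfun_apply (bra2 (hat (f t)) (\<varpi> f))
          (G t (nabla_hat t (blinfun_apply (ket (\<varpi> g)) v)))
        = cinner (\<varpi> (restr {t..} f)) (\<varpi> (restr {t..} g)) *\<^sub>C
          blinfun_apply (bra2 (hat (f t)) (\<varpi> (restr {0..<t} f)))
            (G t (blinfun_apply (ket2 (hat (g t)) (\<varpi> (restr {0..<t} g))) v)))"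

definition has_qs_integral :: "(real \<Rightarrow> ('h::complex_inner, 'k::complex_inner) khF set) \<Rightarrow>
    (real \<Rightarrow> ('h, 'k) khF \<Rightarrow> ('h, 'k) khF) \<Rightarrow> (real \<Rightarrow> ('h, 'k) hF \<Rightarrow> ('h, 'k) hF) \<Rightarrow> bool" where
  "has_qs_integral Dm G X \<longleftrightarrow> qs_integrable Dm G \<and> process X \<and>
     (\<forall>\<zeta>\<in>exp_dom. continuous_on {0..} (\<lambda>t. X t \<zeta>)) \<and>
     (\<forall>\<eta>\<in>exp_dom. \<forall>\<zeta>\<in>exp_dom. \<forall>t\<ge>0. cinner \<eta> (X t \<zeta>)
        = (\<integral>s. cinner (nabla_hat s \<eta>) (G s (nabla_hat s \<zeta>)) \<partial>lebesgue_on {0..t}))"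

text \<open>The algebraic ampliation \<open>I \<otimes> X\<close>, with domain \<open>UNIV \<otimes>\<^sub>a exp_dom\<close>.\<close>

definition ampl :: "(('h::complex_inner, 'k::complex_inner) hF \<Rightarrow> ('h, 'k) hF) \<Rightarrow>
    ('h, 'k) khF \<Rightarrow> ('h, 'k) khF" where
  "ampl X = (SOME Z. clinear_on (UNIV \<otimes>\<^sub>a exp_dom) Z \<and>
     (\<forall>c. \<forall>\<zeta>\<in>exp_dom. Z (c \<otimes> \<zeta>) = c \<otimes> X \<zeta>))"

text \<open>\<open>Y\<close> is the strong solution of \<open>Y\<^sub>0 = I\<close>, \<open>dY\<^sub>t = \<^bold>j\<^sub>t(F) Y\<^sub>t d\<Lambda>\<^sub>t\<close> (ampliations suppressed).\<close>

definition perturbation_process :: "('h::complex_inner \<Rightarrow>\<^sub>L 'h) set \<Rightarrow>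
    (real \<Rightarrow> ('h \<Rightarrow>\<^sub>L 'h) \<Rightarrow> (('h, 'k::complex_inner) hF \<Rightarrow>\<^sub>L ('h, 'k) hF)) \<Rightarrow>
    ((complex \<times> 'k, 'h) htensor \<Rightarrow>\<^sub>L (complex \<times> 'k, 'h) htensor) \<Rightarrow>
    (real \<Rightarrow> ('h, 'k) hF \<Rightarrow> ('h, 'k) hF) \<Rightarrow> bool" where
  "perturbation_process A j F Y \<longleftrightarrow> process Y \<and>
     has_qs_integral (\<lambda>_. UNIV \<otimes>\<^sub>a exp_dom)
       (\<lambda>t \<xi>. blinfun_apply (ktilde A j t F) (ampl (Y t) \<xi>)) (\<lambda>t \<zeta>. Y t \<zeta> - \<zeta>)"

definition qform :: "((complex \<times> 'k::complex_inner, 'h::complex_inner) htensor \<Rightarrow>\<^sub>L (complex \<times> 'k, 'h) htensor)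
    \<Rightarrow> ((complex \<times> 'k, 'h) htensor \<Rightarrow>\<^sub>L (complex \<times> 'k, 'h) htensor)" where
  "qform F = adj F + F + (adj F o\<^sub>L (Delta \<otimes>\<^sub>o id_blinfun) o\<^sub>L F)"

definition qc_beta :: "real \<Rightarrow> ('h::complex_inner \<Rightarrow>\<^sub>L 'h) set \<Rightarrow>
    ((complex \<times> 'k::complex_inner, 'h) htensor \<Rightarrow>\<^sub>L (complex \<times> 'k, 'h) htensor) set" where
  "qc_beta \<beta> A = {F \<in> bops \<otimes>\<^sub>u\<^sub>w A. op_le (qform F) (\<beta> *\<^sub>R (Delta_perp \<otimes>\<^sub>o id_blinfun))}"

definition qc :: "('h::complex_inner \<Rightarrow>\<^sub>L 'h) set \<Rightarrow>
    ((complex \<times> 'k::complex_inner, 'h) htensor \<Rightarrow>\<^sub>L (complex \<times> 'k, 'h) htensor) set" where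
  "qc A = (\<Union>\<beta>. qc_beta \<beta> A)"

end

theory Submission
  imports Defs
begin

text \<open>For \<open>\<zeta> = \<Sum> u\<^sub>p \<otimes> \<varpi>(f\<^sub>p)\<close> with step functions \<open>f\<^sub>p\<close>, the Ito formula gives \<open>\<parallel>Y\<^sub>t \<zeta>\<parallel>\<^sup>2\<close> the right
  derivative \<open>\<langle>\<xi>\<^sub>t, j\<^sub>t(q(F)) \<xi>\<^sub>t\<rangle>\<close>, where \<open>\<xi>\<^sub>t = \<Sum> f\<^sub>p(t)\<^sup>\<and> \<otimes> Y\<^sub>t (u\<^sub>p \<otimes> \<varpi>(f\<^sub>p))\<close> and
  \<open>\<Delta>\<^sup>\<bottom> \<xi>\<^sub>t = 1 \<otimes> Y\<^sub>t \<zeta>\<close>. Hence a bound on \<open>q(F)\<close> by \<open>\<beta> \<Delta>\<^sup>\<bottom>\<close>, from above or below, gives by Gronwall the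
  corresponding exponential bound on \<open>\<parallel>Y\<^sub>t \<zeta>\<parallel>\<^sup>2\<close>. Conversely such a bound passes to the derivative at
  \<open>t = 0\<close>, and for \<open>f\<^sub>p = c\<^sub>p 1\<^bsub>[0,\<delta>)\<^esub>\<close> the vectors \<open>\<xi>\<^sub>0\<close> approach, as \<open>\<delta> \<rightarrow> 0\<close>, arbitrary elements
  \<open>\<Sum> (1, c\<^sub>p) \<otimes> u\<^sub>p \<otimes> \<varpi>(0)\<close> of a total set. If \<open>Y\<close> is coisometric, then \<open>Z\<^sub>t = Y\<^sub>t\<^sup>*\<close> is isometric and
  strongly continuous, and \<open>dZ = Z j(F\<^sup>*) d\<Lambda>\<close>, so the argument at \<open>t = 0\<close> applies to \<open>Z\<close>.

  The Ito formula is needed only for right derivatives at continuous integrands. That \<open>id \<otimes> j\<^sub>t\<close> preserves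
  positivity and products is seen from intertwiners between \<open>j\<^sub>t\<close> and the identity representation.\<close>

section \<open>Operators on Hilbert spaces\<close>

text \<open>The amplification of \<open>j t\<close> enters only through \<open>map_tensor\<close>, a
  choice among normal extensions whose existence has to be proved. The structure theorem for normal
  representations is avoided: for a given sequence of vectors it is enough to have countably many
  operators that intertwine \<open>j t\<close> with the identity representation and whose squares
  sum to the identity on those vectors. Expanding inner products over such a family transfers
  identities, inequalities and ultraweak functionals back to \<open>A\<close>.

  Right derivatives suffice because a step function is constant on some \<open>[a, a + r]\<close>.
  There the integrand is continuous, and up to an error o(sqrt h) the integral over
  \<open>[a, a + h]\<close> is that of a constant integrand, an explicit combination of exponential
  and creation vectors; the Ito term is the commutator term in the inner product of two creation
  vectors.

  A factor \<sigma> = 1 or -1 carries upper and lower bounds through the same argument, so isometry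
  is a pair of cases with \<beta> = 0. For the adjoint of a coisometric process no differential
  inequality is integrated; only its derivative at time 0 is used.\<close>

lemma scaleR_eq_scaleC: "r *\<^sub>R (x::'a::complex_vector) = complex_of_real r *\<^sub>C x"
  by (rule scaleR_scaleC)

lemma bounded_linear_scaleC: "bounded_linear (\<lambda>x::'a::complex_inner. c *\<^sub>C x)"
  by (rule bounded_linear_intro[where K = "cmod c"])
    (auto simp: scaleC_add_right scaleR_scaleC mult.commute)

lemmas tendsto_scaleC [tendsto_intros] = bounded_linear.tendsto[OF bounded_linear_scaleC]
lemmas continuous_on_scaleC [continuous_intros] = bounded_linear.continuous_on[OF bounded_linear_scaleC]
lemmas continuous_on_cinner [continuous_intros] = bounded_bilinear.continuous_on[OF bounded_bilinear_cinner]
lemmas continuous_on_tensor [continuous_intros] = bounded_bilinear.continuous_on[OF bounded_bilinear_tensor]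
lemmas tendsto_tensor [tendsto_intros] = bounded_bilinear.tendsto[OF bounded_bilinear_tensor]

lemma cinner_minus_right [simp]: "cinner (x::'a::complex_inner) (- y) = - cinner x y"
  using cinner_diff_right[of x 0 y] by simp

lemma cinner_minus_left [simp]: "cinner (- x::'a::complex_inner) y = - cinner x y"
  using cinner_diff_left[of 0 x y] by simp

lemma cinner_swap_zero: "cinner (x::'a::complex_inner) y = 0 \<Longrightarrow> cinner y x = 0"
  using cinner_commute[of y x] by simp

lemma norm_power2_cinner: "(norm (x::'a::complex_inner))\<^sup>2 = Re (cinner x x)"
  by (simp add: cinner_self)

lemma norm_power2_add: "(norm (x + y::'a::complex_inner))\<^sup>2 = (norm x)\<^sup>2 + 2 * Re (cinner x y) + (norm y)\<^sup>2"
proof -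
  have "Re (cinner y x) = Re (cinner x y)" using cinner_commute[of y x] by simp
  then show ?thesis by (simp add: norm_power2_cinner cinner_add_left cinner_add_right)
qed

section \<open>Closed subspaces and orthogonal projections\<close>

lemma csubspace_scaleR: "complex_vector.subspace M \<Longrightarrow> x \<in> M \<Longrightarrow> r *\<^sub>R (x::'a::complex_inner) \<in> M"
  by (simp add: scaleR_scaleC complex_vector.subspace_scale)

lemma csubspace_closure:
  assumes "complex_vector.subspace (M::'a::complex_inner set)" shows "complex_vector.subspace (closure M)"
proof (rule complex_vector.subspaceI)
  show "0 \<in> closure M" using complex_vector.subspace_0[OF assms] closure_subset by blast
next
  fix x y assume "x \<in> closure M" "y \<in> closure M"
  then obtain a b where "\<And>n. a n \<in> M" "a \<longlonglongrightarrow> x" "\<And>n. b n \<in> M" "b \<longlonglongrightarrow> y"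
    unfolding closure_sequential by blast
  then show "x + y \<in> closure M" unfolding closure_sequential
    by (intro exI[of _ "\<lambda>n. a n + b n"]) (auto intro: tendsto_add complex_vector.subspace_add[OF assms])
next
  fix c x assume "x \<in> closure M"
  then obtain a where "\<And>n. a n \<in> M" "a \<longlonglongrightarrow> x" unfolding closure_sequential by blast
  then show "c *\<^sub>C x \<in> closure M" unfolding closure_sequential
    by (intro exI[of _ "\<lambda>n. c *\<^sub>C a n"]) (auto intro: tendsto_scaleC complex_vector.subspace_scale[OF assms])
qed

text \<open>A minimising sequence for the distance is Cauchy by the parallelogram identity;
  minimality of the limit against small perturbations along each \<open>y\<close> forces
  orthogonality.\<close>

lemma projection_exists:
  fixes M :: "'a::chilbert_space set"
  assumes sub: "complex_vector.subspace M" and cl: "closed M"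
  shows "\<exists>p\<in>M. \<forall>y\<in>M. cinner y (x - p) = 0"
proof -
  define d where "d = (INF m\<in>M. (norm (x - m))\<^sup>2)"
  have bdd: "bdd_below ((\<lambda>m. (norm (x - m))\<^sup>2) ` M)" by (intro bdd_belowI2[of _ 0]) simp
  have ne: "M \<noteq> {}" using complex_vector.subspace_0[OF sub] by blast
  have d_le: "d \<le> (norm (x - m))\<^sup>2" if "m \<in> M" for m
    unfolding d_def by (rule cINF_lower[OF bdd that])
  have "\<exists>m\<in>M. (norm (x - m))\<^sup>2 < d + inverse (real (Suc n))" for n
  proof -
    have "d < d + inverse (real (Suc n))" by simp
    then show ?thesis unfolding d_def using cINF_less_iff[OF ne bdd] by blast
  qed
  then obtain p where pM: "\<And>n. p n \<in> M" and p: "\<And>n. (norm (x - p n))\<^sup>2 < d + inverse (real (Suc n))"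
    by metis
  have par: "(norm (p m - p n))\<^sup>2 \<le> 2 * inverse (real (Suc m)) + 2 * inverse (real (Suc n))" for m n
  proof -
    let ?u = "x - p m" and ?v = "x - p n"
    have "(1/2) *\<^sub>R (p m + p n) \<in> M" by (intro csubspace_scaleR sub complex_vector.subspace_add pM)
    then have 1: "d \<le> (norm (x - (1/2) *\<^sub>R (p m + p n)))\<^sup>2" by (rule d_le)
    have "x - (1/2) *\<^sub>R (p m + p n) = (1/2) *\<^sub>R (?u + ?v)"
      by (simp add: algebra_simps scaleR_2[symmetric] flip: scaleR_add_left)
    then have 2: "4 * (norm (x - (1/2) *\<^sub>R (p m + p n)))\<^sup>2 = (norm (?u + ?v))\<^sup>2"
      by (simp add: power_divide)
    have "(norm (?u - ?v))\<^sup>2 + (norm (?u + ?v))\<^sup>2 = 2 * (norm ?u)\<^sup>2 + 2 * (norm ?v)\<^sup>2"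
      by (simp add: power2_norm_eq_inner inner_add_left inner_add_right inner_diff_left inner_diff_right inner_commute)
    moreover have "norm (?u - ?v) = norm (p m - p n)" by (simp add: norm_minus_commute)
    ultimately show ?thesis using 1 2 p[of m] p[of n] by simp
  qed
  have "Cauchy p"
  proof (rule metric_CauchyI)
    fix e :: real assume "e > 0"
    then have "e\<^sup>2 / 4 > 0" by simp
    then obtain N where N: "inverse (real (Suc N)) < e\<^sup>2 / 4" using reals_Archimedean by blast
    have "dist (p m) (p n) < e" if "m \<ge> N" "n \<ge> N" for m n
    proof -
      have "inverse (real (Suc m)) \<le> inverse (real (Suc N))" "inverse (real (Suc n)) \<le> inverse (real (Suc N))"
        using that by (auto intro!: le_imp_inverse_le)
      then have "(norm (p m - p n))\<^sup>2 < e\<^sup>2" using par[of m n] N by linarith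
      then show ?thesis using \<open>e > 0\<close> by (simp add: dist_norm power2_less_imp_less)
    qed
    then show "\<exists>M. \<forall>m\<ge>M. \<forall>n\<ge>M. dist (p m) (p n) < e" by blast
  qed
  then obtain q where q: "p \<longlonglongrightarrow> q" using Cauchy_convergent_iff convergent_def by blast
  have qM: "q \<in> M" using closed_sequentially[OF cl] pM q by blast
  have "(\<lambda>n. d + inverse (real (Suc n))) \<longlonglongrightarrow> d + 0"
    by (intro tendsto_intros LIMSEQ_inverse_real_of_nat)
  moreover have "(\<lambda>n. (norm (x - p n))\<^sup>2) \<longlonglongrightarrow> (norm (x - q))\<^sup>2" by (intro tendsto_intros q)
  ultimately have qd: "(norm (x - q))\<^sup>2 \<le> d"
    by (intro LIMSEQ_le[where X = "\<lambda>n. (norm (x - p n))\<^sup>2" and Y = "\<lambda>n. d + inverse (real (Suc n))"])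
      (use p less_imp_le in auto)
  have "cinner y (x - q) = 0" if y: "y \<in> M" for y
  proof (rule ccontr)
    assume nz: "cinner y (x - q) \<noteq> 0"
    \<comment> \<open>With this step length \<open>s * (norm y)^2 \<le> 1\<close>, so the quadratic
      term of the perturbed distance cannot compensate the linear gain
      \<open>2 * s * ?c\<close>.\<close>
    define s where "s = 1 / ((norm y)\<^sup>2 + 1)"
    define t where "t = complex_of_real s * cinner y (x - q)"
    let ?c = "(cmod (cinner y (x - q)))\<^sup>2"
    have "q + t *\<^sub>C y \<in> M" by (intro complex_vector.subspace_add complex_vector.subspace_scale sub qM y)
    then have "(norm (x - q))\<^sup>2 \<le> (norm (x - (q + t *\<^sub>C y)))\<^sup>2" using qd d_le order_trans by blast
    also have "x - (q + t *\<^sub>C y) = (x - q) + - (t *\<^sub>C y)" by simp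
    also have "(norm \<dots>)\<^sup>2 = (norm (x - q))\<^sup>2 - 2 * Re (cinner (x - q) (t *\<^sub>C y)) + (cmod t)\<^sup>2 * (norm y)\<^sup>2"
      by (subst norm_power2_add) (simp add: power_mult_distrib)
    also have "Re (cinner (x - q) (t *\<^sub>C y)) = s * ?c"
    proof -
      have "cinner (x - q) y = cnj (cinner y (x - q))" by (rule cinner_commute)
      then show ?thesis by (simp add: t_def cmod_power2) (simp add: power2_eq_square algebra_simps)
    qed
    also have "(cmod t)\<^sup>2 = s\<^sup>2 * ?c" by (simp add: t_def norm_mult power_mult_distrib)
    finally have "2 * s * ?c \<le> s * ?c * (s * (norm y)\<^sup>2)" by (simp add: power2_eq_square algebra_simps)
    moreover have "s * ?c > 0" using nz by (simp add: s_def add_nonneg_pos)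
    moreover have "s * (norm y)\<^sup>2 \<le> 1" by (simp add: s_def divide_simps add_nonneg_pos)
    ultimately show False using mult_left_mono[of "s * (norm y)\<^sup>2" 1 "s * ?c"] by simp
  qed
  then show ?thesis using qM by blast
qed

text \<open>Projecting onto the closed span leaves a remainder orthogonal to \<open>S\<close>, which
  the hypothesis makes zero. Totality of the exponential vectors and of the vectors
  \<open>hat d \<otimes> u\<close> is proved by this criterion.\<close>

lemma dense_cspanI:
  fixes S :: "'a::chilbert_space set"
  assumes "\<And>x. (\<And>s. s \<in> S \<Longrightarrow> cinner s x = 0) \<Longrightarrow> x = 0"
  shows "closure (cspan S) = UNIV"
proof -
  have sub: "complex_vector.subspace (closure (cspan S))"
    by (intro csubspace_closure complex_vector.subspace_span)
  have "x \<in> closure (cspan S)" for x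
  proof -
    obtain p where p: "p \<in> closure (cspan S)" "\<forall>y\<in>closure (cspan S). cinner y (x - p) = 0"
      using projection_exists[OF sub closed_closure] by blast
    have "x - p = 0" by (rule assms) (use p closure_subset complex_vector.span_base in blast)
    then show ?thesis using p by simp
  qed
  then show ?thesis by auto
qed

lemma closed_perp: "closed {x::'a::complex_inner. cinner x y = 0}" "closed {y::'a. cinner x y = 0}"
  by (intro closed_Collect_eq continuous_intros)+

lemma perp_closure_span:
  fixes x :: "'a::complex_inner"
  assumes "\<And>s. s \<in> S \<Longrightarrow> cinner s x = 0" and "y \<in> closure (cspan S)"
  shows "cinner y x = 0"
proof -
  have "cspan S \<subseteq> {y. cinner y x = 0}"
    by (rule complex_vector.span_minimal)
      (use assms in \<open>auto simp: complex_vector.subspace_def cinner_add_left\<close>)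
  then have "closure (cspan S) \<subseteq> {y. cinner y x = 0}" by (rule closure_minimal) (rule closed_perp)
  then show ?thesis using assms by auto
qed

lemma total_eqI:
  fixes x y :: "'a::complex_inner"
  assumes "closure (cspan S) = UNIV" "\<And>s. s \<in> S \<Longrightarrow> cinner s x = cinner s y"
  shows "x = y"
proof -
  have "cinner (x - y) (x - y) = 0"
    by (rule perp_closure_span[of S]) (use assms in \<open>auto simp: cinner_diff_right\<close>)
  then show ?thesis by (simp add: cinner_eq_zero_iff)
qed

lemma cspan_closure_induct:
  assumes "x \<in> closure (cspan S)" "complex_vector.subspace {x. P x}" "closed {x. P x}" "\<And>s. s \<in> S \<Longrightarrow> P s"
  shows "P x"
proof -
  have "cspan S \<subseteq> {x. P x}" by (rule complex_vector.span_minimal) (use assms in auto)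
  then have "closure (cspan S) \<subseteq> {x. P x}" by (rule closure_minimal) (rule assms)
  then show ?thesis using assms by auto
qed

text \<open>Combinations are indexed by \<open>I\<close> rather than by the image, so that two
  families over the same index set can be compared although \<open>e\<close> need not be injective.
  One inclusion needs a choice of one index per vector.\<close>

lemma cspan_image_explicit:
  "cspan (e ` I) = {\<Sum>i\<in>A. c i *\<^sub>C e i |A c. finite A \<and> A \<subseteq> I}"
proof (intro equalityI subsetI)
  fix x assume "x \<in> cspan (e ` I)"
  then obtain t r where t: "finite t" "t \<subseteq> e ` I" "x = (\<Sum>a\<in>t. r a *\<^sub>C a)"
    unfolding complex_vector.span_explicit by blast
  then obtain A where A: "A \<subseteq> I" "inj_on e A" "t = e ` A" by (meson subset_image_inj)
  then have "finite A" using t finite_imageD by blast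
  moreover have "x = (\<Sum>i\<in>A. r (e i) *\<^sub>C e i)" using t A by (simp add: sum.reindex)
  ultimately show "x \<in> {\<Sum>i\<in>A. c i *\<^sub>C e i |A c. finite A \<and> A \<subseteq> I}"
    using A(1) by (intro CollectI exI[of _ A] exI[of _ "\<lambda>i. r (e i)"]) auto
qed (auto intro!: complex_vector.span_sum complex_vector.span_scale intro: complex_vector.span_base)

section \<open>Constructing bounded complex-linear operators\<close>

lemma bops_blinfun:
  assumes "\<And>x y. T (x + y) = T x + T y" "\<And>c x. T (c *\<^sub>C x) = c *\<^sub>C T x" "\<And>x. norm (T x) \<le> M * norm x"
  shows "Blinfun T \<in> bops" "blinfun_apply (Blinfun T) = T" "0 \<le> M \<Longrightarrow> norm (Blinfun T) \<le> M"
proof -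
  have bl: "bounded_linear T"
    by (rule bounded_linear_intro[where K = M]) (use assms in \<open>auto simp: scaleR_scaleC mult.commute\<close>)
  show *: "blinfun_apply (Blinfun T) = T" using bl by (rule bounded_linear_Blinfun_apply)
  show "Blinfun T \<in> bops" by (simp add: bops_def * assms)
  show "0 \<le> M \<Longrightarrow> norm (Blinfun T) \<le> M" by (rule norm_blinfun_bound) (simp_all add: * assms)
qed

lemma bops_scaleC: "T \<in> bops \<Longrightarrow> blinfun_apply T (c *\<^sub>C x) = c *\<^sub>C blinfun_apply T x"
  by (simp add: bops_def)

lemma bops_sum: "blinfun_apply T (\<Sum>i\<in>A. f i) = (\<Sum>i\<in>A. blinfun_apply T (f i))"
  by (simp add: blinfun.sum_right)

text \<open>The operator is the closure of the span of the graph \<open>{(e i, f i)}\<close>, extended by zero.\<close>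

lemma clinear_extension:
  fixes e :: "'i \<Rightarrow> 'a::chilbert_space" and f :: "'i \<Rightarrow> 'b::chilbert_space"
  assumes "0 \<le> M"
    and bd: "\<And>A c. finite A \<Longrightarrow> A \<subseteq> I \<Longrightarrow> norm (\<Sum>i\<in>A. c i *\<^sub>C f i) \<le> M * norm (\<Sum>i\<in>A. c i *\<^sub>C e i)"
  obtains T where "T \<in> bops" "\<And>i. i \<in> I \<Longrightarrow> blinfun_apply T (e i) = f i"
    "\<And>x. (\<And>i. i \<in> I \<Longrightarrow> cinner (e i) x = 0) \<Longrightarrow> blinfun_apply T x = 0" "norm T \<le> M"
proof -
  define G where "G = closure (cspan ((\<lambda>i. (e i, f i)) ` I))"
  have subG: "complex_vector.subspace G"
    unfolding G_def by (intro csubspace_closure complex_vector.subspace_span)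
  have Gb: "norm (snd z) \<le> M * norm (fst z)" if "z \<in> G" for z
  proof -
    have "cspan ((\<lambda>i. (e i, f i)) ` I) \<subseteq> {z. norm (snd z) \<le> M * norm (fst z)}"
    proof
      fix z assume "z \<in> cspan ((\<lambda>i. (e i, f i)) ` I)"
      then obtain A c where A: "finite A" "A \<subseteq> I" and z: "z = (\<Sum>i\<in>A. c i *\<^sub>C (e i, f i))"
        unfolding cspan_image_explicit by blast
      have "fst z = (\<Sum>i\<in>A. c i *\<^sub>C e i)" "snd z = (\<Sum>i\<in>A. c i *\<^sub>C f i)"
        unfolding z by (simp_all add: fst_sum snd_sum scaleC_prod_def)
      then show "z \<in> {z. norm (snd z) \<le> M * norm (fst z)}" using bd[OF A, of c] by simp
    qed
    then have "G \<subseteq> {z. norm (snd z) \<le> M * norm (fst z)}"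
      unfolding G_def by (rule closure_minimal) (intro closed_Collect_le continuous_intros)
    then show ?thesis using that by auto
  qed
  define N where "N = fst ` G"
  have subN: "complex_vector.subspace N"
  proof (rule complex_vector.subspaceI)
    show "0 \<in> N" unfolding N_def using complex_vector.subspace_0[OF subG] by force
    show "x + y \<in> N" if "x \<in> N" "y \<in> N" for x y
      using that complex_vector.subspace_add[OF subG] unfolding N_def by (metis (no_types, lifting) fst_add image_iff)
    show "c *\<^sub>C x \<in> N" if "x \<in> N" for c x
    proof -
      from that obtain z where z: "z \<in> G" "x = fst z" unfolding N_def by blast
      then have "c *\<^sub>C z \<in> G" "c *\<^sub>C x = fst (c *\<^sub>C z)"
        by (auto simp: scaleC_prod_def dest: complex_vector.subspace_scale[OF subG, of _ c])
      then show ?thesis unfolding N_def by blast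
    qed
  qed
  \<comment> \<open>The graph bound makes second components Cauchy whenever first components
    converge, so limits of points of \<open>N\<close> lift to the closed graph
    \<open>G\<close>.\<close>
  have clN: "closed N"
  proof (subst closed_sequential_limits, intro allI impI, elim conjE)
    fix x l assume x: "\<forall>n. x n \<in> N" "x \<longlonglongrightarrow> l"
    then have "\<forall>n. \<exists>y. (x n, y) \<in> G" unfolding N_def by force
    then obtain y where y: "\<And>n. (x n, y n) \<in> G" by metis
    have d: "norm (y m - y n) \<le> M * norm (x m - x n)" for m n
      using Gb[OF complex_vector.subspace_diff[OF subG y[of m] y[of n]]] by simp
    have "Cauchy y"
    proof (rule metric_CauchyI)
      fix r :: real assume r: "r > 0"
      from x(2) have "Cauchy x" by (rule LIMSEQ_imp_Cauchy)
      then obtain K where K: "\<forall>m\<ge>K. \<forall>n\<ge>K. dist (x m) (x n) < r / (M + 1)"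
        using r \<open>0 \<le> M\<close> unfolding Cauchy_def by (meson divide_pos_pos add_nonneg_pos zero_less_one)
      have "dist (y m) (y n) < r" if "m \<ge> K" "n \<ge> K" for m n
      proof -
        have "norm (x m - x n) < r / (M + 1)" using K that by (simp add: dist_norm)
        then have "(M + 1) * norm (x m - x n) < r" using \<open>0 \<le> M\<close> by (simp add: pos_less_divide_eq mult.commute)
        moreover have "M * norm (x m - x n) \<le> (M + 1) * norm (x m - x n)" by (simp add: mult_right_mono)
        ultimately show ?thesis using d[of m n] by (simp add: dist_norm)
      qed
      then show "\<exists>M. \<forall>m\<ge>M. \<forall>n\<ge>M. dist (y m) (y n) < r" by blast
    qed
    then obtain q where "y \<longlonglongrightarrow> q" using Cauchy_convergent_iff convergent_def by blast
    then have "(\<lambda>n. (x n, y n)) \<longlonglongrightarrow> (l, q)" using x by (intro tendsto_Pair) auto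
    then have "(l, q) \<in> G" using y closed_sequentially[of G "\<lambda>n. (x n, y n)" "(l, q)"] by (simp add: G_def)
    then show "l \<in> N" unfolding N_def by force
  qed
  \<comment> \<open>Orthogonal projection onto \<open>N\<close> provides the extension by zero; the
    bound survives because projecting does not increase the norm.\<close>
  have ex: "\<exists>y p. (p, y) \<in> G \<and> (\<forall>m\<in>N. cinner m (x - p) = 0)" for x
    using projection_exists[OF subN clN, of x] unfolding N_def by force
  have un: "y = y'" if "(p, y) \<in> G" "(p', y') \<in> G" "\<forall>m\<in>N. cinner m (x - p) = 0" "\<forall>m\<in>N. cinner m (x - p') = 0"
    for x y y' p p'
  proof -
    have dG: "(p - p', y - y') \<in> G" using complex_vector.subspace_diff[OF subG that(1,2)] by simp
    then have "p - p' \<in> N" unfolding N_def by force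
    then have "cinner (p - p') ((x - p') - (x - p)) = 0" using that by (simp add: cinner_diff_right)
    then have "p = p'" by (simp add: cinner_eq_zero_iff)
    then show ?thesis using Gb[OF dG] by simp
  qed
  define T where "T x = (SOME y. \<exists>p. (p, y) \<in> G \<and> (\<forall>m\<in>N. cinner m (x - p) = 0))" for x
  have TI: "T x = y" if "(p, y) \<in> G" "\<forall>m\<in>N. cinner m (x - p) = 0" for x y p
    unfolding T_def by (rule some_equality) (use that un in blast)+
  have TE: "\<exists>p. (p, T x) \<in> G \<and> (\<forall>m\<in>N. cinner m (x - p) = 0)" for x
    unfolding T_def by (rule someI_ex) (rule ex)
  have T: "T (x + y) = T x + T y" "T (c *\<^sub>C x) = c *\<^sub>C T x" for x y c
  proof -
    from TE[of x] obtain p where p: "(p, T x) \<in> G" "\<forall>m\<in>N. cinner m (x - p) = 0" by blast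
    from TE[of y] obtain q where q: "(q, T y) \<in> G" "\<forall>m\<in>N. cinner m (y - q) = 0" by blast
    show "T (x + y) = T x + T y"
    proof (rule TI)
      show "(p + q, T x + T y) \<in> G" using complex_vector.subspace_add[OF subG p(1) q(1)] by simp
      show "\<forall>m\<in>N. cinner m (x + y - (p + q)) = 0"
        using p q by (simp add: cinner_diff_right cinner_add_right)
    qed
    show "T (c *\<^sub>C x) = c *\<^sub>C T x"
    proof (rule TI)
      show "(c *\<^sub>C p, c *\<^sub>C T x) \<in> G"
        using complex_vector.subspace_scale[OF subG p(1), of c] by (simp add: scaleC_prod_def)
      show "\<forall>m\<in>N. cinner m (c *\<^sub>C x - c *\<^sub>C p) = 0" using p by (simp add: cinner_diff_right)
    qed
  qed
  have Tb: "norm (T x) \<le> M * norm x" for x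
  proof -
    from TE[of x] obtain p where p: "(p, T x) \<in> G" "\<forall>m\<in>N. cinner m (x - p) = 0" by blast
    have "p \<in> N" using p(1) unfolding N_def by force
    then have "(norm (p + (x - p)))\<^sup>2 = (norm p)\<^sup>2 + (norm (x - p))\<^sup>2"
      using p(2) unfolding norm_power2_add by simp
    then have "(norm p)\<^sup>2 \<le> (norm x)\<^sup>2" by simp
    then have "norm p \<le> norm x" by (rule power2_le_imp_le) simp
    then show ?thesis using Gb[OF p(1)] mult_left_mono[OF _ \<open>0 \<le> M\<close>, of "norm p" "norm x"] by simp
  qed
  note B = bops_blinfun[OF T Tb]
  show thesis
  proof
    show "Blinfun T \<in> bops" by (rule B(1))
    show "norm (Blinfun T) \<le> M" by (rule B(3)[OF \<open>0 \<le> M\<close>])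
    have inG: "(e i, f i) \<in> G" if "i \<in> I" for i
      unfolding G_def by (rule subsetD[OF closure_subset], rule complex_vector.span_base) (use that in blast)
    show "blinfun_apply (Blinfun T) (e i) = f i" if "i \<in> I" for i
      unfolding B(2) by (rule TI[OF inG[OF that]]) simp
    show "blinfun_apply (Blinfun T) x = 0" if x: "\<And>i. i \<in> I \<Longrightarrow> cinner (e i) x = 0" for x
      unfolding B(2)
    proof (rule TI)
      show "(0, 0) \<in> G" using complex_vector.subspace_0[OF subG] by (simp add: zero_prod_def)
      show "\<forall>m\<in>N. cinner m (x - 0) = 0"
      proof
        fix m assume "m \<in> N"
        then obtain y where my: "(m, y) \<in> G" unfolding N_def by force
        have "cinner (m, y) (x, 0) = 0"
          by (rule perp_closure_span[OF _ my[unfolded G_def]]) (auto simp: cinner_prod_def x)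
        then show "cinner m (x - 0) = 0" by (simp add: cinner_prod_def)
      qed
    qed
  qed
qed

lemma clinear_extension_total:
  fixes e :: "'i \<Rightarrow> 'a::chilbert_space" and f :: "'i \<Rightarrow> 'b::chilbert_space"
  assumes "0 \<le> M"
    and "\<And>A c. finite A \<Longrightarrow> norm (\<Sum>i\<in>A. c i *\<^sub>C f i) \<le> M * norm (\<Sum>i\<in>A. c i *\<^sub>C e i)"
  shows "\<exists>T\<in>bops. norm T \<le> M \<and> (\<forall>i. blinfun_apply T (e i) = f i)"
  by (rule clinear_extension[where I = UNIV, OF assms]) auto

text \<open>A vector \<open>w\<close> outside the closed kernel and orthogonal to it spans the
  complement, so the functional is a multiple of the inner product with \<open>w\<close>.\<close>

lemma riesz:
  fixes T :: "'a::chilbert_space \<Rightarrow>\<^sub>L complex"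
  assumes "T \<in> bops"
  shows "\<exists>r. \<forall>x. blinfun_apply T x = cinner r x"
proof (cases "\<forall>x. blinfun_apply T x = 0")
  case True
  then show ?thesis by (intro exI[of _ 0]) simp
next
  case False
  then obtain x0 where x0: "blinfun_apply T x0 \<noteq> 0" by blast
  define M where "M = {x. blinfun_apply T x = 0}"
  have "complex_vector.subspace M"
    unfolding M_def complex_vector.subspace_def by (auto simp: blinfun.add_right bops_scaleC[OF assms])
  moreover have "closed M" unfolding M_def by (intro closed_Collect_eq continuous_intros)
  ultimately obtain p where p: "p \<in> M" "\<forall>y\<in>M. cinner y (x0 - p) = 0" using projection_exists by blast
  define w where "w = x0 - p"
  have Tw: "blinfun_apply T w \<noteq> 0" using p x0 by (simp add: w_def blinfun.diff_right M_def)
  then have ww: "cinner w w \<noteq> 0" by (auto simp: cinner_eq_zero_iff)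
  define r where "r = cnj (blinfun_apply T w / cinner w w) *\<^sub>C w"
  have "blinfun_apply T x = cinner r x" for x
  proof -
    define y where "y = x - (blinfun_apply T x / blinfun_apply T w) *\<^sub>C w"
    have "y \<in> M" using Tw by (simp add: M_def y_def blinfun.diff_right bops_scaleC[OF assms] scaleC_complex_def)
    then have "cinner w y = 0" using p cinner_swap_zero unfolding w_def by blast
    then have "cinner w x = blinfun_apply T x / blinfun_apply T w * cinner w w"
      by (simp add: y_def cinner_diff_right)
    then show ?thesis using Tw ww by (simp add: r_def)
  qed
  then show ?thesis by blast
qed

text \<open>Riesz in the first variable turns each column of \<open>K\<close> into a vector
  \<open>r j\<close>; the two-sided bound then lets \<open>f j \<mapsto> r j\<close> extend
  linearly. This is how an operator is obtained from prescribed matrix elements, such as those of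
  the amplified representation.\<close>

lemma bounded_form_operator:
  fixes e :: "'i \<Rightarrow> 'a::chilbert_space" and f :: "'j \<Rightarrow> 'b::chilbert_space"
  assumes M: "0 \<le> M" and tot: "closure (cspan (range e)) = UNIV"
    and bd: "\<And>A B a b. finite A \<Longrightarrow> finite B \<Longrightarrow> cmod (\<Sum>i\<in>A. \<Sum>j\<in>B. cnj (a i) * b j * K i j)
      \<le> M * norm (\<Sum>i\<in>A. a i *\<^sub>C e i) * norm (\<Sum>j\<in>B. b j *\<^sub>C f j)"
  obtains R where "R \<in> bops" "\<And>i j. cinner (e i) (blinfun_apply R (f j)) = K i j" "norm R \<le> M"
proof -
  have "\<exists>r. \<forall>i. cinner (e i) r = K i j" for j
  proof -
    have "norm (\<Sum>i\<in>A. c i *\<^sub>C cnj (K i j)) \<le> (M * norm (f j)) * norm (\<Sum>i\<in>A. c i *\<^sub>C e i)" if "finite A" for A c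
    proof -
      have "cmod (cnj (\<Sum>i\<in>A. c i * cnj (K i j))) \<le> (M * norm (f j)) * norm (\<Sum>i\<in>A. c i *\<^sub>C e i)"
        using bd[OF that, of "{j}" c "\<lambda>_. 1"] by (simp add: mult_ac)
      then show ?thesis unfolding complex_mod_cnj by (simp add: scaleC_complex_def)
    qed
    then have *: "norm (\<Sum>i\<in>A. c i *\<^sub>C cnj (K i j)) \<le> (M * norm (f j)) * norm (\<Sum>i\<in>A. c i *\<^sub>C e i)"
      if "finite A" "A \<subseteq> UNIV" for A c using that by blast
    \<comment> \<open>The conjugate appears because \<open>cinner\<close> is conjugate-linear on the
      left, whereas \<open>riesz\<close> represents linear functionals.\<close>
    obtain T :: "'a \<Rightarrow>\<^sub>L complex" where T: "T \<in> bops" "\<And>i. blinfun_apply T (e i) = cnj (K i j)"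
      by (rule clinear_extension[OF _ *]) (use M in auto)
    then obtain r where "\<forall>x. blinfun_apply T x = cinner r x" using riesz by blast
    then have "cinner (e i) r = K i j" for i using T(2)[of i] cinner_commute[of "e i" r] by simp
    then show ?thesis by blast
  qed
  then obtain r where r: "\<And>i j. cinner (e i) (r j) = K i j" by metis
  have *: "norm (\<Sum>j\<in>B. b j *\<^sub>C r j) \<le> M * norm (\<Sum>j\<in>B. b j *\<^sub>C f j)" if B: "finite B" "B \<subseteq> UNIV" for B b
  proof -
    let ?v = "\<Sum>j\<in>B. b j *\<^sub>C r j" and ?w = "\<Sum>j\<in>B. b j *\<^sub>C f j"
    have "range e = e ` UNIV" ..
    have "cspan (e ` UNIV) \<subseteq> {u. cmod (cinner u ?v) \<le> M * norm u * norm ?w}"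
      unfolding cspan_image_explicit
    proof clarify
      fix A :: "'i set" and a :: "'i \<Rightarrow> complex" assume "finite A"
      have "cinner (\<Sum>i\<in>A. a i *\<^sub>C e i) ?v = (\<Sum>i\<in>A. \<Sum>j\<in>B. cnj (a i) * b j * K i j)"
        by (subst sum.swap) (simp add: cinner_sum_left cinner_sum_right r sum_distrib_left mult_ac)
      then show "cmod (cinner (\<Sum>i\<in>A. a i *\<^sub>C e i) ?v) \<le> M * norm (\<Sum>i\<in>A. a i *\<^sub>C e i) * norm ?w"
        using bd[OF \<open>finite A\<close> B(1)] by simp
    qed
    then have "closure (cspan (range e)) \<subseteq> {u. cmod (cinner u ?v) \<le> M * norm u * norm ?w}"
      by (rule closure_minimal) (intro closed_Collect_le continuous_intros)
    then have "cmod (cinner ?v ?v) \<le> M * norm ?v * norm ?w" unfolding tot by blast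
    then have "norm ?v * norm ?v \<le> norm ?v * (M * norm ?w)"
      by (simp add: cinner_self norm_power power2_eq_square norm_mult mult_ac)
    then show ?thesis using M by (cases "?v = 0") auto
  qed
  obtain R where "R \<in> bops" "\<And>j. blinfun_apply R (f j) = r j" "norm R \<le> M"
    by (rule clinear_extension[where I = UNIV, OF M *]) auto
  then show thesis using that r by auto
qed

section \<open>Adjoints\<close>

lemma adj_ex:
  fixes T :: "'a::chilbert_space \<Rightarrow>\<^sub>L 'b::complex_inner"
  assumes T: "T \<in> bops"
  shows "\<exists>S. S \<in> bops \<and> (\<forall>x y. cinner (blinfun_apply S y) x = cinner y (blinfun_apply T x))"
proof -
  have "\<exists>r. \<forall>x. cinner y (blinfun_apply T x) = cinner r x" for y
  proof -
    let ?g = "\<lambda>x. cinner y (blinfun_apply T x)"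
    have "norm (?g x) \<le> (norm y * norm T) * norm x" for x
      using order_trans[OF cmod_cinner_le mult_left_mono[OF norm_blinfun]] by (simp add: mult.assoc)
    note B = bops_blinfun[of ?g, OF _ _ this]
    show ?thesis using riesz[of "Blinfun ?g"] B
      by (auto simp: blinfun.add_right cinner_add_right bops_scaleC[OF T] scaleC_complex_def)
  qed
  then obtain S where S: "\<And>y x. cinner y (blinfun_apply T x) = cinner (S y) x" by metis
  have Sb: "norm (S y) \<le> norm T * norm y" for y
  proof -
    have "(norm (S y))\<^sup>2 = cmod (cinner y (blinfun_apply T (S y)))" by (simp add: S cinner_self norm_power)
    also have "\<dots> \<le> norm y * (norm T * norm (S y))"
      using order_trans[OF cmod_cinner_le mult_left_mono[OF norm_blinfun]] by simp
    finally have "norm (S y) * norm (S y) \<le> (norm T * norm y) * norm (S y)" by (simp add: power2_eq_square mult_ac)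
    then show ?thesis by (cases "S y = 0") auto
  qed
  have eq: "u = v" if "\<And>x. cinner u x = cinner v x" for u v :: 'a
    using that[of "u - v"] by (metis cinner_diff_left cinner_eq_zero_iff right_minus_eq)
  have "S (x + y) = S x + S y" "S (c *\<^sub>C x) = c *\<^sub>C S x" for x y c
    by (rule eq, simp add: cinner_add_left flip: S)+
  from bops_blinfun[OF this Sb] show ?thesis using S by (intro exI[of _ "Blinfun S"]) simp
qed

lemma adj:
  fixes T :: "'a::chilbert_space \<Rightarrow>\<^sub>L 'b::complex_inner"
  assumes T: "T \<in> bops"
  shows adj_bops: "adj T \<in> bops"
    and cinner_adj_left: "cinner (blinfun_apply (adj T) y) x = cinner y (blinfun_apply T x)"
    and cinner_adj_right: "cinner x (blinfun_apply (adj T) y) = cinner (blinfun_apply T x) y"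
proof -
  from adj_ex[OF T] obtain S where S: "S \<in> bops" "\<forall>x y. cinner (blinfun_apply S y) x = cinner y (blinfun_apply T x)"
    by blast
  have un: "R = S" if "R \<in> bops \<and> (\<forall>x y. cinner (blinfun_apply R y) x = cinner y (blinfun_apply T x))" for R
  proof (rule blinfun_eqI)
    fix y
    have "cinner (blinfun_apply R y - blinfun_apply S y) (blinfun_apply R y - blinfun_apply S y) = 0"
      using that S by (simp add: cinner_diff_left)
    then show "blinfun_apply R y = blinfun_apply S y" by (simp add: cinner_eq_zero_iff)
  qed
  have A: "adj T = S" unfolding adj_def by (rule the_equality, rule conjI[OF S], erule un)
  show "adj T \<in> bops" "cinner (blinfun_apply (adj T) y) x = cinner y (blinfun_apply T x)" using A S by auto
  then show "cinner x (blinfun_apply (adj T) y) = cinner (blinfun_apply T x) y"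
    using A S cinner_commute by metis
qed

lemma cinner_eqI: "(\<And>x. cinner x u = cinner x v) \<Longrightarrow> u = (v::'a::complex_inner)"
  using total_eqI[of UNIV u v] by (simp add: complex_vector.span_UNIV)

lemma adj_eqI:
  fixes T :: "'a::chilbert_space \<Rightarrow>\<^sub>L 'b::complex_inner"
  assumes "T \<in> bops" "\<And>x y. cinner x (blinfun_apply S y) = cinner (blinfun_apply T x) y"
  shows "adj T = S"
  by (rule blinfun_eqI, rule cinner_eqI) (simp add: assms cinner_adj_right)

lemma adj_adj: "T \<in> bops \<Longrightarrow> adj (adj T) = (T :: 'a::chilbert_space \<Rightarrow>\<^sub>L 'b::chilbert_space)"
  by (rule adj_eqI) (auto simp: adj_bops cinner_adj_left)

lemma norm_adj_le:
  fixes T :: "'a::chilbert_space \<Rightarrow>\<^sub>L 'b::complex_inner"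
  assumes "T \<in> bops" shows "norm (adj T) \<le> norm T"
proof (rule norm_blinfun_bound)
  fix y
  let ?s = "blinfun_apply (adj T) y"
  have "(norm ?s)\<^sup>2 = cmod (cinner y (blinfun_apply T ?s))"
    by (simp flip: cinner_adj_left[OF assms] add: cinner_self norm_power)
  also have "\<dots> \<le> norm y * (norm T * norm ?s)"
    using order_trans[OF cmod_cinner_le mult_left_mono[OF norm_blinfun]] by simp
  finally have "norm ?s * norm ?s \<le> (norm T * norm y) * norm ?s" by (simp add: power2_eq_square mult_ac)
  then show "norm ?s \<le> norm T * norm y" by (cases "?s = 0") auto
qed simp

lemma bops_intros [intro, simp]:
  "id_blinfun \<in> bops" "0 \<in> bops"
  "S \<in> bops \<Longrightarrow> T \<in> bops \<Longrightarrow> S + T \<in> bops"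
  "S \<in> bops \<Longrightarrow> T \<in> bops \<Longrightarrow> S - T \<in> bops"
  "S \<in> bops \<Longrightarrow> r *\<^sub>R S \<in> bops"
  "S \<in> bops \<Longrightarrow> c *\<^sub>C S \<in> bops"
  by (auto simp: bops_def blinfun.add_left blinfun.diff_left scaleC_add_right scaleC_blinfun.rep_eq
      complex_vector.scale_right_diff_distrib blinfun.scaleR_left scaleR_scaleC mult.commute)

lemma bops_compose [intro, simp]: "S \<in> bops \<Longrightarrow> T \<in> bops \<Longrightarrow> S o\<^sub>L T \<in> bops"
  by (simp add: bops_def)

lemma bra_ket:
  fixes w :: "'w::complex_inner" and v :: "'h::chilbert_space"
  shows ket_bops: "(ket w :: 'h \<Rightarrow>\<^sub>L _) \<in> bops" and bra_bops: "(bra w :: _ \<Rightarrow>\<^sub>L 'h) \<in> bops"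
    and cinner_bra: "cinner v (blinfun_apply (bra w) x) = cinner (v \<otimes> w) x"
proof -
  show *: "(ket w :: 'h \<Rightarrow>\<^sub>L _) \<in> bops" by (simp add: bops_def tensor_scale_left)
  show "(bra w :: _ \<Rightarrow>\<^sub>L 'h) \<in> bops" unfolding bra_def by (rule adj_bops[OF *])
  show "cinner v (blinfun_apply (bra w) x) = cinner (v \<otimes> w) x"
    unfolding bra_def cinner_adj_right[OF *] by simp
qed

section \<open>Orthonormal expansions and tensor products of operators\<close>

lemma sum_tensor_left: "(\<Sum>i\<in>A. f i) \<otimes> y = (\<Sum>i\<in>A. f i \<otimes> y)"
  by (rule bounded_bilinear.sum_left[OF bounded_bilinear_tensor])

lemma sum_tensor_right: "x \<otimes> (\<Sum>i\<in>A. f i) = (\<Sum>i\<in>A. x \<otimes> f i)"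
  by (rule bounded_bilinear.sum_right[OF bounded_bilinear_tensor])

definition orthonormal :: "'a::complex_inner set \<Rightarrow> bool" where
  "orthonormal E \<longleftrightarrow> (\<forall>e\<in>E. \<forall>f\<in>E. cinner e f = (if e = f then 1 else 0))"

lemma norm_sum_tensor_left:
  assumes "finite E" "orthonormal E"
  shows "(norm (\<Sum>e\<in>E. e \<otimes> Y e))\<^sup>2 = (\<Sum>e\<in>E. (norm (Y e))\<^sup>2)"
proof -
  have "cinner (\<Sum>e\<in>E. e \<otimes> Y e) (\<Sum>e\<in>E. e \<otimes> Y e) = (\<Sum>e\<in>E. \<Sum>f\<in>E. if e = f then cinner (Y e) (Y e) else 0)"
    unfolding cinner_sum_left cinner_sum_right
    by (intro sum.cong refl) (use assms in \<open>simp add: orthonormal_def\<close>)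
  also have "\<dots> = (\<Sum>e\<in>E. cinner (Y e) (Y e))" using assms by simp
  finally show ?thesis by (simp add: norm_power2_cinner)
qed

lemma norm_sum_tensor_right:
  assumes "finite E" "orthonormal E"
  shows "(norm (\<Sum>e\<in>E. Y e \<otimes> e))\<^sup>2 = (\<Sum>e\<in>E. (norm (Y e))\<^sup>2)"
proof -
  have "cinner (\<Sum>e\<in>E. Y e \<otimes> e) (\<Sum>e\<in>E. Y e \<otimes> e) = (\<Sum>e\<in>E. \<Sum>f\<in>E. if e = f then cinner (Y e) (Y e) else 0)"
    unfolding cinner_sum_left cinner_sum_right
    by (intro sum.cong refl) (use assms in \<open>simp add: orthonormal_def\<close>)
  also have "\<dots> = (\<Sum>e\<in>E. cinner (Y e) (Y e))" using assms by simp
  finally show ?thesis by (simp add: norm_power2_cinner)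
qed

lemma orthonormal_expansion:
  assumes "finite A"
  obtains E where "finite E" "orthonormal E" "\<And>i. i \<in> A \<Longrightarrow> x i = (\<Sum>e\<in>E. cinner e (x i) *\<^sub>C (e::'a::complex_inner))"
proof -
  from finite_orthonormal_expansion[OF finite_imageI[OF assms], of x] obtain E
    where E: "finite E" "\<forall>e\<in>E. \<forall>f\<in>E. cinner e f = (if e = f then 1 else 0)"
      "\<forall>y\<in>x ` A. y = (\<Sum>e\<in>E. cinner e y *\<^sub>C e)" by (elim exE conjE)
  have "x i = (\<Sum>e\<in>E. cinner e (x i) *\<^sub>C e)" if "i \<in> A" for i
    by (rule E(3)[rule_format]) (use that in blast)
  then show thesis using that[of E] E(1,2) unfolding orthonormal_def by blast
qed

text \<open>Over an orthonormal set the norm of an algebraic tensor is the Pythagorean sum of its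
  coefficient norms. Bounds on amplifications and well-definedness of maps on tensors are read off
  from this normal form.\<close>

lemma tensor_expand_left:
  assumes "\<And>i. i \<in> A \<Longrightarrow> x i = (\<Sum>e\<in>E. cinner e (x i) *\<^sub>C e)"
  shows "(\<Sum>i\<in>A. x i \<otimes> y i) = (\<Sum>e\<in>E. e \<otimes> (\<Sum>i\<in>A. cinner e (x i) *\<^sub>C y i))"
proof -
  have "(\<Sum>i\<in>A. x i \<otimes> y i) = (\<Sum>i\<in>A. \<Sum>e\<in>E. cinner e (x i) *\<^sub>C (e \<otimes> y i))"
    by (rule sum.cong[OF refl], subst assms, assumption) (simp add: sum_tensor_left tensor_scale_left)
  also have "\<dots> = (\<Sum>e\<in>E. \<Sum>i\<in>A. cinner e (x i) *\<^sub>C (e \<otimes> y i))" by (rule sum.swap)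
  finally show ?thesis by (simp add: sum_tensor_right tensor_scale_right)
qed

lemma tensor_expand_right:
  assumes "\<And>i. i \<in> A \<Longrightarrow> y i = (\<Sum>e\<in>E. cinner e (y i) *\<^sub>C e)"
  shows "(\<Sum>i\<in>A. x i \<otimes> y i) = (\<Sum>e\<in>E. (\<Sum>i\<in>A. cinner e (y i) *\<^sub>C x i) \<otimes> e)"
proof -
  have "(\<Sum>i\<in>A. x i \<otimes> y i) = (\<Sum>i\<in>A. \<Sum>e\<in>E. cinner e (y i) *\<^sub>C (x i \<otimes> e))"
    by (rule sum.cong[OF refl], subst assms, assumption) (simp add: sum_tensor_right tensor_scale_right)
  also have "\<dots> = (\<Sum>e\<in>E. \<Sum>i\<in>A. cinner e (y i) *\<^sub>C (x i \<otimes> e))" by (rule sum.swap)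
  finally show ?thesis by (simp add: sum_tensor_left tensor_scale_left)
qed

text \<open>The same characterisation as \<open>op_tensor\<close>, but between four possibly
  different spaces; intertwiners between different representation spaces need this
  generality.\<close>

definition tmap :: "('a::complex_inner \<Rightarrow>\<^sub>L 'c::complex_inner) \<Rightarrow> ('b::complex_inner \<Rightarrow>\<^sub>L 'd::complex_inner) \<Rightarrow>
    (('a, 'b) htensor \<Rightarrow>\<^sub>L ('c, 'd) htensor)" where
  "tmap S T = (THE R. R \<in> bops \<and>
     (\<forall>x y. blinfun_apply R (x \<otimes> y) = blinfun_apply S x \<otimes> blinfun_apply T y))"

lemma op_tensor_tmap: "S \<otimes>\<^sub>o T = tmap S T"
  by (simp add: op_tensor_def tmap_def)

lemma range_tensor: "range (\<lambda>p. fst p \<otimes> snd p) = {x \<otimes> y |x y. True}"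
proof safe
  fix x y show "x \<otimes> y \<in> range (\<lambda>p. fst p \<otimes> snd p)" by (rule image_eqI[of _ _ "(x, y)"]) auto
qed auto

lemma tensor_operator_eqI:
  assumes "R \<in> bops" "R' \<in> bops"
    and "\<And>x y. blinfun_apply R (x \<otimes> y) = blinfun_apply R' (x \<otimes> y)"
  shows "R = (R' :: ('a::complex_inner, 'b::complex_inner) htensor \<Rightarrow>\<^sub>L 'c::complex_inner)"
proof (rule blinfun_eqI)
  fix z :: "('a, 'b) htensor"
  have "z \<in> closure (cspan {x \<otimes> y |x y. True})" unfolding tensor_total by simp
  then show "blinfun_apply R z = blinfun_apply R' z"
    by (rule cspan_closure_induct)
      (use assms in \<open>auto simp: complex_vector.subspace_def blinfun.add_right bops_scaleC
        intro!: closed_Collect_eq continuous_intros\<close>)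
qed

text \<open>After the first factors are expanded over an orthonormal set \<open>E\<close>, the
  operator acts separately on each coefficient \<open>Y e\<close>, so the estimate holds
  coefficientwise with the constant \<open>norm T\<close>.\<close>

lemma tmap_right_ex:
  fixes T :: "'b::chilbert_space \<Rightarrow>\<^sub>L 'd::chilbert_space"
  assumes T: "T \<in> bops"
  shows "\<exists>R\<in>bops. norm R \<le> norm T \<and>
    (\<forall>(x::'a::chilbert_space) y. blinfun_apply R (x \<otimes> y) = x \<otimes> blinfun_apply T y)"
proof -
  have bd: "norm (\<Sum>i\<in>A. c i *\<^sub>C (fst i \<otimes> blinfun_apply T (snd i))) \<le> norm T * norm (\<Sum>i\<in>A. c i *\<^sub>C (fst i \<otimes> snd i))"
    if A: "finite A" for A :: "('a \<times> 'b) set" and c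
  proof -
    obtain E where E: "finite E" "orthonormal E"
      and ex: "\<And>i. i \<in> A \<Longrightarrow> c i *\<^sub>C fst i = (\<Sum>e\<in>E. cinner e (c i *\<^sub>C fst i) *\<^sub>C e)"
      using orthonormal_expansion[OF A, of "\<lambda>i. c i *\<^sub>C fst i"] by blast
    define Y where "Y e = (\<Sum>i\<in>A. cinner e (c i *\<^sub>C fst i) *\<^sub>C snd i)" for e
    have "(\<Sum>i\<in>A. (c i *\<^sub>C fst i) \<otimes> blinfun_apply T (snd i)) = (\<Sum>e\<in>E. e \<otimes> blinfun_apply T (Y e))"
      by (simp add: tensor_expand_left[OF ex] Y_def bops_sum bops_scaleC[OF T])
    then have "(norm (\<Sum>i\<in>A. c i *\<^sub>C (fst i \<otimes> blinfun_apply T (snd i))))\<^sup>2 = (\<Sum>e\<in>E. (norm (blinfun_apply T (Y e)))\<^sup>2)"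
      by (simp add: tensor_scale_left norm_sum_tensor_left[OF E])
    also have "\<dots> \<le> (\<Sum>e\<in>E. (norm T * norm (Y e))\<^sup>2)"
      by (intro sum_mono power_mono norm_blinfun) simp
    also have "\<dots> = (norm T * norm (\<Sum>e\<in>E. e \<otimes> Y e))\<^sup>2"
      by (simp add: power_mult_distrib norm_sum_tensor_left[OF E] sum_distrib_left)
    also have "(\<Sum>e\<in>E. e \<otimes> Y e) = (\<Sum>i\<in>A. c i *\<^sub>C (fst i \<otimes> snd i))"
      unfolding Y_def by (subst tensor_expand_left[OF ex, symmetric]) (auto simp: tensor_scale_left)
    finally show ?thesis by (rule power2_le_imp_le) simp
  qed
  from clinear_extension_total[OF norm_ge_zero bd] show ?thesis by auto
qed

lemma tmap_left_ex:
  fixes T :: "'a::chilbert_space \<Rightarrow>\<^sub>L 'c::chilbert_space"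
  assumes T: "T \<in> bops"
  shows "\<exists>R\<in>bops. norm R \<le> norm T \<and>
    (\<forall>x (y::'b::chilbert_space). blinfun_apply R (x \<otimes> y) = blinfun_apply T x \<otimes> y)"
proof -
  have bd: "norm (\<Sum>i\<in>A. c i *\<^sub>C (blinfun_apply T (fst i) \<otimes> snd i)) \<le> norm T * norm (\<Sum>i\<in>A. c i *\<^sub>C (fst i \<otimes> snd i))"
    if A: "finite A" for A :: "('a \<times> 'b) set" and c
  proof -
    obtain E where E: "finite E" "orthonormal E"
      and ex: "\<And>i. i \<in> A \<Longrightarrow> c i *\<^sub>C snd i = (\<Sum>e\<in>E. cinner e (c i *\<^sub>C snd i) *\<^sub>C e)"
      using orthonormal_expansion[OF A, of "\<lambda>i. c i *\<^sub>C snd i"] by blast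
    define Y where "Y e = (\<Sum>i\<in>A. cinner e (c i *\<^sub>C snd i) *\<^sub>C fst i)" for e
    have "(\<Sum>i\<in>A. blinfun_apply T (fst i) \<otimes> (c i *\<^sub>C snd i)) = (\<Sum>e\<in>E. blinfun_apply T (Y e) \<otimes> e)"
      by (simp add: tensor_expand_right[OF ex] Y_def bops_sum bops_scaleC[OF T])
    then have "(norm (\<Sum>i\<in>A. c i *\<^sub>C (blinfun_apply T (fst i) \<otimes> snd i)))\<^sup>2 = (\<Sum>e\<in>E. (norm (blinfun_apply T (Y e)))\<^sup>2)"
      by (simp add: tensor_scale_right norm_sum_tensor_right[OF E])
    also have "\<dots> \<le> (\<Sum>e\<in>E. (norm T * norm (Y e))\<^sup>2)"
      by (intro sum_mono power_mono norm_blinfun) simp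
    also have "\<dots> = (norm T * norm (\<Sum>e\<in>E. Y e \<otimes> e))\<^sup>2"
      by (simp add: power_mult_distrib norm_sum_tensor_right[OF E] sum_distrib_left)
    also have "(\<Sum>e\<in>E. Y e \<otimes> e) = (\<Sum>i\<in>A. c i *\<^sub>C (fst i \<otimes> snd i))"
      unfolding Y_def by (subst tensor_expand_right[OF ex, symmetric]) (auto simp: tensor_scale_right)
    finally show ?thesis by (rule power2_le_imp_le) simp
  qed
  from clinear_extension_total[OF norm_ge_zero bd] show ?thesis by auto
qed

lemma tmap:
  fixes S :: "'a::chilbert_space \<Rightarrow>\<^sub>L 'c::chilbert_space" and T :: "'b::chilbert_space \<Rightarrow>\<^sub>L 'd::chilbert_space"
  assumes S: "S \<in> bops" and T: "T \<in> bops"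
  shows tmap_bops: "tmap S T \<in> bops"
    and tmap_tensor: "blinfun_apply (tmap S T) (x \<otimes> y) = blinfun_apply S x \<otimes> blinfun_apply T y"
    and norm_tmap: "norm (tmap S T) \<le> norm S * norm T"
proof -
  obtain R1 where R1: "R1 \<in> bops" "norm R1 \<le> norm T"
    "\<And>(x::'a) y. blinfun_apply R1 (x \<otimes> y) = x \<otimes> blinfun_apply T y" using tmap_right_ex[OF T] by blast
  obtain R2 where R2: "R2 \<in> bops" "norm R2 \<le> norm S"
    "\<And>x (y::'d). blinfun_apply R2 (x \<otimes> y) = blinfun_apply S x \<otimes> y" using tmap_left_ex[OF S] by blast
  let ?R = "R2 o\<^sub>L R1"
  have R: "?R \<in> bops" "\<forall>x y. blinfun_apply ?R (x \<otimes> y) = blinfun_apply S x \<otimes> blinfun_apply T y"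
    using R1 R2 by auto
  have un: "R' = ?R" if "R' \<in> bops \<and> (\<forall>x y. blinfun_apply R' (x \<otimes> y) = blinfun_apply S x \<otimes> blinfun_apply T y)" for R'
    by (rule tensor_operator_eqI) (use that R in auto)
  have eq: "tmap S T = ?R" unfolding tmap_def by (rule the_equality, rule conjI[OF R], erule un)
  show "tmap S T \<in> bops" "blinfun_apply (tmap S T) (x \<otimes> y) = blinfun_apply S x \<otimes> blinfun_apply T y"
    using R eq by auto
  have "norm ?R \<le> norm R2 * norm R1" by (rule norm_blinfun_compose)
  also have "\<dots> \<le> norm S * norm T" using R1(2) R2(2) by (intro mult_mono) auto
  finally show "norm (tmap S T) \<le> norm S * norm T" unfolding eq .
qed

lemma htensor_cinner_eqI:
  fixes u v :: "('a::complex_inner, 'b::complex_inner) htensor"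
  assumes "\<And>x y. cinner (x \<otimes> y) u = cinner (x \<otimes> y) v" shows "u = v"
  by (rule total_eqI[OF tensor_total]) (use assms in auto)

lemma adj_tmap:
  fixes S :: "'a::chilbert_space \<Rightarrow>\<^sub>L 'c::chilbert_space" and T :: "'b::chilbert_space \<Rightarrow>\<^sub>L 'd::chilbert_space"
  assumes S: "S \<in> bops" and T: "T \<in> bops"
  shows "adj (tmap S T) = tmap (adj S) (adj T)"
proof (rule tensor_operator_eqI)
  fix x y
  show "blinfun_apply (adj (tmap S T)) (x \<otimes> y) = blinfun_apply (tmap (adj S) (adj T)) (x \<otimes> y)"
    by (rule htensor_cinner_eqI)
      (simp add: cinner_adj_right tmap_bops tmap_tensor S T adj_bops)
qed (auto intro: adj_bops tmap_bops S T)

lemma tmap_compose: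
  fixes S :: "'a::chilbert_space \<Rightarrow>\<^sub>L 'c::chilbert_space" and T :: "'b::chilbert_space \<Rightarrow>\<^sub>L 'd::chilbert_space"
    and S' :: "'e::chilbert_space \<Rightarrow>\<^sub>L 'a" and T' :: "'f::chilbert_space \<Rightarrow>\<^sub>L 'b"
  assumes "S \<in> bops" "T \<in> bops" "S' \<in> bops" "T' \<in> bops"
  shows "tmap S T o\<^sub>L tmap S' T' = tmap (S o\<^sub>L S') (T o\<^sub>L T')"
  by (rule tensor_operator_eqI) (use assms in \<open>auto simp: tmap_bops tmap_tensor\<close>)

section \<open>Step functions\<close>

lemma step_zero: "(\<lambda>_. 0) \<in> step_funs"
  unfolding step_funs_def by (intro CollectI exI[of _ 0]) auto

lemma step_plus_indicator:
  assumes "f \<in> step_funs" "0 \<le> a" shows "(\<lambda>s. f s + indicator {a..<b} s *\<^sub>R c) \<in> step_funs"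
proof -
  from assms(1) obtain n :: nat and p q d where "\<forall>i<n. 0 \<le> p i" "f = (\<lambda>s. \<Sum>i<n. indicator {p i..<q i} s *\<^sub>R d i)"
    unfolding step_funs_def by blast
  then show ?thesis using assms(2) unfolding step_funs_def
    by (intro CollectI exI[of _ "Suc n"] exI[of _ "p(n := a)"] exI[of _ "q(n := b)"] exI[of _ "d(n := c)"])
      (auto simp: less_Suc_eq)
qed

text \<open>Every partial sum of a representation is again a step function, which is why the
  induction step may assume \<open>f \<in> step_funs\<close> besides \<open>P f\<close>.\<close>

lemma step_induct [consumes 1, case_names zero plus]:
  assumes "f \<in> step_funs" "P (\<lambda>_. 0)"
    and "\<And>f a b c. f \<in> step_funs \<Longrightarrow> P f \<Longrightarrow> 0 \<le> a \<Longrightarrow> P (\<lambda>s. f s + indicator {a..<b} s *\<^sub>R c)"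
  shows "P f"
proof -
  from assms(1) obtain n :: nat and p q d where p: "\<forall>i<n. 0 \<le> p i"
    and f: "f = (\<lambda>s. \<Sum>i<n. indicator {p i..<q i} s *\<^sub>R d i)"
    unfolding step_funs_def by blast
  have "m \<le> n \<Longrightarrow> (\<lambda>s. \<Sum>i<m. indicator {p i..<q i} s *\<^sub>R d i) \<in> step_funs
      \<and> P (\<lambda>s. \<Sum>i<m. indicator {p i..<q i} s *\<^sub>R d i)" for m
  proof (induction m)
    case (Suc m)
    then have IH: "(\<lambda>s. \<Sum>i<m. indicator {p i..<q i} s *\<^sub>R d i) \<in> step_funs"
      "P (\<lambda>s. \<Sum>i<m. indicator {p i..<q i} s *\<^sub>R d i)" "0 \<le> p m" using p by auto
    show ?case unfolding sum.lessThan_Suc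
      using assms(3)[OF IH, of "q m" "d m"] step_plus_indicator[OF IH(1,3), of "q m" "d m"] by blast
  qed (simp add: step_zero assms)
  then show ?thesis using f by simp
qed

lemma step_indicator: "0 \<le> a \<Longrightarrow> (\<lambda>s. indicator {a..<b} s *\<^sub>R c) \<in> step_funs"
  using step_plus_indicator[OF step_zero] by simp

lemma step_add:
  assumes "f \<in> step_funs" "g \<in> step_funs" shows "(\<lambda>s. f s + g s) \<in> step_funs"
  using assms(2)
proof (induction g rule: step_induct)
  case (plus g a b c)
  then show ?case using step_plus_indicator[of "\<lambda>s. f s + g s" a b c] by (simp add: add.assoc)
qed (simp add: assms)

lemma step_scale: "f \<in> step_funs \<Longrightarrow> (\<lambda>s. z *\<^sub>C f s) \<in> step_funs"
proof (induction f rule: step_induct)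
  case (plus g a b c)
  have "(\<lambda>s. z *\<^sub>C (g s + indicator {a..<b} s *\<^sub>R c)) = (\<lambda>s. z *\<^sub>C g s + indicator {a..<b} s *\<^sub>R (z *\<^sub>C c))"
    by (simp add: scaleC_add_right scaleR_scaleC mult.commute)
  then show ?case using step_plus_indicator[OF plus(3,2), of b "z *\<^sub>C c"] by simp
qed (simp add: step_zero)

lemma step_restr_lt: "f \<in> step_funs \<Longrightarrow> restr {0..<t} f \<in> step_funs"
proof (induction f rule: step_induct)
  case zero
  then show ?case by (simp add: restr_def step_zero)
next
  case (plus g a b c)
  have "restr {0..<t} (\<lambda>s. g s + indicator {a..<b} s *\<^sub>R c)
      = (\<lambda>s. restr {0..<t} g s + indicator {a..<min b t} s *\<^sub>R c)"
    using plus(2) by (auto simp: restr_def fun_eq_iff indicator_def)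
  then show ?case using step_plus_indicator[OF plus(3,2)] by simp
qed

lemma step_restr_ge: "f \<in> step_funs \<Longrightarrow> restr {t..} f \<in> step_funs"
proof (induction f rule: step_induct)
  case zero
  then show ?case by (simp add: restr_def step_zero)
next
  case (plus g a b c)
  have "restr {t..} (\<lambda>s. g s + indicator {a..<b} s *\<^sub>R c)
      = (\<lambda>s. restr {t..} g s + indicator {max a t..<b} s *\<^sub>R c)"
    by (auto simp: restr_def fun_eq_iff indicator_def)
  moreover have "0 \<le> max a t" using plus(2) by simp
  ultimately show ?case using step_plus_indicator[OF plus(3)] by simp
qed

lemma step_neg: "f \<in> step_funs \<Longrightarrow> s < 0 \<Longrightarrow> f s = 0"
  by (induction f rule: step_induct) (auto simp: indicator_def)

text \<open>This is where the half-open intervals matter: the indicator of \<open>[a, b)\<close> is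
  constant immediately to the right of every point, including \<open>a\<close> and \<open>b\<close>.
  It reduces derivatives from the right to constant values of the step functions.\<close>

lemma step_right_constant: "f \<in> step_funs \<Longrightarrow> \<exists>r>0. \<forall>u. s \<le> u \<longrightarrow> u \<le> s + r \<longrightarrow> f u = f s"
proof (induction f rule: step_induct)
  case zero
  then show ?case by (intro exI[of _ 1]) auto
next
  case (plus g a b c)
  then obtain r where r: "r > 0" "\<And>u. s \<le> u \<Longrightarrow> u \<le> s + r \<Longrightarrow> g u = g s" by blast
  have "\<exists>q>0. \<forall>u. s \<le> u \<longrightarrow> u \<le> s + q \<longrightarrow> (indicator {a..<b} u :: real) = indicator {a..<b} s"
  proof -
    consider "s < a" | "a \<le> s" "s < b" | "b \<le> s" by linarith
    then show ?thesis
    proof cases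
      case 1 then show ?thesis by (intro exI[of _ "(a - s) / 2"]) (auto simp: indicator_def field_simps)
    next
      case 2 then show ?thesis by (intro exI[of _ "(b - s) / 2"]) (auto simp: indicator_def field_simps)
    next
      case 3 then show ?thesis by (intro exI[of _ 1]) (auto simp: indicator_def)
    qed
  qed
  then obtain q where q: "q > 0" "\<And>u. s \<le> u \<Longrightarrow> u \<le> s + q \<Longrightarrow> (indicator {a..<b} u :: real) = indicator {a..<b} s" by blast
  show ?case
  proof (intro exI[of _ "min r q"] conjI allI impI)
    fix u assume u: "s \<le> u" "u \<le> s + min r q"
    have "g u = g s" by (rule r) (use u in auto)
    moreover have "(indicator {a..<b} u :: real) = indicator {a..<b} s" by (rule q) (use u in auto)
    ultimately show "g u + indicator {a..<b} u *\<^sub>R c = g s + indicator {a..<b} s *\<^sub>R c" by simp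
  qed (use r q in auto)
qed

lemma step_simple: "f \<in> step_funs \<Longrightarrow> simple_function borel f"
proof (induction f rule: step_induct)
  case (plus g a b c)
  have "simple_function borel (indicator {a..<b} :: real \<Rightarrow> real)" by (rule simple_function_indicator) simp
  then have "simple_function borel (\<lambda>s. indicator {a..<b} s *\<^sub>R c)"
    by (rule simple_function_compose1[of _ _ "\<lambda>x. x *\<^sub>R c"])
  then show ?case by (rule simple_function_compose2[OF plus(3)])
qed simp

lemma step_range: "f \<in> step_funs \<Longrightarrow> finite (range f)"
  using step_simple[of f] by (simp add: simple_function_def)

lemma step_level_borel: "f \<in> step_funs \<Longrightarrow> {s. f s = c} \<in> sets borel"
proof -
  assume f: "f \<in> step_funs"
  show ?thesis
  proof (cases "c \<in> range f")
    case True
    then have "f -` {c} \<inter> space borel \<in> sets borel" using step_simple[OF f] by (auto simp: simple_function_def)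
    moreover have "f -` {c} = {s. f s = c}" by auto
    ultimately show ?thesis by simp
  next
    case False
    then have "{s. f s = c} = {}" by auto
    then show ?thesis by simp
  qed
qed

lemma indicator_integrable:
  fixes c :: "'b::banach"
  shows "(\<lambda>s. indicator {p..<q} s *\<^sub>R c) integrable_on {a..b::real}"
proof -
  have "(\<lambda>s. if s \<in> {p..q} then c else 0) integrable_on {a..b}"
    unfolding integrable_restrict_Int by (simp add: integrable_const_ivl)
  then show ?thesis
    by (rule integrable_spike_finite[of "{q}", rotated 2]) (auto simp: indicator_def)
qed

lemma step_integrable:
  fixes f :: "real \<Rightarrow> 'b::chilbert_space"
  shows "f \<in> step_funs \<Longrightarrow> f integrable_on {a..b}"
  by (induction f rule: step_induct) (auto intro!: integrable_add indicator_integrable integrable_0)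

subsection \<open>Step functions are dense\<close>

lemma norm_abs_L2:
  assumes "square_integrable f"
  shows "(norm (abs_L2 f))\<^sup>2 = (\<integral>s. (norm (f s))\<^sup>2 \<partial>lebesgue_on {0..})"
  using L2_self[OF assms] by (simp add: norm_power2_cinner)

lemma cinner_abs_L2:
  assumes "square_integrable f" "square_integrable g"
  shows "cinner (abs_L2 f) (abs_L2 g) = (\<integral>s. cinner (f s) (g s) \<partial>lebesgue_on {0..})"
  using assms by (simp add: L2_simps)

lemma abs_L2_add: "square_integrable f \<Longrightarrow> square_integrable g \<Longrightarrow> abs_L2 (\<lambda>s. f s + g s) = abs_L2 f + abs_L2 g"
  by (simp add: L2_simps)
lemma abs_L2_diff: "square_integrable f \<Longrightarrow> square_integrable g \<Longrightarrow> abs_L2 (\<lambda>s. f s - g s) = abs_L2 f - abs_L2 g"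
  by (simp add: L2_simps)
lemma abs_L2_scale: "square_integrable f \<Longrightarrow> abs_L2 (\<lambda>s. c *\<^sub>C f s) = c *\<^sub>C abs_L2 f"
  by (simp add: L2_simps)

text \<open>Dominated convergence for the squared distance, with majorant \<open>4 * (g s)^2\<close>
  because the limit is bounded by \<open>g\<close> as well.\<close>

lemma L2_dominated:
  fixes f :: "real \<Rightarrow> 'k::complex_inner"
  assumes F: "\<And>n. square_integrable (F n)" and f: "square_integrable f"
    and g: "integrable (lebesgue_on {0..}) (\<lambda>s. (g s)\<^sup>2)"
    and lim: "\<And>s. 0 \<le> s \<Longrightarrow> (\<lambda>n. F n s) \<longlonglongrightarrow> f s"
    and bd: "\<And>n s. 0 \<le> s \<Longrightarrow> norm (F n s) \<le> g s"
  shows "(\<lambda>n. abs_L2 (F n)) \<longlonglongrightarrow> abs_L2 f"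
proof -
  let ?M = "lebesgue_on {0::real..}"
  have fb: "norm (f s) \<le> g s" if "0 \<le> s" for s
    by (rule LIMSEQ_le_const2[OF tendsto_norm[OF lim[OF that]]]) (use bd that in auto)
  have d: "square_integrable (\<lambda>s. F n s - f s)" for n by (rule square_integrable_diff[OF F f])
  have "(\<lambda>n. \<integral>s. (norm (F n s - f s))\<^sup>2 \<partial>?M) \<longlonglongrightarrow> (\<integral>s. 0 \<partial>?M)"
  proof (rule integral_dominated_convergence[where w = "\<lambda>s. 4 * (g s)\<^sup>2"])
    show "(\<lambda>s. (norm (F n s - f s))\<^sup>2) \<in> borel_measurable ?M" for n
      using d[of n] by (auto simp: square_integrable_def)
    show "AE s in ?M. (\<lambda>n. (norm (F n s - f s))\<^sup>2) \<longlonglongrightarrow> 0"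
    proof (rule AE_I2)
      fix s :: real assume "s \<in> space ?M"
      then have "(\<lambda>n. F n s - f s) \<longlonglongrightarrow> f s - f s" by (intro tendsto_diff lim tendsto_const) simp
      then have "(\<lambda>n. (norm (F n s - f s))\<^sup>2) \<longlonglongrightarrow> (norm (f s - f s))\<^sup>2" by (intro tendsto_power tendsto_norm)
      then show "(\<lambda>n. (norm (F n s - f s))\<^sup>2) \<longlonglongrightarrow> 0" by simp
    qed
    show "AE s in ?M. norm ((norm (F n s - f s))\<^sup>2) \<le> 4 * (g s)\<^sup>2" for n
    proof (rule AE_I2)
      fix s :: real assume "s \<in> space ?M"
      then have s: "0 \<le> s" by simp
      have "norm (F n s - f s) \<le> 2 * g s"
        using norm_triangle_ineq4[of "F n s" "f s"] bd[OF s, of n] fb[OF s] by linarith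
      then have "(norm (F n s - f s))\<^sup>2 \<le> (2 * g s)\<^sup>2" by (rule power_mono) simp
      then show "norm ((norm (F n s - f s))\<^sup>2) \<le> 4 * (g s)\<^sup>2" by (simp add: power_mult_distrib)
    qed
    show "integrable ?M (\<lambda>s. 4 * (g s)\<^sup>2)" using g by simp
  qed simp
  then have "(\<lambda>n. (norm (abs_L2 (F n) - abs_L2 f))\<^sup>2) \<longlonglongrightarrow> 0"
    by (simp add: norm_abs_L2[OF d] flip: abs_L2_diff[OF F f])
  then have "(\<lambda>n. sqrt ((norm (abs_L2 (F n) - abs_L2 f))\<^sup>2)) \<longlonglongrightarrow> sqrt 0" by (rule tendsto_real_sqrt)
  then show ?thesis by (simp add: LIM_zero_cancel tendsto_norm_zero_iff)
qed

definition step_dense :: "(real \<Rightarrow> 'k::complex_inner) \<Rightarrow> bool" where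
  "step_dense f \<longleftrightarrow> square_integrable f \<and> abs_L2 f \<in> closure (abs_L2 ` step_funs)"

lemma step_denseI: "f \<in> step_funs \<Longrightarrow> step_dense f"
  unfolding step_dense_def using square_integrable_step closure_subset[of "abs_L2 ` step_funs"] by auto

lemma step_dense_add: "step_dense f \<Longrightarrow> step_dense g \<Longrightarrow> step_dense (\<lambda>s. f s + g s)"
proof -
  assume *: "step_dense f" "step_dense g"
  from * obtain F where F: "\<And>n. F n \<in> abs_L2 ` step_funs" "F \<longlonglongrightarrow> abs_L2 f"
    unfolding step_dense_def closure_sequential by blast
  from * obtain G where G: "\<And>n. G n \<in> abs_L2 ` step_funs" "G \<longlonglongrightarrow> abs_L2 g"
    unfolding step_dense_def closure_sequential by blast
  have "F n + G n \<in> abs_L2 ` step_funs" for n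
  proof -
    obtain p q where "p \<in> step_funs" "F n = abs_L2 p" "q \<in> step_funs" "G n = abs_L2 q"
      using F(1)[of n] G(1)[of n] by blast
    then show ?thesis
      by (intro image_eqI[of _ _ "\<lambda>s. p s + q s"]) (simp_all add: abs_L2_add square_integrable_step step_add)
  qed
  moreover have "(\<lambda>n. F n + G n) \<longlonglongrightarrow> abs_L2 f + abs_L2 g" by (intro tendsto_add F G)
  ultimately have "abs_L2 f + abs_L2 g \<in> closure (abs_L2 ` step_funs)"
    unfolding closure_sequential by (intro exI[of _ "\<lambda>n. F n + G n"]) simp
  then show ?thesis using * by (simp add: step_dense_def abs_L2_add square_integrable_add)
qed

lemma step_dense_scale: "step_dense f \<Longrightarrow> step_dense (\<lambda>s. c *\<^sub>C f s)"
proof -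
  assume *: "step_dense f"
  then obtain F where F: "\<And>n. F n \<in> abs_L2 ` step_funs" "F \<longlonglongrightarrow> abs_L2 f"
    unfolding step_dense_def closure_sequential by blast
  have "c *\<^sub>C F n \<in> abs_L2 ` step_funs" for n
  proof -
    obtain p where "p \<in> step_funs" "F n = abs_L2 p" using F(1)[of n] by blast
    then show ?thesis
      by (intro image_eqI[of _ _ "\<lambda>s. c *\<^sub>C p s"]) (simp_all add: abs_L2_scale square_integrable_step step_scale)
  qed
  moreover have "(\<lambda>n. c *\<^sub>C F n) \<longlonglongrightarrow> c *\<^sub>C abs_L2 f" by (intro tendsto_scaleC F)
  ultimately have "c *\<^sub>C abs_L2 f \<in> closure (abs_L2 ` step_funs)"
    unfolding closure_sequential by (intro exI[of _ "\<lambda>n. c *\<^sub>C F n"]) simp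
  then show ?thesis using * by (simp add: step_dense_def abs_L2_scale square_integrable_scale)
qed

lemma step_dense_sum: "(\<And>i. i \<in> A \<Longrightarrow> step_dense (f i)) \<Longrightarrow> step_dense (\<lambda>s. \<Sum>i\<in>A. f i s)"
  by (induction A rule: infinite_finite_induct) (auto intro: step_dense_add step_denseI step_zero)

lemma step_dense_lim:
  assumes "\<And>n. step_dense (F n)" "square_integrable f" "(\<lambda>n. abs_L2 (F n)) \<longlonglongrightarrow> abs_L2 f"
  shows "step_dense f"
  using assms closed_sequentially[OF closed_closure, of "\<lambda>n. abs_L2 (F n)"] by (auto simp: step_dense_def)

lemma step_dense_AE:
  assumes "step_dense g" "square_integrable f" "AE s in lebesgue_on {0..}. f s = g s"
  shows "step_dense f"
  using assms L2_eq_iff[of f g] by (simp add: step_dense_def)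

lemma half_line_lebesgue: "{a::real..} \<in> sets lebesgue"
  by (intro sets_completionI_sets) simp

lemma integrable_indicator_half_line:
  fixes A :: "real set"
  assumes "A \<in> sets lebesgue" "A \<subseteq> {0..}" "emeasure lebesgue A < \<infinity>"
  shows "integrable (lebesgue_on {0..}) (\<lambda>s. indicator A s * (r::real))"
proof (intro integrable_mult_left integrable_real_indicator)
  show "A \<in> sets (lebesgue_on {0..})" using assms by (auto simp: sets_restrict_space)
  then show "emeasure (lebesgue_on {0..}) A < \<infinity>" using assms by (subst emeasure_restrict_space) auto
qed

lemma square_integrable_indicator:
  assumes "A \<in> sets lebesgue" "A \<subseteq> {0..}" "emeasure lebesgue A < \<infinity>"
  shows "square_integrable (\<lambda>s. indicator A s *\<^sub>R c)"
proof -
  have "A \<in> sets (lebesgue_on {0..})" using assms by (auto simp: sets_restrict_space)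
  then have "simple_function (lebesgue_on {0..}) (indicator A :: real \<Rightarrow> real)" by (rule simple_function_indicator)
  then have "simple_function (lebesgue_on {0..}) (\<lambda>s. indicator A s *\<^sub>R c)"
    by (rule simple_function_compose1[of _ _ "\<lambda>x. x *\<^sub>R c"])
  then have "strongly_measurable (lebesgue_on {0..}) (\<lambda>s. indicator A s *\<^sub>R c)"
    unfolding strongly_measurable_def by (intro exI[of _ "\<lambda>_ s. indicator A s *\<^sub>R c"]) auto
  moreover have "integrable (lebesgue_on {0..}) (\<lambda>s. (norm (indicator A s *\<^sub>R c))\<^sup>2)"
    by (rule Bochner_Integration.integrable_cong[THEN iffD1, OF refl _ integrable_indicator_half_line[OF assms, of "(norm c)\<^sup>2"]])
      (auto simp: indicator_def)
  ultimately show ?thesis by (simp add: square_integrable_def)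
qed

lemma emeasure_bounded_interval: "emeasure lebesgue (A \<inter> {0..<N::real}) < \<infinity>"
proof -
  have "emeasure lebesgue (A \<inter> {0..<N}) \<le> emeasure lebesgue {0..N}" by (rule emeasure_mono) auto
  also have "\<dots> < \<infinity>" using emeasure_lborel_cbox_finite[of 0 N] by simp
  finally show ?thesis .
qed

text \<open>Dynkin argument: half-open intervals form an intersection-stable generator of the Borel
  sets. The truncation to \<open>[0, N)\<close> keeps all measures finite, so complements and
  disjoint countable unions stay inside L2.\<close>

lemma step_dense_borel:
  assumes "A \<in> sets borel"
  shows "step_dense (\<lambda>s. indicator (A \<inter> {0..<N::real}) s *\<^sub>R c)"
proof -
  have sq: "square_integrable (\<lambda>s. indicator (A \<inter> {0..<N::real}) s *\<^sub>R c)" if "A \<in> sets borel" for A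
  proof (rule square_integrable_indicator[OF _ _ emeasure_bounded_interval])
    show "A \<inter> {0..<N} \<in> sets lebesgue" using that by (intro sets_completionI_sets) simp
  qed auto
  have A_gen: "A \<in> sigma_sets UNIV (range (\<lambda>(a, b). {a..<b::real}))"
    using assms by (subst (asm) borel_eq_atLeastLessThan) simp
  have gen: "sigma_sets UNIV (range (\<lambda>(a, b). {a..<b::real})) = sets borel"
    by (subst borel_eq_atLeastLessThan) simp
  show ?thesis using A_gen
  proof (induction rule: sigma_sets_induct_disjoint[rotated 2, consumes 1, case_names basic empty compl union stable subs])
    case (basic A)
    then obtain a b where "A = {a..<b}" by auto
    then have "(\<lambda>s. indicator (A \<inter> {0..<N::real}) s *\<^sub>R c) = (\<lambda>s. indicator {max a 0..<min b N} s *\<^sub>R c)"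
      by (auto simp: fun_eq_iff indicator_def)
    then show ?case by (simp add: step_denseI step_indicator)
  next
    case empty
    then show ?case by (simp add: step_denseI step_zero)
  next
    \<comment> \<open>The complement is taken inside \<open>[0, N)\<close>, whose indicator is
      itself a step function.\<close>
    case (compl A)
    have eq: "(\<lambda>s. indicator ((UNIV - A) \<inter> {0..<N::real}) s *\<^sub>R c)
        = (\<lambda>s. indicator {0..<N} s *\<^sub>R c + (-1) *\<^sub>C (indicator (A \<inter> {0..<N}) s *\<^sub>R c))"
      by (auto simp: fun_eq_iff indicator_def complex_vector.scale_minus_left)
    show ?case unfolding eq
      by (rule step_dense_add[OF step_denseI[OF step_indicator] step_dense_scale[OF compl(2)]]) simp
  next
    case (union A)
    let ?F = "\<lambda>n s. \<Sum>i<n. indicator (A i \<inter> {0..<N}) s *\<^sub>R c"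
    have Fi: "?F n s = indicator ((\<Union>i<n. A i) \<inter> {0..<N}) s *\<^sub>R c" for n s
    proof -
      have "disjoint_family_on A {..<n}" using union(1) by (auto simp: disjoint_family_on_def)
      then have "(indicator (\<Union>i<n. A i) s :: real) = (\<Sum>i<n. indicator (A i) s)"
        by (rule indicator_UN_disjoint[OF finite_lessThan])
      then show ?thesis
        by (simp only: indicator_inter_arith scaleR_sum_left sum_distrib_right scaleR_scaleR)
    qed
    have sqU: "square_integrable (\<lambda>s. indicator ((\<Union>i. A i) \<inter> {0..<N}) s *\<^sub>R c)"
      using union(2) unfolding gen by (intro sq sets.countable_UN) auto
    show ?case
    proof (rule step_dense_lim[of ?F, OF step_dense_sum[OF union(3)] sqU])
      show "(\<lambda>n. abs_L2 (?F n)) \<longlonglongrightarrow> abs_L2 (\<lambda>s. indicator ((\<Union>i. A i) \<inter> {0..<N}) s *\<^sub>R c)"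
      proof (rule L2_dominated[where g = "\<lambda>s. indicator {0..<N} s * norm c"])
        show "square_integrable (?F n)" for n
          using step_dense_sum[of "{..<n}" "\<lambda>i s. indicator (A i \<inter> {0..<N}) s *\<^sub>R c", OF union(3)]
          by (simp add: step_dense_def)
        show "integrable (lebesgue_on {0..}) (\<lambda>s. (indicator {0..<N} s * norm c)\<^sup>2)"
          by (rule Bochner_Integration.integrable_cong[THEN iffD1, OF refl _
              integrable_indicator_half_line[OF _ _ emeasure_bounded_interval[of UNIV N], of "(norm c)\<^sup>2"]])
            (auto simp: indicator_def)
        show "(\<lambda>n. ?F n s) \<longlonglongrightarrow> indicator ((\<Union>i. A i) \<inter> {0..<N}) s *\<^sub>R c" for s
        proof (cases "s \<in> (\<Union>i. A i) \<inter> {0..<N}")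
          case True
          then obtain i where i: "s \<in> A i" by blast
          have "\<forall>\<^sub>F n in sequentially. indicator ((\<Union>i. A i) \<inter> {0..<N}) s *\<^sub>R c = ?F n s"
            using eventually_gt_at_top[of i]
          proof eventually_elim
            case (elim n)
            show ?case unfolding Fi using True i elim by (auto simp: indicator_def)
          qed
          then show ?thesis by (rule Lim_transform_eventually[OF tendsto_const])
        next
          case False
          then have "?F n s = 0" for n unfolding Fi by (auto simp: indicator_def)
          then show ?thesis using False by simp
        qed
        show "norm (?F n s) \<le> indicator {0..<N} s * norm c" for n s
          unfolding Fi by (auto simp: indicator_def)
      qed (rule sqU)
    qed
  next
    case stable
    show ?case
    proof (rule Int_stableI)
      fix a b :: "real set" assume "a \<in> range (\<lambda>(a, b). {a..<b})" "b \<in> range (\<lambda>(a, b). {a..<b})"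
      then obtain p q r s where "a = {p..<q}" "b = {r..<s}" by auto
      then show "a \<inter> b \<in> range (\<lambda>(a, b). {a..<b})" by (intro image_eqI[of _ _ "(max p r, min q s)"]) auto
    qed
  qed auto
qed

text \<open>A Lebesgue set differs from a Borel set \<open>S\<close> by a null set, and the
  truncations of \<open>S\<close> to \<open>[0, n)\<close> converge in L2 because \<open>S\<close>
  has finite measure.\<close>

lemma step_dense_indicator:
  assumes A: "A \<in> sets lebesgue" "A \<subseteq> {0..}" "emeasure lebesgue A < \<infinity>"
  shows "step_dense (\<lambda>s. indicator A s *\<^sub>R c)"
proof -
  obtain S N N' where S: "A = S \<union> N" "N \<subseteq> N'" "N' \<in> null_sets lborel" "S \<in> sets lborel"
    using A(1) by (auto elim: sets_completionE)
  let ?F = "\<lambda>n s. indicator (S \<inter> {0..<real n}) s *\<^sub>R c"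
  have S': "S \<in> sets borel" using S by simp
  have sub: "S \<subseteq> A" "S \<subseteq> {0..}" using S A by auto
  have leb: "S \<in> sets lebesgue" using S by (intro sets_completionI_sets) simp
  have "emeasure lebesgue S \<le> emeasure lebesgue A" by (rule emeasure_mono) (use sub A in auto)
  then have fin: "emeasure lebesgue S < \<infinity>" using A(3) by simp
  have sq: "square_integrable (\<lambda>s. indicator S s *\<^sub>R c)" by (rule square_integrable_indicator[OF leb sub(2) fin])
  have dn: "step_dense (?F n)" for n by (rule step_dense_borel[OF S'])
  have "step_dense (\<lambda>s. indicator S s *\<^sub>R c)"
  proof (rule step_dense_lim[of ?F, OF dn sq])
    show "(\<lambda>n. abs_L2 (?F n)) \<longlonglongrightarrow> abs_L2 (\<lambda>s. indicator S s *\<^sub>R c)"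
    proof (rule L2_dominated[where g = "\<lambda>s. indicator S s * norm c"])
      show "square_integrable (?F n)" for n using dn by (simp add: step_dense_def)
      show "integrable (lebesgue_on {0..}) (\<lambda>s. (indicator S s * norm c)\<^sup>2)"
        by (rule Bochner_Integration.integrable_cong[THEN iffD1, OF refl _
            integrable_indicator_half_line[OF leb sub(2) fin, of "(norm c)\<^sup>2"]])
          (auto simp: indicator_def)
      show "(\<lambda>n. ?F n s) \<longlonglongrightarrow> indicator S s *\<^sub>R c" if "0 \<le> s" for s
      proof -
        have "\<forall>\<^sub>F n in sequentially. indicator S s *\<^sub>R c = ?F n s"
          using eventually_gt_at_top[of "nat \<lceil>s\<rceil>"]
          by eventually_elim (use that in \<open>auto simp: indicator_def, linarith\<close>)
        then show ?thesis by (rule Lim_transform_eventually[OF tendsto_const])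
      qed
      show "norm (?F n s) \<le> indicator S s * norm c" for n s by (simp add: indicator_def)
    qed (rule sq)
  qed
  then show ?thesis
  proof (rule step_dense_AE[OF _ square_integrable_indicator[OF A]])
    have "N' \<in> null_sets lebesgue" using S(3) by (rule null_sets_completionI)
    then have "AE s in lebesgue. s \<notin> N'" by (rule AE_not_in)
    then have "AE s in lebesgue. s \<in> {0..} \<longrightarrow> indicator A s *\<^sub>R c = indicator S s *\<^sub>R c"
      by eventually_elim (use S in \<open>auto simp: indicator_def\<close>)
    then show "AE s in lebesgue_on {0..}. indicator A s *\<^sub>R c = indicator S s *\<^sub>R c"
      by (subst AE_restrict_space_iff) auto
  qed
qed

text \<open>The function is the sum over its nonzero values of the indicators of their level sets.
  The value zero is left out since its level set may have infinite measure, while square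
  integrability makes the others finite.\<close>

lemma step_dense_simple:
  assumes t: "simple_function (lebesgue_on {0..}) t" and sq: "integrable (lebesgue_on {0..}) (\<lambda>s. (norm (t s))\<^sup>2)"
  shows "step_dense t"
proof -
  let ?M = "lebesgue_on {0::real..}"
  define A where "A c = t -` {c} \<inter> {0..}" for c
  have fin: "finite (t ` {0..})" using t by (simp add: simple_function_def)
  have AM: "A c \<in> sets ?M" if "c \<in> t ` {0..}" for c using t that by (auto simp: simple_function_def A_def)
  have AL: "A c \<in> sets lebesgue" "A c \<subseteq> {0..}" if c: "c \<in> t ` {0..}" for c
  proof -
    obtain x where x: "A c = {0..} \<inter> x" "x \<in> sets lebesgue"
      using AM[OF c] by (auto simp: sets_restrict_space)
    show "A c \<in> sets lebesgue" unfolding x(1) by (rule sets.Int[OF half_line_lebesgue x(2)])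
  qed (auto simp: A_def)
  have Afin: "emeasure lebesgue (A c) < \<infinity>" if c: "c \<in> t ` {0..}" "c \<noteq> 0" for c
  proof -
    have "integrable ?M (\<lambda>s. (norm c)\<^sup>2 * indicator (A c) s)"
    proof (rule Bochner_Integration.integrable_bound[OF sq])
      show "(\<lambda>s. (norm c)\<^sup>2 * indicator (A c) s) \<in> borel_measurable ?M"
        using AM[OF c(1)] by (intro borel_measurable_times borel_measurable_const borel_measurable_indicator)
    qed (auto simp: A_def indicator_def)
    then have "integrable ?M (\<lambda>s. (1 / (norm c)\<^sup>2) * ((norm c)\<^sup>2 * indicator (A c) s))" by (rule integrable_mult_right)
    then have "integrable ?M (indicator (A c) :: real \<Rightarrow> real)"
      by (rule Bochner_Integration.integrable_cong[THEN iffD1, rotated 2]) (use c in auto)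
    then have "emeasure ?M (A c \<inter> space ?M) < \<infinity>" unfolding integrable_indicator_iff by blast
    then show ?thesis using AL[OF c(1)] by (simp add: emeasure_restrict_space Int_absorb2)
  qed
  have d: "step_dense (\<lambda>s. \<Sum>c\<in>t ` {0..} - {0}. indicator (A c) s *\<^sub>R c)"
    by (intro step_dense_sum step_dense_indicator AL Afin) auto
  have eq: "(\<Sum>c\<in>t ` {0..} - {0}. indicator (A c) s *\<^sub>R c) = t s" if "0 \<le> s" for s
  proof -
    have "(\<Sum>c\<in>t ` {0..} - {0}. indicator (A c) s *\<^sub>R c) = (\<Sum>c\<in>t ` {0..} - {0}. if c = t s then t s else 0)"
      using that by (intro sum.cong) (auto simp: A_def indicator_def)
    also have "\<dots> = t s" using fin that by (subst sum.delta) auto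
    finally show ?thesis .
  qed
  show ?thesis
  proof (rule step_dense_AE[OF d])
    show "square_integrable t" using t sq unfolding square_integrable_def strongly_measurable_def
      by (intro conjI exI[of _ "\<lambda>_. t"]) auto
    show "AE s in ?M. t s = (\<Sum>c\<in>t ` {0..} - {0}. indicator (A c) s *\<^sub>R c)"
      by (rule AE_I2) (simp add: eq)
  qed
qed

lemma closure_abs_L2_step: "closure (abs_L2 ` step_funs) = (UNIV :: 'k::complex_inner L2 set)"
proof -
  have "F \<in> closure (abs_L2 ` step_funs)" for F :: "'k L2"
  proof -
    let ?M = "lebesgue_on {0::real..}"
    obtain f where f: "square_integrable f" "F = abs_L2 f" by (rule L2_exhaust)
    then obtain s where s: "\<And>n. simple_function ?M (s n)" "\<And>x. x \<in> space ?M \<Longrightarrow> (\<lambda>n. s n x) \<longlonglongrightarrow> f x"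
      unfolding square_integrable_def strongly_measurable_def by blast
    have fm: "(\<lambda>x. norm (f x)) \<in> borel_measurable ?M"
      by (rule measurable_compose[OF borel_measurable_strongly borel_measurable_norm])
        (use f(1) in \<open>simp add: square_integrable_def\<close>)
    \<comment> \<open>Discarding values larger than \<open>2 * norm (f x)\<close> gives a dominated
      sequence of simple functions. The factor 2 leaves room: where \<open>f x\<close> is nonzero
      the condition eventually holds, and where \<open>f x = 0\<close> the truncation is exactly
      zero.\<close>
    define t where "t n x = (if norm (s n x) \<le> 2 * norm (f x) then s n x else 0)" for n x
    have tsim: "simple_function ?M (t n)" for n
      unfolding t_def
    proof (rule simple_function_If[OF s(1)])
      have "(\<lambda>x. norm (s n x)) \<in> borel_measurable ?M"
        by (rule borel_measurable_simple_function[OF simple_function_compose1[OF s(1)]])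
      then show "{x \<in> space ?M. norm (s n x) \<le> 2 * norm (f x)} \<in> sets ?M"
        using fm by measurable
    qed simp
    have tb: "norm (t n x) \<le> 2 * norm (f x)" for n x by (simp add: t_def)
    have g: "integrable ?M (\<lambda>x. (2 * norm (f x))\<^sup>2)"
      using f(1) by (simp add: square_integrable_def power_mult_distrib)
    have tsq: "integrable ?M (\<lambda>x. (norm (t n x))\<^sup>2)" for n
    proof (rule Bochner_Integration.integrable_bound[OF g])
      show "(\<lambda>x. (norm (t n x))\<^sup>2) \<in> borel_measurable ?M"
        by (rule borel_measurable_simple_function[OF simple_function_compose1[OF tsim]])
      show "AE x in ?M. norm ((norm (t n x))\<^sup>2) \<le> norm ((2 * norm (f x))\<^sup>2)"
        by (rule AE_I2, insert power_mono[OF tb norm_ge_zero, of n _ 2]) simp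
    qed
    have td: "step_dense (t n)" for n by (rule step_dense_simple[OF tsim tsq])
    have "step_dense f"
    proof (rule step_dense_lim[OF td f(1) L2_dominated[OF _ f(1) g]])
      show "square_integrable (t n)" for n using td by (simp add: step_dense_def)
      show "norm (t n x) \<le> 2 * norm (f x)" for n x by (rule tb)
      fix x :: real assume "0 \<le> x"
      then have sx: "(\<lambda>n. s n x) \<longlonglongrightarrow> f x" by (intro s(2)) simp
      show "(\<lambda>n. t n x) \<longlonglongrightarrow> f x"
      proof (cases "f x = 0")
        case True
        then have "t n x = 0" for n using tb[of n x] by simp
        then show ?thesis using True by simp
      next
        case False
        then have "norm (f x) < 2 * norm (f x)" by simp
        from order_tendstoD(2)[OF tendsto_norm[OF sx] this]
        have "\<forall>\<^sub>F n in sequentially. s n x = t n x" by eventually_elim (simp add: t_def)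
        then show ?thesis by (rule Lim_transform_eventually[OF sx])
      qed
    qed
    then show ?thesis using f by (simp add: step_dense_def)
  qed
  then show ?thesis by auto
qed

section \<open>Exponential vectors\<close>

text \<open>The unnormalised exponential vector. Without the Gaussian factor its inner products are
  exactly \<open>exp (cinner f g)\<close>, so it can be differentiated in \<open>f\<close> without
  extra terms.\<close>

definition eps :: "'a::complex_inner \<Rightarrow> 'a fock" where
  "eps f = exp ((norm f)\<^sup>2 / 2) *\<^sub>R nexp f"

lemma cinner_scaleR_left: "cinner (r *\<^sub>R x) y = complex_of_real r * cinner (x::'a::complex_inner) y"
  by (simp add: scaleR_scaleC)

lemma cinner_scaleR_right: "cinner x (r *\<^sub>R y) = complex_of_real r * cinner (x::'a::complex_inner) y"
  by (simp add: scaleR_scaleC)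

lemma cinner_eps: "cinner (eps f) (eps g) = exp (cinner f g)"
  by (simp add: eps_def cinner_scaleR_left cinner_scaleR_right cinner_nexp exp_of_real[symmetric] flip: exp_add)

lemma nexp_eps: "nexp f = exp (- (norm f)\<^sup>2 / 2) *\<^sub>R eps f"
  by (simp add: eps_def flip: exp_add)

lemma eps_suminf: "eps f = suminf (\<lambda>n. (1 / sqrt (fact n)) *\<^sub>R sympow f n)"
  by (simp add: eps_def nexp_def flip: exp_add)

lemma exp_quotient_lim: "(\<lambda>n. of_nat (Suc n) * (exp (w / of_nat (Suc n)) - 1)) \<longlonglongrightarrow> (w::complex)"
proof -
  have "((\<lambda>t. exp (w * t)) has_field_derivative w) (at 0)"
    by (auto intro!: derivative_eq_intros)
  then have "((\<lambda>t. (exp (w * t) - 1) / t) \<longlongrightarrow> w) (at 0)"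
    by (simp add: has_field_derivative_iff)
  moreover have "filterlim (\<lambda>n. 1 / of_nat (Suc n) :: complex) (at 0) sequentially"
  proof (rule filterlim_atI)
    have "(\<lambda>n. complex_of_real (inverse (real (Suc n)))) \<longlonglongrightarrow> complex_of_real 0"
      by (intro tendsto_of_real LIMSEQ_inverse_real_of_nat)
    then show "(\<lambda>n. 1 / of_nat (Suc n) :: complex) \<longlonglongrightarrow> 0" by (simp add: field_simps)
  qed (simp del: of_nat_Suc)
  ultimately have "((\<lambda>n. (exp (w * (1 / of_nat (Suc n))) - 1) / (1 / of_nat (Suc n))) \<longlonglongrightarrow> w)"
    by (rule filterlim_compose)
  then show ?thesis by (simp add: mult.commute)
qed

text \<open>The difference quotient of \<open>eps\<close> at \<open>e\<close> in direction
  \<open>x\<close> with step 1/(n+1); its limit is the creation operator of \<open>x\<close> applied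
  to \<open>eps e\<close>. Creation vectors are obtained this way without introducing an unbounded
  operator.\<close>

definition crq :: "'a::complex_inner \<Rightarrow> 'a \<Rightarrow> nat \<Rightarrow> 'a fock" where
  "crq x e n = of_nat (Suc n) *\<^sub>C (eps (e + (1 / of_nat (Suc n)) *\<^sub>C x) - eps e)"

text \<open>The terms are grouped so that each factor depending on the indices is either
  \<open>N * (exp (w / N) - 1)\<close> or \<open>exp (w / N)\<close>. The third index is chosen
  because \<open>Suc (n * m + n + m)\<close> is the product of \<open>Suc n\<close> and
  \<open>Suc m\<close>.\<close>

lemma cinner_crq:
  "cinner (crq x e n) (crq y e' m) = exp (cinner e e') *
    ((of_nat (Suc n) * (exp (cinner x e' / of_nat (Suc n)) - 1)) * (of_nat (Suc m) * (exp (cinner e y / of_nat (Suc m)) - 1))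
     + exp (cinner x e' / of_nat (Suc n)) * exp (cinner e y / of_nat (Suc m)) *
       (of_nat (Suc (n * m + n + m)) * (exp (cinner x y / of_nat (Suc (n * m + n + m))) - 1)))"
proof -
  define N M :: complex where "N = of_nat (Suc n)" and "M = of_nat (Suc m)"
  have nz: "N \<noteq> 0" "M \<noteq> 0" by (simp_all add: N_def M_def del: of_nat_Suc)
  have NM: "of_nat (Suc (n * m + n + m)) = N * M" by (simp add: N_def M_def algebra_simps)
  have cn: "cnj N = N" "cnj M = M" by (simp_all add: N_def M_def)
  have "cinner (e + (1 / N) *\<^sub>C x) (e' + (1 / M) *\<^sub>C y) = cinner e e' + cinner x e' / N + cinner e y / M + cinner x y / (N * M)"
    using nz by (simp add: cinner_add_left cinner_add_right cn field_simps)
  then have 1: "cinner (eps (e + (1 / N) *\<^sub>C x)) (eps (e' + (1 / M) *\<^sub>C y)) =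
      exp (cinner e e') * exp (cinner x e' / N) * exp (cinner e y / M) * exp (cinner x y / (N * M))"
    by (simp add: cinner_eps exp_add)
  have 2: "cinner (eps (e + (1 / N) *\<^sub>C x)) (eps e') = exp (cinner e e') * exp (cinner x e' / N)"
    by (simp add: cinner_eps cinner_add_left cn exp_add)
  have 3: "cinner (eps e) (eps (e' + (1 / M) *\<^sub>C y)) = exp (cinner e e') * exp (cinner e y / M)"
    by (simp add: cinner_eps cinner_add_right cn exp_add)
  have 4: "cinner (eps e) (eps e') = exp (cinner e e')" by (rule cinner_eps)
  show ?thesis unfolding crq_def NM
    unfolding N_def[symmetric] M_def[symmetric]
    by (simp add: cinner_diff_left cinner_diff_right 1 2 3 4 cn) (simp add: algebra_simps)
qed

lemma cinner_crq_tendsto: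
  "((\<lambda>p. cinner (crq x e (fst p)) (crq y e' (snd p))) \<longlongrightarrow> exp (cinner e e') * (cinner x e' * cinner e y + cinner x y))
     (sequentially \<times>\<^sub>F sequentially)"
proof -
  have f: "filterlim fst sequentially (sequentially \<times>\<^sub>F sequentially)" by (rule filterlim_fst)
  have s: "filterlim snd sequentially (sequentially \<times>\<^sub>F sequentially)" by (rule filterlim_snd)
  have fs: "filterlim (\<lambda>p. fst p * snd p + fst p + snd p) sequentially (sequentially \<times>\<^sub>F sequentially)"
    by (rule filterlim_at_top_mono[OF f]) (simp add: always_eventually)
  have 0: "(\<lambda>n. exp (w / of_nat (Suc n))) \<longlonglongrightarrow> 1" for w :: complex
  proof -
    have "(\<lambda>n. w * complex_of_real (inverse (real (Suc n)))) \<longlonglongrightarrow> w * complex_of_real 0"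
      by (intro tendsto_mult tendsto_const tendsto_of_real LIMSEQ_inverse_real_of_nat)
    from tendsto_exp[OF this] show ?thesis by (simp add: divide_inverse)
  qed
  have "((\<lambda>p. cinner (crq x e (fst p)) (crq y e' (snd p))) \<longlongrightarrow> exp (cinner e e') * (cinner x e' * cinner e y + 1 * 1 * cinner x y))
     (sequentially \<times>\<^sub>F sequentially)"
    unfolding cinner_crq
    by (intro tendsto_mult tendsto_add tendsto_const
        filterlim_compose[OF exp_quotient_lim f] filterlim_compose[OF exp_quotient_lim s]
        filterlim_compose[OF 0 f] filterlim_compose[OF 0 s] filterlim_compose[OF exp_quotient_lim fs])
  then show ?thesis by simp
qed

lemma filterlim_diag: "filterlim (\<lambda>n. (n, n)) (sequentially \<times>\<^sub>F sequentially) sequentially"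
  by (intro filterlim_Pair filterlim_ident)

definition creation :: "'a::complex_inner \<Rightarrow> 'a \<Rightarrow> 'a fock" where
  "creation x e = lim (crq x e)"

text \<open>The inner products of two members have a joint limit \<open>?L\<close>, hence the
  squared distance tends to \<open>?L - ?L - ?L + ?L\<close>, which is 0. Both indices move
  independently, which is why the product filter is used.\<close>

lemma crq_tendsto: "crq x e \<longlonglongrightarrow> creation x e"
proof -
  let ?X = "crq x e" and ?F = "sequentially \<times>\<^sub>F sequentially"
  let ?L = "exp (cinner e e) * (cinner x e * cinner e x + cinner x x)"
  have *: "((\<lambda>p. cinner (?X (fst p)) (?X (snd p))) \<longlongrightarrow> ?L) ?F" by (rule cinner_crq_tendsto)
  have sw: "((\<lambda>p. cinner (?X (snd p)) (?X (fst p))) \<longlongrightarrow> ?L) ?F"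
    using filterlim_compose[OF *, of "\<lambda>p. (snd p, fst p)" ?F]
    by (simp add: filterlim_Pair filterlim_fst filterlim_snd)
  have d: "((\<lambda>n. cinner (?X n) (?X n)) \<longlongrightarrow> ?L) sequentially"
    using filterlim_compose[OF * filterlim_diag] by simp
  have "((\<lambda>p. Re (cinner (?X (fst p)) (?X (fst p)) - cinner (?X (fst p)) (?X (snd p))
      - cinner (?X (snd p)) (?X (fst p)) + cinner (?X (snd p)) (?X (snd p)))) \<longlongrightarrow> Re (?L - ?L - ?L + ?L)) ?F"
    by (intro tendsto_Re tendsto_add tendsto_diff * sw filterlim_compose[OF d filterlim_fst] filterlim_compose[OF d filterlim_snd])
  then have lim: "((\<lambda>p. (norm (?X (fst p) - ?X (snd p)))\<^sup>2) \<longlongrightarrow> 0) ?F"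
    by (simp add: norm_power2_cinner cinner_diff_left cinner_diff_right algebra_simps)
  have "Cauchy ?X"
  proof (rule metric_CauchyI)
    fix r :: real assume r: "r > 0"
    then have "r\<^sup>2 > 0" by simp
    from order_tendstoD(2)[OF lim this] obtain N where
      N: "\<forall>n\<ge>N. \<forall>m\<ge>N. (norm (?X m - ?X n))\<^sup>2 < r\<^sup>2"
      unfolding eventually_prod_sequentially by auto
    have "dist (?X m) (?X n) < r" if "m \<ge> N" "n \<ge> N" for m n
    proof -
      have "(norm (?X m - ?X n))\<^sup>2 < r\<^sup>2" using N that by blast
      then show ?thesis unfolding dist_norm by (rule power2_less_imp_less) (use r in simp)
    qed
    then show "\<exists>M. \<forall>m\<ge>M. \<forall>n\<ge>M. dist (?X m) (?X n) < r" by blast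
  qed
  then show ?thesis unfolding creation_def by (simp add: Cauchy_convergent_iff convergent_LIMSEQ_iff)
qed

text \<open>The summand \<open>cinner x y\<close> is the contribution of the canonical commutation
  relations. For indicators over \<open>[a, b)\<close> it is of first order in \<open>b - a\<close>
  and becomes the Ito correction, whereas the product \<open>cinner x e' * cinner e y\<close> is of
  second order.\<close>

lemma cinner_creation:
  "cinner (creation x e) (creation y e') = exp (cinner e e') * (cinner x e' * cinner e y + cinner x y)"
proof -
  have "(\<lambda>n. cinner (crq x e n) (crq y e' n)) \<longlonglongrightarrow> cinner (creation x e) (creation y e')"
    by (intro tendsto_cinner crq_tendsto)
  moreover have "(\<lambda>n. cinner (crq x e n) (crq y e' n)) \<longlonglongrightarrow> exp (cinner e e') * (cinner x e' * cinner e y + cinner x y)"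
    using filterlim_compose[OF cinner_crq_tendsto filterlim_diag] by simp
  ultimately show ?thesis by (rule LIMSEQ_unique)
qed

lemma cinner_eps_creation: "cinner (eps g) (creation x e) = cinner g x * exp (cinner g e)"
proof -
  have "cinner (eps g) (crq x e n) = (of_nat (Suc n) * (exp (cinner g x / of_nat (Suc n)) - 1)) * exp (cinner g e)" for n
    by (simp add: crq_def cinner_diff_right cinner_eps cinner_add_right exp_add algebra_simps)
  moreover have "(\<lambda>n. (of_nat (Suc n) * (exp (cinner g x / of_nat (Suc n)) - 1)) * exp (cinner g e)) \<longlonglongrightarrow> cinner g x * exp (cinner g e)"
    by (intro tendsto_mult exp_quotient_lim tendsto_const)
  ultimately have "(\<lambda>n. cinner (eps g) (crq x e n)) \<longlonglongrightarrow> cinner g x * exp (cinner g e)" by simp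
  moreover have "(\<lambda>n. cinner (eps g) (crq x e n)) \<longlonglongrightarrow> cinner (eps g) (creation x e)"
    by (intro tendsto_cinner crq_tendsto tendsto_const)
  ultimately show ?thesis using LIMSEQ_unique by blast
qed

lemma cinner_creation_eps: "cinner (creation x e) (eps g) = cinner x g * exp (cinner e g)"
proof -
  have "cinner (creation x e) (eps g) = cnj (cinner (eps g) (creation x e))" by (rule cinner_commute)
  then show ?thesis
    by (simp add: cinner_eps_creation exp_cnj cinner_commute[of x g] cinner_commute[of e g])
qed

subsection \<open>Totality\<close>

lemma eps_tendsto: "X \<longlonglongrightarrow> x \<Longrightarrow> (\<lambda>n. eps (X n)) \<longlonglongrightarrow> eps x"
proof -
  assume X: "X \<longlonglongrightarrow> x"
  have "(\<lambda>n. Re (exp (cinner (X n) (X n)) - exp (cinner (X n) x) - exp (cinner x (X n)) + exp (cinner x x)))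
      \<longlonglongrightarrow> Re (exp (cinner x x) - exp (cinner x x) - exp (cinner x x) + exp (cinner x x))"
    by (intro tendsto_intros X)
  then have "(\<lambda>n. (norm (eps (X n) - eps x))\<^sup>2) \<longlonglongrightarrow> 0"
    by (simp add: norm_power2_cinner cinner_diff_left cinner_diff_right cinner_eps algebra_simps)
  then have "(\<lambda>n. sqrt ((norm (eps (X n) - eps x))\<^sup>2)) \<longlonglongrightarrow> sqrt 0" by (rule tendsto_real_sqrt)
  then show ?thesis by (simp add: LIM_zero_cancel tendsto_norm_zero_iff)
qed

lemma powser_zero_coeffs:
  fixes a :: "nat \<Rightarrow> complex"
  assumes "\<And>z. (\<lambda>n. a n * z ^ n) sums 0"
  shows "a m = 0"
proof (induction m rule: less_induct)
  case (less m)
  have "((\<lambda>_. 0) \<longlongrightarrow> a (0 + m)) (at (0::complex))"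
  proof (rule powser_limit_0_strong[where s = 1 and a = "\<lambda>n. a (n + m)"])
    fix z :: complex assume z: "z \<noteq> 0"
    have "(\<lambda>n. a (n + m) * z ^ (n + m)) sums (0 - (\<Sum>i<m. a i * z ^ i))"
      using sums_split_initial_segment[OF assms] by simp
    then have "(\<lambda>n. (a (n + m) * z ^ (n + m)) / z ^ m) sums (0 / z ^ m)"
      by (intro sums_divide) (simp add: less)
    then show "(\<lambda>n. a (n + m) * z ^ n) sums 0" using z by (simp add: power_add)
  qed simp
  then have "0 = a (0 + m)" by (rule LIM_const_eq)
  then show ?case by simp
qed

lemma sympow_scale: "sympow (c *\<^sub>C f) n = c ^ n *\<^sub>C sympow f n"
proof -
  let ?d = "sympow (c *\<^sub>C f) n - c ^ n *\<^sub>C sympow f n"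
  have "cinner ?d ?d = 0" by (simp add: cinner_diff_left cinner_diff_right power_mult_distrib)
  then show ?thesis by (simp add: cinner_eq_zero_iff)
qed

lemma expvec_eps: "\<varpi> f = exp (- (norm (abs_L2 f))\<^sup>2 / 2) *\<^sub>R eps (abs_L2 f)"
  by (simp add: expvec_def nexp_eps)

lemma cinner_expvec:
  "cinner (\<varpi> f) (\<varpi> g) = exp (cinner (abs_L2 f) (abs_L2 g) - (norm (abs_L2 f))\<^sup>2 / 2 - (norm (abs_L2 g))\<^sup>2 / 2)"
  by (simp add: expvec_def cinner_nexp)

text \<open>Density of the step functions and continuity of \<open>eps\<close> extend orthogonality
  to every \<open>eps F\<close>. Replacing \<open>F\<close> by its multiples by \<open>z\<close>
  gives a power series in \<open>z\<close> that vanishes identically; up to factorials its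
  coefficients are the inner products with the symmetric powers of \<open>F\<close>, which are
  total.\<close>

lemma expvec_total: "closure (cspan (\<varpi> ` step_funs)) = (UNIV :: 'k::complex_inner L2 fock set)"
proof (rule dense_cspanI)
  fix x :: "'k L2 fock" assume x: "\<And>s. s \<in> \<varpi> ` step_funs \<Longrightarrow> cinner s x = 0"
  have 1: "cinner (eps (abs_L2 f)) x = 0" if "f \<in> step_funs" for f
    using x[of "\<varpi> f"] that by (simp add: expvec_eps cinner_scaleR_left)
  have 2: "cinner (eps F) x = 0" for F
  proof -
    have "F \<in> closure (abs_L2 ` step_funs)" by (simp add: closure_abs_L2_step)
    then obtain X where X: "\<And>n. X n \<in> abs_L2 ` step_funs" "X \<longlonglongrightarrow> F" unfolding closure_sequential by blast
    have "(\<lambda>n. cinner (eps (X n)) x) \<longlonglongrightarrow> cinner (eps F) x" by (intro tendsto_cinner eps_tendsto X tendsto_const)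
    moreover have "cinner (eps (X n)) x = 0" for n using X(1)[of n] 1 by auto
    ultimately show ?thesis by (simp add: LIMSEQ_const_iff)
  qed
  have 3: "cinner x (sympow F n) = 0" for F n
  proof -
    define a where "a n = cinner x (sympow F n) / sqrt (fact n)" for n
    have "(\<lambda>n. a n * z ^ n) sums 0" for z
    proof -
      have "(\<lambda>n. (1 / sqrt (fact n)) *\<^sub>R sympow (z *\<^sub>C F) n) sums eps (z *\<^sub>C F)"
        unfolding eps_suminf by (rule summable_sums[OF summable_nexp])
      then have "(\<lambda>n. cinner x ((1 / sqrt (fact n)) *\<^sub>R sympow (z *\<^sub>C F) n)) sums cinner x (eps (z *\<^sub>C F))"
        by (rule bounded_linear.sums[OF bounded_bilinear.bounded_linear_right[OF bounded_bilinear_cinner]])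
      then show ?thesis using cinner_swap_zero[OF 2] by (simp add: a_def cinner_scaleR_right sympow_scale mult_ac)
    qed
    then have "a n = 0" by (rule powser_zero_coeffs)
    then show ?thesis by (simp add: a_def)
  qed
  have "cinner x x = 0"
    by (rule perp_closure_span[of "{sympow f n |f n. True}"])
      (use 3 cinner_swap_zero sympow_total in auto)
  then show "x = 0" by (simp add: cinner_eq_zero_iff)
qed

lemma hF_total: "closure (cspan {u \<otimes> \<varpi> f |u f. f \<in> step_funs}) = (UNIV :: ('h::chilbert_space, 'k::complex_inner) hF set)"
proof (rule dense_cspanI)
  fix z :: "('h, 'k) hF" assume z: "\<And>s. s \<in> {u \<otimes> \<varpi> f |u f. f \<in> step_funs} \<Longrightarrow> cinner s z = 0"
  have "cinner (u \<otimes> w) z = 0" for u w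
  proof -
    have "w \<in> closure (cspan (\<varpi> ` step_funs))" by (simp add: expvec_total)
    then show ?thesis
    proof (rule cspan_closure_induct)
      show "complex_vector.subspace {w. cinner (u \<otimes> w) z = 0}"
        by (auto simp: complex_vector.subspace_def tensor_add_right cinner_add_left tensor_scale_right
            bounded_bilinear.zero_right[OF bounded_bilinear_tensor])
      show "closed {w. cinner (u \<otimes> w) z = 0}" by (intro closed_Collect_eq continuous_intros)
    qed (use z in auto)
  qed
  then show "z = 0" by (intro htensor_cinner_eqI) simp
qed

lemma hF_cinner_eqI:
  fixes u v :: "('h::chilbert_space, 'k::complex_inner) hF"
  assumes "\<And>w f. f \<in> step_funs \<Longrightarrow> cinner (w \<otimes> \<varpi> f) u = cinner (w \<otimes> \<varpi> f) v" shows "u = v"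
  by (rule total_eqI[OF hF_total]) (use assms in auto)

lemma khF_cinner_eqI:
  fixes u v :: "('c::chilbert_space, ('h::chilbert_space, 'k::complex_inner) hF) htensor"
  assumes "\<And>c w f. f \<in> step_funs \<Longrightarrow> cinner (c \<otimes> (w \<otimes> \<varpi> f)) u = cinner (c \<otimes> (w \<otimes> \<varpi> f)) v" shows "u = v"
proof (rule htensor_cinner_eqI)
  fix c and y :: "('h, 'k) hF"
  have "y \<in> closure (cspan {u \<otimes> \<varpi> f |u f. f \<in> step_funs})" by (simp add: hF_total)
  then have "cinner (c \<otimes> y) (u - v) = 0"
  proof (rule cspan_closure_induct)
    show "complex_vector.subspace {y. cinner (c \<otimes> y) (u - v) = 0}"
      by (auto simp: complex_vector.subspace_def tensor_add_right cinner_add_left tensor_scale_right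
          bounded_bilinear.zero_right[OF bounded_bilinear_tensor])
    show "closed {y. cinner (c \<otimes> y) (u - v) = 0}" by (intro closed_Collect_eq continuous_intros)
  qed (use assms in \<open>auto simp: cinner_diff_right\<close>)
  then show "cinner (c \<otimes> y) u = cinner (c \<otimes> y) v" by (simp add: cinner_diff_right)
qed

section \<open>Linear operators on exponential domains\<close>

lemma clinear_on_sum:
  assumes "clinear_on V N" "complex_vector.subspace V" "\<And>i. i \<in> A \<Longrightarrow> x i \<in> V"
  shows "N (\<Sum>i\<in>A. c i *\<^sub>C x i) = (\<Sum>i\<in>A. c i *\<^sub>C N (x i))"
  using assms(3)
proof (induction A rule: infinite_finite_induct)
  case (insert i A)
  have "(\<Sum>i\<in>A. c i *\<^sub>C x i) \<in> V" "c i *\<^sub>C x i \<in> V"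
    using insert by (auto intro!: complex_vector.subspace_sum[OF assms(2)] complex_vector.subspace_scale[OF assms(2)])
  then show ?case using insert assms(1) by (simp add: clinear_on_def)
next
  case empty
  have "N (0 *\<^sub>C 0) = 0 *\<^sub>C N 0"
    using assms(1) complex_vector.subspace_0[OF assms(2)] unfolding clinear_on_def by blast
  then show ?case by (simp add: complex_vector.scale_zero_left)
next
  case (infinite A)
  have "N (0 *\<^sub>C 0) = 0 *\<^sub>C N 0"
    using assms(1) complex_vector.subspace_0[OF assms(2)] unfolding clinear_on_def by blast
  then show ?case using infinite by (simp add: complex_vector.scale_zero_left)
qed

text \<open>The counterpart of \<open>clinear_extension\<close> without a bound: on the algebraic
  span, well-definedness on finite combinations is enough. It makes the choices in
  \<open>nabla_hat\<close> and \<open>ampl\<close> non-vacuous.\<close>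

lemma clinear_on_span_ex:
  fixes e :: "'i \<Rightarrow> 'a::complex_vector" and f :: "'i \<Rightarrow> 'b::complex_vector"
  assumes wd: "\<And>A c. finite A \<Longrightarrow> A \<subseteq> I \<Longrightarrow> (\<Sum>i\<in>A. c i *\<^sub>C e i) = 0 \<Longrightarrow> (\<Sum>i\<in>A. c i *\<^sub>C f i) = 0"
  shows "\<exists>N. clinear_on (cspan (e ` I)) N \<and> (\<forall>i\<in>I. N (e i) = f i)"
proof -
  define G where "G = cspan ((\<lambda>i. (e i, f i)) ` I)"
  have subG: "complex_vector.subspace G" unfolding G_def by (rule complex_vector.subspace_span)
  have zero: "snd z = 0" if "z \<in> G" "fst z = 0" for z
  proof -
    from that(1) obtain A c where A: "finite A" "A \<subseteq> I" and z: "z = (\<Sum>i\<in>A. c i *\<^sub>C (e i, f i))"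
      unfolding G_def cspan_image_explicit by blast
    have "fst z = (\<Sum>i\<in>A. c i *\<^sub>C e i)" "snd z = (\<Sum>i\<in>A. c i *\<^sub>C f i)"
      unfolding z by (simp_all add: fst_sum snd_sum scaleC_prod_def)
    then show ?thesis using wd[OF A, of c] that(2) by simp
  qed
  define N where "N x = (SOME y. (x, y) \<in> G)" for x
  have NI: "N x = y" if "(x, y) \<in> G" for x y
    unfolding N_def
  proof (rule some_equality, rule that)
    fix y' assume "(x, y') \<in> G"
    from complex_vector.subspace_diff[OF subG this that] zero[of "(x, y') - (x, y)"] show "y' = y" by simp
  qed
  have ex: "\<exists>y. (x, y) \<in> G" if "x \<in> cspan (e ` I)" for x
  proof -
    from that obtain A c where A: "finite A" "A \<subseteq> I" and x: "x = (\<Sum>i\<in>A. c i *\<^sub>C e i)"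
      unfolding cspan_image_explicit by blast
    have "(\<Sum>i\<in>A. c i *\<^sub>C (e i, f i)) \<in> G"
      unfolding G_def cspan_image_explicit using A by blast
    moreover have "fst (\<Sum>i\<in>A. c i *\<^sub>C (e i, f i)) = x" unfolding x by (simp add: fst_sum scaleC_prod_def)
    ultimately show ?thesis by (metis prod.collapse)
  qed
  have NG: "(x, N x) \<in> G" if "x \<in> cspan (e ` I)" for x using ex[OF that] NI by metis
  have "clinear_on (cspan (e ` I)) N"
    unfolding clinear_on_def
  proof (intro conjI ballI allI)
    fix x y assume "x \<in> cspan (e ` I)" "y \<in> cspan (e ` I)"
    from complex_vector.subspace_add[OF subG NG[OF this(1)] NG[OF this(2)]]
    show "N (x + y) = N x + N y" by (intro NI) simp
  next
    fix c x assume "x \<in> cspan (e ` I)"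
    from complex_vector.subspace_scale[OF subG NG[OF this], of c]
    show "N (c *\<^sub>C x) = c *\<^sub>C N x" by (intro NI) (simp add: scaleC_prod_def)
  qed
  moreover have "N (e i) = f i" if "i \<in> I" for i
    by (rule NI) (use that in \<open>auto simp: G_def intro: complex_vector.span_base\<close>)
  ultimately show ?thesis by blast
qed

lemma exp_dom_eq: "(exp_dom :: ('h::complex_inner, 'k::complex_inner) hF set)
    = cspan ((\<lambda>p. fst p \<otimes> \<varpi> (snd p)) ` (UNIV \<times> step_funs))"
  unfolding exp_dom_def alg_tensor_def
proof (rule complex_vector.span_eq[THEN iffD2], intro conjI)
  show "{v \<otimes> w |(v::'h) (w::'k L2 fock). v \<in> UNIV \<and> w \<in> exp_space} \<subseteq> cspan ((\<lambda>p. fst p \<otimes> \<varpi> (snd p)) ` (UNIV \<times> step_funs))"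
  proof clarify
    fix v :: 'h and w :: "'k L2 fock" assume "w \<in> exp_space"
    then obtain A c where A: "finite A" "A \<subseteq> step_funs" "w = (\<Sum>f\<in>A. c f *\<^sub>C \<varpi> f)"
      unfolding exp_space_def cspan_image_explicit by blast
    have "v \<otimes> \<varpi> f \<in> cspan ((\<lambda>p. fst p \<otimes> \<varpi> (snd p)) ` (UNIV \<times> step_funs))" if "f \<in> A" for f
      by (rule complex_vector.span_base, rule image_eqI[of _ _ "(v, f)"]) (use A that in auto)
    then show "v \<otimes> w \<in> cspan ((\<lambda>p. fst p \<otimes> \<varpi> (snd p)) ` (UNIV \<times> step_funs))"
      unfolding A(3) by (simp add: sum_tensor_right tensor_scale_right complex_vector.span_sum complex_vector.span_scale)
  qed
  show "(\<lambda>p. fst p \<otimes> \<varpi> (snd p)) ` (UNIV \<times> step_funs) \<subseteq> cspan {v \<otimes> w |(v::'h) (w::'k L2 fock). v \<in> UNIV \<and> w \<in> exp_space}"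
  proof clarify
    fix v :: 'h and f :: "real \<Rightarrow> 'k" assume "f \<in> step_funs"
    then have "\<varpi> f \<in> exp_space" unfolding exp_space_def by (intro complex_vector.span_base imageI)
    then show "fst (v, f) \<otimes> \<varpi> (snd (v, f)) \<in> cspan {v \<otimes> w |(v::'h) (w::'k L2 fock). v \<in> UNIV \<and> w \<in> exp_space}"
      by (intro complex_vector.span_base) auto
  qed
qed

text \<open>The coefficients are absorbed into \<open>u\<close>. The first components of
  \<open>A\<close> are only labels, so that a step function may occur more than once.\<close>

lemma exp_domE:
  fixes \<zeta> :: "('h::chilbert_space, 'k::complex_inner) hF"
  assumes "\<zeta> \<in> exp_dom"
  obtains A :: "('h \<times> (real \<Rightarrow> 'k)) set" and u where "finite A" "\<And>p. p \<in> A \<Longrightarrow> snd p \<in> step_funs" "\<zeta> = (\<Sum>p\<in>A. u p \<otimes> \<varpi> (snd p))"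
proof -
  from assms obtain A c where A: "finite A" "A \<subseteq> UNIV \<times> step_funs" "\<zeta> = (\<Sum>p\<in>A. c p *\<^sub>C (fst p \<otimes> \<varpi> (snd p)))"
    unfolding exp_dom_eq cspan_image_explicit by blast
  show thesis
    by (rule that[of A "\<lambda>p. c p *\<^sub>C fst p"]) (use A in \<open>auto simp: tensor_scale_left\<close>)
qed

lemma exp_dom_subspace: "complex_vector.subspace exp_dom"
  unfolding exp_dom_eq by (rule complex_vector.subspace_span)

lemma tensor_expvec_in_exp_dom: "f \<in> step_funs \<Longrightarrow> u \<otimes> \<varpi> f \<in> exp_dom"
  unfolding exp_dom_eq by (rule complex_vector.span_base, rule image_eqI[of _ _ "(u, f)"]) auto

lemma exp_dom_dense: "closure exp_dom = (UNIV :: ('h::chilbert_space, 'k::complex_inner) hF set)"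
proof -
  have "{u \<otimes> \<varpi> f |(u::'h) (f::real \<Rightarrow> 'k). f \<in> step_funs} = (\<lambda>p. fst p \<otimes> \<varpi> (snd p)) ` (UNIV \<times> step_funs)" by force
  then show ?thesis unfolding exp_dom_eq using hF_total[where 'h = 'h and 'k = 'k] by argo
qed

section \<open>Well-definedness of the gradient and of ampliations\<close>

lemma cinner_step_indicator:
  fixes f :: "real \<Rightarrow> 'k::complex_inner"
  assumes f: "f \<in> step_funs" and a: "0 \<le> a" "a \<le> b"
  shows "cinner (abs_L2 f) (abs_L2 (\<lambda>s. indicator {a..<b} s *\<^sub>R x)) = integral {a..b} (\<lambda>s. cinner (f s) x)"
proof -
  let ?g = "\<lambda>s. cinner (f s) (indicator {a..<b} s *\<^sub>R x)"
  note sq = square_integrable_step[OF f] square_integrable_step[OF step_indicator[OF a(1)], of b x]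
  have "cinner (abs_L2 f) (abs_L2 (\<lambda>s. indicator {a..<b} s *\<^sub>R x)) = (\<integral>s. ?g s \<partial>lebesgue_on {0..})"
    by (rule cinner_abs_L2[OF sq])
  also have "\<dots> = integral {0..} ?g"
    by (rule lebesgue_integral_eq_integral[OF integrable_cinner[OF sq] half_line_lebesgue])
  also have "\<dots> = integral {0..} (\<lambda>s. if s \<in> {a..b} then cinner (f s) x else 0)"
    by (rule integral_spike[of "{b}"]) (auto simp: indicator_def)
  also have "\<dots> = integral {a..b} (\<lambda>s. cinner (f s) x)"
    unfolding Henstock_Kurzweil_Integration.integral_restrict_Int using a by (simp add: Int_absorb2)
  finally show ?thesis .
qed

lemma cinner_indicator_const:
  fixes f :: "real \<Rightarrow> 'k::complex_inner"
  assumes f: "f \<in> step_funs" and a: "0 \<le> a" "a \<le> b" and c: "\<And>s. a \<le> s \<Longrightarrow> s < b \<Longrightarrow> f s = d"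
  shows "cinner (abs_L2 f) (abs_L2 (\<lambda>s. indicator {a..<b} s *\<^sub>R x)) = of_real (b - a) * cinner d x"
    "cinner (abs_L2 (\<lambda>s. indicator {a..<b} s *\<^sub>R x)) (abs_L2 f) = of_real (b - a) * cinner x d"
proof -
  have "integral {a..b} (\<lambda>s. cinner (f s) x) = integral {a..b} (\<lambda>s. cinner d x)"
    by (rule integral_spike[of "{b}"]) (auto simp: c)
  also have "\<dots> = of_real (b - a) * cinner d x" using a by (simp add: scaleR_conv_of_real)
  finally show 1: "cinner (abs_L2 f) (abs_L2 (\<lambda>s. indicator {a..<b} s *\<^sub>R x)) = of_real (b - a) * cinner d x"
    unfolding cinner_step_indicator[OF f a] .
  have "cinner (abs_L2 (\<lambda>s. indicator {a..<b} s *\<^sub>R x)) (abs_L2 f)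
      = cnj (cinner (abs_L2 f) (abs_L2 (\<lambda>s. indicator {a..<b} s *\<^sub>R x)))" by (rule cinner_commute)
  then show "cinner (abs_L2 (\<lambda>s. indicator {a..<b} s *\<^sub>R x)) (abs_L2 f) = of_real (b - a) * cinner x d"
    unfolding 1 by (simp add: cinner_commute[of x d])
qed

lemma step_common_right_constant:
  assumes "finite A" "\<And>p. p \<in> A \<Longrightarrow> f p \<in> step_funs"
  shows "\<exists>r>0. \<forall>p\<in>A. \<forall>u. s \<le> u \<longrightarrow> u \<le> s + r \<longrightarrow> f p u = f p s"
  using assms
proof (induction A)
  case empty
  then show ?case by (intro exI[of _ 1]) auto
next
  case (insert p A)
  then obtain r where r: "r > 0" "\<forall>p\<in>A. \<forall>u. s \<le> u \<longrightarrow> u \<le> s + r \<longrightarrow> f p u = f p s" by blast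
  have "f p \<in> step_funs" by (rule insert.prems) simp
  from step_right_constant[OF this, of s]
  obtain q where q: "q > 0" "\<forall>u. s \<le> u \<longrightarrow> u \<le> s + q \<longrightarrow> f p u = f p s" by (elim exE conjE)
  show ?case
  proof (intro exI[of _ "min r q"] conjI ballI allI impI)
    fix p' u assume *: "p' \<in> insert p A" "s \<le> u" "u \<le> s + min r q"
    then have "u \<le> s + r" "u \<le> s + q" by simp_all
    then show "f p' u = f p' s" using * r(2) q(2) by blast
  qed (use r q in simp)
qed

lemma cinner_expvec_eps:
  "cinner (\<varpi> f) (\<varpi> g) = of_real (exp (- (norm (abs_L2 f))\<^sup>2 / 2)) * of_real (exp (- (norm (abs_L2 g))\<^sup>2 / 2)) * exp (cinner (abs_L2 f) (abs_L2 g))"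
  by (simp add: expvec_eps cinner_scaleR_left cinner_scaleR_right cinner_eps)

text \<open>Testing \<open>\<Sum> u\<^sub>p \<otimes> \<varpi>(f\<^sub>p) = 0\<close> against the creation vectors of \<open>c 1\<^bsub>[s,s+r)\<^esub>\<close> extracts the values \<open>f\<^sub>p(s)\<close>.\<close>

lemma nabla_well_defined:
  fixes u :: "_ \<Rightarrow> 'h::chilbert_space" and f :: "_ \<Rightarrow> real \<Rightarrow> 'k::chilbert_space"
  assumes A: "finite A" "\<And>p. p \<in> A \<Longrightarrow> f p \<in> step_funs" and s: "0 \<le> s"
    and z: "(\<Sum>p\<in>A. u p \<otimes> \<varpi> (f p)) = 0"
  shows "(\<Sum>p\<in>A. hat (f p s) \<otimes> (u p \<otimes> \<varpi> (f p))) = 0"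
proof (rule khF_cinner_eqI)
  fix c :: "complex \<times> 'k" and w :: 'h and h :: "real \<Rightarrow> 'k" assume h: "h \<in> step_funs"
  \<comment> \<open>One radius works for all finitely many \<open>f p\<close>, so testing against
    the indicator of \<open>[s, s + r)\<close> sees only their values at \<open>s\<close>.\<close>
  obtain r where r: "r > 0" "\<forall>p\<in>A. \<forall>u. s \<le> u \<longrightarrow> u \<le> s + r \<longrightarrow> f p u = f p s"
    using step_common_right_constant[OF A(1), of f s] A(2) by blast
  let ?x = "abs_L2 (\<lambda>u. indicator {s..<s+r} u *\<^sub>R snd c)"
  let ?k = "\<lambda>f. complex_of_real (exp (- (norm (abs_L2 f))\<^sup>2 / 2))"
  have "0 = cinner (w \<otimes> \<varpi> h) (\<Sum>p\<in>A. u p \<otimes> \<varpi> (f p))" by (simp add: z)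
  then have 1: "(\<Sum>p\<in>A. cinner w (u p) * cinner (\<varpi> h) (\<varpi> (f p))) = 0" by (simp add: cinner_sum_right)
  have x: "cinner ?x (abs_L2 (f p)) = of_real r * cinner (snd c) (f p s)" if p: "p \<in> A" for p
  proof -
    have "f p u = f p s" if "s \<le> u" "u < s + r" for u using r(2) p that by (meson less_imp_le)
    from cinner_indicator_const(2)[OF A(2)[OF p] s _ this, where x = "snd c"] r(1) show ?thesis by simp
  qed
  have "0 = cinner (w \<otimes> creation ?x (abs_L2 h)) (\<Sum>p\<in>A. u p \<otimes> \<varpi> (f p))" by (simp add: z)
  also have "\<dots> = (\<Sum>p\<in>A. cinner w (u p) * (?k (f p) * (of_real r * cinner (snd c) (f p s) * exp (cinner (abs_L2 h) (abs_L2 (f p))))))"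
    by (simp add: cinner_sum_right expvec_eps cinner_scaleR_right cinner_creation_eps x)
  finally have "0 = ?k h / of_real r * (\<Sum>p\<in>A. cinner w (u p) * (?k (f p) * (of_real r * cinner (snd c) (f p s) * exp (cinner (abs_L2 h) (abs_L2 (f p))))))"
    by simp
  also have "\<dots> = (\<Sum>p\<in>A. cinner (snd c) (f p s) * (cinner w (u p) * cinner (\<varpi> h) (\<varpi> (f p))))"
    unfolding sum_distrib_left using r(1) by (intro sum.cong) (simp_all add: cinner_expvec_eps)
  finally have 2: "(\<Sum>p\<in>A. cinner (snd c) (f p s) * (cinner w (u p) * cinner (\<varpi> h) (\<varpi> (f p)))) = 0" by simp
  have "cinner (c \<otimes> (w \<otimes> \<varpi> h)) (\<Sum>p\<in>A. hat (f p s) \<otimes> (u p \<otimes> \<varpi> (f p)))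
      = cnj (fst c) * (\<Sum>p\<in>A. cinner w (u p) * cinner (\<varpi> h) (\<varpi> (f p)))
        + (\<Sum>p\<in>A. cinner (snd c) (f p s) * (cinner w (u p) * cinner (\<varpi> h) (\<varpi> (f p))))"
    by (simp add: cinner_sum_right cinner_prod_def hat_def cinner_complex_def algebra_simps sum.distrib sum_distrib_left)
  then show "cinner (c \<otimes> (w \<otimes> \<varpi> h)) (\<Sum>p\<in>A. hat (f p s) \<otimes> (u p \<otimes> \<varpi> (f p))) = cinner (c \<otimes> (w \<otimes> \<varpi> h)) 0"
    using 1 2 by simp
qed

lemma nabla_hat:
  fixes u :: "'h::chilbert_space" and f :: "real \<Rightarrow> 'k::chilbert_space"
  assumes s: "0 \<le> s"
  shows nabla_hat_linear: "clinear_on exp_dom (nabla_hat s :: ('h, 'k) hF \<Rightarrow> _)"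
    and nabla_hat_tensor: "f \<in> step_funs \<Longrightarrow> nabla_hat s (u \<otimes> \<varpi> f) = hat (f s) \<otimes> (u \<otimes> \<varpi> f)"
proof -
  have "\<exists>N. clinear_on (cspan ((\<lambda>p. fst p \<otimes> \<varpi> (snd p)) ` (UNIV \<times> step_funs))) N \<and>
     (\<forall>p\<in>UNIV \<times> step_funs. N (fst p \<otimes> \<varpi> (snd p)) = (hat (snd p s) \<otimes> (fst p \<otimes> \<varpi> (snd p)) :: ('h, 'k) khF))"
  proof (rule clinear_on_span_ex)
    fix A :: "('h \<times> (real \<Rightarrow> 'k)) set" and c
    assume A: "finite A" "A \<subseteq> UNIV \<times> step_funs" "(\<Sum>p\<in>A. c p *\<^sub>C (fst p \<otimes> \<varpi> (snd p))) = 0"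
    have "(\<Sum>p\<in>A. hat (snd p s) \<otimes> ((c p *\<^sub>C fst p) \<otimes> \<varpi> (snd p))) = 0"
      by (rule nabla_well_defined[OF A(1) _ s]) (use A in \<open>auto simp: tensor_scale_left\<close>)
    then show "(\<Sum>p\<in>A. c p *\<^sub>C (hat (snd p s) \<otimes> (fst p \<otimes> \<varpi> (snd p)))) = 0"
      by (simp add: tensor_scale_left tensor_scale_right)
  qed
  then have "\<exists>N. clinear_on exp_dom N \<and> (\<forall>u. \<forall>f\<in>step_funs. N (u \<otimes> \<varpi> f) = (hat (f s) \<otimes> (u \<otimes> \<varpi> f) :: ('h, 'k) khF))"
    unfolding exp_dom_eq by fastforce
  from someI_ex[OF this] show "clinear_on exp_dom (nabla_hat s :: ('h, 'k) hF \<Rightarrow> _)"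
    "f \<in> step_funs \<Longrightarrow> nabla_hat s (u \<otimes> \<varpi> f) = hat (f s) \<otimes> (u \<otimes> \<varpi> f)"
    unfolding nabla_hat_def by blast+
qed

lemma Collect_pair_image: "{g v w |v w. v \<in> UNIV \<and> w \<in> D} = (\<lambda>p. g (fst p) (snd p)) ` (UNIV \<times> D)"
  by force

text \<open>For unbounded \<open>X\<close> only well-definedness is at stake. Over an orthonormal
  set a vanishing tensor has vanishing coefficients \<open>Y e\<close>; these are finite
  combinations of vectors of the domain, so \<open>X\<close> may be applied to them.\<close>

lemma ampl:
  fixes X :: "('h::chilbert_space, 'k::chilbert_space) hF \<Rightarrow> ('h, 'k) hF"
  assumes X: "clinear_on exp_dom X"
  shows ampl_linear: "clinear_on (UNIV \<otimes>\<^sub>a exp_dom) (ampl X)"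
    and ampl_tensor: "\<zeta> \<in> exp_dom \<Longrightarrow> ampl X (c \<otimes> \<zeta>) = c \<otimes> X \<zeta>"
proof -
  have im: "{v \<otimes> w |(v::complex \<times> 'k) (w::('h, 'k) hF). v \<in> UNIV \<and> w \<in> exp_dom}
      = (\<lambda>p. fst p \<otimes> snd p) ` (UNIV \<times> exp_dom)"
    by (rule Collect_pair_image)
  have "\<exists>N. clinear_on (cspan ((\<lambda>p. fst p \<otimes> snd p) ` (UNIV \<times> exp_dom))) N \<and>
     (\<forall>p\<in>UNIV \<times> exp_dom. N (fst p \<otimes> snd p) = (fst p \<otimes> X (snd p) :: ('h, 'k) khF))"
  proof (rule clinear_on_span_ex)
    fix A :: "((complex \<times> 'k) \<times> ('h, 'k) hF) set" and c
    assume A: "finite A" "A \<subseteq> UNIV \<times> exp_dom" "(\<Sum>p\<in>A. c p *\<^sub>C (fst p \<otimes> snd p)) = 0"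
    obtain E where E: "finite E" "orthonormal E"
      and ex: "\<And>p. p \<in> A \<Longrightarrow> c p *\<^sub>C fst p = (\<Sum>e\<in>E. cinner e (c p *\<^sub>C fst p) *\<^sub>C e)"
      using orthonormal_expansion[OF A(1), of "\<lambda>p. c p *\<^sub>C fst p"] by blast
    define Y where "Y e = (\<Sum>p\<in>A. cinner e (c p *\<^sub>C fst p) *\<^sub>C snd p)" for e
    have "(\<Sum>e\<in>E. e \<otimes> Y e) = 0"
      unfolding Y_def using A(3) by (subst tensor_expand_left[OF ex, symmetric]) (auto simp: tensor_scale_left)
    then have "(\<Sum>e\<in>E. (norm (Y e))\<^sup>2) = 0" by (simp flip: norm_sum_tensor_left[OF E])
    then have Y0: "Y e = 0" if "e \<in> E" for e using E(1) that by (simp add: sum_nonneg_eq_0_iff)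
    have XY: "X (Y e) = (\<Sum>p\<in>A. cinner e (c p *\<^sub>C fst p) *\<^sub>C X (snd p))" for e
      unfolding Y_def by (rule clinear_on_sum[OF X exp_dom_subspace]) (use A in auto)
    have X0: "X 0 = 0" using clinear_on_sum[OF X exp_dom_subspace, of "{}"] by simp
    have "(\<Sum>p\<in>A. (c p *\<^sub>C fst p) \<otimes> X (snd p)) = (\<Sum>e\<in>E. e \<otimes> X (Y e))"
      unfolding XY by (rule tensor_expand_left[OF ex])
    also have "\<dots> = 0" by (rule sum.neutral) (simp add: Y0 X0 bounded_bilinear.zero_right[OF bounded_bilinear_tensor])
    finally show "(\<Sum>p\<in>A. c p *\<^sub>C (fst p \<otimes> X (snd p))) = 0" by (simp add: tensor_scale_left)
  qed
  then obtain N where N: "clinear_on (cspan ((\<lambda>p. fst p \<otimes> snd p) ` (UNIV \<times> exp_dom))) N"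
     "\<forall>p\<in>UNIV \<times> exp_dom. N (fst p \<otimes> snd p) = (fst p \<otimes> X (snd p) :: ('h, 'k) khF)" by blast
  have "N (c \<otimes> \<zeta>) = c \<otimes> X \<zeta>" if "\<zeta> \<in> exp_dom" for c \<zeta>
    using N(2)[rule_format, of "(c, \<zeta>)"] that by simp
  with N(1) have "\<exists>N. clinear_on (UNIV \<otimes>\<^sub>a exp_dom) N \<and> (\<forall>c. \<forall>\<zeta>\<in>exp_dom. N (c \<otimes> \<zeta>) = (c \<otimes> X \<zeta> :: ('h, 'k) khF))"
    unfolding alg_tensor_def im by blast
  from someI_ex[OF this] show "clinear_on (UNIV \<otimes>\<^sub>a exp_dom) (ampl X)" "\<zeta> \<in> exp_dom \<Longrightarrow> ampl X (c \<otimes> \<zeta>) = c \<otimes> X \<zeta>"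
    unfolding ampl_def by blast+
qed

section \<open>The ultraweak topology\<close>

definition sqsum :: "(nat \<Rightarrow> 'a::real_normed_vector) \<Rightarrow> bool" where
  "sqsum u \<longleftrightarrow> summable (\<lambda>n. (norm (u n))\<^sup>2)"

definition uwfun :: "(nat \<Rightarrow> 'a::complex_inner) \<Rightarrow> (nat \<Rightarrow> 'a) \<Rightarrow> ('a \<Rightarrow>\<^sub>L 'a) \<Rightarrow> complex" where
  "uwfun u v T = suminf (\<lambda>n. cinner (u n) (blinfun_apply T (v n)))"

lemma ultraweak_uwfun:
  "ultraweak = topology_generated_by {{T. uwfun u v T \<in> U} | u v U. sqsum u \<and> sqsum v \<and> open U}"
  unfolding ultraweak_def uwfun_def sqsum_def ..

lemma mult_le_sum_squares: "a * b \<le> a\<^sup>2 + (b::real)\<^sup>2"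
proof -
  have "0 \<le> (a - b)\<^sup>2" by simp
  then have "2 * (a * b) \<le> a\<^sup>2 + b\<^sup>2" by (simp add: power2_diff)
  moreover have "0 \<le> a\<^sup>2 + b\<^sup>2" by simp
  ultimately show ?thesis by linarith
qed

lemma summable_norm_cinner:
  fixes u v :: "nat \<Rightarrow> 'a::complex_inner"
  assumes "sqsum u" "sqsum v" shows "summable (\<lambda>n. norm (cinner (u n) (v n)))"
proof (rule summable_comparison_test')
  show "summable (\<lambda>n. (norm (u n))\<^sup>2 + (norm (v n))\<^sup>2)"
    using assms unfolding sqsum_def by (rule summable_add)
  show "norm (norm (cinner (u n) (v n))) \<le> (norm (u n))\<^sup>2 + (norm (v n))\<^sup>2" if "n \<ge> 0" for n
    using cmod_cinner_le[of "u n" "v n"] mult_le_sum_squares[of "norm (u n)" "norm (v n)"] by simp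
qed

lemma sqsum_apply:
  assumes "sqsum v" shows "sqsum (\<lambda>n. blinfun_apply T (v n))"
  unfolding sqsum_def
proof (rule summable_comparison_test')
  show "summable (\<lambda>n. (norm T)\<^sup>2 * (norm (v n))\<^sup>2)" using assms unfolding sqsum_def by (rule summable_mult)
  show "norm ((norm (blinfun_apply T (v n)))\<^sup>2) \<le> (norm T)\<^sup>2 * (norm (v n))\<^sup>2" if "n \<ge> 0" for n
    using power_mono[OF norm_blinfun[of T "v n"] norm_ge_zero, of 2] by (simp add: power_mult_distrib)
qed

lemma summable_uwfun:
  assumes "sqsum u" "sqsum v" shows "summable (\<lambda>n. cinner (u n) (blinfun_apply T (v n)))"
  by (rule summable_norm_cancel[OF summable_norm_cinner[OF assms(1) sqsum_apply[OF assms(2)]]])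

lemma openin_uwfun: "sqsum u \<Longrightarrow> sqsum v \<Longrightarrow> open U \<Longrightarrow> openin ultraweak {T. uwfun u v T \<in> U}"
  unfolding ultraweak_uwfun openin_topology_generated_by_iff by (rule generate_topology_on.Basis) blast

lemma sqsum_zero: "sqsum (\<lambda>_. 0)" by (simp add: sqsum_def)

lemma topspace_ultraweak [simp]: "topspace ultraweak = UNIV"
proof -
  have "openin ultraweak {T. uwfun (\<lambda>_. 0) (\<lambda>_. 0) T \<in> UNIV}" by (intro openin_uwfun sqsum_zero open_UNIV)
  then show ?thesis using openin_subset by fastforce
qed

text \<open>Induction over the generation of the topology: intersections merge the finite sets of
  functionals and take the smaller radius, unions keep those of one member.\<close>

lemma ultraweak_neighbourhood:
  assumes "openin ultraweak W" "T0 \<in> W"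
  shows "\<exists>P e. finite P \<and> e > 0 \<and> (\<forall>(u, v)\<in>P. sqsum u \<and> sqsum v) \<and>
    (\<forall>T. (\<forall>(u, v)\<in>P. norm (uwfun u v T - uwfun u v T0) < e) \<longrightarrow> T \<in> W)"
proof -
  have "generate_topology_on {{T. uwfun u v T \<in> U} | u v U. sqsum u \<and> sqsum v \<and> open U} W"
    using assms(1) unfolding ultraweak_uwfun openin_topology_generated_by_iff .
  then show ?thesis using assms(2)
  proof (induction)
    case Empty
    then show ?case by simp
  next
    case (Int a b)
    from Int obtain P e where 1: "finite P" "e > 0" "\<forall>(u, v)\<in>P. sqsum u \<and> sqsum v"
      "\<And>T. (\<forall>(u, v)\<in>P. norm (uwfun u v T - uwfun u v T0) < e) \<Longrightarrow> T \<in> a" by auto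
    from Int obtain Q d where 2: "finite Q" "d > 0" "\<forall>(u, v)\<in>Q. sqsum u \<and> sqsum v"
      "\<And>T. (\<forall>(u, v)\<in>Q. norm (uwfun u v T - uwfun u v T0) < d) \<Longrightarrow> T \<in> b" by auto
    show ?case
    proof (intro exI[of _ "P \<union> Q"] exI[of _ "min e d"] conjI allI impI)
      fix T assume "\<forall>(u, v)\<in>P \<union> Q. norm (uwfun u v T - uwfun u v T0) < min e d"
      then have "\<forall>(u, v)\<in>P. norm (uwfun u v T - uwfun u v T0) < e"
        "\<forall>(u, v)\<in>Q. norm (uwfun u v T - uwfun u v T0) < d" by auto
      then show "T \<in> a \<inter> b" using 1(4) 2(4) by blast
    qed (use 1 2 in auto)
  next
    case (UN K)
    then obtain k where k: "k \<in> K" "T0 \<in> k" by blast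
    from UN.IH[OF k] obtain P e where 1: "finite P" "e > 0" "\<forall>(u, v)\<in>P. sqsum u \<and> sqsum v"
      "\<And>T. (\<forall>(u, v)\<in>P. norm (uwfun u v T - uwfun u v T0) < e) \<Longrightarrow> T \<in> k" by auto
    show ?case
    proof (intro exI[of _ P] exI[of _ e] conjI allI impI)
      fix T assume "\<forall>(u, v)\<in>P. norm (uwfun u v T - uwfun u v T0) < e"
      then show "T \<in> \<Union>K" using 1(4) k(1) by blast
    qed (use 1 in auto)
  next
    case (Basis s)
    then obtain u v U where s: "s = {T. uwfun u v T \<in> U}" "sqsum u" "sqsum v" "open U" by blast
    then obtain e where "e > 0" "ball (uwfun u v T0) e \<subseteq> U" using Basis open_contains_ball by blast
    then show ?case using s
      by (intro exI[of _ "{(u, v)}"] exI[of _ e]) (auto simp: dist_norm norm_minus_commute subset_eq)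
  qed
qed

text \<open>Two matrix elements are packed into one functional supported at the indices 0 and 1. A
  relation such as homogeneity or commutation, moved to one side, is the vanishing of such a
  functional and so passes to ultraweak closures.\<close>

lemma uwfun_pair:
  obtains u v where "sqsum u" "sqsum v"
    "\<And>T. uwfun u v T = cinner x (blinfun_apply T y) + cinner x' (blinfun_apply T y')"
proof -
  define u v where "u n = (if n = 0 then x else if n = 1 then x' else 0)"
    and "v n = (if n = 0 then y else if n = 1 then y' else 0)" for n :: nat
  have sq: "sqsum u" "sqsum v"
    unfolding sqsum_def by (rule summable_finite[of "{0, 1}"]; simp add: u_def v_def)+
  have "uwfun u v T = (\<Sum>n\<in>{0, 1}. cinner (u n) (blinfun_apply T (v n)))" for T
    unfolding uwfun_def by (rule suminf_finite) (auto simp: u_def)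
  then show thesis using sq by (intro that[of u v]) (simp_all add: u_def v_def)
qed

lemma continuous_map_uwfun:
  assumes "sqsum u" "sqsum v" shows "continuous_map ultraweak euclidean (uwfun u v)"
  unfolding continuous_map_def using openin_uwfun[OF assms] by simp

lemma continuous_map_cinner_ultraweak:
  "continuous_map ultraweak euclidean (\<lambda>T. cinner x (blinfun_apply T y))"
proof -
  obtain u v where "sqsum u" "sqsum v" "\<And>T. uwfun u v T = cinner x (blinfun_apply T y) + cinner 0 (blinfun_apply T 0)"
    by (rule uwfun_pair[of x y 0 0]) blast
  then have "uwfun u v = (\<lambda>T. cinner x (blinfun_apply T y))" by (simp add: fun_eq_iff)
  then show ?thesis using continuous_map_uwfun[OF \<open>sqsum u\<close> \<open>sqsum v\<close>] by simp
qed

lemma ultraweak_closure_eq: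
  assumes T: "T \<in> ultraweak closure_of S"
    and eq: "\<And>T. T \<in> S \<Longrightarrow> cinner x (blinfun_apply T y) + cinner x' (blinfun_apply T y') = 0"
  shows "cinner x (blinfun_apply T y) + cinner x' (blinfun_apply T y') = 0"
proof -
  obtain u v where uv: "sqsum u" "sqsum v"
    "\<And>T. uwfun u v T = cinner x (blinfun_apply T y) + cinner x' (blinfun_apply T y')"
    by (rule uwfun_pair[of x y x' y']) blast
  have "uwfun u v T = 0"
    using forall_in_closure_of_eq[OF T Hausdorff_space_euclidean continuous_map_uwfun[OF uv(1,2)], of "\<lambda>_. 0"] uv(3) eq
    by simp
  then show ?thesis using uv by simp
qed

lemma ultraweak_closure_bops:
  assumes "T \<in> ultraweak closure_of S" "S \<subseteq> bops"
  shows "T \<in> (bops :: ('a::complex_inner \<Rightarrow>\<^sub>L 'a) set)"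
  unfolding bops_def
proof (intro CollectI allI)
  fix c and x :: 'a
  show "blinfun_apply T (c *\<^sub>C x) = c *\<^sub>C blinfun_apply T x"
  proof (rule cinner_eqI)
    fix z :: 'a
    have "cinner z (blinfun_apply T (c *\<^sub>C x)) + cinner (- (cnj c *\<^sub>C z)) (blinfun_apply T x) = 0"
      by (rule ultraweak_closure_eq[OF assms(1)]) (use assms(2) in \<open>auto simp: bops_scaleC\<close>)
    then show "cinner z (blinfun_apply T (c *\<^sub>C x)) = cinner z (c *\<^sub>C blinfun_apply T x)" by simp
  qed
qed

section \<open>Von Neumann algebras\<close>

lemma vn_bops: "von_neumann_algebra A \<Longrightarrow> a \<in> A \<Longrightarrow> a \<in> bops"
  by (auto simp: von_neumann_algebra_def)

lemma vn_adj: "von_neumann_algebra A \<Longrightarrow> a \<in> A \<Longrightarrow> adj a \<in> A"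
  by (auto simp: von_neumann_algebra_def)

lemma vnI:
  assumes "von_neumann_algebra A" "T \<in> bops"
    and "\<And>S x. S \<in> commutant A \<Longrightarrow> S \<in> bops \<Longrightarrow> blinfun_apply T (blinfun_apply S x) = blinfun_apply S (blinfun_apply T x)"
  shows "T \<in> A"
proof -
  have "T \<in> commutant (commutant A)"
    unfolding commutant_def[of "commutant A"]
    using assms(2,3) by (auto intro!: blinfun_eqI simp: commutant_def)
  then show ?thesis using assms(1) by (simp add: von_neumann_algebra_def)
qed

lemma vnD:
  assumes "a \<in> A" "S \<in> commutant A"
  shows "blinfun_apply a (blinfun_apply S x) = blinfun_apply S (blinfun_apply a x)"
proof -
  have "S o\<^sub>L a = a o\<^sub>L S" using assms by (simp add: commutant_def)
  from arg_cong[OF this, of "\<lambda>T. blinfun_apply T x"] show ?thesis by simp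
qed

lemma vn_id: "von_neumann_algebra A \<Longrightarrow> id_blinfun \<in> A"
  by (rule vnI) simp_all

lemma vn_compose:
  assumes "von_neumann_algebra A" "a \<in> A" "b \<in> A" shows "a o\<^sub>L b \<in> A"
  by (rule vnI) (use assms in \<open>auto simp: vn_bops vnD\<close>)

lemma vn_subspace:
  assumes "von_neumann_algebra A" shows "complex_vector.subspace A"
proof (rule complex_vector.subspaceI)
  show "0 \<in> A" by (rule vnI[OF assms]) simp_all
  show "a + b \<in> A" if "a \<in> A" "b \<in> A" for a b
    by (rule vnI[OF assms]) (use that assms in \<open>auto simp: vn_bops vnD blinfun.add_left blinfun.add_right\<close>)
  show "c *\<^sub>C a \<in> A" if "a \<in> A" for c a
    by (rule vnI[OF assms]) (use that assms in \<open>auto simp: vn_bops vnD scaleC_blinfun.rep_eq bops_scaleC\<close>)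
qed

lemma adj_compose:
  fixes S :: "'b::chilbert_space \<Rightarrow>\<^sub>L 'c::complex_inner" and T :: "'a::chilbert_space \<Rightarrow>\<^sub>L 'b"
  assumes "S \<in> bops" "T \<in> bops" shows "adj (S o\<^sub>L T) = adj T o\<^sub>L adj S"
  by (rule adj_eqI) (use assms in \<open>auto simp: cinner_adj_right\<close>)

lemma commutant_adj:
  assumes A: "von_neumann_algebra A" and S: "S \<in> commutant A" shows "adj S \<in> commutant A"
proof -
  have Sb: "S \<in> bops" using S by (simp add: commutant_def)
  have "adj S o\<^sub>L a = a o\<^sub>L adj S" if "a \<in> A" for a
  proof -
    have b: "adj a \<in> A" "a \<in> bops" "adj a \<in> bops" using that A vn_adj vn_bops by blast+
    then have "S o\<^sub>L adj a = adj a o\<^sub>L S" using S by (simp add: commutant_def)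
    then have "adj (S o\<^sub>L adj a) = adj (adj a o\<^sub>L S)" by simp
    then show ?thesis using b Sb by (simp add: adj_compose adj_adj)
  qed
  then show ?thesis using Sb by (simp add: commutant_def adj_bops)
qed

section \<open>Normal representations are dominated by amplifications\<close>

text \<open>The Hilbert space \<open>\<ell>\<^sup>2\<close> is realised as the Fock space over \<open>\<complex>\<close>, with orthonormal basis \<open>\<delta> n\<close>.\<close>

definition \<delta> :: "nat \<Rightarrow> complex fock" where "\<delta> n = sympow 1 n"

lemma cinner_delta [simp]: "cinner (\<delta> m) (\<delta> n) = (if m = n then 1 else 0)"
  by (simp add: \<delta>_def cinner_complex_def)

lemma l2_cinner_eqI:
  fixes X Z :: "('h::chilbert_space, complex fock) htensor"
  assumes "\<And>w n. cinner (w \<otimes> \<delta> n) X = cinner (w \<otimes> \<delta> n) Z" shows "X = Z"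
proof (rule htensor_cinner_eqI)
  fix x :: 'h and y :: "complex fock"
  have "y \<in> closure (cspan {sympow f n |f n. True})" unfolding sympow_total by simp
  then have "cinner (x \<otimes> y) (X - Z) = 0"
  proof (rule cspan_closure_induct)
    show "complex_vector.subspace {y. cinner (x \<otimes> y) (X - Z) = 0}"
      by (auto simp: complex_vector.subspace_def tensor_add_right cinner_add_left tensor_scale_right
          bounded_bilinear.zero_right[OF bounded_bilinear_tensor])
    show "closed {y. cinner (x \<otimes> y) (X - Z) = 0}" by (intro closed_Collect_eq continuous_intros)
    fix s :: "complex fock" assume "s \<in> {sympow f n |f n. True}"
    then obtain f n where "s = sympow (f *\<^sub>C 1) n" by (auto simp: scaleC_complex_def)
    then have "s = f ^ n *\<^sub>C \<delta> n" by (simp add: sympow_scale \<delta>_def)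
    then show "cinner (x \<otimes> s) (X - Z) = 0" using assms[of x n] by (simp add: tensor_scale_right cinner_diff_right)
  qed
  then show "cinner (x \<otimes> y) X = cinner (x \<otimes> y) Z" by (simp add: cinner_diff_right)
qed

lemma norm_sum_delta:
  assumes "finite F" shows "(norm (\<Sum>n\<in>F. x n \<otimes> \<delta> n))\<^sup>2 = (\<Sum>n\<in>F. (norm (x n))\<^sup>2)"
proof -
  have "cinner (\<Sum>n\<in>F. x n \<otimes> \<delta> n) (\<Sum>n\<in>F. x n \<otimes> \<delta> n) = (\<Sum>n\<in>F. \<Sum>m\<in>F. if n = m then cinner (x n) (x n) else 0)"
    unfolding cinner_sum_left cinner_sum_right by (intro sum.cong refl) simp
  also have "\<dots> = (\<Sum>n\<in>F. cinner (x n) (x n))" using assms by simp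
  finally show ?thesis by (simp add: norm_power2_cinner)
qed

lemma l2_series:
  fixes x :: "nat \<Rightarrow> 'h::chilbert_space"
  assumes "sqsum x"
  shows "summable (\<lambda>n. x n \<otimes> \<delta> n)" "(norm (suminf (\<lambda>n. x n \<otimes> \<delta> n)))\<^sup>2 = suminf (\<lambda>n. (norm (x n))\<^sup>2)"
proof -
  have sm: "summable (\<lambda>n. (norm (x n))\<^sup>2)" using assms by (simp add: sqsum_def)
  show *: "summable (\<lambda>n. x n \<otimes> \<delta> n)"
    unfolding summable_Cauchy
  proof (intro allI impI)
    fix e :: real assume "e > 0"
    then have "e\<^sup>2 > 0" by simp
    with sm obtain N where N: "\<And>m n. m \<ge> N \<Longrightarrow> norm (\<Sum>n\<in>{m..<n}. (norm (x n))\<^sup>2) < e\<^sup>2"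
      unfolding summable_Cauchy by blast
    have "norm (\<Sum>n\<in>{m..<n}. x n \<otimes> \<delta> n) < e" if "m \<ge> N" for m n
    proof -
      have "(norm (\<Sum>n\<in>{m..<n}. x n \<otimes> \<delta> n))\<^sup>2 < e\<^sup>2"
        using N[OF that, of n] by (simp add: norm_sum_delta sum_nonneg)
      then show ?thesis by (rule power2_less_imp_less) (use \<open>e > 0\<close> in simp)
    qed
    then show "\<exists>N. \<forall>m\<ge>N. \<forall>n. norm (\<Sum>n\<in>{m..<n}. x n \<otimes> \<delta> n) < e" by blast
  qed
  have "(\<lambda>N. (norm (\<Sum>n<N. x n \<otimes> \<delta> n))\<^sup>2) \<longlonglongrightarrow> (norm (suminf (\<lambda>n. x n \<otimes> \<delta> n)))\<^sup>2"
    by (intro tendsto_power tendsto_norm summable_LIMSEQ *)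
  moreover have "(\<lambda>N. (norm (\<Sum>n<N. x n \<otimes> \<delta> n))\<^sup>2) \<longlonglongrightarrow> suminf (\<lambda>n. (norm (x n))\<^sup>2)"
    by (simp add: norm_sum_delta) (intro summable_LIMSEQ sm)
  ultimately show "(norm (suminf (\<lambda>n. x n \<otimes> \<delta> n)))\<^sup>2 = suminf (\<lambda>n. (norm (x n))\<^sup>2)" by (rule LIMSEQ_unique)
qed

lemma sums_interleave:
  fixes g h :: "nat \<Rightarrow> real"
  assumes "g sums a" "h sums b"
  shows "(\<lambda>n. if even n then g (n div 2) else h (n div 2)) sums (a + b)"
proof -
  have "(\<lambda>n. if even n then g (n div 2) else h ((n - 1) div 2)) sums (b + a)"
    using sums_if[OF assms(2,1)] .
  moreover have "(\<lambda>n. if even n then g (n div 2) else h ((n - 1) div 2)) = (\<lambda>n. if even n then g (n div 2) else h (n div 2))"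
    by (auto simp: fun_eq_iff elim!: oddE)
  ultimately show ?thesis by (simp add: add.commute)
qed

text \<open>Using the even and the odd places joins two square-summable sequences into one. Thus the
  finitely many functionals of a neighbourhood are controlled by a single vector of the
  l2-amplification.\<close>

lemma sqsum_merge:
  fixes P :: "((nat \<Rightarrow> 'h::complex_inner) \<times> (nat \<Rightarrow> 'h)) set"
  assumes "finite P" "\<forall>(u, v)\<in>P. sqsum u \<and> sqsum v"
  shows "\<exists>\<xi>. sqsum \<xi> \<and> (\<forall>a::'h \<Rightarrow>\<^sub>L 'h. suminf (\<lambda>n. (norm (blinfun_apply a (\<xi> n)))\<^sup>2)
    = (\<Sum>(u, v)\<in>P. suminf (\<lambda>n. (norm (blinfun_apply a (u n)))\<^sup>2) + suminf (\<lambda>n. (norm (blinfun_apply a (v n)))\<^sup>2)))"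
  using assms
proof (induction P)
  case empty
  show ?case by (intro exI[of _ "\<lambda>_. 0"]) (simp add: sqsum_zero)
next
  case (insert p P)
  have mrg: "\<exists>\<zeta>. sqsum \<zeta> \<and> (\<forall>a::'h \<Rightarrow>\<^sub>L 'h. suminf (\<lambda>n. (norm (blinfun_apply a (\<zeta> n)))\<^sup>2)
     = suminf (\<lambda>n. (norm (blinfun_apply a (x n)))\<^sup>2) + suminf (\<lambda>n. (norm (blinfun_apply a (y n)))\<^sup>2))"
    if xy: "sqsum x" "sqsum y" for x y :: "nat \<Rightarrow> 'h"
  proof -
    define \<zeta> where "\<zeta> n = (if even n then x (n div 2) else y (n div 2))" for n
    have sums: "(\<lambda>n. (norm (blinfun_apply a (\<zeta> n)))\<^sup>2) sums
       (suminf (\<lambda>n. (norm (blinfun_apply a (x n)))\<^sup>2) + suminf (\<lambda>n. (norm (blinfun_apply a (y n)))\<^sup>2))" for a :: "'h \<Rightarrow>\<^sub>L 'h"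
    proof -
      have "(\<lambda>n. (norm (blinfun_apply a (\<zeta> n)))\<^sup>2) =
        (\<lambda>n. if even n then (norm (blinfun_apply a (x (n div 2))))\<^sup>2 else (norm (blinfun_apply a (y (n div 2))))\<^sup>2)"
        by (auto simp: \<zeta>_def fun_eq_iff)
      moreover have "(\<lambda>n. (norm (blinfun_apply a (x n)))\<^sup>2) sums suminf (\<lambda>n. (norm (blinfun_apply a (x n)))\<^sup>2)"
        "(\<lambda>n. (norm (blinfun_apply a (y n)))\<^sup>2) sums suminf (\<lambda>n. (norm (blinfun_apply a (y n)))\<^sup>2)"
        using sqsum_apply[OF xy(1), of a] sqsum_apply[OF xy(2), of a] unfolding sqsum_def by (auto intro: summable_sums)
      ultimately show ?thesis using sums_interleave by simp
    qed
    have "sqsum \<zeta>" using sums_summable[OF sums[of id_blinfun]] by (simp add: sqsum_def)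
    then show ?thesis using sums_unique[OF sums] by (intro exI[of _ \<zeta>]) simp
  qed
  obtain u v where p: "p = (u, v)" by (cases p)
  from insert obtain \<xi> where \<xi>: "sqsum \<xi>" "\<And>a::'h \<Rightarrow>\<^sub>L 'h. suminf (\<lambda>n. (norm (blinfun_apply a (\<xi> n)))\<^sup>2)
    = (\<Sum>(u, v)\<in>P. suminf (\<lambda>n. (norm (blinfun_apply a (u n)))\<^sup>2) + suminf (\<lambda>n. (norm (blinfun_apply a (v n)))\<^sup>2))" by auto
  have "sqsum u" "sqsum v" using insert.prems p by auto
  from mrg[OF this] obtain \<zeta> where \<zeta>: "sqsum \<zeta>" "\<And>a::'h \<Rightarrow>\<^sub>L 'h. suminf (\<lambda>n. (norm (blinfun_apply a (\<zeta> n)))\<^sup>2)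
     = suminf (\<lambda>n. (norm (blinfun_apply a (u n)))\<^sup>2) + suminf (\<lambda>n. (norm (blinfun_apply a (v n)))\<^sup>2)" by blast
  from mrg[OF \<zeta>(1) \<xi>(1)] obtain \<omega> where "sqsum \<omega>" "\<And>a::'h \<Rightarrow>\<^sub>L 'h. suminf (\<lambda>n. (norm (blinfun_apply a (\<omega> n)))\<^sup>2)
     = suminf (\<lambda>n. (norm (blinfun_apply a (\<zeta> n)))\<^sup>2) + suminf (\<lambda>n. (norm (blinfun_apply a (\<xi> n)))\<^sup>2)" by blast
  then show ?case using insert.hyps \<xi>(2) \<zeta>(2) p by (intro exI[of _ \<omega>]) simp
qed

locale normal_rep =
  fixes A :: "('h::chilbert_space \<Rightarrow>\<^sub>L 'h) set" and j :: "('h \<Rightarrow>\<^sub>L 'h) \<Rightarrow> ('b::chilbert_space \<Rightarrow>\<^sub>L 'b)"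
  assumes vn: "von_neumann_algebra A"
    and j_bops: "a \<in> A \<Longrightarrow> j a \<in> bops"
    and j_linear: "clinear_on A j"
    and j_normal: "normal_on A j"
    and j_mult: "a \<in> A \<Longrightarrow> b \<in> A \<Longrightarrow> j (a o\<^sub>L b) = j a o\<^sub>L j b"
    and j_adj: "a \<in> A \<Longrightarrow> j (adj a) = adj (j a)"
    and j_id: "j id_blinfun = id_blinfun"
begin

lemma j_add: "a \<in> A \<Longrightarrow> b \<in> A \<Longrightarrow> j (a + b) = j a + j b"
  using j_linear by (simp add: clinear_on_def)

lemma j_scale: "a \<in> A \<Longrightarrow> j (c *\<^sub>C a) = c *\<^sub>C j a"
  using j_linear by (simp add: clinear_on_def)

lemma j_zero: "j 0 = 0"
  using j_scale[OF vn_id[OF vn], of 0] by (simp add: complex_vector.scale_zero_left)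

lemma continuous_map_j: "continuous_map (subtopology ultraweak A) euclidean (\<lambda>a. cinner x (blinfun_apply (j a) y))"
  using continuous_map_compose[OF j_normal[unfolded normal_on_def] continuous_map_cinner_ultraweak, of x y]
  by (simp add: o_def)

text \<open>Ultraweak continuity at zero bounds the functional \<open>\<phi>\<close> by finitely
  many \<open>uwfun u v\<close> near zero, and by homogeneity everywhere. At
  \<open>adj a o\<^sub>L a\<close> each of these is at most the sum of the squared norms of
  \<open>a\<close> on the sequences \<open>u\<close> and \<open>v\<close>.\<close>

lemma domination:
  shows "\<exists>\<xi>. sqsum \<xi> \<and> (\<forall>a\<in>A. (norm (blinfun_apply (j a) y))\<^sup>2 \<le> suminf (\<lambda>n. (norm (blinfun_apply a (\<xi> n)))\<^sup>2))"
proof -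
  define \<phi> where "\<phi> a = cinner y (blinfun_apply (j a) y)" for a
  have "openin (subtopology ultraweak A) {a \<in> topspace (subtopology ultraweak A). \<phi> a \<in> ball 0 1}"
    unfolding \<phi>_def by (rule openin_continuous_map_preimage[OF continuous_map_j]) simp
  then obtain W where W: "openin ultraweak W" "{a \<in> A. \<phi> a \<in> ball 0 1} = W \<inter> A"
    by (auto simp: openin_subtopology)
  have A0: "0 \<in> A" by (rule complex_vector.subspace_0[OF vn_subspace[OF vn]])
  have "\<phi> 0 = 0" by (simp add: \<phi>_def j_zero)
  then have "0 \<in> W \<inter> A" unfolding W(2)[symmetric] using A0 by simp
  then have "0 \<in> W" by simp
  from ultraweak_neighbourhood[OF W(1) this] obtain P e where P: "finite P" "e > 0" "\<forall>(u, v)\<in>P. sqsum u \<and> sqsum v"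
    "\<And>T. (\<forall>(u, v)\<in>P. norm (uwfun u v T - uwfun u v 0) < e) \<Longrightarrow> T \<in> W" by auto
  have uw0: "uwfun u v 0 = 0" for u v :: "nat \<Rightarrow> 'h" by (simp add: uwfun_def)
  have nb: "norm (\<phi> a) < 1" if "a \<in> A" "\<forall>(u, v)\<in>P. norm (uwfun u v a) < e" for a
  proof -
    have "a \<in> W" using that(2) by (intro P(4)) (simp add: uw0)
    then have "a \<in> {a \<in> A. \<phi> a \<in> ball 0 1}" unfolding W(2) using that(1) by simp
    then show ?thesis by simp
  qed
  have uws: "uwfun u v (c *\<^sub>C a) = c * uwfun u v a" if "sqsum u" "sqsum v" for u v c and a :: "'h \<Rightarrow>\<^sub>L 'h"
    unfolding uwfun_def by (simp add: scaleC_blinfun.rep_eq suminf_mult summable_uwfun[OF that])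
  have phis: "\<phi> (c *\<^sub>C a) = c * \<phi> a" if "a \<in> A" for c a
    using that by (simp add: \<phi>_def j_scale scaleC_blinfun.rep_eq)
  \<comment> \<open>Scaling \<open>a\<close> into the neighbourhood of radius \<open>e\<close> gives
    the constant; 2 instead of 1 keeps the scaled element strictly inside. If all the functionals
    vanish at \<open>a\<close>, every multiple lies inside and \<open>\<phi> a\<close> must be
    zero.\<close>
  have bound: "norm (\<phi> a) \<le> (2 / e) * (\<Sum>(u, v)\<in>P. norm (uwfun u v a))" if a: "a \<in> A" for a
  proof -
    define s where "s = (\<Sum>(u, v)\<in>P. norm (uwfun u v a))"
    have le: "norm (uwfun u v a) \<le> s" if "(u, v) \<in> P" for u v
      unfolding s_def using member_le_sum[OF that, of "\<lambda>(u, v). norm (uwfun u v a)"] P(1) by auto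
    have s0: "0 \<le> s" unfolding s_def by (rule sum_nonneg) auto
    have key: "r * norm (\<phi> a) < 1" if r: "0 \<le> r" "r * s < e" for r
    proof -
      have "complex_of_real r *\<^sub>C a \<in> A" using vn_subspace[OF vn] a by (rule complex_vector.subspace_scale)
      moreover have "norm (uwfun u v (complex_of_real r *\<^sub>C a)) < e" if uv: "(u, v) \<in> P" for u v
      proof -
        have "sqsum u" "sqsum v" using P(3) uv by auto
        then have "norm (uwfun u v (complex_of_real r *\<^sub>C a)) = r * norm (uwfun u v a)" using r by (simp add: uws norm_mult)
        also have "\<dots> \<le> r * s" by (rule mult_left_mono[OF le[OF uv] r(1)])
        finally show ?thesis using r by simp
      qed
      ultimately have "norm (\<phi> (complex_of_real r *\<^sub>C a)) < 1" by (intro nb) auto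
      then show ?thesis using r a by (simp add: phis norm_mult)
    qed
    show ?thesis
    proof (cases "s = 0")
      case True
      have "norm (\<phi> a) = 0"
      proof (rule ccontr)
        assume "norm (\<phi> a) \<noteq> 0"
        then have "2 / norm (\<phi> a) * norm (\<phi> a) < 1" using True P(2) by (intro key) auto
        then show False using \<open>norm (\<phi> a) \<noteq> 0\<close> by simp
      qed
      then show ?thesis using True by (simp add: s_def)
    next
      case False
      then have "s > 0" using s0 by simp
      then have "e / (2 * s) * norm (\<phi> a) < 1" using P(2) by (intro key) (auto simp: field_simps)
      then show ?thesis using \<open>s > 0\<close> P(2) by (simp add: s_def[symmetric] field_simps)
    qed
  qed
  obtain \<xi> where \<xi>: "sqsum \<xi>" "\<And>a::'h \<Rightarrow>\<^sub>L 'h. suminf (\<lambda>n. (norm (blinfun_apply a (\<xi> n)))\<^sup>2)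
    = (\<Sum>(u, v)\<in>P. suminf (\<lambda>n. (norm (blinfun_apply a (u n)))\<^sup>2) + suminf (\<lambda>n. (norm (blinfun_apply a (v n)))\<^sup>2))"
    using sqsum_merge[OF P(1,3)] by blast
  have main: "(norm (blinfun_apply (j a) y))\<^sup>2 \<le> (2 / e) * suminf (\<lambda>n. (norm (blinfun_apply a (\<xi> n)))\<^sup>2)" if a: "a \<in> A" for a
  proof -
    have ad: "adj a \<in> A" "adj a o\<^sub>L a \<in> A" "a \<in> bops" "j a \<in> bops"
      using a vn_adj[OF vn] vn_compose[OF vn] vn_bops[OF vn] j_bops by blast+
    have "\<phi> (adj a o\<^sub>L a) = cinner (blinfun_apply (j a) y) (blinfun_apply (j a) y)"
      using a ad by (simp add: \<phi>_def j_mult j_adj cinner_adj_right)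
    then have "(norm (blinfun_apply (j a) y))\<^sup>2 = norm (\<phi> (adj a o\<^sub>L a))" by (simp add: cinner_self norm_power)
    also have "\<dots> \<le> (2 / e) * (\<Sum>(u, v)\<in>P. norm (uwfun u v (adj a o\<^sub>L a)))" by (rule bound[OF ad(2)])
    also have "\<dots> \<le> (2 / e) *
      (\<Sum>(u, v)\<in>P. suminf (\<lambda>n. (norm (blinfun_apply a (u n)))\<^sup>2) + suminf (\<lambda>n. (norm (blinfun_apply a (v n)))\<^sup>2))"
    proof (rule mult_left_mono, rule sum_mono, clarify)
      fix u v assume "(u, v) \<in> P"
      then have sq: "sqsum (\<lambda>n. blinfun_apply a (u n))" "sqsum (\<lambda>n. blinfun_apply a (v n))"
        using P(3) sqsum_apply by blast+
      have sm: "summable (\<lambda>n. (norm (blinfun_apply a (u n)))\<^sup>2)" "summable (\<lambda>n. (norm (blinfun_apply a (v n)))\<^sup>2)"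
        using sq unfolding sqsum_def by blast+
      have "norm (uwfun u v (adj a o\<^sub>L a)) = norm (suminf (\<lambda>n. cinner (blinfun_apply a (u n)) (blinfun_apply a (v n))))"
        using ad by (simp add: uwfun_def cinner_adj_right)
      also have "\<dots> \<le> suminf (\<lambda>n. norm (cinner (blinfun_apply a (u n)) (blinfun_apply a (v n))))"
        by (rule summable_norm[OF summable_norm_cinner[OF sq]])
      also have "\<dots> \<le> suminf (\<lambda>n. (norm (blinfun_apply a (u n)))\<^sup>2 + (norm (blinfun_apply a (v n)))\<^sup>2)"
        by (rule suminf_le[OF _ summable_norm_cinner[OF sq] summable_add[OF sm]])
          (rule order_trans[OF cmod_cinner_le mult_le_sum_squares])
      also have "\<dots> = suminf (\<lambda>n. (norm (blinfun_apply a (u n)))\<^sup>2) + suminf (\<lambda>n. (norm (blinfun_apply a (v n)))\<^sup>2)"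
        by (rule suminf_add[OF sm, symmetric])
      finally show "norm (uwfun u v (adj a o\<^sub>L a))
        \<le> suminf (\<lambda>n. (norm (blinfun_apply a (u n)))\<^sup>2) + suminf (\<lambda>n. (norm (blinfun_apply a (v n)))\<^sup>2)" .
    qed (use P(2) in simp)
    finally show ?thesis by (simp add: \<xi>(2))
  qed
  \<comment> \<open>The constant \<open>2 / e\<close> is absorbed into the vectors.\<close>
  let ?\<xi> = "\<lambda>n. sqrt (2 / e) *\<^sub>R \<xi> n"
  have sc: "(\<lambda>n. (norm (blinfun_apply a (?\<xi> n)))\<^sup>2) = (\<lambda>n. (2 / e) * (norm (blinfun_apply a (\<xi> n)))\<^sup>2)" for a
    using P(2) by (simp add: blinfun.scaleR_right power_mult_distrib)
  have sm: "summable (\<lambda>n. (norm (blinfun_apply a (\<xi> n)))\<^sup>2)" for a :: "'h \<Rightarrow>\<^sub>L 'h"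
    using sqsum_apply[OF \<xi>(1), of a] by (simp add: sqsum_def)
  have "sqsum ?\<xi>" using sc[of id_blinfun] summable_mult[OF sm[of id_blinfun], of "2 / e"] by (simp add: sqsum_def)
  moreover have "(norm (blinfun_apply (j a) y))\<^sup>2 \<le> suminf (\<lambda>n. (norm (blinfun_apply a (?\<xi> n)))\<^sup>2)" if "a \<in> A" for a
    using main[OF that] unfolding sc suminf_mult[OF sm] .
  ultimately show ?thesis by blast
qed

text \<open>By \<open>domination\<close> the map sending \<open>e a\<close>, the image of \<Xi>
  under the amplified \<open>a\<close>, to \<open>j a y\<close> is a contraction \<open>T\<close> on
  the cyclic subspace of \<Xi>. Its adjoint intertwines, and since \<open>T\<close> sends \<Xi> to
  \<open>y\<close>, the kernel of the adjoint is orthogonal to \<open>y\<close>.\<close>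

lemma ex_intertwiner:
  "\<exists>R :: 'b \<Rightarrow>\<^sub>L ('h, complex fock) htensor. R \<in> bops \<and> norm R \<le> 1
    \<and> (\<forall>b\<in>A. \<forall>x. blinfun_apply R (blinfun_apply (j b) x) = blinfun_apply (tmap b id_blinfun) (blinfun_apply R x))
    \<and> (\<forall>x. blinfun_apply R x = 0 \<longrightarrow> cinner y x = 0)"
proof -
  obtain \<xi> where \<xi>: "sqsum \<xi>" "\<And>a. a \<in> A \<Longrightarrow> (norm (blinfun_apply (j a) y))\<^sup>2 \<le> suminf (\<lambda>n. (norm (blinfun_apply a (\<xi> n)))\<^sup>2)"
    using domination[of y] by blast
  define \<Xi> where "\<Xi> = suminf (\<lambda>n. \<xi> n \<otimes> \<delta> n)"
  define e where "e a = blinfun_apply (tmap a id_blinfun) \<Xi>" for a :: "'h \<Rightarrow>\<^sub>L 'h"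
  note ab = vn_bops[OF vn]
  have e_norm: "(norm (e a))\<^sup>2 = suminf (\<lambda>n. (norm (blinfun_apply a (\<xi> n)))\<^sup>2)" if "a \<in> A" for a
  proof -
    have "e a = suminf (\<lambda>n. blinfun_apply (tmap a id_blinfun) (\<xi> n \<otimes> \<delta> n))"
      unfolding e_def \<Xi>_def by (rule bounded_linear.suminf[OF blinfun.bounded_linear_right l2_series(1)[OF \<xi>(1)]])
    also have "\<dots> = suminf (\<lambda>n. blinfun_apply a (\<xi> n) \<otimes> \<delta> n)" using ab[OF that] by (simp add: tmap_tensor)
    finally show ?thesis using l2_series(2)[OF sqsum_apply[OF \<xi>(1), of a]] by simp
  qed
  have e_mult: "blinfun_apply (tmap b id_blinfun) (e a) = e (b o\<^sub>L a)" if "a \<in> A" "b \<in> A" for a b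
  proof -
    have "(id_blinfun :: complex fock \<Rightarrow>\<^sub>L _) o\<^sub>L id_blinfun = id_blinfun" by (rule blinfun_eqI) simp
    then have "tmap b id_blinfun o\<^sub>L tmap a id_blinfun = tmap (b o\<^sub>L a) (id_blinfun :: complex fock \<Rightarrow>\<^sub>L _)"
      using tmap_compose[OF ab[OF that(2)] _ ab[OF that(1)], of "id_blinfun :: complex fock \<Rightarrow>\<^sub>L _" "id_blinfun :: complex fock \<Rightarrow>\<^sub>L _"] by simp
    then show ?thesis unfolding e_def by (simp flip: blinfun_apply_blinfun_compose)
  qed
  have e_sum: "e (\<Sum>a\<in>F. c a *\<^sub>C a) = (\<Sum>a\<in>F. c a *\<^sub>C e a) \<and> (\<Sum>a\<in>F. c a *\<^sub>C a) \<in> A" if "finite F" "F \<subseteq> A" for F c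
    using that
  proof (induction F)
    case empty
    have "tmap (0 :: 'h \<Rightarrow>\<^sub>L 'h) id_blinfun = (0 :: ('h, complex fock) htensor \<Rightarrow>\<^sub>L ('h, complex fock) htensor)"
      by (rule tensor_operator_eqI) (auto simp: tmap_bops tmap_tensor bounded_bilinear.zero_left[OF bounded_bilinear_tensor])
    then show ?case using complex_vector.subspace_0[OF vn_subspace[OF vn]] by (simp add: e_def)
  next
    case (insert a F)
    let ?s = "\<Sum>a\<in>F. c a *\<^sub>C a"
    have s: "?s \<in> A" "a \<in> A" "c a *\<^sub>C a \<in> A" using insert complex_vector.subspace_scale[OF vn_subspace[OF vn]] by auto
    have "tmap (c a *\<^sub>C a + ?s) id_blinfun = c a *\<^sub>C tmap a id_blinfun + (tmap ?s id_blinfun :: ('h, complex fock) htensor \<Rightarrow>\<^sub>L _)"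
      by (rule tensor_operator_eqI)
        (use ab[OF s(1)] ab[OF s(2)] in \<open>auto simp: tmap_bops tmap_tensor blinfun.add_left scaleC_blinfun.rep_eq tensor_add_left tensor_scale_left\<close>)
    then have "e (c a *\<^sub>C a + ?s) = c a *\<^sub>C e a + e ?s" by (simp add: e_def blinfun.add_left scaleC_blinfun.rep_eq)
    then show ?case using insert s complex_vector.subspace_add[OF vn_subspace[OF vn] s(3,1)] by simp
  qed
  obtain T :: "('h, complex fock) htensor \<Rightarrow>\<^sub>L 'b" where T: "T \<in> bops" "\<And>a. a \<in> A \<Longrightarrow> blinfun_apply T (e a) = blinfun_apply (j a) y"
    "\<And>x. (\<And>a. a \<in> A \<Longrightarrow> cinner (e a) x = 0) \<Longrightarrow> blinfun_apply T x = 0" "norm T \<le> 1"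
  proof (rule clinear_extension[of 1 A "\<lambda>a. blinfun_apply (j a) y" e])
    fix F c assume F: "finite F" "F \<subseteq> A"
    let ?s = "\<Sum>a\<in>F. c a *\<^sub>C a"
    have "j ?s = (\<Sum>a\<in>F. c a *\<^sub>C j a)"
      by (rule clinear_on_sum[OF j_linear vn_subspace[OF vn]]) (use F in auto)
    then have "blinfun_apply (j ?s) y = (\<Sum>a\<in>F. c a *\<^sub>C blinfun_apply (j a) y)"
      by (simp add: blinfun.sum_left scaleC_blinfun.rep_eq)
    moreover have sA: "?s \<in> A" "e ?s = (\<Sum>a\<in>F. c a *\<^sub>C e a)" using e_sum[OF F, of c] by blast+
    have "(norm (blinfun_apply (j ?s) y))\<^sup>2 \<le> (norm (e ?s))\<^sup>2" using \<xi>(2)[OF sA(1)] e_norm[OF sA(1)] by simp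
    then have "norm (blinfun_apply (j ?s) y) \<le> norm (e ?s)" by (rule power2_le_imp_le) simp
    ultimately show "norm (\<Sum>a\<in>F. c a *\<^sub>C blinfun_apply (j a) y) \<le> 1 * norm (\<Sum>a\<in>F. c a *\<^sub>C e a)"
      unfolding sA(2) by simp
  qed auto
  \<comment> \<open>The identity is checked on the closed cyclic subspace and on its orthogonal
    complement; \<open>T\<close> vanishes on the latter, which is invariant because \<open>A\<close>
    contains adjoints.\<close>
  have Tj: "blinfun_apply T (blinfun_apply (tmap b id_blinfun) x) = blinfun_apply (j b) (blinfun_apply T x)" if b: "b \<in> A" for b x
  proof -
    have bb: "b \<in> bops" "j b \<in> bops" "adj b \<in> A" using ab[OF b] j_bops[OF b] vn_adj[OF vn b] by auto
    have tb: "(tmap b id_blinfun :: ('h, complex fock) htensor \<Rightarrow>\<^sub>L _) \<in> bops" using bb by (simp add: tmap_bops)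
    obtain p where p: "p \<in> closure (cspan (e ` A))" "\<forall>y\<in>closure (cspan (e ` A)). cinner y (x - p) = 0"
      using projection_exists[OF csubspace_closure[OF complex_vector.subspace_span] closed_closure] by blast
    have 1: "blinfun_apply T (blinfun_apply (tmap b id_blinfun) p) = blinfun_apply (j b) (blinfun_apply T p)"
      using p(1)
    proof (rule cspan_closure_induct)
      show "complex_vector.subspace {p. blinfun_apply T (blinfun_apply (tmap b id_blinfun) p) = blinfun_apply (j b) (blinfun_apply T p)}"
        using T(1) bb tb by (auto simp: complex_vector.subspace_def blinfun.add_right bops_scaleC)
      show "closed {p. blinfun_apply T (blinfun_apply (tmap b id_blinfun) p) = blinfun_apply (j b) (blinfun_apply T p)}"
        by (intro closed_Collect_eq continuous_intros)
      fix s assume "s \<in> e ` A"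
      then obtain a where a: "a \<in> A" "s = e a" by blast
      then show "blinfun_apply T (blinfun_apply (tmap b id_blinfun) s) = blinfun_apply (j b) (blinfun_apply T s)"
        using b by (simp add: e_mult T vn_compose[OF vn] j_mult)
    qed
    have q: "cinner (e a) (x - p) = 0" if "a \<in> A" for a
      by (rule bspec[OF p(2)], rule subsetD[OF closure_subset], rule complex_vector.span_base) (use that in blast)
    have "blinfun_apply T (x - p) = 0" by (rule T(3)) (rule q)
    moreover have "blinfun_apply T (blinfun_apply (tmap b id_blinfun) (x - p)) = 0"
    proof (rule T(3))
      fix a assume a: "a \<in> A"
      have "cinner (e a) (blinfun_apply (tmap b id_blinfun) (x - p)) = cinner (blinfun_apply (adj (tmap b id_blinfun)) (e a)) (x - p)"
        by (simp add: cinner_adj_left[OF tb])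
      also have "adj (tmap b id_blinfun) = tmap (adj b) (id_blinfun :: complex fock \<Rightarrow>\<^sub>L _)"
        using adj_tmap[OF bb(1), of "id_blinfun :: complex fock \<Rightarrow>\<^sub>L _"] adj_eqI[of "id_blinfun :: complex fock \<Rightarrow>\<^sub>L _" id_blinfun] by simp
      also have "cinner (blinfun_apply (tmap (adj b) id_blinfun) (e a)) (x - p) = 0"
        unfolding e_mult[OF a bb(3)] by (rule q) (rule vn_compose[OF vn bb(3) a])
      finally show "cinner (e a) (blinfun_apply (tmap b id_blinfun) (x - p)) = 0" .
    qed
    ultimately show ?thesis using 1 by (simp add: blinfun.diff_right)
  qed
  have eid: "e id_blinfun = \<Xi>"
  proof -
    have "tmap id_blinfun id_blinfun = (id_blinfun :: ('h, complex fock) htensor \<Rightarrow>\<^sub>L _)"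
      by (rule tensor_operator_eqI) (auto simp: tmap_bops tmap_tensor)
    then show ?thesis by (simp add: e_def)
  qed
  show ?thesis
  proof (intro exI[of _ "adj T"] conjI ballI allI impI)
    show "adj T \<in> bops" by (rule adj_bops[OF T(1)])
    show "norm (adj T) \<le> 1" using norm_adj_le[OF T(1)] T(4) by simp
    fix b x assume b: "b \<in> A"
    have bb: "b \<in> bops" "j b \<in> bops" "adj b \<in> A" "adj b \<in> bops" using ab[OF b] j_bops[OF b] vn_adj[OF vn b] ab by auto
    have tb: "(tmap b id_blinfun :: ('h, complex fock) htensor \<Rightarrow>\<^sub>L _) \<in> bops" using bb by (simp add: tmap_bops)
    have adt: "adj (tmap b id_blinfun) = tmap (adj b) (id_blinfun :: complex fock \<Rightarrow>\<^sub>L _)"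
      using adj_tmap[OF bb(1), of "id_blinfun :: complex fock \<Rightarrow>\<^sub>L _"] adj_eqI[of "id_blinfun :: complex fock \<Rightarrow>\<^sub>L _" id_blinfun] by simp
    show "blinfun_apply (adj T) (blinfun_apply (j b) x) = blinfun_apply (tmap b id_blinfun) (blinfun_apply (adj T) x)"
    proof (rule cinner_eqI)
      fix z
      have "cinner z (blinfun_apply (adj T) (blinfun_apply (j b) x)) = cinner (blinfun_apply (adj (j b)) (blinfun_apply T z)) x"
        by (simp add: cinner_adj_right[OF T(1)] cinner_adj_left[OF bb(2)])
      also have "\<dots> = cinner (blinfun_apply T (blinfun_apply (tmap (adj b) id_blinfun) z)) x"
        by (simp add: Tj[OF bb(3)] j_adj[OF b])
      also have "\<dots> = cinner z (blinfun_apply (tmap b id_blinfun) (blinfun_apply (adj T) x))"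
        by (simp add: cinner_adj_right[OF T(1), symmetric] adt[symmetric] cinner_adj_left[OF tb])
      finally show "cinner z (blinfun_apply (adj T) (blinfun_apply (j b) x)) = cinner z (blinfun_apply (tmap b id_blinfun) (blinfun_apply (adj T) x))" .
    qed
  next
    fix x assume "blinfun_apply (adj T) x = 0"
    then have "cinner (blinfun_apply T \<Xi>) x = 0" using cinner_adj_right[OF T(1), of \<Xi> x] by simp
    moreover have "blinfun_apply T \<Xi> = y" using T(2)[OF vn_id[OF vn]] by (simp add: eid j_id)
    ultimately show "cinner y x = 0" by simp
  qed
qed

end

section \<open>Bessel families of operators and the resolvent sequence\<close>

definition bessel :: "('i \<Rightarrow> 'a::complex_inner \<Rightarrow>\<^sub>L 'b::complex_inner) \<Rightarrow> bool" where
  "bessel V \<longleftrightarrow> (\<forall>F x. finite F \<longrightarrow> (\<Sum>i\<in>F. (norm (blinfun_apply (V i) x))\<^sup>2) \<le> (norm x)\<^sup>2)"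

lemma besselD: "bessel V \<Longrightarrow> finite F \<Longrightarrow> (\<Sum>i\<in>F. (norm (blinfun_apply (V i) x))\<^sup>2) \<le> (norm x)\<^sup>2"
  by (simp add: bessel_def)

lemma bessel_sum_bound:
  assumes V: "bessel V" and F: "finite F"
  shows "(\<Sum>i\<in>F. norm (blinfun_apply (V i) x) * norm (blinfun_apply (V i) y)) \<le> norm x * norm y"
proof -
  have "(\<Sum>i\<in>F. norm (blinfun_apply (V i) x) * norm (blinfun_apply (V i) y))
      \<le> L2_set (\<lambda>i. norm (blinfun_apply (V i) x)) F * L2_set (\<lambda>i. norm (blinfun_apply (V i) y)) F"
    using L2_set_mult_ineq[of "\<lambda>i. norm (blinfun_apply (V i) x)" "\<lambda>i. norm (blinfun_apply (V i) y)" F] by simp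
  also have "\<dots> \<le> norm x * norm y"
  proof (rule mult_mono)
    show "L2_set (\<lambda>i. norm (blinfun_apply (V i) x)) F \<le> norm x" for x
      unfolding L2_set_def by (rule real_le_lsqrt) (use besselD[OF V F] in \<open>auto intro: sum_nonneg\<close>)
    then show "L2_set (\<lambda>i. norm (blinfun_apply (V i) y)) F \<le> norm y" .
  qed (auto simp: L2_set_nonneg)
  finally show ?thesis .
qed

lemma bessel_cinner_bound:
  assumes V: "bessel V" and F: "finite F"
  shows "cmod (\<Sum>i\<in>F. cinner (blinfun_apply (V i) x) (blinfun_apply T (blinfun_apply (V i) y))) \<le> norm T * norm x * norm y"
proof -
  have "cmod (\<Sum>i\<in>F. cinner (blinfun_apply (V i) x) (blinfun_apply T (blinfun_apply (V i) y)))
      \<le> (\<Sum>i\<in>F. norm T * (norm (blinfun_apply (V i) x) * norm (blinfun_apply (V i) y)))"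
  proof (rule order_trans[OF norm_sum sum_mono])
    fix i
    have "cmod (cinner (blinfun_apply (V i) x) (blinfun_apply T (blinfun_apply (V i) y)))
      \<le> norm (blinfun_apply (V i) x) * (norm T * norm (blinfun_apply (V i) y))"
      by (rule order_trans[OF cmod_cinner_le mult_left_mono[OF norm_blinfun]]) simp
    then show "cmod (cinner (blinfun_apply (V i) x) (blinfun_apply T (blinfun_apply (V i) y)))
      \<le> norm T * (norm (blinfun_apply (V i) x) * norm (blinfun_apply (V i) y))" by (simp add: mult_ac)
  qed
  also have "\<dots> \<le> norm T * (norm x * norm y)"
    unfolding sum_distrib_left[symmetric] by (rule mult_left_mono[OF bessel_sum_bound[OF V F]]) simp
  finally show ?thesis by (simp add: mult.assoc)
qed

lemma bessel_cinner_bound_id: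
  assumes V: "bessel V" and F: "finite F"
  shows "cmod (\<Sum>i\<in>F. cinner (blinfun_apply (V i) x) (blinfun_apply (V i) y)) \<le> norm x * norm y"
proof -
  have "cmod (\<Sum>i\<in>F. cinner (blinfun_apply (V i) x) (blinfun_apply (V i) y))
      \<le> (\<Sum>i\<in>F. norm (blinfun_apply (V i) x) * norm (blinfun_apply (V i) y))"
    by (rule order_trans[OF norm_sum sum_mono]) (rule cmod_cinner_le)
  then show ?thesis using bessel_sum_bound[OF V F, of x y] by linarith
qed

text \<open>The Bessel bound makes the finite partial sums Lipschitz in \<open>x\<close> with one
  constant, so an expansion valid on a generating set extends to its closed span.\<close>

lemma bessel_closed_left:
  fixes V :: "'i \<Rightarrow> 'a::complex_inner \<Rightarrow>\<^sub>L 'b::complex_inner"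
  assumes V: "bessel V"
  shows "closed {x. ((\<lambda>i. cinner (blinfun_apply (V i) x) (blinfun_apply (V i) y)) has_sum cinner x y) UNIV}"
proof (subst closed_sequential_limits, intro allI impI, elim conjE)
  fix X x assume X: "\<forall>n. X n \<in> {x. ((\<lambda>i. cinner (blinfun_apply (V i) x) (blinfun_apply (V i) y)) has_sum cinner x y) UNIV}"
    "X \<longlonglongrightarrow> x"
  let ?S = "\<lambda>x F. \<Sum>i\<in>F. cinner (blinfun_apply (V i) x) (blinfun_apply (V i) y)"
  have "(?S x \<longlongrightarrow> cinner x y) (finite_subsets_at_top UNIV)"
  proof (rule tendstoI)
    fix e :: real assume e: "e > 0"
    have "(\<lambda>n. 2 * (norm (X n - x) * norm y)) \<longlonglongrightarrow> 2 * (norm (x - x) * norm y)"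
      by (intro tendsto_intros X)
    then have "\<forall>\<^sub>F n in sequentially. 2 * (norm (X n - x) * norm y) < e / 2"
      by (rule order_tendstoD) (use e in simp)
    then obtain n where n: "2 * (norm (X n - x) * norm y) < e / 2" by (meson eventually_happens trivial_limit_sequentially)
    have "(?S (X n) \<longlongrightarrow> cinner (X n) y) (finite_subsets_at_top UNIV)" using X by (simp add: has_sum_def)
    then have "\<forall>\<^sub>F F in finite_subsets_at_top UNIV. dist (?S (X n) F) (cinner (X n) y) < e / 2"
      by (rule tendstoD) (use e in simp)
    moreover have "\<forall>\<^sub>F F in finite_subsets_at_top (UNIV::'i set). finite F" by (rule eventually_finite_subsets_at_top_weakI)
    ultimately show "\<forall>\<^sub>F F in finite_subsets_at_top UNIV. dist (?S x F) (cinner x y) < e"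
    proof eventually_elim
      case (elim F)
      have tri: "cmod (a - b + c) \<le> cmod a + cmod b + cmod c" for a b c
        using norm_triangle_ineq[of "a - b" c] norm_triangle_ineq4[of a b] by linarith
      have eq: "?S x F - cinner x y = (?S (X n) F - cinner (X n) y) - ?S (X n - x) F + cinner (X n - x) y"
        by (simp add: blinfun.diff_right cinner_diff_left sum_subtractf)
      have "cmod (?S x F - cinner x y) \<le> cmod (?S (X n) F - cinner (X n) y) + cmod (?S (X n - x) F) + cmod (cinner (X n - x) y)"
        unfolding eq by (rule tri)
      also have "\<dots> < e"
        using elim n bessel_cinner_bound_id[OF V elim(2), of "X n - x" y] cmod_cinner_le[of "X n - x" y]
        unfolding dist_norm by linarith
      finally show ?case by (simp add: dist_norm)
    qed
  qed
  then show "x \<in> {x. ((\<lambda>i. cinner (blinfun_apply (V i) x) (blinfun_apply (V i) y)) has_sum cinner x y) UNIV}"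
    by (simp add: has_sum_def)
qed

lemma bessel_subspace_left:
  assumes "\<And>i. V i \<in> bops"
  shows "complex_vector.subspace {x. ((\<lambda>i. cinner (blinfun_apply (V i) x) (blinfun_apply (V i) y)) has_sum cinner x y) UNIV}"
  unfolding complex_vector.subspace_def
  by (auto simp: blinfun.add_right cinner_add_left bops_scaleC[OF assms] intro!: has_sum_add has_sum_cmult_right has_sum_0)

lemma has_sum_cinner_swap:
  assumes "((\<lambda>i. cinner (f i) (g i)) has_sum cinner x y) S"
  shows "((\<lambda>i. cinner (g i) (f i)) has_sum cinner y (x::'a::complex_inner)) S"
  using has_sum_cnj_iff[THEN iffD2, OF assms] by (simp flip: cinner_commute)

text \<open>With \<open>D\<^sub>0 = I\<close> and \<open>D\<^sub>n\<^sub>+\<^sub>1 = D\<^sub>n - D\<^sub>n B D\<^sub>n\<close> one has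
  \<open>\<Sum> D\<^sub>n B D\<^sub>n = I\<close> on the closed range of \<open>B\<close>; this replaces the polar decomposition.\<close>

definition pos_contraction :: "('a::complex_inner \<Rightarrow>\<^sub>L 'a) \<Rightarrow> bool" where
  "pos_contraction D \<longleftrightarrow> D \<in> bops \<and> (\<forall>x y. cinner x (blinfun_apply D y) = cinner (blinfun_apply D x) y)
    \<and> (\<forall>x. 0 \<le> Re (cinner x (blinfun_apply D x)) \<and> Re (cinner x (blinfun_apply D x)) \<le> (norm x)\<^sup>2)"

lemma pos_contractionD:
  assumes "pos_contraction D"
  shows "D \<in> bops" "cinner x (blinfun_apply D y) = cinner (blinfun_apply D x) y"
    "0 \<le> Re (cinner x (blinfun_apply D x))" "Re (cinner x (blinfun_apply D x)) \<le> (norm x)\<^sup>2"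
  using assms unfolding pos_contraction_def by blast+

text \<open>Positivity of \<open>D\<close> at \<open>x - D x\<close> bounds twice the squared norm
  of \<open>D x\<close> by the form at \<open>x\<close> plus the form at \<open>D x\<close>, and the
  latter is at most that squared norm once. In operator terms the square of \<open>D\<close> is
  below \<open>D\<close>, obtained without square roots.\<close>

lemma pos_contraction_norm:
  assumes "pos_contraction D"
  shows "(norm (blinfun_apply D x))\<^sup>2 \<le> Re (cinner x (blinfun_apply D x))"
proof -
  let ?d = "blinfun_apply D x"
  have sa: "cinner x (blinfun_apply D ?d) = cinner ?d ?d" by (rule pos_contractionD[OF assms])
  have "0 \<le> Re (cinner (x - ?d) (blinfun_apply D (x - ?d)))" by (rule pos_contractionD[OF assms])
  also have "\<dots> = Re (cinner x ?d) - 2 * (norm ?d)\<^sup>2 + Re (cinner ?d (blinfun_apply D ?d))"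
    by (simp add: blinfun.diff_right cinner_diff_left cinner_diff_right sa norm_power2_cinner)
  also have "Re (cinner ?d (blinfun_apply D ?d)) \<le> (norm ?d)\<^sup>2" by (rule pos_contractionD[OF assms])
  finally show ?thesis by simp
qed

primrec resolvent_seq :: "('a::complex_inner \<Rightarrow>\<^sub>L 'a) \<Rightarrow> nat \<Rightarrow> 'a \<Rightarrow>\<^sub>L 'a" where
  "resolvent_seq B 0 = id_blinfun"
| "resolvent_seq B (Suc n) = resolvent_seq B n - (resolvent_seq B n o\<^sub>L B o\<^sub>L resolvent_seq B n)"

text \<open>Each step lowers the form by the value of \<open>B\<close> at \<open>?d\<close>. This is
  at most the squared norm of \<open>?d\<close>, which by \<open>pos_contraction_norm\<close> is at
  most the old form; so positivity is preserved.\<close>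

lemma pos_contraction_resolvent:
  assumes B: "pos_contraction B" shows "pos_contraction (resolvent_seq B n)"
proof (induction n)
  case 0
  then show ?case by (simp add: pos_contraction_def norm_power2_cinner flip: norm_power2_cinner)
next
  case (Suc n)
  let ?D = "resolvent_seq B n"
  have b: "?D \<in> bops" "B \<in> bops" and sa: "cinner x (blinfun_apply ?D y) = cinner (blinfun_apply ?D x) y"
    "cinner x (blinfun_apply B y) = cinner (blinfun_apply B x) y" for x y
    using Suc B by (simp_all add: pos_contraction_def)
  have "0 \<le> Re (cinner x (blinfun_apply (resolvent_seq B (Suc n)) x)) \<and> Re (cinner x (blinfun_apply (resolvent_seq B (Suc n)) x)) \<le> (norm x)\<^sup>2" for x
  proof -
    let ?d = "blinfun_apply ?D x"
    have eq: "Re (cinner x (blinfun_apply (resolvent_seq B (Suc n)) x)) = Re (cinner x ?d) - Re (cinner ?d (blinfun_apply B ?d))"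
      by (simp add: blinfun.diff_left cinner_diff_right sa)
    have "Re (cinner ?d (blinfun_apply B ?d)) \<le> (norm ?d)\<^sup>2" "0 \<le> Re (cinner ?d (blinfun_apply B ?d))"
      by (rule pos_contractionD[OF B])+
    moreover have "(norm ?d)\<^sup>2 \<le> Re (cinner x ?d)" by (rule pos_contraction_norm[OF Suc])
    moreover have "Re (cinner x ?d) \<le> (norm x)\<^sup>2" by (rule pos_contractionD[OF Suc])
    ultimately show ?thesis unfolding eq by linarith
  qed
  moreover have "cinner x (blinfun_apply (resolvent_seq B (Suc n)) y) = cinner (blinfun_apply (resolvent_seq B (Suc n)) x) y" for x y
    by (simp add: blinfun.diff_left cinner_diff_right cinner_diff_left sa)
  moreover have "resolvent_seq B (Suc n) \<in> bops" using b by simp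
  ultimately show ?case unfolding pos_contraction_def by blast
qed

lemma resolvent_telescope:
  assumes B: "pos_contraction B"
  shows "(\<Sum>n<N. cinner (blinfun_apply (resolvent_seq B n) x) (blinfun_apply B (blinfun_apply (resolvent_seq B n) y)))
    = cinner x y - cinner x (blinfun_apply (resolvent_seq B N) y)"
proof (induction N)
  case (Suc N)
  have "cinner x (blinfun_apply (resolvent_seq B N) z) = cinner (blinfun_apply (resolvent_seq B N) x) z" for z
    using pos_contraction_resolvent[OF B, of N] by (simp add: pos_contraction_def)
  then show ?case using Suc by (simp add: blinfun.diff_left cinner_diff_right)
qed simp

lemma resolvent_energy:
  assumes B: "pos_contraction B"
  shows "(\<Sum>n<N. Re (cinner (blinfun_apply (resolvent_seq B n) x) (blinfun_apply B (blinfun_apply (resolvent_seq B n) x)))) \<le> (norm x)\<^sup>2"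
proof -
  have "0 \<le> Re (cinner x (blinfun_apply (resolvent_seq B N) x))"
    by (rule pos_contractionD[OF pos_contraction_resolvent[OF B]])
  then show ?thesis
    using arg_cong[OF resolvent_telescope[OF B, where N = N and x = x and y = x], of Re] by (simp add: norm_power2_cinner)
qed

text \<open>The telescoped remainder has to vanish. Bounded energy forces \<open>B\<close> applied
  to the resolvent vectors of \<open>y\<close> to tend to zero, hence the remainder vanishes against
  vectors in the range of \<open>B\<close>; as the resolvents are contractions, it also vanishes
  against limits of such vectors.\<close>

lemma resolvent_sums:
  assumes B: "pos_contraction B" and x: "x \<in> closure (range (blinfun_apply B))"
  shows "(\<lambda>n. cinner (blinfun_apply (resolvent_seq B n) x) (blinfun_apply B (blinfun_apply (resolvent_seq B n) y))) sums cinner x y"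
proof -
  let ?D = "resolvent_seq B"
  have sa: "cinner u (blinfun_apply B v) = cinner (blinfun_apply B u) v" for u v using B by (simp add: pos_contraction_def)
  have Dn: "norm (blinfun_apply (?D n) z) \<le> norm z" for n z
  proof -
    have "(norm (blinfun_apply (?D n) z))\<^sup>2 \<le> (norm z)\<^sup>2"
      using pos_contraction_norm[OF pos_contraction_resolvent[OF B], of n z] pos_contraction_resolvent[OF B, of n]
      unfolding pos_contraction_def by (meson order_trans)
    then show ?thesis by (rule power2_le_imp_le) simp
  qed
  have "summable (\<lambda>n. Re (cinner (blinfun_apply (?D n) y) (blinfun_apply B (blinfun_apply (?D n) y))))"
    by (rule summableI_nonneg_bounded[where x = "(norm y)\<^sup>2"])
      (use B resolvent_energy[OF B] in \<open>auto simp: pos_contraction_def\<close>)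
  then have "(\<lambda>n. Re (cinner (blinfun_apply (?D n) y) (blinfun_apply B (blinfun_apply (?D n) y)))) \<longlonglongrightarrow> 0"
    by (rule summable_LIMSEQ_zero)
  then have "(\<lambda>n. (norm (blinfun_apply B (blinfun_apply (?D n) y)))\<^sup>2) \<longlonglongrightarrow> 0"
    by (rule tendsto_zero_le) (use pos_contraction_norm[OF B] in auto)
  then have "(\<lambda>n. sqrt ((norm (blinfun_apply B (blinfun_apply (?D n) y)))\<^sup>2)) \<longlonglongrightarrow> sqrt 0" by (rule tendsto_real_sqrt)
  then have BD: "(\<lambda>n. norm (blinfun_apply B (blinfun_apply (?D n) y))) \<longlonglongrightarrow> 0" by simp
  have "(\<lambda>N. cinner x (blinfun_apply (?D N) y)) \<longlonglongrightarrow> 0"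
  proof (rule LIMSEQ_I)
    fix e :: real assume e: "e > 0"
    define r where "r = e / (2 * (norm y + 1))"
    have r: "r > 0" using e by (simp add: r_def add_nonneg_pos)
    then obtain z where z: "dist (blinfun_apply B z) x < r" using x unfolding closure_approachable by blast
    have "(\<lambda>n. norm z * norm (blinfun_apply B (blinfun_apply (?D n) y))) \<longlonglongrightarrow> norm z * 0" by (intro tendsto_intros BD)
    then have "\<forall>\<^sub>F n in sequentially. norm z * norm (blinfun_apply B (blinfun_apply (?D n) y)) < e / 2"
      by (rule order_tendstoD) (use e in simp)
    then obtain N where N: "\<And>n. n \<ge> N \<Longrightarrow> norm z * norm (blinfun_apply B (blinfun_apply (?D n) y)) < e / 2"
      unfolding eventually_sequentially by blast
    have "norm (cinner x (blinfun_apply (?D n) y) - 0) < e" if "n \<ge> N" for n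
    proof -
      let ?w = "blinfun_apply (?D n) y"
      have "cinner x ?w = cinner z (blinfun_apply B ?w) - cinner (blinfun_apply B z - x) ?w"
        by (simp add: cinner_diff_left sa)
      then have "cmod (cinner x ?w) \<le> cmod (cinner z (blinfun_apply B ?w)) + cmod (cinner (blinfun_apply B z - x) ?w)"
        by (metis norm_triangle_ineq4)
      moreover have "cmod (cinner z (blinfun_apply B ?w)) < e / 2"
        using cmod_cinner_le[of z "blinfun_apply B ?w"] N[OF that] by linarith
      moreover have "cmod (cinner (blinfun_apply B z - x) ?w) \<le> r * (norm y + 1)"
      proof -
        have "cmod (cinner (blinfun_apply B z - x) ?w) \<le> norm (blinfun_apply B z - x) * norm ?w" by (rule cmod_cinner_le)
        also have "\<dots> \<le> r * (norm y + 1)"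
          by (rule mult_mono) (use z Dn[of n y] r in \<open>auto simp: dist_norm\<close>)
        finally show ?thesis .
      qed
      moreover have "r * (norm y + 1) = e / 2"
      proof -
        have *: "e / (2 * q) * q = e / 2" if "q \<noteq> 0" for q :: real using that by simp
        have "norm y + 1 \<noteq> 0" by (smt (verit) norm_ge_zero)
        then show ?thesis unfolding r_def by (rule *)
      qed
      ultimately show ?thesis by simp
    qed
    then show "\<exists>no. \<forall>n\<ge>no. norm (cinner x (blinfun_apply (?D n) y) - 0) < e" by blast
  qed
  then have "(\<lambda>N. cinner x y - cinner x (blinfun_apply (?D N) y)) \<longlonglongrightarrow> cinner x y - 0" by (intro tendsto_intros)
  then show ?thesis unfolding sums_def resolvent_telescope[OF B] by simp
qed

text \<open>Coordinates in the basis \<delta> of the l2 factor. The Parseval identity holds first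
  for \<open>w \<otimes> \<delta> n\<close>, where a single term survives, and then by
  closure.\<close>

lemma bra_delta:
  fixes X :: "('h::chilbert_space, complex fock) htensor"
  shows bra_delta_tensor: "blinfun_apply (bra (\<delta> m)) (w \<otimes> \<delta> n) = (if m = n then w else (0::'h))"
    and bessel_bra_delta: "bessel (\<lambda>m. bra (\<delta> m) :: ('h, complex fock) htensor \<Rightarrow>\<^sub>L 'h)"
    and bra_delta_has_sum: "((\<lambda>m. cinner (blinfun_apply (bra (\<delta> m)) X) (blinfun_apply (bra (\<delta> m)) Z :: 'h)) has_sum cinner X Z) UNIV"
proof -
  show 1: "blinfun_apply (bra (\<delta> m)) (w \<otimes> \<delta> n) = (if m = n then w else (0::'h))" for m n w
    by (rule cinner_eqI) (simp add: cinner_bra)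
  show bess: "bessel (\<lambda>m. bra (\<delta> m) :: ('h, complex fock) htensor \<Rightarrow>\<^sub>L 'h)"
    unfolding bessel_def
  proof (intro allI impI)
    fix F :: "nat set" and X :: "('h, complex fock) htensor" assume F: "finite F"
    let ?Z = "\<Sum>m\<in>F. blinfun_apply (bra (\<delta> m)) X \<otimes> \<delta> m"
    have "cinner ?Z X = (\<Sum>m\<in>F. cinner (blinfun_apply (bra (\<delta> m)) X) (blinfun_apply (bra (\<delta> m)) X))"
      by (simp add: cinner_sum_left flip: cinner_bra)
    then have "(norm ?Z)\<^sup>2 = Re (cinner ?Z X)"
      unfolding norm_sum_delta[OF F] by (simp add: norm_power2_cinner)
    also have "\<dots> \<le> norm ?Z * norm X" using complex_Re_le_cmod cmod_cinner_le order_trans by blast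
    finally have "norm ?Z \<le> norm X" by (cases "norm ?Z = 0") (auto simp: power2_eq_square)
    then have "(norm ?Z)\<^sup>2 \<le> (norm X)\<^sup>2" by (rule power_mono) simp
    then show "(\<Sum>m\<in>F. (norm (blinfun_apply (bra (\<delta> m)) X))\<^sup>2) \<le> (norm X)\<^sup>2" by (simp add: norm_sum_delta[OF F])
  qed
  have tot: "closure (cspan {w \<otimes> \<delta> n |(w::'h) n. True}) = UNIV"
  proof (rule dense_cspanI)
    fix x assume *: "\<And>s. s \<in> {w \<otimes> \<delta> n |(w::'h) n. True} \<Longrightarrow> cinner s x = 0"
    show "x = 0" by (rule l2_cinner_eqI) (use * in auto)
  qed
  have "X \<in> closure (cspan {w \<otimes> \<delta> n |(w::'h) n. True})" unfolding tot by simp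
  then show "((\<lambda>m. cinner (blinfun_apply (bra (\<delta> m)) X) (blinfun_apply (bra (\<delta> m)) Z :: 'h)) has_sum cinner X Z) UNIV"
  proof (rule cspan_closure_induct[OF _ bessel_subspace_left[OF bra_bops] bessel_closed_left[OF bess]])
    fix s assume "s \<in> {w \<otimes> \<delta> n |(w::'h) n. True}"
    then obtain w n where s: "s = w \<otimes> \<delta> n" by blast
    have "((\<lambda>m. cinner (blinfun_apply (bra (\<delta> m)) s) (blinfun_apply (bra (\<delta> m)) Z :: 'h)) has_sum
      (\<Sum>m\<in>{n}. cinner (blinfun_apply (bra (\<delta> m)) s) (blinfun_apply (bra (\<delta> m)) Z :: 'h))) {n}"
      by (rule has_sum_finite) simp
    then have "((\<lambda>m. cinner (blinfun_apply (bra (\<delta> m)) s) (blinfun_apply (bra (\<delta> m)) Z :: 'h)) has_sum cinner s Z) {n}"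
      by (simp add: s 1 cinner_bra)
    then show "((\<lambda>m. cinner (blinfun_apply (bra (\<delta> m)) s) (blinfun_apply (bra (\<delta> m)) Z :: 'h)) has_sum cinner s Z) UNIV"
      by (rule has_sum_cong_neutral[THEN iffD1, rotated 3]) (auto simp: s 1)
  qed
qed

lemma infsum_eq_sums:
  fixes f :: "nat \<Rightarrow> complex"
  assumes "f summable_on UNIV" "f sums S" shows "infsum f UNIV = S"
  using has_sum_imp_sums[OF has_sum_infsum[OF assms(1)]] assms(2) sums_unique2 by blast

section \<open>Countable families of intertwiners\<close>

context normal_rep
begin

text \<open>Each \<open>y k\<close> has an operator \<open>R k\<close> from
  \<open>ex_intertwiner\<close>. Their weighted squares add up to a positive contraction
  \<open>B\<close> that commutes with the representation and has all \<open>y k\<close> in its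
  closed range; the resolvent sequence of \<open>B\<close> corrects it to the identity there. The
  triple index records the resolvent step, the vector and the l2-coordinate.\<close>

lemma ex_family_triple:
  fixes y :: "nat \<Rightarrow> 'b"
  shows "\<exists>V :: nat \<times> nat \<times> nat \<Rightarrow> 'b \<Rightarrow>\<^sub>L 'h. (\<forall>i. V i \<in> bops) \<and> bessel V
    \<and> (\<forall>i. \<forall>a\<in>A. \<forall>x. blinfun_apply (V i) (blinfun_apply (j a) x) = blinfun_apply a (blinfun_apply (V i) x))
    \<and> (\<forall>k x. ((\<lambda>i. cinner (blinfun_apply (V i) (y k)) (blinfun_apply (V i) x)) has_sum cinner (y k) x) UNIV)"
proof -
  have "\<forall>k. \<exists>R :: 'b \<Rightarrow>\<^sub>L ('h, complex fock) htensor. R \<in> bops \<and> norm R \<le> 1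
    \<and> (\<forall>b\<in>A. \<forall>x. blinfun_apply R (blinfun_apply (j b) x) = blinfun_apply (tmap b id_blinfun) (blinfun_apply R x))
    \<and> (\<forall>x. blinfun_apply R x = 0 \<longrightarrow> cinner (y k) x = 0)" using ex_intertwiner by blast
  then obtain R :: "nat \<Rightarrow> 'b \<Rightarrow>\<^sub>L ('h, complex fock) htensor" where R: "\<And>k. R k \<in> bops" "\<And>k. norm (R k) \<le> 1"
    "\<And>k b x. b \<in> A \<Longrightarrow> blinfun_apply (R k) (blinfun_apply (j b) x) = blinfun_apply (tmap b id_blinfun) (blinfun_apply (R k) x)"
    "\<And>k x. blinfun_apply (R k) x = 0 \<Longrightarrow> cinner (y k) x = 0" by metis
  \<comment> \<open>Positive weights with sum 1 keep \<open>B\<close> below the identity while every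
    \<open>R k\<close> still contributes.\<close>
  define w where "w k = (1 / 2 :: real) ^ Suc k" for k
  have w: "w k > 0" "w sums 1" for k using power_half_series by (auto simp: w_def[abs_def])
  define B where "B = suminf (\<lambda>k. w k *\<^sub>R (adj (R k) o\<^sub>L R k))"
  have "norm (w k *\<^sub>R (adj (R k) o\<^sub>L R k)) \<le> w k" for k
  proof -
    have "norm (adj (R k) o\<^sub>L R k) \<le> norm (adj (R k)) * norm (R k)" by (rule norm_blinfun_compose)
    also have "\<dots> \<le> 1 * 1" using norm_adj_le[OF R(1)[of k]] R(2)[of k] by (intro mult_mono) auto
    finally show ?thesis using w(1)[of k] mult_left_mono[of "norm (adj (R k) o\<^sub>L R k)" 1 "w k"] by simp
  qed
  then have sB: "summable (\<lambda>k. w k *\<^sub>R (adj (R k) o\<^sub>L R k))"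
    by (intro summable_comparison_test'[OF sums_summable[OF w(2)]])
  have Bs: "(\<lambda>k. w k * cinner (blinfun_apply (R k) x) (blinfun_apply (R k) z)) sums cinner x (blinfun_apply B z)" for x z
  proof -
    have "(\<lambda>k. blinfun_apply (w k *\<^sub>R (adj (R k) o\<^sub>L R k)) z) sums blinfun_apply B z"
      unfolding B_def by (rule bounded_linear.sums[OF blinfun.bounded_linear_left summable_sums[OF sB]])
    then have "(\<lambda>k. cinner x (blinfun_apply (w k *\<^sub>R (adj (R k) o\<^sub>L R k)) z)) sums cinner x (blinfun_apply B z)"
      by (rule bounded_linear.sums[OF bounded_bilinear.bounded_linear_right[OF bounded_bilinear_cinner]])
    then show ?thesis by (simp add: blinfun.scaleR_left cinner_scaleR_right cinner_adj_right[OF R(1)])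
  qed
  have Bb: "B \<in> bops"
    unfolding bops_def
  proof (intro CollectI allI, rule cinner_eqI)
    fix c x z
    have 1: "(\<lambda>k. c * (w k * cinner (blinfun_apply (R k) z) (blinfun_apply (R k) x))) sums (c * cinner z (blinfun_apply B x))"
      by (rule sums_mult[OF Bs])
    have 2: "(\<lambda>k. c * (w k * cinner (blinfun_apply (R k) z) (blinfun_apply (R k) x))) sums cinner z (blinfun_apply B (c *\<^sub>C x))"
      using Bs[of z "c *\<^sub>C x"] by (simp add: bops_scaleC[OF R(1)] mult_ac)
    show "cinner z (blinfun_apply B (c *\<^sub>C x)) = cinner z (c *\<^sub>C blinfun_apply B x)"
      using sums_unique2[OF 2 1] by simp
  qed
  have Bsa: "cinner x (blinfun_apply B z) = cinner (blinfun_apply B x) z" for x z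
  proof -
    have "(\<lambda>k. cnj (w k * cinner (blinfun_apply (R k) z) (blinfun_apply (R k) x))) sums cnj (cinner z (blinfun_apply B x))"
      by (rule sums_cnj[THEN iffD2, OF Bs])
    then have "(\<lambda>k. w k * cinner (blinfun_apply (R k) x) (blinfun_apply (R k) z)) sums cinner (blinfun_apply B x) z"
      by (simp flip: cinner_commute)
    from sums_unique2[OF Bs this] show ?thesis .
  qed
  have Bre: "(\<lambda>k. w k * (norm (blinfun_apply (R k) x))\<^sup>2) sums Re (cinner x (blinfun_apply B x))" for x
    using sums_Re[OF Bs[of x x]] by (simp add: norm_power2_cinner)
  have pcB: "pos_contraction B"
    unfolding pos_contraction_def
  proof (intro conjI allI Bb Bsa)
    fix x
    show "0 \<le> Re (cinner x (blinfun_apply B x))"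
      by (rule sums_le[OF _ sums_zero Bre]) (use w(1) in \<open>simp add: less_imp_le\<close>)
    have "(norm (blinfun_apply (R k) x))\<^sup>2 \<le> (norm x)\<^sup>2" for k
    proof (rule power_mono)
      have "norm (blinfun_apply (R k) x) \<le> norm (R k) * norm x" by (rule norm_blinfun)
      also have "\<dots> \<le> 1 * norm x" by (rule mult_right_mono[OF R(2)]) simp
      finally show "norm (blinfun_apply (R k) x) \<le> norm x" by simp
    qed simp
    then have "w k * (norm (blinfun_apply (R k) x))\<^sup>2 \<le> w k * (norm x)\<^sup>2" for k
      using w(1)[of k] by (simp add: mult_left_mono)
    moreover have "(\<lambda>k. w k * (norm x)\<^sup>2) sums (1 * (norm x)\<^sup>2)" by (rule sums_mult2[OF w(2)])
    ultimately have "Re (cinner x (blinfun_apply B x)) \<le> 1 * (norm x)\<^sup>2" by (rule sums_le[OF _ Bre])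
    then show "Re (cinner x (blinfun_apply B x)) \<le> (norm x)\<^sup>2" by simp
  qed
  have Bj: "blinfun_apply B (blinfun_apply (j b) x) = blinfun_apply (j b) (blinfun_apply B x)" if b: "b \<in> A" for b x
  proof (rule cinner_eqI)
    fix z
    have bb: "adj b \<in> A" "b \<in> bops" "j b \<in> bops" "adj b \<in> bops" using vn_adj[OF vn b] vn_bops[OF vn] j_bops b by auto
    have idl: "adj (id_blinfun :: complex fock \<Rightarrow>\<^sub>L _) = id_blinfun" by (rule adj_eqI) auto
    have 1: "(\<lambda>k. w k * cinner (blinfun_apply (R k) z) (blinfun_apply (R k) (blinfun_apply (j b) x))) sums cinner z (blinfun_apply B (blinfun_apply (j b) x))"
      by (rule Bs)
    have 2: "(\<lambda>k. w k * cinner (blinfun_apply (R k) (blinfun_apply (j (adj b)) z)) (blinfun_apply (R k) x)) sums cinner (blinfun_apply (j (adj b)) z) (blinfun_apply B x)"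
      by (rule Bs)
    have 3: "cinner (blinfun_apply (R k) (blinfun_apply (j (adj b)) z)) (blinfun_apply (R k) x)
        = cinner (blinfun_apply (R k) z) (blinfun_apply (R k) (blinfun_apply (j b) x))" for k
    proof -
      have "tmap (adj b) (id_blinfun :: complex fock \<Rightarrow>\<^sub>L _) = adj (tmap b id_blinfun)"
        using adj_tmap[OF bb(2), of "id_blinfun :: complex fock \<Rightarrow>\<^sub>L _"] by (simp add: idl)
      then show ?thesis by (simp add: R(3) b bb cinner_adj_left tmap_bops)
    qed
    have "cinner z (blinfun_apply B (blinfun_apply (j b) x)) = cinner (blinfun_apply (j (adj b)) z) (blinfun_apply B x)"
      by (rule sums_unique2[OF 1 2[unfolded 3]])
    then show "cinner z (blinfun_apply B (blinfun_apply (j b) x)) = cinner z (blinfun_apply (j b) (blinfun_apply B x))"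
      using b bb by (simp add: j_adj cinner_adj_left)
  qed
  let ?D = "resolvent_seq B"
  have Dj: "blinfun_apply (?D n) (blinfun_apply (j b) x) = blinfun_apply (j b) (blinfun_apply (?D n) x)" if b: "b \<in> A" for n b x
    by (induction n arbitrary: x) (simp_all add: Bj[OF b] blinfun.diff_left blinfun.diff_right)
  note pcD = pos_contractionD[OF pos_contraction_resolvent[OF pcB]]
  \<comment> \<open>A vector orthogonal to the range of the self-adjoint \<open>B\<close> has zero
    energy, so every \<open>R l\<close> kills it; the kernel condition on \<open>R k\<close> then
    makes it orthogonal to \<open>y k\<close>.\<close>
  have yB: "y k \<in> closure (range (blinfun_apply B))" for k
  proof -
    have sub: "complex_vector.subspace (range (blinfun_apply B))"
    proof (rule complex_vector.subspaceI)
      show "0 \<in> range (blinfun_apply B)" by (rule image_eqI[of _ _ 0]) simp_all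
      fix u v assume "u \<in> range (blinfun_apply B)" "v \<in> range (blinfun_apply B)"
      then obtain p q where "u = blinfun_apply B p" "v = blinfun_apply B q" by blast
      then show "u + v \<in> range (blinfun_apply B)" by (intro image_eqI[of _ _ "p + q"]) (simp_all add: blinfun.add_right)
    next
      fix c u assume "u \<in> range (blinfun_apply B)"
      then obtain p where "u = blinfun_apply B p" by blast
      then show "c *\<^sub>C u \<in> range (blinfun_apply B)"
        by (intro image_eqI[of _ _ "c *\<^sub>C p"]) (simp_all add: bops_scaleC[OF Bb])
    qed
    obtain p where p: "p \<in> closure (range (blinfun_apply B))" "\<forall>z\<in>closure (range (blinfun_apply B)). cinner z (y k - p) = 0"
      using projection_exists[OF csubspace_closure[OF sub] closed_closure] by blast
    let ?q = "y k - p"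
    have "cinner (blinfun_apply B ?q) ?q = 0" by (rule bspec[OF p(2)], rule subsetD[OF closure_subset]) simp
    then have "Re (cinner ?q (blinfun_apply B ?q)) = 0" by (simp add: Bsa)
    then have s0: "(\<lambda>l. w l * (norm (blinfun_apply (R l) ?q))\<^sup>2) sums 0" using Bre[of ?q] by simp
    have "w l * (norm (blinfun_apply (R l) ?q))\<^sup>2 = 0" for l
    proof (rule antisym)
      show "w l * (norm (blinfun_apply (R l) ?q))\<^sup>2 \<le> 0"
        using sum_le_suminf[OF sums_summable[OF s0], of "{l}"] w(1) sums_unique[OF s0] by (simp add: less_imp_le)
    qed (use w(1)[of l] in simp)
    from this[of k] have "blinfun_apply (R k) ?q = 0" using w(1)[of k] by simp
    then have "cinner (y k) ?q = 0" by (rule R(4))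
    moreover have "cinner p ?q = 0" using p by blast
    ultimately have "cinner ?q ?q = 0" by (simp add: cinner_diff_left)
    then have "y k = p" by (simp add: cinner_eq_zero_iff)
    then show ?thesis using p(1) by simp
  qed
  \<comment> \<open>Resolvent, intertwiner and coordinate in turn, so that summing squares over the
    coordinates and then over \<open>k\<close> reproduces the form of \<open>B\<close> at the
    resolvent vectors.\<close>
  define V where "V i = sqrt (w (fst (snd i))) *\<^sub>R (bra (\<delta> (snd (snd i))) o\<^sub>L R (fst (snd i)) o\<^sub>L ?D (fst i))"
    for i :: "nat \<times> nat \<times> nat"
  have Vap: "blinfun_apply (V (n, k, m)) x = sqrt (w k) *\<^sub>R blinfun_apply (bra (\<delta> m)) (blinfun_apply (R k) (blinfun_apply (?D n) x))"
    for n k m x by (simp add: V_def blinfun.scaleR_left)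
  have ww: "complex_of_real (sqrt (w k)) * complex_of_real (sqrt (w k)) = complex_of_real (w k)" for k
    using w(1)[of k] by (simp flip: of_real_mult)
  have Vin: "cinner (blinfun_apply (V (n, k, m)) x) (blinfun_apply (V (n, k, m)) z) = w k * cinner
      (blinfun_apply (bra (\<delta> m)) (blinfun_apply (R k) (blinfun_apply (?D n) x)))
      (blinfun_apply (bra (\<delta> m)) (blinfun_apply (R k) (blinfun_apply (?D n) z)))" for n k m x z
    by (simp add: Vap cinner_scaleR_left cinner_scaleR_right ww flip: mult.assoc)
  have Vno: "(norm (blinfun_apply (V (n, k, m)) x))\<^sup>2 = w k * (norm (blinfun_apply (bra (\<delta> m)) (blinfun_apply (R k) (blinfun_apply (?D n) x))))\<^sup>2"
    for n k m x using w(1)[of k] by (simp add: Vap power_mult_distrib)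
  have bes: "bessel V"
    unfolding bessel_def
  proof (intro allI impI)
    fix F :: "(nat \<times> nat \<times> nat) set" and x assume F: "finite F"
    have "finite (fst ` F \<union> (fst \<circ> snd) ` F \<union> (snd \<circ> snd) ` F)" using F by simp
    then obtain N where N: "fst ` F \<union> (fst \<circ> snd) ` F \<union> (snd \<circ> snd) ` F \<subseteq> {..<N}" by (meson finite_nat_iff_bounded)
    have sub: "F \<subseteq> {..<N} \<times> {..<N} \<times> {..<N}"
    proof
      fix i assume "i \<in> F"
      then have "fst i \<in> {..<N}" "(fst \<circ> snd) i \<in> {..<N}" "(snd \<circ> snd) i \<in> {..<N}" using N by blast+
      then show "i \<in> {..<N} \<times> {..<N} \<times> {..<N}" by (cases i) auto
    qed
    have "(\<Sum>i\<in>F. (norm (blinfun_apply (V i) x))\<^sup>2) \<le> (\<Sum>i\<in>{..<N} \<times> {..<N} \<times> {..<N}. (norm (blinfun_apply (V i) x))\<^sup>2)"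
      by (rule sum_mono2[OF _ sub]) auto
    also have "\<dots> = (\<Sum>n<N. \<Sum>k<N. w k * (\<Sum>m<N. (norm (blinfun_apply (bra (\<delta> m) :: _ \<Rightarrow>\<^sub>L 'h) (blinfun_apply (R k) (blinfun_apply (?D n) x))))\<^sup>2))"
    proof -
      have "sum g ({..<N} \<times> {..<N} \<times> {..<N}) = (\<Sum>n<N. \<Sum>k<N. \<Sum>m<N. g (n, k, m))" for g :: "_ \<Rightarrow> real"
        by (simp add: sum.cartesian_product case_prod_unfold)
      then show ?thesis by (simp add: Vno sum_distrib_left)
    qed
    also have "\<dots> \<le> (\<Sum>n<N. Re (cinner (blinfun_apply (?D n) x) (blinfun_apply B (blinfun_apply (?D n) x))))"
    proof (rule sum_mono)
      fix n
      let ?z = "blinfun_apply (?D n) x"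
      have "(\<Sum>k<N. w k * (\<Sum>m<N. (norm (blinfun_apply (bra (\<delta> m) :: _ \<Rightarrow>\<^sub>L 'h) (blinfun_apply (R k) ?z)))\<^sup>2))
        \<le> (\<Sum>k<N. w k * (norm (blinfun_apply (R k) ?z))\<^sup>2)"
        by (intro sum_mono mult_left_mono besselD[OF bessel_bra_delta]) (use w(1) in \<open>auto simp: less_imp_le\<close>)
      also have "\<dots> \<le> Re (cinner ?z (blinfun_apply B ?z))"
        using sum_le_suminf[OF sums_summable[OF Bre], of "{..<N}" ?z] w(1) sums_unique[OF Bre, of ?z]
        by (simp add: less_imp_le)
      finally show "(\<Sum>k<N. w k * (\<Sum>m<N. (norm (blinfun_apply (bra (\<delta> m) :: _ \<Rightarrow>\<^sub>L 'h) (blinfun_apply (R k) ?z)))\<^sup>2))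
        \<le> Re (cinner ?z (blinfun_apply B ?z))" .
    qed
    also have "\<dots> \<le> (norm x)\<^sup>2" by (rule resolvent_energy[OF pcB])
    finally show "(\<Sum>i\<in>F. (norm (blinfun_apply (V i) x))\<^sup>2) \<le> (norm x)\<^sup>2" .
  qed
  have hs: "((\<lambda>i. cinner (blinfun_apply (V i) (y l)) (blinfun_apply (V i) x)) has_sum cinner (y l) x) UNIV" for l x
  proof -
    let ?f = "\<lambda>i. cinner (blinfun_apply (V i) (y l)) (blinfun_apply (V i) x)"
    \<comment> \<open>Absolute summability comes from the Bessel bound and allows the triple sum to
      be evaluated one index at a time.\<close>
    have "(\<lambda>i. norm (?f i)) summable_on UNIV"
    proof (rule nonneg_bdd_above_summable_on)
      have "(\<Sum>i\<in>F. norm (?f i)) \<le> norm (y l) * norm x" if "finite F" for F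
        using bessel_sum_bound[OF bes that, of "y l" x] sum_mono[of F "\<lambda>i. norm (?f i)"
            "\<lambda>i. norm (blinfun_apply (V i) (y l)) * norm (blinfun_apply (V i) x)"] cmod_cinner_le
        by (meson order_trans)
      then show "bdd_above (sum (\<lambda>i. norm (?f i)) ` {F. F \<subseteq> UNIV \<and> finite F})" by (auto intro!: bdd_aboveI2)
    qed simp
    then have sm: "?f summable_on UNIV \<times> UNIV \<times> UNIV" by (simp add: abs_summable_summable)
    have inner: "infsum (\<lambda>m. ?f (n, k, m)) UNIV = w k * cinner (blinfun_apply (R k) (blinfun_apply (?D n) (y l))) (blinfun_apply (R k) (blinfun_apply (?D n) x))" for n k
      unfolding Vin by (rule infsumI[OF has_sum_cmult_right[OF bra_delta_has_sum]])
    have sm2: "(\<lambda>km. ?f (n, km)) summable_on UNIV \<times> UNIV" for n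
      using summable_on_SigmaD1[of "\<lambda>n km. ?f (n, km)" UNIV "\<lambda>_. UNIV \<times> UNIV"] sm by (simp add: case_prod_unfold)
    have mid: "infsum (\<lambda>km. ?f (n, km)) UNIV = cinner (blinfun_apply (?D n) (y l)) (blinfun_apply B (blinfun_apply (?D n) x))" for n
    proof -
      have "infsum (\<lambda>km. ?f (n, km)) (UNIV \<times> UNIV) = infsum (\<lambda>k. infsum (\<lambda>m. ?f (n, k, m)) UNIV) UNIV"
        using infsum_Sigma'_banach[of "\<lambda>k m. ?f (n, k, m)" UNIV "\<lambda>_. UNIV"] sm2 by (simp add: case_prod_unfold)
      also have "\<dots> = cinner (blinfun_apply (?D n) (y l)) (blinfun_apply B (blinfun_apply (?D n) x))"
      proof (rule infsum_eq_sums)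
        show "(\<lambda>k. infsum (\<lambda>m. ?f (n, k, m)) UNIV) summable_on UNIV"
          using summable_on_Sigma_banach[of "\<lambda>k m. ?f (n, k, m)" UNIV "\<lambda>_. UNIV"] sm2 by (simp add: case_prod_unfold)
        show "(\<lambda>k. infsum (\<lambda>m. ?f (n, k, m)) UNIV) sums cinner (blinfun_apply (?D n) (y l)) (blinfun_apply B (blinfun_apply (?D n) x))"
          unfolding inner by (rule Bs)
      qed
      finally show ?thesis by simp
    qed
    have "infsum ?f (UNIV \<times> UNIV) = infsum (\<lambda>n. infsum (\<lambda>km. ?f (n, km)) UNIV) UNIV"
      using infsum_Sigma'_banach[of "\<lambda>n km. ?f (n, km)" UNIV "\<lambda>_. UNIV"] sm by (simp add: case_prod_unfold)
    also have "\<dots> = cinner (y l) x"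
    proof (rule infsum_eq_sums)
      show "(\<lambda>n. infsum (\<lambda>km. ?f (n, km)) UNIV) summable_on UNIV"
        using summable_on_Sigma_banach[of "\<lambda>n km. ?f (n, km)" UNIV "\<lambda>_. UNIV"] sm by (simp add: case_prod_unfold)
      show "(\<lambda>n. infsum (\<lambda>km. ?f (n, km)) UNIV) sums cinner (y l) x"
        unfolding mid by (rule resolvent_sums[OF pcB yB])
    qed
    finally have "infsum ?f UNIV = cinner (y l) x" by simp
    then show ?thesis using has_sum_infsum[OF sm] by simp
  qed
  have Vj: "blinfun_apply (V i) (blinfun_apply (j a) x) = blinfun_apply a (blinfun_apply (V i) x)" if a: "a \<in> A" for i a x
  proof -
    have ab: "a \<in> bops" by (rule vn_bops[OF vn a])
    have idl: "adj (id_blinfun :: complex fock \<Rightarrow>\<^sub>L _) = id_blinfun" by (rule adj_eqI) auto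
    have br: "blinfun_apply (bra (\<delta> m)) (blinfun_apply (tmap a id_blinfun) X) = blinfun_apply a (blinfun_apply (bra (\<delta> m)) X)" for m X
    proof (rule cinner_eqI)
      fix z
      have "cinner z (blinfun_apply (bra (\<delta> m)) (blinfun_apply (tmap a id_blinfun) X)) = cinner (blinfun_apply (adj (tmap a id_blinfun)) (z \<otimes> \<delta> m)) X"
        by (simp add: cinner_bra cinner_adj_left tmap_bops ab)
      also have "\<dots> = cinner (blinfun_apply (adj a) z \<otimes> \<delta> m) X"
        using adj_tmap[OF ab, of "id_blinfun :: complex fock \<Rightarrow>\<^sub>L _"] by (simp add: idl tmap_tensor adj_bops ab)
      also have "\<dots> = cinner z (blinfun_apply a (blinfun_apply (bra (\<delta> m)) X))"
        by (simp add: cinner_adj_left ab flip: cinner_bra)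
      finally show "cinner z (blinfun_apply (bra (\<delta> m)) (blinfun_apply (tmap a id_blinfun) X)) = cinner z (blinfun_apply a (blinfun_apply (bra (\<delta> m)) X))" .
    qed
    obtain n k m where i: "i = (n, k, m)" by (cases i)
    show ?thesis unfolding i Vap Dj[OF a] R(3)[OF a] br by (simp add: blinfun.scaleR_right)
  qed
  have "V i \<in> bops" for i unfolding V_def using R(1) pcD(1) bra_bops by (intro bops_intros bops_compose) auto
  then show ?thesis using bes hs Vj by (intro exI[of _ V]) blast
qed

text \<open>A bijection of \<open>nat\<close> with the triples; sequences are wanted because
  ultraweak functionals are indexed by \<open>nat\<close>.\<close>

lemma ex_family:
  fixes y :: "nat \<Rightarrow> 'b"
  obtains V :: "nat \<Rightarrow> 'b \<Rightarrow>\<^sub>L 'h" where "\<And>i. V i \<in> bops" "bessel V"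
    "\<And>i a x. a \<in> A \<Longrightarrow> blinfun_apply (V i) (blinfun_apply (j a) x) = blinfun_apply a (blinfun_apply (V i) x)"
    "\<And>k x. ((\<lambda>i. cinner (blinfun_apply (V i) (y k)) (blinfun_apply (V i) x)) has_sum cinner (y k) x) UNIV"
proof -
  obtain V :: "nat \<times> nat \<times> nat \<Rightarrow> 'b \<Rightarrow>\<^sub>L 'h" where V: "\<And>i. V i \<in> bops" "bessel V"
    "\<And>i a x. a \<in> A \<Longrightarrow> blinfun_apply (V i) (blinfun_apply (j a) x) = blinfun_apply a (blinfun_apply (V i) x)"
    "\<And>k x. ((\<lambda>i. cinner (blinfun_apply (V i) (y k)) (blinfun_apply (V i) x)) has_sum cinner (y k) x) UNIV"
    using ex_family_triple[of y] by blast
  let ?\<phi> = "from_nat_into (UNIV :: (nat \<times> nat \<times> nat) set)"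
  have bij: "bij_betw ?\<phi> UNIV UNIV"
    by (rule bij_betw_from_nat_into) (auto simp: finite_prod)
  show thesis
  proof (rule that[of "\<lambda>i. V (?\<phi> i)"])
    show "bessel (\<lambda>i. V (?\<phi> i))"
      unfolding bessel_def
    proof (intro allI impI)
      fix F :: "nat set" and x assume "finite F"
      have "inj_on ?\<phi> F" using bij by (meson bij_betw_imp_inj_on inj_on_subset subset_UNIV)
      then have "(\<Sum>i\<in>F. (norm (blinfun_apply (V (?\<phi> i)) x))\<^sup>2) = (\<Sum>i\<in>?\<phi> ` F. (norm (blinfun_apply (V i) x))\<^sup>2)"
        by (simp add: sum.reindex)
      then show "(\<Sum>i\<in>F. (norm (blinfun_apply (V (?\<phi> i)) x))\<^sup>2) \<le> (norm x)\<^sup>2"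
        using besselD[OF V(2), of "?\<phi> ` F" x] \<open>finite F\<close> by simp
    qed
    show "((\<lambda>i. cinner (blinfun_apply (V (?\<phi> i)) (y k)) (blinfun_apply (V (?\<phi> i)) x)) has_sum cinner (y k) x) UNIV" for k x
      using has_sum_reindex_bij_betw[OF bij, of "\<lambda>i. cinner (blinfun_apply (V i) (y k)) (blinfun_apply (V i) x)"] V(4) by simp
  qed (use V in auto)
qed

end

section \<open>Amplification of normal representations\<close>

definition ketl :: "'c::complex_inner \<Rightarrow> 'h::complex_inner \<Rightarrow>\<^sub>L ('c, 'h) htensor" where
  "ketl c = Blinfun (\<lambda>v. c \<otimes> v)"

lemma ketl_apply [simp]: "blinfun_apply (ketl c) v = c \<otimes> v"
  unfolding ketl_def
  by (subst bounded_linear_Blinfun_apply)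
    (auto intro: bounded_bilinear.bounded_linear_right[OF bounded_bilinear_tensor])

lemma ketl_bops: "ketl c \<in> bops"
  by (simp add: bops_def tensor_scale_right)

text \<open>The slice of \<open>T\<close> by the vector functional of \<open>c\<close> and
  \<open>d\<close> on the first factor. Slices reduce statements about the amplified representation
  to the representation itself.\<close>

definition slice :: "'c::complex_inner \<Rightarrow> 'c \<Rightarrow> (('c, 'h::complex_inner) htensor \<Rightarrow>\<^sub>L ('c, 'h) htensor) \<Rightarrow> ('h \<Rightarrow>\<^sub>L 'h)" where
  "slice c d T = adj (ketl c) o\<^sub>L T o\<^sub>L ketl d"

lemma cinner_slice: "cinner x (blinfun_apply (slice c d T) y) = cinner (c \<otimes> x) (blinfun_apply T (d \<otimes> y))"
  for x :: "'h::chilbert_space"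
  by (simp add: slice_def cinner_adj_right[OF ketl_bops])

lemma slice_bops: "T \<in> bops \<Longrightarrow> slice c d T \<in> bops" for T :: "('c::complex_inner, 'h::chilbert_space) htensor \<Rightarrow>\<^sub>L _"
  unfolding slice_def by (intro bops_compose adj_bops ketl_bops)

abbreviation amp :: "('h::complex_inner \<Rightarrow>\<^sub>L 'g::complex_inner) \<Rightarrow> (('c::complex_inner, 'h) htensor \<Rightarrow>\<^sub>L ('c, 'g) htensor)" where
  "amp S \<equiv> tmap id_blinfun S"

lemma adj_id: "adj (id_blinfun :: 'a::chilbert_space \<Rightarrow>\<^sub>L 'a) = id_blinfun"
  by (rule adj_eqI) auto

lemma adj_amp:
  fixes S :: "'h::chilbert_space \<Rightarrow>\<^sub>L 'g::chilbert_space"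
  assumes "S \<in> bops"
  shows "adj (amp S :: ('c::chilbert_space, 'h) htensor \<Rightarrow>\<^sub>L ('c, 'g) htensor) = amp (adj S)"
  using adj_tmap[of "id_blinfun :: 'c \<Rightarrow>\<^sub>L 'c", OF bops_intros(1) assms] by (simp add: adj_id)

lemma cinner_amp_left:
  fixes S :: "'h::chilbert_space \<Rightarrow>\<^sub>L 'g::chilbert_space"
  assumes "S \<in> bops"
  shows "cinner (c \<otimes> x) (blinfun_apply (amp S) z) = cinner ((c::'c::chilbert_space) \<otimes> blinfun_apply (adj S) x) z"
proof -
  have "cinner (c \<otimes> x) (blinfun_apply (amp S) z) = cinner (blinfun_apply (adj (amp S)) (c \<otimes> x)) z"
    using assms by (simp add: cinner_adj_left tmap_bops)
  then show ?thesis using assms by (simp add: adj_amp tmap_tensor adj_bops)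
qed

text \<open>By the bicommutant property these are the operators on \<open>c \<otimes> h\<close> all of whose slices lie in \<open>A\<close>.\<close>

definition slice_algebra :: "('h::chilbert_space \<Rightarrow>\<^sub>L 'h) set \<Rightarrow> (('c::chilbert_space, 'h) htensor \<Rightarrow>\<^sub>L ('c, 'h) htensor) set" where
  "slice_algebra A = {T \<in> bops. \<forall>S\<in>commutant A. \<forall>z. blinfun_apply T (blinfun_apply (amp S) z) = blinfun_apply (amp S) (blinfun_apply T z)}"

lemma slice_algebra_bops: "T \<in> slice_algebra A \<Longrightarrow> T \<in> bops"
  by (simp add: slice_algebra_def)

lemma commutant_bops: "S \<in> commutant A \<Longrightarrow> S \<in> bops"
  by (simp add: commutant_def)

text \<open>Commutation of \<open>T\<close> with \<open>amp S\<close> becomes commutation of each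
  slice with \<open>S\<close>, and the bicommutant property places the slice in
  \<open>A\<close>.\<close>

lemma slice_in:
  assumes A: "von_neumann_algebra A" and T: "T \<in> slice_algebra A"
  shows "slice c d T \<in> A"
proof (rule vnI[OF A slice_bops[OF slice_algebra_bops[OF T]]])
  fix S x assume S: "S \<in> commutant A" "S \<in> bops"
  show "blinfun_apply (slice c d T) (blinfun_apply S x) = blinfun_apply S (blinfun_apply (slice c d T) x)"
  proof (rule cinner_eqI)
    fix z
    have "cinner z (blinfun_apply (slice c d T) (blinfun_apply S x)) = cinner (c \<otimes> z) (blinfun_apply T (blinfun_apply (amp S) (d \<otimes> x)))"
      using S by (simp add: cinner_slice tmap_tensor)
    also have "\<dots> = cinner (c \<otimes> z) (blinfun_apply (amp S) (blinfun_apply T (d \<otimes> x)))"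
      using T S(1) by (simp add: slice_algebra_def)
    also have "\<dots> = cinner z (blinfun_apply S (blinfun_apply (slice c d T) x))"
      unfolding cinner_amp_left[OF S(2)] using S(2) by (simp add: cinner_adj_left flip: cinner_slice)
    finally show "cinner z (blinfun_apply (slice c d T) (blinfun_apply S x)) = cinner z (blinfun_apply S (blinfun_apply (slice c d T) x))" .
  qed
qed

lemma slice_algebra_compose: "S \<in> slice_algebra A \<Longrightarrow> T \<in> slice_algebra A \<Longrightarrow> S o\<^sub>L T \<in> slice_algebra A"
  by (simp add: slice_algebra_def)

lemma slice_algebra_adj:
  fixes A :: "('h::chilbert_space \<Rightarrow>\<^sub>L 'h) set" and T :: "('c::chilbert_space, 'h) htensor \<Rightarrow>\<^sub>L ('c, 'h) htensor"
  assumes A: "von_neumann_algebra A" and T: "T \<in> slice_algebra A" shows "adj T \<in> slice_algebra A"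
  unfolding slice_algebra_def
proof (intro CollectI conjI ballI allI)
  note Tb = slice_algebra_bops[OF T]
  show "adj T \<in> bops" by (rule adj_bops[OF Tb])
  fix S and z :: "('c, 'h) htensor" assume S: "S \<in> commutant A"
  note Sb = commutant_bops[OF S] and S' = commutant_adj[OF A S]
  note Sb' = commutant_bops[OF S']
  have aS: "amp S = adj (amp (adj S) :: ('c, 'h) htensor \<Rightarrow>\<^sub>L _)" using adj_amp[OF Sb', where 'c = 'c] by (simp add: adj_adj Sb)
  show "blinfun_apply (adj T) (blinfun_apply (amp S) z) = blinfun_apply (amp S) (blinfun_apply (adj T) z)"
  proof (rule cinner_eqI)
    fix w
    have "cinner w (blinfun_apply (adj T) (blinfun_apply (amp S) z)) = cinner (blinfun_apply (amp (adj S)) (blinfun_apply T w)) z"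
      unfolding aS using Sb' by (simp add: cinner_adj_right Tb tmap_bops)
    also have "blinfun_apply (amp (adj S)) (blinfun_apply T w) = blinfun_apply T (blinfun_apply (amp (adj S)) w)"
      using T S' by (simp add: slice_algebra_def)
    also have "cinner \<dots> z = cinner w (blinfun_apply (amp S) (blinfun_apply (adj T) z))"
      unfolding aS using Sb' by (simp add: cinner_adj_right Tb tmap_bops)
    finally show "cinner w (blinfun_apply (adj T) (blinfun_apply (amp S) z)) = cinner w (blinfun_apply (amp S) (blinfun_apply (adj T) z))" .
  qed
qed

lemma tensor_in_slice_algebra:
  fixes A :: "('h::chilbert_space \<Rightarrow>\<^sub>L 'h) set" and S :: "'c::chilbert_space \<Rightarrow>\<^sub>L 'c"
  assumes A: "von_neumann_algebra A" and S: "S \<in> bops" and a: "a \<in> A"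
  shows "tmap S a \<in> slice_algebra A"
  unfolding slice_algebra_def
proof (intro CollectI conjI ballI allI)
  note ab = vn_bops[OF A a]
  show "tmap S a \<in> bops" by (rule tmap_bops[OF S ab])
  fix C z assume C: "C \<in> commutant A"
  note Cb = commutant_bops[OF C]
  have "tmap S a o\<^sub>L amp C = amp C o\<^sub>L tmap S a"
    by (rule tensor_operator_eqI) (use S ab Cb vnD[OF a C] in \<open>auto simp: tmap_bops tmap_tensor\<close>)
  from arg_cong[OF this, of "\<lambda>R. blinfun_apply R z"]
  show "blinfun_apply (tmap S a) (blinfun_apply (amp C) z) = blinfun_apply (amp C) (blinfun_apply (tmap S a) z)" by simp
qed

text \<open>The generators commute with every \<open>amp S\<close>. For fixed vectors this
  commutation is the vanishing of a two-term functional as in \<open>ultraweak_closure_eq\<close>,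
  hence it survives the ultraweak closure.\<close>

lemma uw_tensor_slice_algebra:
  fixes A :: "('h::chilbert_space \<Rightarrow>\<^sub>L 'h) set"
  assumes A: "von_neumann_algebra A" and T: "T \<in> (bops :: ('c::chilbert_space \<Rightarrow>\<^sub>L 'c) set) \<otimes>\<^sub>u\<^sub>w A"
  shows "T \<in> slice_algebra A"
proof -
  let ?G = "cspan {S \<otimes>\<^sub>o T |S T. S \<in> (bops :: ('c \<Rightarrow>\<^sub>L 'c) set) \<and> T \<in> A}"
  have sub: "complex_vector.subspace (slice_algebra A :: (('c, 'h) htensor \<Rightarrow>\<^sub>L ('c, 'h) htensor) set)"
    unfolding complex_vector.subspace_def slice_algebra_def
    by (auto simp: blinfun.add_left blinfun.add_right scaleC_blinfun.rep_eq)
      (metis bops_scaleC bops_intros(1) commutant_bops tmap_bops)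
  have G: "?G \<subseteq> slice_algebra A"
    by (rule complex_vector.span_minimal[OF _ sub]) (use tensor_in_slice_algebra[OF A] in \<open>auto simp: op_tensor_tmap\<close>)
  have T': "T \<in> ultraweak closure_of ?G" using T by (simp add: uw_tensor_def)
  have "?G \<subseteq> bops" using G slice_algebra_bops by blast
  note Tb = ultraweak_closure_bops[OF T' this]
  have "blinfun_apply T (blinfun_apply (amp S) z) = blinfun_apply (amp S) (blinfun_apply T z)" if S: "S \<in> commutant A" for S z
  proof (rule cinner_eqI)
    fix w
    have aSb: "(amp S :: ('c, 'h) htensor \<Rightarrow>\<^sub>L _) \<in> bops" using commutant_bops[OF S] by (simp add: tmap_bops)
    have "cinner w (blinfun_apply T (blinfun_apply (amp S) z)) + cinner (- blinfun_apply (adj (amp S)) w) (blinfun_apply T z) = 0"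
    proof (rule ultraweak_closure_eq[OF T'])
      fix R assume "R \<in> ?G"
      then have "blinfun_apply R (blinfun_apply (amp S) z) = blinfun_apply (amp S) (blinfun_apply R z)"
        using G S by (auto simp: slice_algebra_def)
      then show "cinner w (blinfun_apply R (blinfun_apply (amp S) z)) + cinner (- blinfun_apply (adj (amp S)) w) (blinfun_apply R z) = 0"
        by (simp add: cinner_adj_left[OF aSb])
    qed
    then show "cinner w (blinfun_apply T (blinfun_apply (amp S) z)) = cinner w (blinfun_apply (amp S) (blinfun_apply T z))"
      by (simp add: cinner_adj_left[OF aSb])
  qed
  then show ?thesis using Tb by (simp add: slice_algebra_def)
qed

lemma tensor_closure: "u \<in> closure (cspan {x \<otimes> y |x y. True})"
  unfolding tensor_total by simp

text \<open>On an algebraic tensor expanded over an orthonormal set the estimate splits into the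
  Bessel bounds of the coefficients; for a fixed finite \<open>F\<close> it is a closed
  condition.\<close>

lemma bessel_amp:
  fixes V :: "'i \<Rightarrow> 'b::chilbert_space \<Rightarrow>\<^sub>L 'h::chilbert_space"
  assumes Vb: "\<And>i. V i \<in> bops" and V: "bessel V"
  shows "bessel (\<lambda>i. amp (V i) :: ('c::chilbert_space, 'b) htensor \<Rightarrow>\<^sub>L ('c, 'h) htensor)"
  unfolding bessel_def
proof (intro allI impI)
  fix F :: "'i set" and u :: "('c, 'b) htensor" assume F: "finite F"
  let ?P = "\<lambda>u :: ('c, 'b) htensor. (\<Sum>i\<in>F. (norm (blinfun_apply (amp (V i) :: _ \<Rightarrow>\<^sub>L ('c, 'h) htensor) u))\<^sup>2) \<le> (norm u)\<^sup>2"
  have "cspan {x \<otimes> y |x y. True} \<subseteq> {u. ?P u}"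
  proof
    fix u :: "('c, 'b) htensor" assume "u \<in> cspan {x \<otimes> y |x y. True}"
    then have "u \<in> cspan ((\<lambda>p. fst p \<otimes> snd p) ` UNIV)" by (simp add: range_tensor)
    then obtain A c where A: "finite A" "u = (\<Sum>p\<in>A. c p *\<^sub>C (fst p \<otimes> snd p))"
      unfolding cspan_image_explicit by blast
    obtain E where E: "finite E" "orthonormal E"
      and ex: "\<And>p. p \<in> A \<Longrightarrow> c p *\<^sub>C fst p = (\<Sum>e\<in>E. cinner e (c p *\<^sub>C fst p) *\<^sub>C e)"
      using orthonormal_expansion[OF A(1), of "\<lambda>p. c p *\<^sub>C fst p"] by blast
    define Y where "Y e = (\<Sum>p\<in>A. cinner e (c p *\<^sub>C fst p) *\<^sub>C snd p)" for e
    have u: "u = (\<Sum>e\<in>E. e \<otimes> Y e)"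
      unfolding Y_def A(2) by (subst tensor_expand_left[OF ex, symmetric]) (auto simp: tensor_scale_left)
    have "(\<Sum>i\<in>F. (norm (blinfun_apply (amp (V i) :: _ \<Rightarrow>\<^sub>L ('c, 'h) htensor) u))\<^sup>2) = (\<Sum>i\<in>F. \<Sum>e\<in>E. (norm (blinfun_apply (V i) (Y e)))\<^sup>2)"
      unfolding u by (simp add: bops_sum tmap_tensor Vb norm_sum_tensor_left[OF E])
    also have "\<dots> = (\<Sum>e\<in>E. \<Sum>i\<in>F. (norm (blinfun_apply (V i) (Y e)))\<^sup>2)" by (rule sum.swap)
    also have "\<dots> \<le> (\<Sum>e\<in>E. (norm (Y e))\<^sup>2)" by (intro sum_mono besselD[OF V F])
    also have "\<dots> = (norm u)\<^sup>2" unfolding u by (rule norm_sum_tensor_left[OF E, symmetric])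
    finally show "u \<in> {u. ?P u}" by simp
  qed
  then have "closure (cspan {x \<otimes> y |x y. True}) \<subseteq> {u. ?P u}"
    by (rule closure_minimal) (intro closed_Collect_le continuous_intros)
  then show "?P u" using tensor_closure by blast
qed

text \<open>The arguments are reached by density one after the other: first \<open>z\<close>,
  against an elementary tensor over some \<open>y k\<close>, and then \<open>u\<close>. The symmetry
  of the sum under exchange of its arguments links the two stages.\<close>

lemma amp_has_sum:
  fixes V :: "'i \<Rightarrow> 'b::chilbert_space \<Rightarrow>\<^sub>L 'h::chilbert_space"
  assumes Vb: "\<And>i. V i \<in> bops" and V: "bessel V"
    and hs: "\<And>k x. ((\<lambda>i. cinner (blinfun_apply (V i) (y k)) (blinfun_apply (V i) x)) has_sum cinner (y k) x) UNIV"
    and u: "u \<in> closure (cspan {c \<otimes> y k |(c::'c::chilbert_space) k. True})"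
  shows "((\<lambda>i. cinner (blinfun_apply (amp (V i)) u) (blinfun_apply (amp (V i)) z)) has_sum cinner u z) UNIV"
  using u
proof (rule cspan_closure_induct)
  note ab = tmap_bops[OF bops_intros(1) Vb]
  note bes = bessel_amp[OF Vb V]
  show "complex_vector.subspace {u :: ('c, 'b) htensor. ((\<lambda>i. cinner (blinfun_apply (amp (V i)) u) (blinfun_apply (amp (V i)) z)) has_sum cinner u z) UNIV}"
    by (rule bessel_subspace_left[OF ab])
  show "closed {u :: ('c, 'b) htensor. ((\<lambda>i. cinner (blinfun_apply (amp (V i)) u) (blinfun_apply (amp (V i)) z)) has_sum cinner u z) UNIV}"
    by (rule bessel_closed_left[OF bes])
  fix s assume "s \<in> {c \<otimes> y k |(c::'c) k. True}"
  then obtain c k where s: "s = c \<otimes> y k" by blast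
  have "((\<lambda>i. cinner (blinfun_apply (amp (V i)) z) (blinfun_apply (amp (V i)) s)) has_sum cinner z s) UNIV"
    using tensor_closure[of z]
  proof (rule cspan_closure_induct[OF _ bessel_subspace_left[OF ab] bessel_closed_left[OF bes]])
    fix t :: "('c, 'b) htensor" assume "t \<in> {x \<otimes> y |x y. True}"
    then obtain d x where t: "t = d \<otimes> x" by blast
    have "((\<lambda>i. cinner d c * cinner (blinfun_apply (V i) x) (blinfun_apply (V i) (y k))) has_sum cinner d c * cinner x (y k)) UNIV"
      by (rule has_sum_cmult_right[OF has_sum_cinner_swap[OF hs]])
    then show "((\<lambda>i. cinner (blinfun_apply (amp (V i)) t) (blinfun_apply (amp (V i)) s)) has_sum cinner t s) UNIV"
      by (simp add: s t tmap_tensor Vb)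
  qed
  then show "((\<lambda>i. cinner (blinfun_apply (amp (V i)) s) (blinfun_apply (amp (V i)) z)) has_sum cinner s z) UNIV"
    by (rule has_sum_cinner_swap)
qed

lemma has_sum_finite_sum:
  fixes f :: "'p \<Rightarrow> 'i \<Rightarrow> complex"
  assumes "\<And>p. p \<in> P \<Longrightarrow> (f p has_sum S p) U"
  shows "((\<lambda>i. \<Sum>p\<in>P. f p i) has_sum (\<Sum>p\<in>P. S p)) U"
  using assms by (induction P rule: infinite_finite_induct) (auto intro!: has_sum_add has_sum_0)

text \<open>Approximating each \<open>u n\<close> by finite sums involves only countably many second
  factors altogether, so a single intertwining family serves the whole sequence.\<close>

lemma ex_countable_support:
  fixes u :: "nat \<Rightarrow> ('c::chilbert_space, 'b::chilbert_space) htensor"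
  obtains y :: "nat \<Rightarrow> 'b" where "\<And>n. u n \<in> closure (cspan {c \<otimes> y k |c k. True})"
proof -
  have "\<exists>Ac. finite (fst Ac) \<and> dist (\<Sum>p\<in>fst Ac. snd Ac p *\<^sub>C (fst p \<otimes> snd p)) (u n) < inverse (real (Suc m))" for n m
  proof -
    have "u n \<in> closure (cspan ((\<lambda>p. fst p \<otimes> snd p) ` UNIV))" using tensor_closure[of "u n"] by (simp add: range_tensor)
    then obtain z where "z \<in> cspan ((\<lambda>p. fst p \<otimes> snd p) ` UNIV)" "dist z (u n) < inverse (real (Suc m))"
      unfolding closure_approachable by (metis inverse_positive_iff_positive of_nat_0_less_iff zero_less_Suc)
    then obtain A c where "finite A" "dist (\<Sum>p\<in>A. c p *\<^sub>C (fst p \<otimes> snd p)) (u n) < inverse (real (Suc m))"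
      unfolding cspan_image_explicit by blast
    then show ?thesis by (intro exI[of _ "(A, c)"]) simp
  qed
  then have "\<forall>nm. \<exists>Ac. finite (fst Ac) \<and> dist (\<Sum>p\<in>fst Ac. snd Ac p *\<^sub>C (fst p \<otimes> snd p)) (u (fst nm)) < inverse (real (Suc (snd nm)))"
    by blast
  from choice[OF this] obtain f where f: "\<forall>nm. finite (fst (f nm)) \<and>
    dist (\<Sum>p\<in>fst (f nm). snd (f nm) p *\<^sub>C (fst p \<otimes> snd p)) (u (fst nm)) < inverse (real (Suc (snd nm)))" ..
  define A c where "A n m = fst (f (n, m))" and "c n m = snd (f (n, m))" for n m
  have A: "finite (A n m)" "dist (\<Sum>p\<in>A n m. c n m p *\<^sub>C (fst p \<otimes> snd p)) (u n) < inverse (real (Suc m))" for n m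
    using f[rule_format, of "(n, m)"] by (simp_all add: A_def c_def)
  \<comment> \<open>Zero is inserted so that \<open>S\<close> is nonempty and
    \<open>from_nat_into\<close> enumerates it.\<close>
  define S where "S = insert 0 (\<Union>n m. snd ` A n m)"
  have S: "countable S" "S \<noteq> {}" unfolding S_def
    by (intro countable_insert countable_UN countableI_type countable_image countable_finite A(1)) simp
  let ?y = "from_nat_into S"
  show thesis
  proof (rule that[of ?y])
    fix n
    have mem: "fst p \<otimes> snd p \<in> {c \<otimes> ?y k |c k. True}" if "p \<in> A n m" for p m
    proof -
      have "snd p \<in> S" unfolding S_def using that by blast
      then have "snd p \<in> range ?y" using range_from_nat_into[OF S(2,1)] by simp
      then obtain k where "snd p = ?y k" by blast
      then have "fst p \<otimes> snd p = fst p \<otimes> ?y k" by simp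
      then show ?thesis by blast
    qed
    have z: "(\<Sum>p\<in>A n m. c n m p *\<^sub>C (fst p \<otimes> snd p)) \<in> cspan {c \<otimes> ?y k |c k. True}" for m
      by (intro complex_vector.span_sum complex_vector.span_scale complex_vector.span_base mem)
    show "u n \<in> closure (cspan {c \<otimes> ?y k |c k. True})"
      unfolding closure_approachable
    proof (intro allI impI)
      fix e :: real assume "e > 0"
      then obtain m where m: "inverse (real (Suc m)) < e" using reals_Archimedean by blast
      show "\<exists>z\<in>cspan {c \<otimes> ?y k |c k. True}. dist z (u n) < e"
        by (rule bexI[OF _ z[of m]]) (use A(2)[of n m] m in linarith)
    qed
  qed
qed

section \<open>The amplified representation\<close>

context normal_rep
begin

text \<open>The amplification of \<open>j\<close>, characterised by its slices. Being given by
  matrix elements, it can be constructed before anything is known about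
  \<open>map_tensor\<close>.\<close>

definition lift :: "(('c::chilbert_space, 'h) htensor \<Rightarrow>\<^sub>L ('c, 'h) htensor) \<Rightarrow> (('c, 'b) htensor \<Rightarrow>\<^sub>L ('c, 'b) htensor)" where
  "lift T = (THE R. R \<in> bops \<and> (\<forall>c d x y. cinner (c \<otimes> x) (blinfun_apply R (d \<otimes> y)) = cinner x (blinfun_apply (j (slice c d T)) y)))"

text \<open>Only the bound needs an idea. Expanded over an intertwining family for the vectors
  occurring in \<open>P\<close>, the form becomes a sum of matrix elements of \<open>T\<close> at
  the images of \<open>?u\<close> and \<open>?v\<close>, and the Bessel property bounds that
  sum.\<close>

lemma lift_ex:
  fixes T :: "('c::chilbert_space, 'h) htensor \<Rightarrow>\<^sub>L ('c, 'h) htensor"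
  assumes T: "T \<in> slice_algebra A"
  shows "\<exists>R\<in>bops. norm R \<le> norm T \<and> (\<forall>c d x y. cinner (c \<otimes> x) (blinfun_apply R (d \<otimes> y)) = cinner x (blinfun_apply (j (slice c d T)) y))"
proof -
  note Tb = slice_algebra_bops[OF T]
  let ?e = "\<lambda>p :: 'c \<times> 'b. fst p \<otimes> snd p"
  let ?K = "\<lambda>p q :: 'c \<times> 'b. cinner (snd p) (blinfun_apply (j (slice (fst p) (fst q) T)) (snd q))"
  have bd: "cmod (\<Sum>p\<in>P. \<Sum>q\<in>Q. cnj (a p) * b q * ?K p q) \<le> norm T * norm (\<Sum>p\<in>P. a p *\<^sub>C ?e p) * norm (\<Sum>q\<in>Q. b q *\<^sub>C ?e q)"
    if P: "finite P" and Q: "finite Q" for P Q a b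
  proof -
    let ?S = "insert 0 (snd ` P)"
    let ?y = "from_nat_into ?S"
    have S: "countable ?S" using P by (simp add: countable_finite)
    obtain V :: "nat \<Rightarrow> 'b \<Rightarrow>\<^sub>L 'h" where V: "\<And>i. V i \<in> bops" "bessel V"
      "\<And>i a x. a \<in> A \<Longrightarrow> blinfun_apply (V i) (blinfun_apply (j a) x) = blinfun_apply a (blinfun_apply (V i) x)"
      "\<And>k x. ((\<lambda>i. cinner (blinfun_apply (V i) (?y k)) (blinfun_apply (V i) x)) has_sum cinner (?y k) x) UNIV"
      by (rule ex_family[of ?y]) blast
    let ?W = "\<lambda>i. amp (V i) :: ('c, 'b) htensor \<Rightarrow>\<^sub>L ('c, 'h) htensor"
    let ?u = "\<Sum>p\<in>P. a p *\<^sub>C ?e p" and ?v = "\<Sum>q\<in>Q. b q *\<^sub>C ?e q"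
    have Wb: "?W i \<in> bops" for i by (intro tmap_bops bops_intros V)
    have K: "((\<lambda>i. cinner (blinfun_apply (?W i) (?e p)) (blinfun_apply T (blinfun_apply (?W i) (?e q)))) has_sum ?K p q) UNIV"
      if p: "p \<in> P" for p q
    proof -
      have "snd p \<in> range ?y" using range_from_nat_into[OF _ S] p by simp
      then obtain k where k: "snd p = ?y k" by blast
      have "cinner (blinfun_apply (V i) (snd p)) (blinfun_apply (V i) (blinfun_apply (j (slice (fst p) (fst q) T)) (snd q)))
        = cinner (blinfun_apply (?W i) (?e p)) (blinfun_apply T (blinfun_apply (?W i) (?e q)))" for i
        by (simp add: V(3)[OF slice_in[OF vn T]] cinner_slice tmap_tensor V(1))
      then show ?thesis using V(4)[of k "blinfun_apply (j (slice (fst p) (fst q) T)) (snd q)"] by (simp add: k)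
    qed
    have "((\<lambda>i. \<Sum>p\<in>P. \<Sum>q\<in>Q. cnj (a p) * b q * cinner (blinfun_apply (?W i) (?e p)) (blinfun_apply T (blinfun_apply (?W i) (?e q))))
       has_sum (\<Sum>p\<in>P. \<Sum>q\<in>Q. cnj (a p) * b q * ?K p q)) UNIV"
      by (intro has_sum_finite_sum has_sum_cmult_right K)
    moreover have "(\<Sum>p\<in>P. \<Sum>q\<in>Q. cnj (a p) * b q * cinner (blinfun_apply (?W i) (?e p)) (blinfun_apply T (blinfun_apply (?W i) (?e q))))
       = cinner (blinfun_apply (?W i) ?u) (blinfun_apply T (blinfun_apply (?W i) ?v))" for i
      by (subst sum.swap) (simp add: bops_sum bops_scaleC[OF Wb] bops_scaleC[OF Tb] cinner_sum_left cinner_sum_right sum_distrib_left mult_ac)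
    ultimately have hs: "((\<lambda>i. cinner (blinfun_apply (?W i) ?u) (blinfun_apply T (blinfun_apply (?W i) ?v)))
       has_sum (\<Sum>p\<in>P. \<Sum>q\<in>Q. cnj (a p) * b q * ?K p q)) UNIV" by simp
    have fin: "\<forall>\<^sub>F F in finite_subsets_at_top (UNIV :: nat set).
      cmod (\<Sum>i\<in>F. cinner (blinfun_apply (?W i) ?u) (blinfun_apply T (blinfun_apply (?W i) ?v))) \<le> norm T * norm ?u * norm ?v"
      by (rule eventually_finite_subsets_at_top_weakI) (rule bessel_cinner_bound[OF bessel_amp[OF V(1,2)]])
    show ?thesis
      by (rule tendsto_upperbound[OF tendsto_norm[OF hs[unfolded has_sum_def]] fin]) simp
  qed
  have tot: "closure (cspan (range ?e)) = UNIV" unfolding range_tensor by (rule tensor_total)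
  show ?thesis
  proof (rule bounded_form_operator[OF norm_ge_zero tot bd])
    fix R assume R: "R \<in> bops" "\<And>p q. cinner (?e p) (blinfun_apply R (?e q)) = ?K p q" "norm R \<le> norm T"
    have "cinner (c \<otimes> x) (blinfun_apply R (d \<otimes> y)) = cinner x (blinfun_apply (j (slice c d T)) y)" for c d x y
      using R(2)[of "(c, x)" "(d, y)"] by simp
    then show ?thesis using R(1,3) by blast
  qed
qed

lemma lift:
  fixes T :: "('c::chilbert_space, 'h) htensor \<Rightarrow>\<^sub>L ('c, 'h) htensor"
  assumes T: "T \<in> slice_algebra A"
  shows lift_bops: "lift T \<in> bops"
    and norm_lift: "norm (lift T) \<le> norm T"
    and cinner_lift: "cinner (c \<otimes> x) (blinfun_apply (lift T) (d \<otimes> y)) = cinner x (blinfun_apply (j (slice c d T)) y)"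
proof -
  from lift_ex[OF T] obtain R where R: "R \<in> bops" "norm R \<le> norm T"
    "\<And>c d x y. cinner (c \<otimes> x) (blinfun_apply R (d \<otimes> y)) = cinner x (blinfun_apply (j (slice c d T)) y)" by blast
  have "lift T = R"
    unfolding lift_def
  proof (rule the_equality)
    fix R' assume R': "R' \<in> bops \<and> (\<forall>c d x y. cinner (c \<otimes> x) (blinfun_apply R' (d \<otimes> y)) = cinner x (blinfun_apply (j (slice c d T)) y))"
    show "R' = R"
    proof (rule tensor_operator_eqI)
      show "blinfun_apply R' (d \<otimes> y) = blinfun_apply R (d \<otimes> y)" for d y
        by (rule htensor_cinner_eqI) (simp add: R' R)
    qed (use R R' in auto)
  qed (use R in simp)
  then show "lift T \<in> bops" "norm (lift T) \<le> norm T"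
    "cinner (c \<otimes> x) (blinfun_apply (lift T) (d \<otimes> y)) = cinner x (blinfun_apply (j (slice c d T)) y)" using R by auto
qed

lemma lift_eqI:
  assumes T: "T \<in> slice_algebra A" and R: "R \<in> bops"
    and "\<And>c d x y. cinner (c \<otimes> x) (blinfun_apply R (d \<otimes> y)) = cinner x (blinfun_apply (j (slice c d T)) y)"
  shows "lift T = R"
proof (rule tensor_operator_eqI[OF lift_bops[OF T] R])
  show "blinfun_apply (lift T) (d \<otimes> y) = blinfun_apply R (d \<otimes> y)" for d y
    by (rule htensor_cinner_eqI) (simp add: cinner_lift[OF T] assms)
qed

lemma lift_intertwine:
  assumes T: "T \<in> slice_algebra A" and V: "V \<in> bops"
    "\<And>a x. a \<in> A \<Longrightarrow> blinfun_apply V (blinfun_apply (j a) x) = blinfun_apply a (blinfun_apply V x)"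
  shows "blinfun_apply (amp V) (blinfun_apply (lift T) z) = blinfun_apply T (blinfun_apply (amp V) z)"
proof -
  have "amp V o\<^sub>L lift T = T o\<^sub>L amp V"
  proof (rule tensor_operator_eqI)
    show "amp V o\<^sub>L lift T \<in> bops" "T o\<^sub>L amp V \<in> bops"
      using V(1) lift_bops[OF T] slice_algebra_bops[OF T] by (auto simp: tmap_bops)
    show "blinfun_apply (amp V o\<^sub>L lift T) (d \<otimes> y) = blinfun_apply (T o\<^sub>L amp V) (d \<otimes> y)" for d y
    proof (rule htensor_cinner_eqI)
      fix c x
      have "cinner (c \<otimes> x) (blinfun_apply (amp V o\<^sub>L lift T) (d \<otimes> y)) = cinner x (blinfun_apply V (blinfun_apply (j (slice c d T)) y))"
        by (simp add: cinner_amp_left[OF V(1)] cinner_lift[OF T] cinner_adj_left[OF V(1)])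
      then show "cinner (c \<otimes> x) (blinfun_apply (amp V o\<^sub>L lift T) (d \<otimes> y)) = cinner (c \<otimes> x) (blinfun_apply (T o\<^sub>L amp V) (d \<otimes> y))"
        by (simp add: V(2)[OF slice_in[OF vn T]] cinner_slice tmap_tensor V(1))
    qed
  qed
  from arg_cong[OF this, of "\<lambda>R. blinfun_apply R z"] show ?thesis by simp
qed

text \<open>The working tool for \<open>lift\<close>: applying \<open>W i\<close> replaces
  \<open>lift T\<close> by \<open>T\<close>, and the expansion recovers every inner product with
  \<open>u n\<close>. Multiplicativity, positivity and normality of the amplification are deduced
  from it.\<close>

lemma ex_amp_family:
  fixes u :: "nat \<Rightarrow> ('c::chilbert_space, 'b) htensor"
  obtains W :: "nat \<Rightarrow> ('c, 'b) htensor \<Rightarrow>\<^sub>L ('c, 'h) htensor" where "\<And>i. W i \<in> bops" "bessel W"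
    "\<And>i T z. T \<in> slice_algebra A \<Longrightarrow> blinfun_apply (W i) (blinfun_apply (lift T) z) = blinfun_apply T (blinfun_apply (W i) z)"
    "\<And>n z. ((\<lambda>i. cinner (blinfun_apply (W i) (u n)) (blinfun_apply (W i) z)) has_sum cinner (u n) z) UNIV"
    "\<And>i S z. S \<in> bops \<Longrightarrow> blinfun_apply (W i) (blinfun_apply (tmap S id_blinfun) z) = blinfun_apply (tmap S id_blinfun) (blinfun_apply (W i) z)"
proof -
  obtain y :: "nat \<Rightarrow> 'b" where y: "\<And>n. u n \<in> closure (cspan {c \<otimes> y k |c k. True})"
    by (rule ex_countable_support[of u]) blast
  obtain V :: "nat \<Rightarrow> 'b \<Rightarrow>\<^sub>L 'h" where V: "\<And>i. V i \<in> bops" "bessel V"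
    "\<And>i a x. a \<in> A \<Longrightarrow> blinfun_apply (V i) (blinfun_apply (j a) x) = blinfun_apply a (blinfun_apply (V i) x)"
    "\<And>k x. ((\<lambda>i. cinner (blinfun_apply (V i) (y k)) (blinfun_apply (V i) x)) has_sum cinner (y k) x) UNIV"
    by (rule ex_family[of y]) blast
  show thesis
  proof (rule that[of "\<lambda>i. amp (V i) :: ('c, 'b) htensor \<Rightarrow>\<^sub>L ('c, 'h) htensor"])
    show "(amp (V i) :: ('c, 'b) htensor \<Rightarrow>\<^sub>L ('c, 'h) htensor) \<in> bops" for i by (intro tmap_bops bops_intros V)
    show "bessel (\<lambda>i. amp (V i) :: ('c, 'b) htensor \<Rightarrow>\<^sub>L _)" by (rule bessel_amp[OF V(1,2)])
    show "blinfun_apply (amp (V i)) (blinfun_apply (lift T) z) = blinfun_apply T (blinfun_apply (amp (V i)) z)"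
      if "T \<in> slice_algebra A" for i and T :: "('c, 'h) htensor \<Rightarrow>\<^sub>L ('c, 'h) htensor" and z
      by (rule lift_intertwine[OF that V(1,3)])
    show "((\<lambda>i. cinner (blinfun_apply (amp (V i)) (u n)) (blinfun_apply (amp (V i)) z)) has_sum cinner (u n) z) UNIV" for n z
      by (rule amp_has_sum[OF V(1,2,4) y])
    fix i and S :: "'c \<Rightarrow>\<^sub>L 'c" and z :: "('c, 'b) htensor" assume S: "S \<in> bops"
    have "amp (V i) o\<^sub>L tmap S id_blinfun = tmap S id_blinfun o\<^sub>L amp (V i)"
      by (rule tensor_operator_eqI) (use S V(1) in \<open>auto simp: tmap_bops tmap_tensor\<close>)
    from arg_cong[OF this, of "\<lambda>R. blinfun_apply R z"]
    show "blinfun_apply (amp (V i)) (blinfun_apply (tmap S id_blinfun) z) = blinfun_apply (tmap S id_blinfun) (blinfun_apply (amp (V i)) z)" by simp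
  qed
qed

end

lemma adj_slice:
  fixes T :: "('c::chilbert_space, 'h::chilbert_space) htensor \<Rightarrow>\<^sub>L ('c, 'h) htensor"
  assumes "T \<in> bops" shows "slice c d (adj T) = adj (slice d c T)"
proof (rule adj_eqI[symmetric, OF slice_bops[OF assms]])
  fix x y :: 'h
  have "cinner x (blinfun_apply (slice c d (adj T)) y) = cnj (cinner (d \<otimes> y) (blinfun_apply T (c \<otimes> x)))"
    by (simp add: cinner_slice cinner_adj_right[OF assms] flip: cinner_commute)
  also have "\<dots> = cinner (blinfun_apply (slice d c T) x) y" by (simp add: cinner_slice[symmetric] flip: cinner_commute)
  finally show "cinner x (blinfun_apply (slice c d (adj T)) y) = cinner (blinfun_apply (slice d c T) x) y" .
qed

lemma slice_add: "slice c d (S + T) = slice c d S + slice c d T"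
  for S :: "('c::complex_inner, 'h::chilbert_space) htensor \<Rightarrow>\<^sub>L ('c, 'h) htensor"
  by (rule blinfun_eqI, rule cinner_eqI) (simp add: cinner_slice blinfun.add_left cinner_add_right)

lemma slice_scale: "slice c d (z *\<^sub>C S) = z *\<^sub>C slice c d S"
  for S :: "('c::complex_inner, 'h::chilbert_space) htensor \<Rightarrow>\<^sub>L ('c, 'h) htensor"
  by (rule blinfun_eqI, rule cinner_eqI) (simp add: cinner_slice scaleC_blinfun.rep_eq)

lemma slice_tensor:
  fixes S :: "'c::chilbert_space \<Rightarrow>\<^sub>L 'c" and a :: "'h::chilbert_space \<Rightarrow>\<^sub>L 'h"
  assumes "S \<in> bops" "a \<in> bops" shows "slice c d (tmap S a) = cinner c (blinfun_apply S d) *\<^sub>C a"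
  by (rule blinfun_eqI, rule cinner_eqI) (simp add: cinner_slice tmap_tensor assms scaleC_blinfun.rep_eq)

lemma slice_algebra_subspace:
  "complex_vector.subspace (slice_algebra A :: (('c::chilbert_space, 'h::chilbert_space) htensor \<Rightarrow>\<^sub>L ('c, 'h) htensor) set)"
  unfolding complex_vector.subspace_def
proof (intro conjI ballI allI)
  have b: "(amp S :: ('c, 'h) htensor \<Rightarrow>\<^sub>L ('c, 'h) htensor) \<in> bops" if "S \<in> commutant A" for S
    using commutant_bops[OF that] by (simp add: tmap_bops)
  show "0 \<in> slice_algebra A" by (simp add: slice_algebra_def)
  show "S + T \<in> slice_algebra A" if "S \<in> slice_algebra A" "T \<in> slice_algebra A" for S T :: "('c, 'h) htensor \<Rightarrow>\<^sub>L ('c, 'h) htensor"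
    using that by (simp add: slice_algebra_def blinfun.add_left blinfun.add_right)
  show "c *\<^sub>C S \<in> slice_algebra A" if "S \<in> slice_algebra A" for c and S :: "('c, 'h) htensor \<Rightarrow>\<^sub>L ('c, 'h) htensor"
    using that by (simp add: slice_algebra_def scaleC_blinfun.rep_eq bops_scaleC[OF b])
qed

text \<open>Rearranging the double sum \<open>\<Sum>\<^sub>n\<Sum>\<^sub>i \<langle>W\<^sub>i u\<^sub>n, T W\<^sub>i v\<^sub>n\<rangle>\<close> into an ultraweak functional.\<close>

lemma bessel_sqsum:
  assumes W: "bessel (W :: nat \<Rightarrow> _)" and u: "sqsum u"
  shows "sqsum (\<lambda>m. blinfun_apply (W (snd (prod_decode m))) (u (fst (prod_decode m))))"
  unfolding sqsum_def
proof (rule summableI_nonneg_bounded[where x = "suminf (\<lambda>n. (norm (u n))\<^sup>2)"])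
  fix M
  let ?g = "\<lambda>(n, i). (norm (blinfun_apply (W i) (u n)))\<^sup>2"
  have fin: "finite (fst ` prod_decode ` {..<M} \<union> snd ` prod_decode ` {..<M})" by simp
  then obtain N where N: "fst ` prod_decode ` {..<M} \<union> snd ` prod_decode ` {..<M} \<subseteq> {..<N}" by (meson finite_nat_iff_bounded)
  have sub: "prod_decode ` {..<M} \<subseteq> {..<N} \<times> {..<N}"
  proof
    fix p assume "p \<in> prod_decode ` {..<M}"
    then have "fst p \<in> {..<N}" "snd p \<in> {..<N}" using N by blast+
    then show "p \<in> {..<N} \<times> {..<N}" by (cases p) auto
  qed
  have "(\<Sum>m<M. (norm (blinfun_apply (W (snd (prod_decode m))) (u (fst (prod_decode m)))))\<^sup>2) = sum ?g (prod_decode ` {..<M})"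
    by (subst sum.reindex) (auto simp: case_prod_unfold intro: inj_on_subset[OF inj_prod_decode])
  also have "\<dots> \<le> sum ?g ({..<N} \<times> {..<N})" by (rule sum_mono2[OF _ sub]) auto
  also have "\<dots> = (\<Sum>n<N. \<Sum>i<N. (norm (blinfun_apply (W i) (u n)))\<^sup>2)" by (simp add: sum.cartesian_product)
  also have "\<dots> \<le> (\<Sum>n<N. (norm (u n))\<^sup>2)" by (intro sum_mono besselD[OF W]) simp
  also have "\<dots> \<le> suminf (\<lambda>n. (norm (u n))\<^sup>2)" by (rule sum_le_suminf) (use u in \<open>auto simp: sqsum_def\<close>)
  finally show "(\<Sum>m<M. (norm (blinfun_apply (W (snd (prod_decode m))) (u (fst (prod_decode m)))))\<^sup>2) \<le> suminf (\<lambda>n. (norm (u n))\<^sup>2)" .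
qed simp

lemma uwfun_rearrange:
  assumes W: "bessel (W :: nat \<Rightarrow> _)" and u: "sqsum u" "sqsum v"
    and hs: "\<And>n. ((\<lambda>i. cinner (blinfun_apply (W i) (u n)) (blinfun_apply T (blinfun_apply (W i) (v n)))) has_sum r n) UNIV"
    and r: "summable r"
  shows "suminf r = uwfun (\<lambda>m. blinfun_apply (W (snd (prod_decode m))) (u (fst (prod_decode m))))
    (\<lambda>m. blinfun_apply (W (snd (prod_decode m))) (v (fst (prod_decode m)))) T"
    (is "_ = uwfun ?u ?v T")
proof -
  let ?g = "\<lambda>n i. cinner (blinfun_apply (W i) (u n)) (blinfun_apply T (blinfun_apply (W i) (v n)))"
  let ?h = "\<lambda>m. cinner (?u m) (blinfun_apply T (?v m))"
  have "summable (\<lambda>m. norm (?h m))"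
    by (rule summable_norm_cinner[OF bessel_sqsum[OF W u(1)] sqsum_apply[OF bessel_sqsum[OF W u(2)]]])
  then have "(?h has_sum suminf ?h) UNIV"
    by (rule norm_summable_imp_has_sum) (rule summable_sums[OF summable_uwfun[OF bessel_sqsum[OF W u(1)] bessel_sqsum[OF W u(2)]]])
  then have hs2: "((\<lambda>(n, i). ?g n i) has_sum suminf ?h) UNIV"
    using has_sum_reindex_bij_betw[OF bij_prod_decode, of "\<lambda>(n, i). ?g n i"] by (simp add: case_prod_unfold)
  then have sm: "(\<lambda>(n, i). ?g n i) summable_on UNIV \<times> UNIV" by (auto simp: summable_on_def)
  have in1: "infsum (\<lambda>i. ?g n i) UNIV = r n" for n by (rule infsumI[OF hs])
  have "suminf ?h = infsum (\<lambda>(n, i). ?g n i) (UNIV \<times> UNIV)" using infsumI[OF hs2] by simp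
  also have "\<dots> = infsum (\<lambda>n. infsum (\<lambda>i. ?g n i) UNIV) UNIV"
    using infsum_Sigma'_banach[of ?g UNIV "\<lambda>_. UNIV"] sm by simp
  also have "\<dots> = suminf r"
  proof (rule infsum_eq_sums)
    show "(\<lambda>n. infsum (\<lambda>i. ?g n i) UNIV) summable_on UNIV"
      using summable_on_Sigma_banach[of ?g UNIV "\<lambda>_. UNIV"] sm by simp
    show "(\<lambda>n. infsum (\<lambda>i. ?g n i) UNIV) sums suminf r" unfolding in1 by (rule summable_sums[OF r])
  qed
  finally show ?thesis by (simp add: uwfun_def)
qed

context normal_rep
begin

text \<open>Both sides agree after application of every \<open>W i\<close>, and by the expansion
  these images determine the inner product with \<open>u\<close>.\<close>

lemma lift_compose:
  fixes S T :: "('c::chilbert_space, 'h) htensor \<Rightarrow>\<^sub>L ('c, 'h) htensor"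
  assumes S: "S \<in> slice_algebra A" and T: "T \<in> slice_algebra A"
  shows "lift (S o\<^sub>L T) = lift S o\<^sub>L lift T"
proof (rule blinfun_eqI, rule cinner_eqI)
  fix z u :: "('c, 'b) htensor"
  obtain W :: "nat \<Rightarrow> ('c, 'b) htensor \<Rightarrow>\<^sub>L ('c, 'h) htensor" where W:
    "\<And>i T z. T \<in> slice_algebra A \<Longrightarrow> blinfun_apply (W i) (blinfun_apply (lift T) z) = blinfun_apply T (blinfun_apply (W i) z)"
    "\<And>z. ((\<lambda>i. cinner (blinfun_apply (W i) u) (blinfun_apply (W i) z)) has_sum cinner u z) UNIV"
    by (rule ex_amp_family[of "\<lambda>_. u"]) blast
  note ST = slice_algebra_compose[OF S T]
  have "blinfun_apply (W i) (blinfun_apply (lift (S o\<^sub>L T)) z) = blinfun_apply (W i) (blinfun_apply (lift S o\<^sub>L lift T) z)" for i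
    by (simp add: W(1)[OF S] W(1)[OF T] W(1)[OF ST])
  then show "cinner u (blinfun_apply (lift (S o\<^sub>L T)) z) = cinner u (blinfun_apply (lift S o\<^sub>L lift T) z)"
    using W(2)[of "blinfun_apply (lift (S o\<^sub>L T)) z"] W(2)[of "blinfun_apply (lift S o\<^sub>L lift T) z"] has_sum_unique by simp
qed

lemma lift_adj:
  fixes T :: "('c::chilbert_space, 'h) htensor \<Rightarrow>\<^sub>L ('c, 'h) htensor"
  assumes T: "T \<in> slice_algebra A" shows "lift (adj T) = adj (lift T)"
proof (rule lift_eqI[OF slice_algebra_adj[OF vn T] adj_bops[OF lift_bops[OF T]]])
  fix c d :: 'c and x y :: 'b
  note sl = slice_in[OF vn T]
  have "cinner (c \<otimes> x) (blinfun_apply (adj (lift T)) (d \<otimes> y)) = cnj (cinner (d \<otimes> y) (blinfun_apply (lift T) (c \<otimes> x)))"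
    by (simp add: cinner_adj_right[OF lift_bops[OF T]] flip: cinner_commute)
  also have "\<dots> = cnj (cinner y (blinfun_apply (j (slice d c T)) x))" by (simp add: cinner_lift[OF T])
  also have "\<dots> = cinner x (blinfun_apply (adj (j (slice d c T))) y)"
    by (simp add: cinner_adj_right[OF j_bops[OF sl]] flip: cinner_commute)
  finally show "cinner (c \<otimes> x) (blinfun_apply (adj (lift T)) (d \<otimes> y)) = cinner x (blinfun_apply (j (slice c d (adj T))) y)"
    by (simp add: adj_slice[OF slice_algebra_bops[OF T]] j_adj[OF sl])
qed

lemma lift_tensor:
  fixes S :: "'c::chilbert_space \<Rightarrow>\<^sub>L 'c"
  assumes S: "S \<in> bops" and a: "a \<in> A" shows "lift (tmap S a) = tmap S (j a)"
proof (rule lift_eqI[OF tensor_in_slice_algebra[OF vn S a] tmap_bops[OF S j_bops[OF a]]])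
  show "cinner (c \<otimes> x) (blinfun_apply (tmap S (j a)) (d \<otimes> y)) = cinner x (blinfun_apply (j (slice c d (tmap S a))) y)" for c d x y
    by (simp add: slice_tensor[OF S vn_bops[OF vn a]] j_scale[OF a] scaleC_blinfun.rep_eq tmap_tensor[OF S j_bops[OF a]])
qed

lemma lift_add:
  fixes S T :: "('c::chilbert_space, 'h) htensor \<Rightarrow>\<^sub>L ('c, 'h) htensor"
  assumes S: "S \<in> slice_algebra A" and T: "T \<in> slice_algebra A" shows "lift (S + T) = lift S + lift T"
proof (rule lift_eqI)
  show "S + T \<in> slice_algebra A" by (rule complex_vector.subspace_add[OF slice_algebra_subspace S T])
  show "lift S + lift T \<in> bops" using lift_bops[OF S] lift_bops[OF T] by simp
  show "cinner (c \<otimes> x) (blinfun_apply (lift S + lift T) (d \<otimes> y)) = cinner x (blinfun_apply (j (slice c d (S + T))) y)" for c d x y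
    by (simp add: slice_add j_add slice_in[OF vn] S T blinfun.add_left cinner_add_right cinner_lift)
qed

lemma lift_scale:
  fixes T :: "('c::chilbert_space, 'h) htensor \<Rightarrow>\<^sub>L ('c, 'h) htensor"
  assumes T: "T \<in> slice_algebra A" shows "lift (r *\<^sub>C T) = r *\<^sub>C lift T"
proof (rule lift_eqI)
  show "r *\<^sub>C T \<in> slice_algebra A" by (rule complex_vector.subspace_scale[OF slice_algebra_subspace T])
  show "r *\<^sub>C lift T \<in> bops" using lift_bops[OF T] by simp
  show "cinner (c \<otimes> x) (blinfun_apply (r *\<^sub>C lift T) (d \<otimes> y)) = cinner x (blinfun_apply (j (slice c d (r *\<^sub>C T))) y)" for c d x y
    by (simp add: slice_scale j_scale slice_in[OF vn] T scaleC_blinfun.rep_eq cinner_lift)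
qed

text \<open>Expanding each term over a family for the sequence \<open>u\<close> pulls an ultraweak
  functional on the amplified space back to one on the original; this is the content of
  normality.\<close>

lemma lift_uwfun:
  fixes u v :: "nat \<Rightarrow> ('c::chilbert_space, 'b) htensor"
  assumes u: "sqsum u" "sqsum v"
  obtains u' v' :: "nat \<Rightarrow> ('c, 'h) htensor" where "sqsum u'" "sqsum v'"
    "\<And>T. T \<in> slice_algebra A \<Longrightarrow> uwfun u v (lift T) = uwfun u' v' T"
proof -
  obtain W :: "nat \<Rightarrow> ('c, 'b) htensor \<Rightarrow>\<^sub>L ('c, 'h) htensor" where W: "bessel W"
    "\<And>i T z. T \<in> slice_algebra A \<Longrightarrow> blinfun_apply (W i) (blinfun_apply (lift T) z) = blinfun_apply T (blinfun_apply (W i) z)"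
    "\<And>n z. ((\<lambda>i. cinner (blinfun_apply (W i) (u n)) (blinfun_apply (W i) z)) has_sum cinner (u n) z) UNIV"
    by (rule ex_amp_family[of u]) blast
  show thesis
  proof (rule that[OF bessel_sqsum[OF W(1) u(1)] bessel_sqsum[OF W(1) u(2)]])
    fix T :: "('c, 'h) htensor \<Rightarrow>\<^sub>L ('c, 'h) htensor" assume T: "T \<in> slice_algebra A"
    have "((\<lambda>i. cinner (blinfun_apply (W i) (u n)) (blinfun_apply T (blinfun_apply (W i) (v n)))) has_sum cinner (u n) (blinfun_apply (lift T) (v n))) UNIV" for n
      using W(3)[of n "blinfun_apply (lift T) (v n)"] by (simp add: W(2)[OF T])
    from uwfun_rearrange[OF W(1) u this summable_uwfun[OF u]]
    show "uwfun u v (lift T) = uwfun (\<lambda>m. blinfun_apply (W (snd (prod_decode m))) (u (fst (prod_decode m))))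
      (\<lambda>m. blinfun_apply (W (snd (prod_decode m))) (v (fst (prod_decode m)))) T"
      by (simp add: uwfun_def)
  qed
qed

lemma lift_normal: "normal_on ((bops :: ('c::chilbert_space \<Rightarrow>\<^sub>L 'c) set) \<otimes>\<^sub>u\<^sub>w A) lift"
proof -
  let ?M = "(bops :: ('c \<Rightarrow>\<^sub>L 'c) set) \<otimes>\<^sub>u\<^sub>w A"
  let ?B = "{{T :: ('c, 'b) htensor \<Rightarrow>\<^sub>L ('c, 'b) htensor. uwfun u v T \<in> U} | u v U. sqsum u \<and> sqsum v \<and> open U}"
  have "continuous_map (subtopology ultraweak ?M) (topology_generated_by ?B) lift"
    unfolding continuous_on_generated_topo_iff
  proof (intro conjI allI impI)
    fix O' assume "O' \<in> ?B"
    then obtain u v U where O': "O' = {T. uwfun u v T \<in> U}" "sqsum u" "sqsum v" "open U" by blast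
    obtain u' v' :: "nat \<Rightarrow> ('c, 'h) htensor" where uv: "sqsum u'" "sqsum v'"
      "\<And>T. T \<in> slice_algebra A \<Longrightarrow> uwfun u v (lift T) = uwfun u' v' T"
      by (rule lift_uwfun[OF O'(2,3)]) blast
    have "uwfun u v (lift T) = uwfun u' v' T" if "T \<in> ?M" for T
      by (rule uv(3)[OF uw_tensor_slice_algebra[OF vn that]])
    then have "lift -` O' \<inter> topspace (subtopology ultraweak ?M) = {T. uwfun u' v' T \<in> U} \<inter> ?M"
      by (auto simp: O'(1))
    then show "openin (subtopology ultraweak ?M) (lift -` O' \<inter> topspace (subtopology ultraweak ?M))"
      using openin_uwfun[OF uv(1,2) O'(4)] by (auto simp: openin_subtopology)
  next
    have "{T :: ('c, 'b) htensor \<Rightarrow>\<^sub>L ('c, 'b) htensor. uwfun (\<lambda>_. 0) (\<lambda>_. 0) T \<in> UNIV} \<in> ?B"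
      using sqsum_zero open_UNIV by blast
    then show "lift ` topspace (subtopology ultraweak ?M) \<subseteq> \<Union> ?B" by blast
  qed
  then show ?thesis unfolding normal_on_def ultraweak_uwfun .
qed

text \<open>\<open>lift\<close> meets the description in \<open>map_tensor\<close>, so the choice
  there is not vacuous. Any candidate agrees with \<open>lift\<close> on the algebraic tensor
  product by linearity and on its ultraweak closure by normality.\<close>

lemma map_tensor_lift:
  fixes F :: "('c::chilbert_space, 'h) htensor \<Rightarrow>\<^sub>L ('c, 'h) htensor"
  assumes F: "F \<in> bops \<otimes>\<^sub>u\<^sub>w A"
  shows "map_tensor bops A (\<lambda>Z. Z) j F = lift F"
proof -
  let ?M = "(bops :: ('c \<Rightarrow>\<^sub>L 'c) set) \<otimes>\<^sub>u\<^sub>w A"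
  let ?G = "{S \<otimes>\<^sub>o T |S T. S \<in> (bops :: ('c \<Rightarrow>\<^sub>L 'c) set) \<and> T \<in> A}"
  let ?P = "\<lambda>\<Theta> :: (('c, 'h) htensor \<Rightarrow>\<^sub>L ('c, 'h) htensor) \<Rightarrow> (('c, 'b) htensor \<Rightarrow>\<^sub>L ('c, 'b) htensor).
    clinear_on ?M \<Theta> \<and> normal_on ?M \<Theta> \<and> (\<forall>S\<in>bops. \<forall>T\<in>A. \<Theta> (S \<otimes>\<^sub>o T) = S \<otimes>\<^sub>o j T)"
  note inS = uw_tensor_slice_algebra[OF vn]
  have "clinear_on ?M lift"
    unfolding clinear_on_def using lift_add[OF inS inS] lift_scale[OF inS] by blast
  then have "?P lift" using lift_normal lift_tensor by (auto simp: op_tensor_tmap)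
  then have P: "?P (map_tensor bops A (\<lambda>Z. Z) j)" unfolding map_tensor_def by (rule someI[of ?P])
  have span: "cspan ?G \<subseteq> ?M" unfolding uw_tensor_def by (rule closure_of_subset) simp
  have eq: "T \<in> cspan ?G \<and> \<Theta> T = lift T" if \<Theta>: "?P \<Theta>" and T: "T \<in> cspan ?G" for \<Theta> T
    using T
  proof (induction rule: complex_vector.span_induct_alt)
    case base
    have "0 \<in> ?M" using span complex_vector.span_zero by blast
    then have "\<Theta> (0 *\<^sub>C 0) = 0 *\<^sub>C \<Theta> 0" using \<Theta> unfolding clinear_on_def by blast
    moreover have "lift (0 *\<^sub>C 0) = 0 *\<^sub>C lift (0 :: ('c, 'h) htensor \<Rightarrow>\<^sub>L ('c, 'h) htensor)"
      by (rule lift_scale[OF complex_vector.subspace_0[OF slice_algebra_subspace]])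
    ultimately show ?case by (simp add: complex_vector.scale_zero_left complex_vector.span_zero)
  next
    case (step c x y)
    then have y: "y \<in> cspan ?G" "\<Theta> y = lift y" by blast+
    have xs: "x \<in> cspan ?G" by (rule complex_vector.span_base[OF step(1)])
    note m = subsetD[OF span xs] subsetD[OF span y(1)] subsetD[OF span complex_vector.span_scale[OF xs, of c]]
    from step(1) obtain S T where "x = S \<otimes>\<^sub>o T" "S \<in> bops" "T \<in> A" by blast
    then have x: "\<Theta> x = lift x" using \<Theta> by (simp add: op_tensor_tmap lift_tensor)
    have "\<Theta> (c *\<^sub>C x + y) = \<Theta> (c *\<^sub>C x) + \<Theta> y" "\<Theta> (c *\<^sub>C x) = c *\<^sub>C \<Theta> x"
      using \<Theta> m unfolding clinear_on_def by blast+
    moreover have "lift (c *\<^sub>C x + y) = lift (c *\<^sub>C x) + lift y" "lift (c *\<^sub>C x) = c *\<^sub>C lift x"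
      by (rule lift_add[OF inS[OF m(3)] inS[OF m(2)]], rule lift_scale[OF inS[OF m(1)]])
    ultimately show ?case using x y complex_vector.span_add[OF complex_vector.span_scale[OF xs] y(1)] by simp
  qed
  show ?thesis
  proof (rule blinfun_eqI, rule cinner_eqI)
    fix q p :: "('c, 'b) htensor"
    have cont: "continuous_map (subtopology ultraweak ?M) euclidean (\<lambda>T. cinner p (blinfun_apply (\<Theta> T) q))" if "normal_on ?M \<Theta>" for \<Theta>
      using continuous_map_compose[OF that[unfolded normal_on_def] continuous_map_cinner_ultraweak, of p q] by (simp add: o_def)
    have Fc: "F \<in> subtopology ultraweak ?M closure_of cspan ?G"
      using F span by (simp add: closure_of_subtopology Int_absorb1 uw_tensor_def)
    show "cinner p (blinfun_apply (map_tensor bops A (\<lambda>Z. Z) j F) q) = cinner p (blinfun_apply (lift F) q)"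
      by (rule forall_in_closure_of_eq[OF Fc Hausdorff_space_euclidean cont cont])
        (use P lift_normal eq in auto)
  qed
qed

end

section \<open>Adaptedness\<close>

lemma tensor_zero [simp]: "0 \<otimes> y = 0" "x \<otimes> 0 = 0"
  by (rule bounded_bilinear.zero_left[OF bounded_bilinear_tensor] bounded_bilinear.zero_right[OF bounded_bilinear_tensor])+

text \<open>The tensor product of the initial space, the Fock space over \<open>[0, a)\<close> and
  the line of the exponential vector of \<open>f\<close> on \<open>[a, \<infinity>)\<close>.
  Generating it by exponentials of functions that agree with \<open>f\<close> from \<open>a\<close>
  on avoids an explicit splitting of the Fock space.\<close>

definition adapted :: "real \<Rightarrow> (real \<Rightarrow> 'k::chilbert_space) \<Rightarrow> ('h::chilbert_space, 'k) hF set" where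
  "adapted a f = closure (cspan {v \<otimes> \<varpi> e |v e. e \<in> step_funs \<and> (\<forall>s\<ge>a. e s = f s)})"

definition kadapted :: "real \<Rightarrow> (real \<Rightarrow> 'k::chilbert_space) \<Rightarrow> ('h::chilbert_space, 'k) khF set" where
  "kadapted a f = closure (cspan {c \<otimes> (v \<otimes> \<varpi> e) |c v e. e \<in> step_funs \<and> (\<forall>s\<ge>a. e s = f s)})"

lemma adapted_subspace: "complex_vector.subspace (adapted a f)"
  unfolding adapted_def by (intro csubspace_closure complex_vector.subspace_span)

lemma kadapted_subspace: "complex_vector.subspace (kadapted a f)"
  unfolding kadapted_def by (intro csubspace_closure complex_vector.subspace_span)

lemma adapted_closed: "closed (adapted a f)" and kadapted_closed: "closed (kadapted a f)"
  by (simp_all add: adapted_def kadapted_def)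

lemma adapted_base: "e \<in> step_funs \<Longrightarrow> (\<And>s. s \<ge> a \<Longrightarrow> e s = f s) \<Longrightarrow> v \<otimes> \<varpi> e \<in> adapted a f"
  unfolding adapted_def by (rule subsetD[OF closure_subset], rule complex_vector.span_base) blast

lemma kadapted_base: "e \<in> step_funs \<Longrightarrow> (\<And>s. s \<ge> a \<Longrightarrow> e s = f s) \<Longrightarrow> c \<otimes> (v \<otimes> \<varpi> e) \<in> kadapted a f"
  unfolding kadapted_def by (rule subsetD[OF closure_subset], rule complex_vector.span_base) blast

lemma adapted_mono: "a \<le> b \<Longrightarrow> adapted a f \<subseteq> adapted b f"
  unfolding adapted_def by (intro closure_mono complex_vector.span_mono) force

lemma kadapted_mono: "a \<le> b \<Longrightarrow> kadapted a f \<subseteq> kadapted b f"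
  unfolding kadapted_def by (intro closure_mono complex_vector.span_mono) force

text \<open>Keeps the past of \<open>h\<close> and takes the future of \<open>f\<close>; an
  arbitrary test function becomes one that is admissible for \<open>adapted a f\<close>.\<close>

definition glue :: "real \<Rightarrow> (real \<Rightarrow> 'k) \<Rightarrow> (real \<Rightarrow> 'k) \<Rightarrow> real \<Rightarrow> 'k::chilbert_space" where
  "glue a h f = (\<lambda>s. restr {0..<a} h s + restr {a..} f s)"

lemma glue_step: "h \<in> step_funs \<Longrightarrow> f \<in> step_funs \<Longrightarrow> glue a h f \<in> step_funs"
  unfolding glue_def by (intro step_add step_restr_lt step_restr_ge)

lemma glue_ge: "a \<le> s \<Longrightarrow> glue a h f s = f s"
  by (simp add: glue_def restr_def)

lemma restr_glue: "0 \<le> a \<Longrightarrow> restr {0..<a} (glue a h f) = restr {0..<a} h" "0 \<le> a \<Longrightarrow> restr {a..} (glue a h f) = restr {a..} f"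
  by (auto simp: glue_def restr_def fun_eq_iff)

lemma L2_split:
  assumes f: "f \<in> step_funs" and g: "g \<in> step_funs" and a: "0 \<le> a"
  shows "cinner (abs_L2 f) (abs_L2 g) = cinner (abs_L2 (restr {0..<a} f)) (abs_L2 (restr {0..<a} g))
    + cinner (abs_L2 (restr {a..} f)) (abs_L2 (restr {a..} g))"
proof -
  have dec: "abs_L2 f = abs_L2 (restr {0..<a} f) + abs_L2 (restr {a..} f)" if "f \<in> step_funs" for f
  proof -
    have "f s = restr {0..<a} f s + restr {a..} f s" for s using step_neg[OF that, of s] a by (auto simp: restr_def)
    then have "f = (\<lambda>s. restr {0..<a} f s + restr {a..} f s)" by (rule ext)
    then show ?thesis
      using abs_L2_add[OF square_integrable_step[OF step_restr_lt[OF that]] square_integrable_step[OF step_restr_ge[OF that]], of a a] by simp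
  qed
  have z1: "cinner (abs_L2 (restr {0..<a} f)) (abs_L2 (restr {a..} g)) = 0" if "f \<in> step_funs" "g \<in> step_funs" for f g
  proof -
    have "cinner (restr {0..<a} f s) (restr {a..} g s) = 0" for s by (simp add: restr_def)
    then show ?thesis
      by (simp add: cinner_abs_L2 square_integrable_step step_restr_lt step_restr_ge that)
  qed
  have z2: "cinner (abs_L2 (restr {a..} f)) (abs_L2 (restr {0..<a} g)) = 0"
    using cinner_swap_zero[OF z1[OF g f]] .
  show ?thesis unfolding dec[OF f] dec[OF g] by (simp add: cinner_add_left cinner_add_right z1[OF f g] z2)
qed

lemma cinner_expvec_split:
  assumes f: "f \<in> step_funs" and g: "g \<in> step_funs" and a: "0 \<le> a"
  shows "cinner (\<varpi> f) (\<varpi> g) = cinner (\<varpi> (restr {0..<a} f)) (\<varpi> (restr {0..<a} g)) * cinner (\<varpi> (restr {a..} f)) (\<varpi> (restr {a..} g))"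
proof -
  have n: "(norm (abs_L2 f))\<^sup>2 = (norm (abs_L2 (restr {0..<a} f)))\<^sup>2 + (norm (abs_L2 (restr {a..} f)))\<^sup>2" if "f \<in> step_funs" for f
    using arg_cong[OF L2_split[OF that that a], of Re] by (simp add: norm_power2_cinner)
  have nc: "(complex_of_real (norm (abs_L2 f)))\<^sup>2 = (complex_of_real (norm (abs_L2 (restr {0..<a} f))))\<^sup>2 + (complex_of_real (norm (abs_L2 (restr {a..} f))))\<^sup>2" if "f \<in> step_funs" for f
    using arg_cong[OF n[OF that], of complex_of_real] by simp
  show ?thesis unfolding cinner_expvec exp_add[symmetric]
    by (rule arg_cong[of _ _ exp]) (simp add: L2_split[OF f g a] nc[OF f] nc[OF g] add_divide_distrib)
qed

lemma cinner_expvec_self [simp]: "cinner (\<varpi> f) (\<varpi> f) = 1"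
  unfolding cinner_expvec by (simp add: cinner_self)

text \<open>Elements of \<open>adapted a f\<close> obey the same rule relating inner products with
  \<open>h\<close> to those with \<open>glue a h f\<close>. So the remainder of the projection is
  determined by its inner products with vectors of \<open>adapted a f\<close>, and these
  vanish.\<close>

lemma adaptedI:
  fixes x x0 :: "('h::chilbert_space, 'k::chilbert_space) hF"
  assumes f: "f \<in> step_funs" and a: "0 \<le> a"
    and rel: "\<And>w h. h \<in> step_funs \<Longrightarrow> cinner (w \<otimes> \<varpi> h) x
      = cinner (\<varpi> (restr {a..} h)) (\<varpi> (restr {a..} f)) * cinner (w \<otimes> \<varpi> (restr {0..<a} h)) x0"
  shows "x \<in> adapted a f"
proof -
  obtain p where p: "p \<in> adapted a f" "\<forall>y\<in>adapted a f. cinner y (x - p) = 0"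
    using projection_exists[OF adapted_subspace adapted_closed] by blast
  have "x - p = 0"
  proof (rule hF_cinner_eqI)
    fix w :: 'h and h :: "real \<Rightarrow> 'k" assume h: "h \<in> step_funs"
    let ?h = "glue a h f" and ?k = "cinner (\<varpi> (restr {a..} h)) (\<varpi> (restr {a..} f))"
    note hs = glue_step[OF h f, of a]
    have x: "cinner (w \<otimes> \<varpi> h) x = ?k * cinner (w \<otimes> \<varpi> ?h) x"
      unfolding rel[OF h] rel[OF hs] by (simp add: restr_glue a)
    have "cinner (w \<otimes> \<varpi> h) p = ?k * cinner (w \<otimes> \<varpi> ?h) p"
      using p(1) unfolding adapted_def
    proof (rule cspan_closure_induct)
      show "complex_vector.subspace {p. cinner (w \<otimes> \<varpi> h) p = ?k * cinner (w \<otimes> \<varpi> ?h) p}"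
        by (auto simp: complex_vector.subspace_def cinner_add_right algebra_simps)
      show "closed {p. cinner (w \<otimes> \<varpi> h) p = ?k * cinner (w \<otimes> \<varpi> ?h) p}"
        by (intro closed_Collect_eq continuous_intros)
      fix s assume "s \<in> {v \<otimes> \<varpi> e |(v::'h) e. e \<in> step_funs \<and> (\<forall>s\<ge>a. e s = f s)}"
      then obtain v :: 'h and e where s: "s = v \<otimes> \<varpi> e" "e \<in> step_funs" "\<forall>s\<ge>a. e s = f s" by blast
      then have r: "restr {a..} e = restr {a..} f" by (auto simp: restr_def fun_eq_iff)
      show "cinner (w \<otimes> \<varpi> h) s = ?k * cinner (w \<otimes> \<varpi> ?h) s"
        unfolding s(1) cinner_tensor cinner_expvec_split[OF h s(2) a] cinner_expvec_split[OF hs s(2) a]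
        by (simp add: restr_glue a r)
    qed
    then have "cinner (w \<otimes> \<varpi> h) (x - p) = ?k * cinner (w \<otimes> \<varpi> ?h) (x - p)" using x by (simp add: cinner_diff_right algebra_simps)
    moreover have "cinner (w \<otimes> \<varpi> ?h) (x - p) = 0"
      using p(2) adapted_base[OF hs glue_ge] by blast
    ultimately show "cinner (w \<otimes> \<varpi> h) (x - p) = cinner (w \<otimes> \<varpi> h) 0" by simp
  qed
  then show ?thesis using p(1) by simp
qed

lemma tensor_in_kadapted: "y \<in> adapted a f \<Longrightarrow> c \<otimes> y \<in> kadapted a f"
  unfolding adapted_def
proof (rule cspan_closure_induct[where P = "\<lambda>y. c \<otimes> y \<in> kadapted a f"])
  show "complex_vector.subspace {y. c \<otimes> y \<in> kadapted a f}"
    using kadapted_subspace[of a f]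
    by (auto simp: complex_vector.subspace_def tensor_add_right tensor_scale_right)
  show "closed {y. c \<otimes> y \<in> kadapted a f}"
    using continuous_closed_preimage[of UNIV "\<lambda>y. c \<otimes> y", OF _ closed_UNIV kadapted_closed]
    by (simp add: vimage_def continuous_intros)
qed (auto intro: kadapted_base)

text \<open>Each \<open>y\<close> splits into a part in \<open>adapted a f\<close>, handled by the
  projection of \<open>z\<close>, and an orthogonal part whose tensors are orthogonal to the
  projection and, by hypothesis, to \<open>z\<close>.\<close>

lemma kadaptedI:
  fixes z :: "('h::chilbert_space, 'k::chilbert_space) khF"
  assumes z: "\<And>c y. (\<And>x. x \<in> adapted a f \<Longrightarrow> cinner x y = 0) \<Longrightarrow> cinner (c \<otimes> y) z = 0"
  shows "z \<in> kadapted a f"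
proof -
  obtain p where p: "p \<in> kadapted a f" "\<forall>y\<in>kadapted a f. cinner y (z - p) = 0"
    using projection_exists[OF kadapted_subspace kadapted_closed] by blast
  have "z - p = 0"
  proof (rule htensor_cinner_eqI)
    fix c :: "complex \<times> 'k" and y :: "('h, 'k) hF"
    obtain y1 where y1: "y1 \<in> adapted a f" "\<forall>x\<in>adapted a f. cinner x (y - y1) = 0"
      using projection_exists[OF adapted_subspace adapted_closed] by blast
    have "cinner (c \<otimes> y1) (z - p) = 0" using p(2) tensor_in_kadapted[OF y1(1)] by blast
    moreover have "cinner (c \<otimes> (y - y1)) z = 0" by (rule z) (use y1 in blast)
    moreover have "cinner (c \<otimes> (y - y1)) p = 0"
      using p(1) unfolding kadapted_def
    proof (rule cspan_closure_induct)
      show "complex_vector.subspace {p. cinner (c \<otimes> (y - y1)) p = 0}"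
        by (auto simp: complex_vector.subspace_def cinner_add_right)
      show "closed {p. cinner (c \<otimes> (y - y1)) p = 0}" by (intro closed_Collect_eq continuous_intros)
      fix s assume "s \<in> {c \<otimes> (v \<otimes> \<varpi> e) |(c::complex \<times> 'k) (v::'h) e. e \<in> step_funs \<and> (\<forall>s\<ge>a. e s = f s)}"
      then obtain d :: "complex \<times> 'k" and v :: 'h and e where s: "s = d \<otimes> (v \<otimes> \<varpi> e)" "e \<in> step_funs" "\<forall>s\<ge>a. e s = f s" by blast
      have "v \<otimes> \<varpi> e \<in> adapted a f" by (rule adapted_base) (use s in auto)
      then have "cinner (y - y1) (v \<otimes> \<varpi> e) = 0" using y1(2) cinner_swap_zero by blast
      then show "cinner (c \<otimes> (y - y1)) s = 0" by (simp add: s(1))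
    qed
    moreover have "c \<otimes> y = c \<otimes> y1 + c \<otimes> (y - y1)" by (simp flip: tensor_add_right)
    ultimately show "cinner (c \<otimes> y) (z - p) = cinner (c \<otimes> y) 0" by (simp add: cinner_add_left cinner_diff_right)
  qed
  then show ?thesis using p(1) by simp
qed

section \<open>The quantum Ito formula for continuous integrands\<close>

definition hint :: "real \<Rightarrow> real \<Rightarrow> (real \<Rightarrow> 'k::chilbert_space) \<Rightarrow> complex \<times> 'k" where
  "hint a b h = integral {a..b} (\<lambda>s. hat (h s))"

text \<open>The first fundamental formula for the constant integrand \<gamma>, taken as a
  definition; totality of the exponential vectors makes \<open>V\<close> unique.\<close>

definition const_integral :: "real \<Rightarrow> real \<Rightarrow> ('h::chilbert_space, 'k::chilbert_space) khF \<Rightarrow> ('h, 'k) hF \<Rightarrow> bool" where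
  "const_integral a b \<gamma> V \<longleftrightarrow> (\<forall>w. \<forall>h\<in>step_funs. cinner (w \<otimes> \<varpi> h) V = cinner (hint a b h \<otimes> (w \<otimes> \<varpi> h)) \<gamma>)"

lemma hat_integrable:
  fixes h :: "real \<Rightarrow> 'k::chilbert_space"
  assumes "h \<in> step_funs" shows "(\<lambda>s. hat (h s)) integrable_on {a..b}"
proof -
  have "(\<lambda>s. (0::complex, h s)) integrable_on {a..b}"
    by (rule integrable_linear[OF step_integrable[OF assms], of "\<lambda>x. (0, x)", unfolded o_def])
      (intro bounded_linear_Pair bounded_linear_zero bounded_linear_ident)
  then have "(\<lambda>s. (1, 0) + (0::complex, h s)) integrable_on {a..b}" by (intro integrable_add integrable_const_ivl)
  then show ?thesis by (simp add: hat_def)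
qed

lemma bounded_linear_cinner_left: "bounded_linear (\<lambda>x. cinner x y)"
  by (rule bounded_bilinear.bounded_linear_left[OF bounded_bilinear_cinner])

lemma bounded_linear_cinner_right: "bounded_linear (\<lambda>y. cinner x y)"
  by (rule bounded_bilinear.bounded_linear_right[OF bounded_bilinear_cinner])

lemma bounded_linear_cinner_tensor: "bounded_linear (\<lambda>x. cinner (x \<otimes> y) z)"
  by (rule bounded_linear_compose[OF bounded_linear_cinner_left bounded_bilinear.bounded_linear_left[OF bounded_bilinear_tensor]])

lemma has_integral_hat:
  assumes "h \<in> step_funs"
  shows "((\<lambda>s. cinner (hat (h s) \<otimes> y) z) has_integral cinner (hint a b h \<otimes> y) z) {a..b}"
  using has_integral_linear[OF integrable_integral[OF hat_integrable[OF assms]] bounded_linear_cinner_tensor]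
  by (simp add: o_def hint_def)

lemma cinner_hint:
  assumes h: "h \<in> step_funs" and a: "0 \<le> a" "a \<le> b"
  shows "cinner (hint a b h) c = of_real (b - a) * fst c + cinner (abs_L2 h) (abs_L2 (\<lambda>s. indicator {a..<b} s *\<^sub>R snd c))"
proof -
  have 1: "((\<lambda>s. cinner (hat (h s)) c) has_integral cinner (hint a b h) c) {a..b}"
    using has_integral_linear[OF integrable_integral[OF hat_integrable[OF h]] bounded_linear_cinner_left]
    by (simp add: o_def hint_def)
  have "(\<lambda>s. cinner (h s) (snd c)) integrable_on {a..b}"
    using integrable_linear[OF step_integrable[OF h] bounded_linear_cinner_left] by (simp add: o_def)
  then have "((\<lambda>s. cinner (h s) (snd c)) has_integral cinner (abs_L2 h) (abs_L2 (\<lambda>s. indicator {a..<b} s *\<^sub>R snd c))) {a..b}"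
    unfolding cinner_step_indicator[OF h a] by (rule integrable_integral)
  moreover have "((\<lambda>s. fst c) has_integral of_real (b - a) * fst c) {a..b}"
    using has_integral_const_real[of "fst c" a b] a by (simp add: scaleR_conv_of_real)
  ultimately have "((\<lambda>s. fst c + cinner (h s) (snd c)) has_integral
      (of_real (b - a) * fst c + cinner (abs_L2 h) (abs_L2 (\<lambda>s. indicator {a..<b} s *\<^sub>R snd c)))) {a..b}"
    by (intro has_integral_add)
  then have "((\<lambda>s. cinner (hat (h s)) c) has_integral
      (of_real (b - a) * fst c + cinner (abs_L2 h) (abs_L2 (\<lambda>s. indicator {a..<b} s *\<^sub>R snd c)))) {a..b}"
    by (simp add: hat_def cinner_prod_def cinner_complex_def)
  then show ?thesis using 1 has_integral_unique by blast
qed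

lemma const_integral_unique: "const_integral a b \<gamma> V \<Longrightarrow> const_integral a b \<gamma> V' \<Longrightarrow> V = V'"
  by (rule hF_cinner_eqI) (simp add: const_integral_def)

text \<open>The integral over \<open>[a,b)\<close> of the constant integrand \<open>c \<otimes> v \<otimes> \<varpi> e\<close>.\<close>

definition const_int_vec :: "real \<Rightarrow> real \<Rightarrow> complex \<times> 'k::chilbert_space \<Rightarrow> 'h::chilbert_space \<Rightarrow> (real \<Rightarrow> 'k) \<Rightarrow> ('h, 'k) hF" where
  "const_int_vec a b c v e = v \<otimes> ((of_real (b - a) * fst c) *\<^sub>C \<varpi> e
     + exp (- (norm (abs_L2 e))\<^sup>2 / 2) *\<^sub>R creation (abs_L2 (\<lambda>s. indicator {a..<b} s *\<^sub>R snd c)) (abs_L2 e))"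

lemma const_int_vec_integral:
  assumes a: "0 \<le> a" "a \<le> b" shows "const_integral a b (c \<otimes> (v \<otimes> \<varpi> e)) (const_int_vec a b c v e)"
  unfolding const_integral_def
proof (intro allI ballI)
  fix w and h :: "real \<Rightarrow> 'a" assume h: "h \<in> step_funs"
  show "cinner (w \<otimes> \<varpi> h) (const_int_vec a b c v e) = cinner (hint a b h \<otimes> (w \<otimes> \<varpi> h)) (c \<otimes> (v \<otimes> \<varpi> e))"
    unfolding const_int_vec_def
    by (simp add: cinner_hint[OF h a] cinner_add_right cinner_scaleR_left cinner_scaleR_right expvec_eps
        cinner_eps cinner_eps_creation) (simp add: algebra_simps)
qed

text \<open>All terms come from inner products of exponential and creation vectors. The commutator
  term gives \<open>b - a\<close> times the inner product of the \<open>snd\<close> parts; since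
  \<open>e\<close> and \<open>e'\<close> are constant on the interval, the remaining terms assemble
  into the product with factor \<open>b - a\<close> squared.\<close>

lemma cinner_const_int_vec:
  assumes a: "0 \<le> a" "a \<le> b" and e: "e \<in> step_funs" "\<And>s. a \<le> s \<Longrightarrow> s < b \<Longrightarrow> e s = d"
    and e': "e' \<in> step_funs" "\<And>s. a \<le> s \<Longrightarrow> s < b \<Longrightarrow> e' s = d'"
  shows "cinner (const_int_vec a b c v e) (const_int_vec a b c' v' e') = cinner v v' * cinner (\<varpi> e) (\<varpi> e') *
    (of_real (b - a) * cinner (snd c) (snd c') + (of_real (b - a))\<^sup>2 * (cinner c (hat d') * cinner (hat d) c'))"
proof -
  let ?x = "\<lambda>c. abs_L2 (\<lambda>s. indicator {a..<b} s *\<^sub>R snd c)"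
  note ie = cinner_indicator_const[OF e(1) a e(2)] cinner_indicator_const[OF e'(1) a e'(2)]
  have xx: "cinner (?x c) (?x c') = of_real (b - a) * cinner (snd c) (snd c')"
    by (rule cinner_indicator_const(2)[OF step_indicator[OF a(1)] a]) simp
  show ?thesis
    unfolding const_int_vec_def
    by (simp add: cinner_add_left cinner_add_right cinner_scaleR_left cinner_scaleR_right expvec_eps cinner_eps
        cinner_eps_creation cinner_creation_eps cinner_creation ie xx cinner_prod_def hat_def cinner_complex_def)
      (simp add: algebra_simps power2_eq_square)
qed

section \<open>The Ito product for constant integrands\<close>

abbreviation Dl :: "(complex \<times> 'k::chilbert_space, 'x::chilbert_space) htensor \<Rightarrow>\<^sub>L (complex \<times> 'k, 'x) htensor" where
  "Dl \<equiv> tmap Delta id_blinfun"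

abbreviation El :: "complex \<times> 'k::chilbert_space \<Rightarrow> (complex \<times> 'k, 'x::chilbert_space) htensor \<Rightarrow>\<^sub>L 'x" where
  "El u \<equiv> adj (ketl u)"

lemma Delta_bops: "(Delta :: (complex \<times> 'k::chilbert_space) \<Rightarrow>\<^sub>L _) \<in> bops"
  by (simp add: bops_def scaleC_prod_def)

lemma norm_Delta: "norm (Delta :: (complex \<times> 'k::chilbert_space) \<Rightarrow>\<^sub>L _) \<le> 1"
  by (rule norm_blinfun_bound) (auto simp: norm_prod_def)

lemma Dl_bops: "Dl \<in> bops"
  by (simp add: tmap_bops Delta_bops)

lemma Dl_tensor: "blinfun_apply Dl (c \<otimes> y) = (0, snd c) \<otimes> y"
  by (simp add: tmap_tensor Delta_bops)

lemma norm_Dl: "norm (blinfun_apply Dl z) \<le> norm z"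
proof -
  have "norm (Dl :: (complex \<times> 'a, 'b) htensor \<Rightarrow>\<^sub>L _) \<le> 1 * 1"
    by (rule order_trans[OF norm_tmap]) (use mult_mono[OF norm_Delta norm_blinfun_id_le] in \<open>auto simp: Delta_bops\<close>)
  then show ?thesis using norm_blinfun[of Dl z] mult_right_mono[of "norm Dl" 1 "norm z"] by fastforce
qed

lemma El_bops: "El u \<in> bops"
  by (simp add: adj_bops ketl_bops)

lemma cinner_El: "cinner x (blinfun_apply (El u) z) = cinner (u \<otimes> x) z"
  by (simp add: cinner_adj_right ketl_bops)

lemma El_tensor: "blinfun_apply (El u) (c \<otimes> y) = cinner u c *\<^sub>C y"
  by (rule cinner_eqI) (simp add: cinner_El)

lemma norm_El: "norm (blinfun_apply (El u) z) \<le> norm u * norm z"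
  for z :: "(complex \<times> 'k::chilbert_space, 'x::chilbert_space) htensor"
proof -
  have "norm (El u :: (_, 'x) htensor \<Rightarrow>\<^sub>L 'x) \<le> norm u"
    by (rule order_trans[OF norm_adj_le[OF ketl_bops]], rule norm_blinfun_bound) (auto simp: norm_tensor)
  then show ?thesis by (rule order_trans[OF norm_blinfun mult_right_mono]) simp
qed

text \<open>The Ito product of two constant integrands over an interval of length \<open>\<tau>\<close>.\<close>

definition ito :: "real \<Rightarrow> complex \<times> 'k::chilbert_space \<Rightarrow> complex \<times> 'k \<Rightarrow>
    (complex \<times> 'k, 'x::chilbert_space) htensor \<Rightarrow> (complex \<times> 'k, 'x) htensor \<Rightarrow> complex" where
  "ito \<tau> u u' z z' = of_real \<tau> * cinner (blinfun_apply Dl z) (blinfun_apply Dl z')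
     + (of_real \<tau>)\<^sup>2 * cinner (blinfun_apply (El u') z) (blinfun_apply (El u) z')"

lemma cinner_const_int_vec_ito:
  assumes "0 \<le> a" "a \<le> b" "e \<in> step_funs" "\<And>s. a \<le> s \<Longrightarrow> s < b \<Longrightarrow> e s = d"
    and "e' \<in> step_funs" "\<And>s. a \<le> s \<Longrightarrow> s < b \<Longrightarrow> e' s = d'"
  shows "cinner (const_int_vec a b c v e) (const_int_vec a b c' v' e')
    = ito (b - a) (hat d) (hat d') (c \<otimes> (v \<otimes> \<varpi> e)) (c' \<otimes> (v' \<otimes> \<varpi> e'))"
  unfolding ito_def
  by (subst cinner_const_int_vec[OF assms]) (simp_all add: Dl_tensor El_tensor cinner_prod_def[of "(0, _)"] algebra_simps cinner_commute[of c "hat d'"])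

lemma ito_sums:
  "ito \<tau> u u' (\<Sum>i\<in>A. c i *\<^sub>C x i) (\<Sum>j\<in>B. d j *\<^sub>C y j) = (\<Sum>i\<in>A. \<Sum>j\<in>B. cnj (c i) * d j * ito \<tau> u u' (x i) (y j))"
  unfolding ito_def bops_sum bops_scaleC[OF Dl_bops] bops_scaleC[OF El_bops] cinner_sum_left
  unfolding cinner_sum_right sum_distrib_left sum.distrib[symmetric]
  by (intro sum.cong[OF refl]) (simp add: algebra_simps)

lemma norm_ito: "0 \<le> \<tau> \<Longrightarrow> cmod (ito \<tau> u u z z) \<le> (\<tau> + \<tau>\<^sup>2 * (norm u)\<^sup>2) * (norm z)\<^sup>2"
proof -
  assume d: "0 \<le> \<tau>"
  have "(norm (blinfun_apply Dl z))\<^sup>2 \<le> (norm z)\<^sup>2" by (intro power_mono norm_Dl) simp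
  moreover have "(norm (blinfun_apply (El u) z))\<^sup>2 \<le> (norm u * norm z)\<^sup>2" by (intro power_mono norm_El) simp
  moreover have "cmod (ito \<tau> u u z z) \<le> \<tau> * (norm (blinfun_apply Dl z))\<^sup>2 + \<tau>\<^sup>2 * (norm (blinfun_apply (El u) z))\<^sup>2"
    unfolding ito_def cinner_self
    by (rule order_trans[OF norm_triangle_ineq]) (simp add: norm_mult norm_power d)
  ultimately have "cmod (ito \<tau> u u z z) \<le> \<tau> * (norm z)\<^sup>2 + \<tau>\<^sup>2 * (norm u * norm z)\<^sup>2"
    using d by (meson add_mono mult_left_mono order_trans zero_le_power2)
  then show ?thesis by (simp add: algebra_simps power_mult_distrib)
qed

text \<open>By sesquilinearity the inner products of the explicit vectors are given by
  \<open>ito\<close>, so \<open>norm_ito\<close> supplies the bound required for an extension, with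
  constant \<open>sqrt ?K\<close>.\<close>

lemma const_integral_operator:
  fixes f :: "real \<Rightarrow> 'k::chilbert_space"
  assumes a: "0 \<le> a" "a \<le> b" and d: "\<And>s. a \<le> s \<Longrightarrow> s < b \<Longrightarrow> f s = d"
  obtains T :: "('h::chilbert_space, 'k) khF \<Rightarrow>\<^sub>L ('h, 'k) hF" where "T \<in> bops"
    "\<And>c v e. e \<in> step_funs \<Longrightarrow> (\<And>s. a \<le> s \<Longrightarrow> e s = f s) \<Longrightarrow> blinfun_apply T (c \<otimes> (v \<otimes> \<varpi> e)) = const_int_vec a b c v e"
proof -
  let ?I = "UNIV \<times> UNIV \<times> {e\<in>step_funs. \<forall>s\<ge>a. e s = f s} :: ((complex \<times> 'k) \<times> 'h \<times> (real \<Rightarrow> 'k)) set"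
  let ?e = "\<lambda>(c, v, e). c \<otimes> (v \<otimes> \<varpi> e)" and ?f = "\<lambda>(c, v, e). const_int_vec a b c v e"
  let ?K = "(b - a) + (b - a)\<^sup>2 * (norm (hat d))\<^sup>2"
  have K: "0 \<le> ?K" using a by simp
  have "norm (\<Sum>i\<in>B. z i *\<^sub>C ?f i) \<le> sqrt ?K * norm (\<Sum>i\<in>B. z i *\<^sub>C ?e i)" if "finite B" "B \<subseteq> ?I" for B z
  proof -
    have ff: "cinner (?f i) (?f k) = ito (b - a) (hat d) (hat d) (?e i) (?e k)" if ik: "i \<in> B" "k \<in> B" for i k
    proof -
      obtain c v e where i: "i = (c, v, e)" "e \<in> step_funs" "\<forall>s\<ge>a. e s = f s" using ik(1) \<open>B \<subseteq> ?I\<close> by blast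
      obtain c' v' e' where k: "k = (c', v', e')" "e' \<in> step_funs" "\<forall>s\<ge>a. e' s = f s" using ik(2) \<open>B \<subseteq> ?I\<close> by blast
      have "e s = d" "e' s = d" if "a \<le> s" "s < b" for s using i(3) k(3) d[OF that] that by simp_all
      then show ?thesis unfolding i(1) k(1) prod.case by (intro cinner_const_int_vec_ito a i k) simp_all
    qed
    have "cinner (\<Sum>i\<in>B. z i *\<^sub>C ?f i) (\<Sum>i\<in>B. z i *\<^sub>C ?f i) = ito (b - a) (hat d) (hat d) (\<Sum>i\<in>B. z i *\<^sub>C ?e i) (\<Sum>i\<in>B. z i *\<^sub>C ?e i)"
      unfolding ito_sums cinner_sum_left unfolding cinner_sum_right
      by (intro sum.cong[OF refl]) (simp add: ff mult_ac)
    then have "(norm (\<Sum>i\<in>B. z i *\<^sub>C ?f i))\<^sup>2 \<le> ?K * (norm (\<Sum>i\<in>B. z i *\<^sub>C ?e i))\<^sup>2"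
      using norm_ito[of "b - a" "hat d" "\<Sum>i\<in>B. z i *\<^sub>C ?e i"] a complex_Re_le_cmod[of "cinner (\<Sum>i\<in>B. z i *\<^sub>C ?f i) (\<Sum>i\<in>B. z i *\<^sub>C ?f i)"]
      by (simp add: norm_power2_cinner)
    then have "norm (\<Sum>i\<in>B. z i *\<^sub>C ?f i) \<le> sqrt (?K * (norm (\<Sum>i\<in>B. z i *\<^sub>C ?e i))\<^sup>2)" by (rule real_le_rsqrt)
    then show ?thesis by (simp add: real_sqrt_mult)
  qed
  then obtain T where T: "T \<in> bops" "\<And>i. i \<in> ?I \<Longrightarrow> blinfun_apply T (?e i) = ?f i"
    by (rule clinear_extension[where M = "sqrt ?K" and I = ?I and e = ?e and f = ?f, rotated]) (use K in auto)
  show ?thesis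
  proof (rule that[OF T(1)])
    fix c v e assume "e \<in> step_funs" "\<And>s. a \<le> s \<Longrightarrow> e s = f s"
    then show "blinfun_apply T (c \<otimes> (v \<otimes> \<varpi> e)) = const_int_vec a b c v e" using T(2)[of "(c, v, e)"] by simp
  qed
qed

lemma eps_adapted:
  assumes "e \<in> step_funs" "\<And>s. a \<le> s \<Longrightarrow> e s = f s" shows "v \<otimes> eps (abs_L2 e) \<in> adapted a f"
proof -
  have "eps (abs_L2 e) = exp ((norm (abs_L2 e))\<^sup>2 / 2) *\<^sub>R \<varpi> e"
    by (simp add: expvec_eps flip: exp_add)
  then have "v \<otimes> eps (abs_L2 e) = exp ((norm (abs_L2 e))\<^sup>2 / 2) *\<^sub>R (v \<otimes> \<varpi> e)"
    by (simp add: scaleR_eq_scaleC tensor_scale_right)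
  then show ?thesis using csubspace_scaleR[OF adapted_subspace adapted_base[OF assms]] by simp
qed

text \<open>The creation vector is a limit of differences of exponentials of functions changed only
  on \<open>[a, b)\<close>; these still agree with \<open>f\<close> from \<open>b\<close>
  on.\<close>

lemma const_int_vec_adapted:
  fixes e :: "real \<Rightarrow> 'k::chilbert_space"
  assumes a: "0 \<le> a" "a \<le> b" and e: "e \<in> step_funs" "\<And>s. a \<le> s \<Longrightarrow> e s = f s"
  shows "const_int_vec a b c v e \<in> adapted b f"
proof -
  let ?x = "\<lambda>s. indicator {a..<b} s *\<^sub>R snd c"
  note sub = adapted_subspace[of b f]
  have eb: "e s = f s" if "b \<le> s" for s using e(2) a that by simp
  have "v \<otimes> crq (abs_L2 ?x) (abs_L2 e) n \<in> adapted b f" for n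
  proof -
    let ?e = "\<lambda>s. e s + (1 / of_nat (Suc n)) *\<^sub>C ?x s"
    have L: "abs_L2 e + (1 / of_nat (Suc n)) *\<^sub>C abs_L2 ?x = abs_L2 ?e"
      by (subst abs_L2_add) (simp_all add: square_integrable_step e step_scale step_indicator a abs_L2_scale)
    have "?e \<in> step_funs" by (intro step_add step_scale step_indicator e a)
    then have "v \<otimes> eps (abs_L2 ?e) \<in> adapted b f" by (rule eps_adapted) (use eb in simp)
    moreover have "v \<otimes> eps (abs_L2 e) \<in> adapted b f" by (rule eps_adapted[OF e(1) eb])
    moreover have "v \<otimes> crq (abs_L2 ?x) (abs_L2 e) n = of_nat (Suc n) *\<^sub>C (v \<otimes> eps (abs_L2 ?e) - v \<otimes> eps (abs_L2 e))"
      unfolding crq_def L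
      by (simp only: tensor_scale_right bounded_bilinear.diff_right[OF bounded_bilinear_tensor])
    ultimately show ?thesis
      using complex_vector.subspace_scale[OF sub complex_vector.subspace_diff[OF sub]] by simp
  qed
  moreover have "(\<lambda>n. v \<otimes> crq (abs_L2 ?x) (abs_L2 e) n) \<longlonglongrightarrow> v \<otimes> creation (abs_L2 ?x) (abs_L2 e)"
    by (intro tendsto_intros crq_tendsto)
  ultimately have "v \<otimes> creation (abs_L2 ?x) (abs_L2 e) \<in> adapted b f"
    by (rule closed_sequentially[OF adapted_closed])
  moreover have "v \<otimes> \<varpi> e \<in> adapted b f" by (rule adapted_base[OF e(1) eb])
  moreover have "const_int_vec a b c v e = (of_real (b - a) * fst c) *\<^sub>C (v \<otimes> \<varpi> e)
      + exp (- (norm (abs_L2 e))\<^sup>2 / 2) *\<^sub>R (v \<otimes> creation (abs_L2 ?x) (abs_L2 e))"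
    unfolding const_int_vec_def scaleR_eq_scaleC by (simp only: tensor_scale_right tensor_add_right)
  ultimately show ?thesis
    using complex_vector.subspace_add[OF sub complex_vector.subspace_scale[OF sub] csubspace_scaleR[OF sub]] by simp
qed

lemma kadapted_induct:
  assumes "z \<in> kadapted a f" "complex_vector.subspace {x. P x}" "closed {x. P x}"
    and "\<And>c v e. e \<in> step_funs \<Longrightarrow> (\<And>s. a \<le> s \<Longrightarrow> e s = f s) \<Longrightarrow> P (c \<otimes> (v \<otimes> \<varpi> e))"
  shows "P z"
  using assms(1) unfolding kadapted_def
  by (rule cspan_closure_induct[OF _ assms(2,3)]) (use assms(4) in blast)

lemma adapted_induct:
  assumes "z \<in> adapted a f" "complex_vector.subspace {x. P x}" "closed {x. P x}"
    and "\<And>v e. e \<in> step_funs \<Longrightarrow> (\<And>s. a \<le> s \<Longrightarrow> e s = f s) \<Longrightarrow> P (v \<otimes> \<varpi> e)"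
  shows "P z"
  using assms(1) unfolding adapted_def
  by (rule cspan_closure_induct[OF _ assms(2,3)]) (use assms(4) in blast)

lemma const_integral_ex:
  fixes f :: "real \<Rightarrow> 'k::chilbert_space"
  assumes a: "0 \<le> a" "a \<le> b" and d: "\<And>s. a \<le> s \<Longrightarrow> s < b \<Longrightarrow> f s = d"
  obtains T :: "('h::chilbert_space, 'k) khF \<Rightarrow>\<^sub>L ('h, 'k) hF" where "T \<in> bops"
    "\<And>c v e. e \<in> step_funs \<Longrightarrow> (\<And>s. a \<le> s \<Longrightarrow> e s = f s) \<Longrightarrow> blinfun_apply T (c \<otimes> (v \<otimes> \<varpi> e)) = const_int_vec a b c v e"
    "\<And>\<gamma>. \<gamma> \<in> kadapted a f \<Longrightarrow> const_integral a b \<gamma> (blinfun_apply T \<gamma>)"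
    "\<And>\<gamma>. \<gamma> \<in> kadapted a f \<Longrightarrow> blinfun_apply T \<gamma> \<in> adapted b f"
proof -
  obtain T :: "('h, 'k) khF \<Rightarrow>\<^sub>L ('h, 'k) hF" where T: "T \<in> bops"
    "\<And>c v e. e \<in> step_funs \<Longrightarrow> (\<And>s. a \<le> s \<Longrightarrow> e s = f s) \<Longrightarrow> blinfun_apply T (c \<otimes> (v \<otimes> \<varpi> e)) = const_int_vec a b c v e"
    using const_integral_operator[where 'h = 'h and f = f, OF a d] by blast
  show ?thesis
  proof (rule that[OF T])
    fix \<gamma> :: "('h, 'k) khF" assume g: "\<gamma> \<in> kadapted a f"
    have "cinner (w \<otimes> \<varpi> h) (blinfun_apply T \<gamma>) = cinner (hint a b h \<otimes> (w \<otimes> \<varpi> h)) \<gamma>" if h: "h \<in> step_funs" for w h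
      using g
    proof (rule kadapted_induct)
      show "complex_vector.subspace {\<gamma>. cinner (w \<otimes> \<varpi> h) (blinfun_apply T \<gamma>) = cinner (hint a b h \<otimes> (w \<otimes> \<varpi> h)) \<gamma>}"
        by (simp add: complex_vector.subspace_def cinner_add_right blinfun.add_right bops_scaleC[OF T(1)] blinfun.zero_right)
      show "closed {\<gamma>. cinner (w \<otimes> \<varpi> h) (blinfun_apply T \<gamma>) = cinner (hint a b h \<otimes> (w \<otimes> \<varpi> h)) \<gamma>}"
        by (intro closed_Collect_eq continuous_intros)
      fix c :: "complex \<times> 'k" and v :: 'h and e assume e: "e \<in> step_funs" "\<And>s. a \<le> s \<Longrightarrow> e s = f s"
      show "cinner (w \<otimes> \<varpi> h) (blinfun_apply T (c \<otimes> (v \<otimes> \<varpi> e))) = cinner (hint a b h \<otimes> (w \<otimes> \<varpi> h)) (c \<otimes> (v \<otimes> \<varpi> e))"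
        using const_int_vec_integral[OF a, of c v e] h by (subst T(2)[OF e]) (simp_all add: const_integral_def)
    qed
    then show "const_integral a b \<gamma> (blinfun_apply T \<gamma>)" by (simp add: const_integral_def)
    show "blinfun_apply T \<gamma> \<in> adapted b f"
      using g
    proof (rule kadapted_induct)
      show "complex_vector.subspace {\<gamma>. blinfun_apply T \<gamma> \<in> adapted b f}"
        using adapted_subspace[of b f] unfolding complex_vector.subspace_def
        by (simp add: blinfun.add_right bops_scaleC[OF T(1)] blinfun.zero_right) blast
      show "closed {\<gamma>. blinfun_apply T \<gamma> \<in> adapted b f}"
        using continuous_closed_preimage[of UNIV "blinfun_apply T", OF _ closed_UNIV adapted_closed]
        by (simp add: vimage_def linear_continuous_on blinfun.bounded_linear_right)
      fix c :: "complex \<times> 'k" and v :: 'h and e assume e: "e \<in> step_funs" "\<And>s. a \<le> s \<Longrightarrow> e s = f s"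
      show "blinfun_apply T (c \<otimes> (v \<otimes> \<varpi> e)) \<in> adapted b f"
        by (subst T(2)[OF e]) (auto intro: const_int_vec_adapted[OF a e])
    qed
  qed
qed

lemma ito_left:
  "ito \<tau> u u' (x + y) z = ito \<tau> u u' x z + ito \<tau> u u' y z" "ito \<tau> u u' (c *\<^sub>C x) z = cnj c * ito \<tau> u u' x z"
  "ito \<tau> u u' 0 z = 0"
  and ito_right:
  "ito \<tau> u u' z (x + y) = ito \<tau> u u' z x + ito \<tau> u u' z y" "ito \<tau> u u' z (c *\<^sub>C x) = c * ito \<tau> u u' z x"
  "ito \<tau> u u' z 0 = 0"
  by (simp_all add: ito_def blinfun.add_right bops_scaleC Dl_bops El_bops cinner_add_left cinner_add_right algebra_simps blinfun.zero_right)

text \<open>The formula is known on exponential generators, and both sides are sesquilinear and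
  continuous in the integrands. Uniqueness identifies \<open>V\<close> and \<open>V'\<close> with
  the values of the constructed operators.\<close>

lemma const_integral_ito:
  fixes f f' :: "real \<Rightarrow> 'k::chilbert_space"
  assumes a: "0 \<le> a" "a \<le> b"
    and d: "\<And>s. a \<le> s \<Longrightarrow> s < b \<Longrightarrow> f s = d" and d': "\<And>s. a \<le> s \<Longrightarrow> s < b \<Longrightarrow> f' s = d'"
    and \<gamma>: "\<gamma> \<in> kadapted a f" "const_integral a b \<gamma> V" and \<gamma>': "\<gamma>' \<in> kadapted a f'" "const_integral a b \<gamma>' V'"
  shows "cinner V V' = ito (b - a) (hat d) (hat d') (\<gamma> :: ('h::chilbert_space, 'k) khF) \<gamma>'"
proof -
  obtain T :: "('h, 'k) khF \<Rightarrow>\<^sub>L ('h, 'k) hF" where T: "T \<in> bops"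
    "\<And>c v e. e \<in> step_funs \<Longrightarrow> (\<And>s. a \<le> s \<Longrightarrow> e s = f s) \<Longrightarrow> blinfun_apply T (c \<otimes> (v \<otimes> \<varpi> e)) = const_int_vec a b c v e"
    "\<And>\<gamma>. \<gamma> \<in> kadapted a f \<Longrightarrow> const_integral a b \<gamma> (blinfun_apply T \<gamma>)"
    by (rule const_integral_ex[where 'h = 'h and f = f, OF a d]) blast+
  obtain T' :: "('h, 'k) khF \<Rightarrow>\<^sub>L ('h, 'k) hF" where T': "T' \<in> bops"
    "\<And>c v e. e \<in> step_funs \<Longrightarrow> (\<And>s. a \<le> s \<Longrightarrow> e s = f' s) \<Longrightarrow> blinfun_apply T' (c \<otimes> (v \<otimes> \<varpi> e)) = const_int_vec a b c v e"
    "\<And>\<gamma>. \<gamma> \<in> kadapted a f' \<Longrightarrow> const_integral a b \<gamma> (blinfun_apply T' \<gamma>)"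
    by (rule const_integral_ex[where 'h = 'h and f = f', OF a d']) blast+
  have "cinner (blinfun_apply T \<gamma>) (blinfun_apply T' \<gamma>') = ito (b - a) (hat d) (hat d') \<gamma> \<gamma>'"
    using \<gamma>(1)
  proof (rule kadapted_induct)
    show "complex_vector.subspace {\<gamma>. cinner (blinfun_apply T \<gamma>) (blinfun_apply T' \<gamma>') = ito (b - a) (hat d) (hat d') \<gamma> \<gamma>'}"
      by (simp add: complex_vector.subspace_def cinner_add_left blinfun.add_right bops_scaleC[OF T(1)] blinfun.zero_right ito_left)
    show "closed {\<gamma>. cinner (blinfun_apply T \<gamma>) (blinfun_apply T' \<gamma>') = ito (b - a) (hat d) (hat d') \<gamma> \<gamma>'}"
      unfolding ito_def by (intro closed_Collect_eq continuous_intros)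
    fix c :: "complex \<times> 'k" and v :: 'h and e assume e: "e \<in> step_funs" "\<And>s. a \<le> s \<Longrightarrow> e s = f s"
    have ed: "e s = d" if "a \<le> s" "s < b" for s using e(2)[OF that(1)] d[OF that] by simp
    show "cinner (blinfun_apply T (c \<otimes> (v \<otimes> \<varpi> e))) (blinfun_apply T' \<gamma>') = ito (b - a) (hat d) (hat d') (c \<otimes> (v \<otimes> \<varpi> e)) \<gamma>'"
      using \<gamma>'(1)
    proof (rule kadapted_induct)
      show "complex_vector.subspace {\<gamma>'. cinner (blinfun_apply T (c \<otimes> (v \<otimes> \<varpi> e))) (blinfun_apply T' \<gamma>') = ito (b - a) (hat d) (hat d') (c \<otimes> (v \<otimes> \<varpi> e)) \<gamma>'}"
        by (simp add: complex_vector.subspace_def cinner_add_right blinfun.add_right bops_scaleC[OF T'(1)] blinfun.zero_right ito_right distrib_left)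
      show "closed {\<gamma>'. cinner (blinfun_apply T (c \<otimes> (v \<otimes> \<varpi> e))) (blinfun_apply T' \<gamma>') = ito (b - a) (hat d) (hat d') (c \<otimes> (v \<otimes> \<varpi> e)) \<gamma>'}"
        unfolding ito_def by (intro closed_Collect_eq continuous_intros)
      fix c' :: "complex \<times> 'k" and v' :: 'h and e' assume e': "e' \<in> step_funs" "\<And>s. a \<le> s \<Longrightarrow> e' s = f' s"
      have ed': "e' s = d'" if "a \<le> s" "s < b" for s using e'(2)[OF that(1)] d'[OF that] by simp
      show "cinner (blinfun_apply T (c \<otimes> (v \<otimes> \<varpi> e))) (blinfun_apply T' (c' \<otimes> (v' \<otimes> \<varpi> e')))
          = ito (b - a) (hat d) (hat d') (c \<otimes> (v \<otimes> \<varpi> e)) (c' \<otimes> (v' \<otimes> \<varpi> e'))"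
        by (subst T(2)[OF e], assumption, subst T'(2)[OF e'], assumption) (rule cinner_const_int_vec_ito[OF a e(1) ed e'(1) ed'])
    qed
  qed
  then show ?thesis
    using const_integral_unique[OF \<gamma>(2) T(3)[OF \<gamma>(1)]] const_integral_unique[OF \<gamma>'(2) T'(3)[OF \<gamma>'(1)]] by simp
qed

lemma norm_const_integral:
  fixes \<gamma> :: "('h::chilbert_space, 'k::chilbert_space) khF"
  assumes "0 \<le> a" "a \<le> b" "\<And>s. a \<le> s \<Longrightarrow> s < b \<Longrightarrow> f s = d" "\<gamma> \<in> kadapted a f" "const_integral a b \<gamma> V"
  shows "(norm V)\<^sup>2 \<le> ((b - a) + (b - a)\<^sup>2 * (norm (hat d))\<^sup>2) * (norm \<gamma>)\<^sup>2"
proof -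
  have "(norm V)\<^sup>2 = Re (ito (b - a) (hat d) (hat d) \<gamma> \<gamma>)"
    using const_integral_ito[OF assms(1,2,3,3,4,5,4,5)] by (simp add: norm_power2_cinner)
  also have "\<dots> \<le> cmod (ito (b - a) (hat d) (hat d) \<gamma> \<gamma>)" by (rule complex_Re_le_cmod)
  also have "\<dots> \<le> ((b - a) + (b - a)\<^sup>2 * (norm (hat d))\<^sup>2) * (norm \<gamma>)\<^sup>2" by (rule norm_ito) (use assms in simp)
  finally show ?thesis .
qed

section \<open>Weak integrals of continuous integrands\<close>

definition wint :: "(real \<Rightarrow> ('h::chilbert_space, 'k::chilbert_space) khF) \<Rightarrow> real \<Rightarrow> real \<Rightarrow> ('h, 'k) hF \<Rightarrow> bool" where
  "wint g a b V \<longleftrightarrow> (\<forall>w. \<forall>h\<in>step_funs.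
     ((\<lambda>s. cinner (hat (h s) \<otimes> (w \<otimes> \<varpi> h)) (g s)) has_integral cinner (w \<otimes> \<varpi> h) V) {a..b})"

lemma wint_const: "const_integral a b \<gamma> V \<Longrightarrow> wint (\<lambda>_. \<gamma>) a b V"
  unfolding const_integral_def wint_def by (auto simp: has_integral_hat)

lemma wint_diff: "wint g a b V \<Longrightarrow> wint g' a b V' \<Longrightarrow> wint (\<lambda>s. g s - g' s) a b (V - V')"
  unfolding wint_def by (auto simp: cinner_diff_right intro: has_integral_diff)

text \<open>The test functions generating \<open>adapted a f\<close> have the constant value
  \<open>d\<close> on \<open>[a, b)\<close>, so the time-dependent test vector can be frozen and the
  weak integral becomes an ordinary one; the endpoint \<open>b\<close> is negligible.\<close>

lemma wint_cross:
  fixes g :: "real \<Rightarrow> ('h::chilbert_space, 'k::chilbert_space) khF"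
  assumes x: "x \<in> adapted a f" and d: "\<And>s. a \<le> s \<Longrightarrow> s < b \<Longrightarrow> f s = d"
    and g: "continuous_on {a..b} g" "wint g a b V"
  shows "cinner x V = cinner (hat d \<otimes> x) (integral {a..b} g)"
  using x
proof (rule adapted_induct)
  show "complex_vector.subspace {x. cinner x V = cinner (hat d \<otimes> x) (integral {a..b} g)}"
    by (simp add: complex_vector.subspace_def cinner_add_left tensor_add_right tensor_scale_right)
  show "closed {x. cinner x V = cinner (hat d \<otimes> x) (integral {a..b} g)}"
    by (intro closed_Collect_eq continuous_intros)
  fix v :: 'h and e assume e: "e \<in> step_funs" "\<And>s. a \<le> s \<Longrightarrow> e s = f s"
  have "((\<lambda>s. cinner (hat (e s) \<otimes> (v \<otimes> \<varpi> e)) (g s)) has_integral cinner (v \<otimes> \<varpi> e) V) {a..b}"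
    using g(2) e(1) by (simp add: wint_def)
  then have "((\<lambda>s. cinner (hat d \<otimes> (v \<otimes> \<varpi> e)) (g s)) has_integral cinner (v \<otimes> \<varpi> e) V) {a..b}"
    by (rule has_integral_spike_finite[rotated 2, where S = "{b}"]) (auto simp: e(2) d)
  moreover have "((\<lambda>s. cinner (hat d \<otimes> (v \<otimes> \<varpi> e)) (g s)) has_integral cinner (hat d \<otimes> (v \<otimes> \<varpi> e)) (integral {a..b} g)) {a..b}"
    using has_integral_linear[OF integrable_integral[OF integrable_continuous_real[OF g(1)]] bounded_linear_cinner_right]
    by (simp add: o_def)
  ultimately show "cinner (v \<otimes> \<varpi> e) V = cinner (hat d \<otimes> (v \<otimes> \<varpi> e)) (integral {a..b} g)"
    by (rule has_integral_unique)
qed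

lemma const_integral_cross:
  fixes \<gamma> :: "('h::chilbert_space, 'k::chilbert_space) khF"
  assumes "x \<in> adapted a f" "\<And>s. a \<le> s \<Longrightarrow> s < b \<Longrightarrow> f s = d" "const_integral a b \<gamma> V" "a \<le> b"
  shows "cinner x V = of_real (b - a) * cinner (hat d \<otimes> x) \<gamma>"
  using wint_cross[OF assms(1,2) continuous_on_const wint_const[OF assms(3)]] assms(4)
  by (simp add: cinner_scaleR_right)

lemma hat_bound:
  fixes h :: "real \<Rightarrow> 'k::chilbert_space"
  assumes "h \<in> step_funs" obtains B where "0 \<le> B" "\<And>s. norm (hat (h s)) \<le> B"
proof -
  have "finite (range (\<lambda>s. hat (h s)))" using finite_imageI[OF step_range[OF assms], of hat] by (simp add: image_image)
  then have "bounded (range (\<lambda>s. hat (h s)))" by (rule finite_imp_bounded)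
  then obtain B where B: "\<And>s. norm (hat (h s)) \<le> B" by (auto simp: bounded_iff)
  then show ?thesis using that[of B] norm_ge_zero order_trans by blast
qed

text \<open>A vector \<open>V\<close> given only weakly has to be estimated in norm. Left-endpoint
  sums \<open>S\<close> of constant integrals satisfy a recursion for the squared norm that is
  solved like a discrete Gronwall inequality, and they approximate the integral against exponential
  vectors with an error governed by the modulus of continuity \<epsilon>.\<close>

lemma riemann_sum:
  fixes g :: "real \<Rightarrow> ('h::chilbert_space, 'k::chilbert_space) khF"
  assumes a: "0 \<le> a" "0 \<le> \<tau>" "\<tau> \<le> 1" "b = a + real N * \<tau>"
    and d: "\<And>s. a \<le> s \<Longrightarrow> s < b \<Longrightarrow> f s = d"
    and g: "\<And>s. a \<le> s \<Longrightarrow> s \<le> b \<Longrightarrow> g s \<in> kadapted s f" "\<And>s. a \<le> s \<Longrightarrow> s \<le> b \<Longrightarrow> norm (g s) \<le> M"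
    and V: "wint g a b V"
    and e: "\<And>s s'. a \<le> s \<Longrightarrow> s \<le> s' \<Longrightarrow> s' \<le> b \<Longrightarrow> s' \<le> s + \<tau> \<Longrightarrow> norm (g s - g s') \<le> \<epsilon>"
  shows "k \<le> N \<Longrightarrow> \<exists>S \<in> adapted (a + real k * \<tau>) f.
      (norm S)\<^sup>2 \<le> real k * \<tau> * (1 + 2 * (norm (hat d))\<^sup>2) * M\<^sup>2 * (1 + \<tau>) ^ k \<and>
      (\<forall>w h B. h \<in> step_funs \<longrightarrow> 0 \<le> B \<longrightarrow> (\<forall>s. norm (hat (h s)) \<le> B) \<longrightarrow>
        cmod (cinner (w \<otimes> \<varpi> h) S - integral {a..a + real k * \<tau>} (\<lambda>s. cinner (hat (h s) \<otimes> (w \<otimes> \<varpi> h)) (g s)))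
        \<le> \<epsilon> * B * norm (w \<otimes> \<varpi> h) * (real k * \<tau>))"
proof (induction k)
  case 0
  show ?case
    by (rule bexI[of _ 0]) (use complex_vector.subspace_0[OF adapted_subspace] in auto)
next
  case (Suc k)
  let ?s = "a + real k * \<tau>" and ?t = "a + real (Suc k) * \<tau>" and ?C = "1 + 2 * (norm (hat d))\<^sup>2"
  let ?\<phi> = "\<lambda>w h s. cinner (hat (h s) \<otimes> (w \<otimes> \<varpi> h)) (g s)"
  from Suc obtain S where S: "S \<in> adapted ?s f"
    "(norm S)\<^sup>2 \<le> real k * \<tau> * ?C * M\<^sup>2 * (1 + \<tau>) ^ k"
    and E: "\<And>w h B. h \<in> step_funs \<Longrightarrow> 0 \<le> B \<Longrightarrow> (\<forall>s. norm (hat (h s)) \<le> B) \<Longrightarrow>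
        cmod (cinner (w \<otimes> \<varpi> h) S - integral {a..?s} (?\<phi> w h)) \<le> \<epsilon> * B * norm (w \<otimes> \<varpi> h) * (real k * \<tau>)"
    by (auto simp del: of_nat_Suc)
  have st: "0 \<le> ?s" "?s \<le> ?t" "a \<le> ?s" "?t = ?s + \<tau>" using a by (simp_all add: algebra_simps)
  have tt: "?t - ?s = \<tau>" using st(4) by simp
  have tb: "?t \<le> b" using Suc.prems a(2) mult_right_mono[of "real (Suc k)" "real N" \<tau>] unfolding a(4) by simp
  have ds: "f s = d" if "?s \<le> s" "s < ?t" for s using d[of s] that st tb by simp
  have gs: "g ?s \<in> kadapted ?s f" "norm (g ?s) \<le> M" using g st tb by auto
  obtain T :: "('h, 'k) khF \<Rightarrow>\<^sub>L ('h, 'k) hF" where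
    T: "\<And>\<gamma>. \<gamma> \<in> kadapted ?s f \<Longrightarrow> const_integral ?s ?t \<gamma> (blinfun_apply T \<gamma>)"
    "\<And>\<gamma>. \<gamma> \<in> kadapted ?s f \<Longrightarrow> blinfun_apply T \<gamma> \<in> adapted ?t f"
    by (rule const_integral_ex[where 'h = 'h and f = f, OF st(1,2) ds]) blast+
  let ?V = "blinfun_apply T (g ?s)"
  have M: "0 \<le> M" using gs(2) norm_ge_zero order_trans by blast
  have c: "Re (cinner S ?V) \<le> \<tau> * (norm (hat d) * norm S * M)"
  proof -
    have "Re (cinner S ?V) \<le> cmod (cinner S ?V)" by (rule complex_Re_le_cmod)
    also have "\<dots> = \<tau> * cmod (cinner (hat d \<otimes> S) (g ?s))"
      using const_integral_cross[OF S(1) ds T(1)[OF gs(1)] st(2)] a(2) by (simp add: norm_mult algebra_simps)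
    also have "\<dots> \<le> \<tau> * (norm (hat d \<otimes> S) * norm (g ?s))" by (intro mult_left_mono cmod_cinner_le a)
    also have "\<dots> \<le> \<tau> * (norm (hat d) * norm S * M)"
      unfolding norm_tensor by (intro mult_left_mono gs a) simp
    finally show ?thesis .
  qed
  \<comment> \<open>Splits the cross term: one part feeds the growth factor
    \<open>1 + \<tau>\<close>, the other contributes one of the two multiples of the squared norm of
    \<open>hat d\<close> in \<open>?C\<close>.\<close>
  have amgm: "2 * (norm (hat d) * norm S * M) \<le> (norm S)\<^sup>2 + (norm (hat d))\<^sup>2 * M\<^sup>2"
    using sum_squares_bound[of "norm S" "norm (hat d) * M"] by (simp add: power_mult_distrib mult_ac)
  have v: "(norm ?V)\<^sup>2 \<le> \<tau> * ((1 + (norm (hat d))\<^sup>2) * M\<^sup>2)"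
  proof -
    have "(norm ?V)\<^sup>2 \<le> (\<tau> + \<tau>\<^sup>2 * (norm (hat d))\<^sup>2) * (norm (g ?s))\<^sup>2"
      using norm_const_integral[OF st(1,2) ds gs(1) T(1)[OF gs(1)]] unfolding tt .
    also have "\<dots> \<le> (\<tau> + \<tau> * (norm (hat d))\<^sup>2) * M\<^sup>2"
      using a power_decreasing[of 1 2 \<tau>] by (intro mult_mono add_mono power_mono gs) auto
    finally show ?thesis by (simp add: algebra_simps)
  qed
  have "(norm (S + ?V))\<^sup>2 \<le> (norm S)\<^sup>2 + \<tau> * (2 * (norm (hat d) * norm S * M)) + \<tau> * ((1 + (norm (hat d))\<^sup>2) * M\<^sup>2)"
    unfolding norm_power2_add using c v by simp
  also have "\<dots> \<le> (norm S)\<^sup>2 + \<tau> * ((norm S)\<^sup>2 + (norm (hat d))\<^sup>2 * M\<^sup>2) + \<tau> * ((1 + (norm (hat d))\<^sup>2) * M\<^sup>2)"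
    using mult_left_mono[OF amgm a(2)] by simp
  also have "\<dots> = (1 + \<tau>) * (norm S)\<^sup>2 + \<tau> * ?C * M\<^sup>2" by (simp add: algebra_simps)
  also have "\<dots> \<le> (1 + \<tau>) * (real k * \<tau> * ?C * M\<^sup>2 * (1 + \<tau>) ^ k) + \<tau> * ?C * M\<^sup>2 * (1 + \<tau>) ^ Suc k"
  proof (rule add_mono)
    show "(1 + \<tau>) * (norm S)\<^sup>2 \<le> (1 + \<tau>) * (real k * \<tau> * ?C * M\<^sup>2 * (1 + \<tau>) ^ k)"
      by (rule mult_left_mono[OF S(2)]) (use a in simp)
    show "\<tau> * ?C * M\<^sup>2 \<le> \<tau> * ?C * M\<^sup>2 * (1 + \<tau>) ^ Suc k"
      using mult_left_mono[OF one_le_power[of "1 + \<tau>" "Suc k"], of "\<tau> * ?C * M\<^sup>2"] a(2) by simp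
  qed
  also have "\<dots> = real (Suc k) * \<tau> * ?C * M\<^sup>2 * (1 + \<tau>) ^ Suc k" by (simp add: algebra_simps)
  finally have n: "(norm (S + ?V))\<^sup>2 \<le> real (Suc k) * \<tau> * ?C * M\<^sup>2 * (1 + \<tau>) ^ Suc k" .
  have "cmod (cinner (w \<otimes> \<varpi> h) (S + ?V) - integral {a..?t} (?\<phi> w h)) \<le> \<epsilon> * B * norm (w \<otimes> \<varpi> h) * (real (Suc k) * \<tau>)"
    if h: "h \<in> step_funs" "0 \<le> B" "\<forall>s. norm (hat (h s)) \<le> B" for w h B
  proof -
    let ?x = "w \<otimes> \<varpi> h"
    have int: "?\<phi> w h integrable_on {a..b}" using V h(1) by (auto simp: wint_def)
    have i1: "?\<phi> w h integrable_on {a..?t}" by (rule integrable_on_subinterval[OF int]) (use tb in auto)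
    have i2: "?\<phi> w h integrable_on {?s..?t}" by (rule integrable_on_subinterval[OF int]) (use st tb in auto)
    have split: "integral {a..?t} (?\<phi> w h) = integral {a..?s} (?\<phi> w h) + integral {?s..?t} (?\<phi> w h)"
      using Henstock_Kurzweil_Integration.integral_combine[OF st(3,2) i1] by simp
    have "((\<lambda>s. cinner (hat (h s) \<otimes> ?x) (g ?s)) has_integral cinner ?x ?V) {?s..?t}"
      using wint_const[OF T(1)[OF gs(1)]] h(1) by (simp add: wint_def)
    then have "((\<lambda>s. cinner (hat (h s) \<otimes> ?x) (g ?s) - ?\<phi> w h s) has_integral (cinner ?x ?V - integral {?s..?t} (?\<phi> w h))) {?s..?t}"
      by (intro has_integral_diff integrable_integral i2)
    then have "cmod (cinner ?x ?V - integral {?s..?t} (?\<phi> w h)) \<le> (\<epsilon> * B * norm ?x) * measure lborel {?s..?t}"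
    proof (rule has_integral_bound_real[where S = "{}", rotated 2])
      have "0 \<le> \<epsilon>" using e[of ?s ?s] st tb a by simp
      then show "0 \<le> \<epsilon> * B * norm ?x" using h by simp
      fix s assume s: "s \<in> {?s..?t} - {}"
      have "cmod (cinner (hat (h s) \<otimes> ?x) (g ?s) - ?\<phi> w h s) \<le> norm (hat (h s) \<otimes> ?x) * norm (g ?s - g s)"
        unfolding cinner_diff_right[symmetric] by (rule cmod_cinner_le)
      also have "\<dots> \<le> (B * norm ?x) * \<epsilon>"
        unfolding norm_tensor[of "hat (h s)"]
        using s st tb by (intro mult_mono h(3)[rule_format] e) (auto simp: h)
      finally show "cmod (cinner (hat (h s) \<otimes> ?x) (g ?s) - ?\<phi> w h s) \<le> \<epsilon> * B * norm ?x" by (simp add: mult_ac)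
    qed auto
    then have p1: "cmod (cinner ?x ?V - integral {?s..?t} (?\<phi> w h)) \<le> \<epsilon> * B * norm ?x * \<tau>"
      using st by simp
    have p2: "cmod (cinner ?x S - integral {a..?s} (?\<phi> w h)) \<le> \<epsilon> * B * norm ?x * (real k * \<tau>)" by (rule E[OF h])
    have p3: "cinner ?x (S + ?V) - integral {a..?t} (?\<phi> w h)
        = (cinner ?x S - integral {a..?s} (?\<phi> w h)) + (cinner ?x ?V - integral {?s..?t} (?\<phi> w h))"
      unfolding split cinner_add_right by simp
    have "cmod (cinner ?x (S + ?V) - integral {a..?t} (?\<phi> w h)) \<le> \<epsilon> * B * norm ?x * (real k * \<tau>) + \<epsilon> * B * norm ?x * \<tau>"
      unfolding p3 by (rule order_trans[OF norm_triangle_ineq add_mono[OF p2 p1]])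
    then show ?thesis by (simp add: algebra_simps)
  qed
  moreover have "S + ?V \<in> adapted ?t f"
    using complex_vector.subspace_add[OF adapted_subspace subsetD[OF adapted_mono[OF st(2)] S(1)] T(2)[OF gs(1)]] .
  ultimately show ?case using n by (intro bexI[of _ "S + ?V"] conjI allI impI) auto
qed

text \<open>Riemann sums with a uniform norm bound approximate \<open>V\<close> against exponential
  vectors, which bounds \<open>V\<close> as a functional on a dense subspace. The factor 3 bounds
  \<open>exp 1\<close>, the Gronwall factor over an interval of length at most 1.\<close>

lemma wint_bound:
  fixes g :: "real \<Rightarrow> ('h::chilbert_space, 'k::chilbert_space) khF"
  assumes a: "0 \<le> a" "a \<le> b" "b \<le> a + 1" and d: "\<And>s. a \<le> s \<Longrightarrow> s < b \<Longrightarrow> f s = d"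
    and g: "continuous_on {a..b} g" "\<And>s. a \<le> s \<Longrightarrow> s \<le> b \<Longrightarrow> g s \<in> kadapted s f" "\<And>s. a \<le> s \<Longrightarrow> s \<le> b \<Longrightarrow> norm (g s) \<le> M"
    and V: "wint g a b V"
  shows "(norm V)\<^sup>2 \<le> (b - a) * (3 * (1 + 2 * (norm (hat d))\<^sup>2)) * M\<^sup>2" (is "_ \<le> ?K")
proof -
  have K: "0 \<le> ?K" using a by simp
  have approx: "cmod (cinner \<zeta> V) \<le> sqrt ?K * norm \<zeta>" if z: "\<zeta> \<in> exp_dom" for \<zeta> :: "('h, 'k) hF"
  proof -
    obtain A :: "('h \<times> (real \<Rightarrow> 'k)) set" and u where A: "finite A" "\<And>p. p \<in> A \<Longrightarrow> snd p \<in> step_funs"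
      "\<zeta> = (\<Sum>p\<in>A. u p \<otimes> \<varpi> (snd p))" by (rule exp_domE[OF z]) blast
    have "\<forall>p\<in>A. \<exists>B\<ge>0. \<forall>s. norm (hat (snd p s)) \<le> B" using hat_bound[OF A(2)] by metis
    then obtain B where B: "\<And>p. p \<in> A \<Longrightarrow> 0 \<le> B p \<and> (\<forall>s. norm (hat (snd p s)) \<le> B p)" by metis
    define L where "L = (\<Sum>p\<in>A. B p * norm (u p \<otimes> \<varpi> (snd p)) * (b - a))"
    have L: "0 \<le> L" unfolding L_def using B a by (intro sum_nonneg) auto
    show ?thesis
    proof (rule field_le_epsilon)
      fix e :: real assume e: "0 < e"
      \<comment> \<open>\<open>L\<close> is the total weight with which \<epsilon> enters the error
        for \<zeta>; adding 1 avoids division by zero.\<close>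
      define \<epsilon> where "\<epsilon> = e / (L + 1)"
      have \<epsilon>: "0 < \<epsilon>" using e L by (simp add: \<epsilon>_def)
      obtain r where r: "0 < r" "\<And>s s'. s \<in> {a..b} \<Longrightarrow> s' \<in> {a..b} \<Longrightarrow> dist s' s < r \<Longrightarrow> dist (g s') (g s) < \<epsilon>"
        using compact_uniformly_continuous[OF g(1) compact_Icc] \<epsilon> unfolding uniformly_continuous_on_def by metis
      obtain N :: nat where N: "(b - a + 1) / r < real N" using reals_Archimedean2 by blast
      then have N0: "0 < N" using a r by (cases N) (auto simp: field_simps not_less)
      define \<tau> where "\<tau> = (b - a) / real N"
      have t: "0 \<le> \<tau>" "\<tau> \<le> 1" "\<tau> < r" "b = a + real N * \<tau>" "b - a = real N * \<tau>"
        using N N0 a r by (auto simp: \<tau>_def field_simps)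
      have mod: "norm (g s - g s') \<le> \<epsilon>" if "a \<le> s" "s \<le> s'" "s' \<le> b" "s' \<le> s + \<tau>" for s s'
        using r(2)[of s' s] that t(3) by (auto simp: dist_norm intro: less_imp_le)
      obtain S where S: "(norm S)\<^sup>2 \<le> real N * \<tau> * (1 + 2 * (norm (hat d))\<^sup>2) * M\<^sup>2 * (1 + \<tau>) ^ N"
        and E: "\<And>w h B. h \<in> step_funs \<Longrightarrow> 0 \<le> B \<Longrightarrow> (\<forall>s. norm (hat (h s)) \<le> B) \<Longrightarrow>
          cmod (cinner (w \<otimes> \<varpi> h) S - integral {a..a + real N * \<tau>} (\<lambda>s. cinner (hat (h s) \<otimes> (w \<otimes> \<varpi> h)) (g s)))
            \<le> \<epsilon> * B * norm (w \<otimes> \<varpi> h) * (real N * \<tau>)"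
        using riemann_sum[where f = f and g = g and V = V and k = N, OF a(1) t(1,2,4) d g(2,3) V mod] by auto
      have "(1 + \<tau>) ^ N \<le> exp \<tau> ^ N" by (rule power_mono) (use t exp_ge_add_one_self[of \<tau>] in auto)
      also have "\<dots> = exp (b - a)" by (simp add: exp_of_nat_mult t(5))
      also have "\<dots> \<le> exp 1" using a by simp
      also have "\<dots> \<le> 3" by (rule exp_le)
      finally have "(norm S)\<^sup>2 \<le> real N * \<tau> * (1 + 2 * (norm (hat d))\<^sup>2) * M\<^sup>2 * 3"
        using t by (intro order_trans[OF S] mult_left_mono) auto
      then have "(norm S)\<^sup>2 \<le> ?K" unfolding t(5) by (simp add: algebra_simps)
      then have nS: "norm S \<le> sqrt ?K" by (rule real_le_rsqrt)
      have "cmod (cinner (u p \<otimes> \<varpi> (snd p)) V - cinner (u p \<otimes> \<varpi> (snd p)) S) \<le> \<epsilon> * (B p * norm (u p \<otimes> \<varpi> (snd p)) * (b - a))"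
        if p: "p \<in> A" for p
      proof -
        have "integral {a..a + real N * \<tau>} (\<lambda>s. cinner (hat (snd p s) \<otimes> (u p \<otimes> \<varpi> (snd p))) (g s)) = cinner (u p \<otimes> \<varpi> (snd p)) V"
          using V A(2)[OF p] unfolding wint_def t(4)[symmetric] by (blast intro: integral_unique)
        then show ?thesis
          using E[of "snd p" "B p" "u p"] A(2)[OF p] B[OF p] by (simp add: norm_minus_commute t(5) mult_ac)
      qed
      then have "cmod (cinner \<zeta> V - cinner \<zeta> S) \<le> \<epsilon> * L"
        unfolding A(3) L_def cinner_sum_left sum_subtractf[symmetric] sum_distrib_left by (rule sum_norm_le)
      also have "\<dots> \<le> e" using e L by (simp add: \<epsilon>_def field_simps)
      finally have "cmod (cinner \<zeta> V - cinner \<zeta> S) \<le> e" .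
      moreover have "cmod (cinner \<zeta> S) \<le> norm \<zeta> * sqrt ?K"
        by (rule order_trans[OF cmod_cinner_le mult_left_mono[OF nS]]) simp
      moreover have "cmod (cinner \<zeta> V) \<le> cmod (cinner \<zeta> V - cinner \<zeta> S) + cmod (cinner \<zeta> S)"
        using norm_triangle_sub[of "cinner \<zeta> V" "cinner \<zeta> S"] by simp
      ultimately show "cmod (cinner \<zeta> V) \<le> sqrt ?K * norm \<zeta> + e" by (simp add: mult.commute)
    qed
  qed
  have "closed {\<zeta>. cmod (cinner \<zeta> V) \<le> sqrt ?K * norm \<zeta>}" by (intro closed_Collect_le continuous_intros)
  then have "closure exp_dom \<subseteq> {\<zeta>. cmod (cinner \<zeta> V) \<le> sqrt ?K * norm \<zeta>}"
    by (intro closure_minimal) (use approx in auto)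
  then have "V \<in> {\<zeta>. cmod (cinner \<zeta> V) \<le> sqrt ?K * norm \<zeta>}" unfolding exp_dom_dense by (rule subsetD) simp
  then have "norm V * norm V \<le> sqrt ?K * norm V" by (simp add: cinner_self power2_eq_square norm_mult)
  then have "norm V \<le> sqrt ?K" using K by (cases "norm V = 0") (simp_all add: mult_le_cancel_right_pos)
  then have "(norm V)\<^sup>2 \<le> (sqrt ?K)\<^sup>2" by (rule power_mono) simp
  then show ?thesis unfolding real_sqrt_pow2[OF K] .
qed

text \<open>The data of an integral process near \<open>a\<close>: the integrand \<open>g\<close> is adapted to the future of \<open>f\<close>, which
  takes the value \<open>d\<close> on \<open>[a, a + r)\<close>, and \<open>V h\<close> is the integral over \<open>[a, a + h]\<close>.\<close>

locale local_integral =
  fixes a r :: real and f :: "real \<Rightarrow> 'k::chilbert_space" and d :: 'k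
    and g :: "real \<Rightarrow> ('h::chilbert_space, 'k) khF" and V :: "real \<Rightarrow> ('h, 'k) hF"
  assumes a: "0 \<le> a" and r: "0 < r" and d: "\<And>s. a \<le> s \<Longrightarrow> s < a + r \<Longrightarrow> f s = d"
    and g_cont: "continuous_on {a..a + r} g"
    and g_adapted: "\<And>s. a \<le> s \<Longrightarrow> s \<le> a + r \<Longrightarrow> g s \<in> kadapted s f"
    and V: "\<And>h. 0 < h \<Longrightarrow> h \<le> r \<Longrightarrow> wint g a (a + h) (V h)"
begin

lemma small:
  assumes "0 < e"
  obtains u where "0 < u" "u \<le> r" "u \<le> 1" "\<And>s. a \<le> s \<Longrightarrow> s \<le> a + u \<Longrightarrow> norm (g s - g a) \<le> e"
proof -
  obtain u where u: "0 < u" "\<And>s. s \<in> {a..a + r} \<Longrightarrow> dist s a < u \<Longrightarrow> dist (g s) (g a) < e"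
    using g_cont r assms unfolding continuous_on_iff by (metis add_increasing2 atLeastAtMost_iff less_imp_le order_refl)
  show ?thesis
  proof (rule that[of "min (u / 2) (min r 1)"])
    fix s assume "a \<le> s" "s \<le> a + min (u / 2) (min r 1)"
    then have "a \<le> s" "s \<le> a + r" "s - a < u" using u(1) by linarith+
    then show "norm (g s - g a) \<le> e" using u(2)[of s] by (simp add: dist_norm)
  qed (use u r in auto)
qed

lemma eventually_small:
  assumes "0 < e"
  shows "eventually (\<lambda>h. 0 < h \<and> h \<le> r \<and> h \<le> 1 \<and> (\<forall>s. a \<le> s \<longrightarrow> s \<le> a + h \<longrightarrow> norm (g s - g a) \<le> e)) (at_right 0)"
proof -
  obtain u where u: "0 < u" "u \<le> r" "u \<le> 1" "\<And>s. a \<le> s \<Longrightarrow> s \<le> a + u \<Longrightarrow> norm (g s - g a) \<le> e"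
    by (rule small[OF assms]) blast
  show ?thesis unfolding eventually_at_right_field
    by (rule exI[of _ u]) (use u in auto)
qed

text \<open>The leading part of \<open>V h\<close>: the integral over \<open>[a, a + h]\<close> with
  the integrand frozen at its initial value.\<close>

definition W :: "real \<Rightarrow> ('h, 'k) hF" where
  "W h = (SOME w. const_integral a (a + h) (g a) w)"

lemma W:
  assumes "0 < h" "h \<le> r" shows "const_integral a (a + h) (g a) (W h)"
proof -
  obtain T :: "('h, 'k) khF \<Rightarrow>\<^sub>L ('h, 'k) hF"
    where "\<And>\<gamma>. \<gamma> \<in> kadapted a f \<Longrightarrow> const_integral a (a + h) \<gamma> (blinfun_apply T \<gamma>)"
    by (rule const_integral_ex[where 'h = 'h and f = f and a = a and b = "a + h" and d = d]) (use a assms d in auto)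
  then have "const_integral a (a + h) (g a) (blinfun_apply T (g a))" using g_adapted[of a] r by simp
  then show ?thesis unfolding W_def by (rule someI)
qed

lemma norm_W: "0 < h \<Longrightarrow> h \<le> r \<Longrightarrow> h \<le> 1 \<Longrightarrow> norm ((1 / sqrt h) *\<^sub>R W h) \<le> sqrt (1 + (norm (hat d))\<^sup>2) * norm (g a)"
proof -
  assume h: "0 < h" "h \<le> r" "h \<le> 1"
  have dh: "f s = d" if "a \<le> s" "s < a + h" for s using d that h by simp
  have "(norm (W h))\<^sup>2 \<le> ((a + h - a) + (a + h - a)\<^sup>2 * (norm (hat d))\<^sup>2) * (norm (g a))\<^sup>2"
    by (rule norm_const_integral[OF a _ dh _ W]) (use h g_adapted r in auto)
  also have "\<dots> \<le> (h + h * (norm (hat d))\<^sup>2) * (norm (g a))\<^sup>2"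
    using h power_decreasing[of 1 2 h] by (intro mult_right_mono add_mono) auto
  finally have "(norm (W h))\<^sup>2 / h \<le> (1 + (norm (hat d))\<^sup>2) * (norm (g a))\<^sup>2"
    using h by (simp add: field_simps)
  then have "(norm ((1 / sqrt h) *\<^sub>R W h))\<^sup>2 \<le> (1 + (norm (hat d))\<^sup>2) * (norm (g a))\<^sup>2"
    using h by (simp add: power_divide)
  then have "norm ((1 / sqrt h) *\<^sub>R W h) \<le> sqrt ((1 + (norm (hat d))\<^sup>2) * (norm (g a))\<^sup>2)" by (rule real_le_rsqrt)
  then show ?thesis by (simp add: real_sqrt_mult)
qed

text \<open>The difference is the integral of \<open>g s - g a\<close>, which is uniformly small
  near \<open>a\<close>. By \<open>wint_bound\<close> the error is o(sqrt h), enough for inner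
  products that are divided by \<open>h\<close>.\<close>

lemma V_W: "((\<lambda>h. (1 / sqrt h) *\<^sub>R (V h - W h)) \<longlongrightarrow> 0) (at_right 0)"
proof (rule tendstoI)
  let ?K = "3 * (1 + 2 * (norm (hat d))\<^sup>2)"
  have K: "0 < ?K" by (simp add: add_pos_nonneg)
  fix e :: real assume e: "0 < e"
  define e' where "e' = e / (2 * sqrt ?K)"
  have e': "0 < e'" "sqrt ?K * e' < e" using e K by (auto simp: e'_def field_simps)
  show "eventually (\<lambda>h. dist ((1 / sqrt h) *\<^sub>R (V h - W h)) 0 < e) (at_right 0)"
    using eventually_small[OF e'(1)]
  proof (rule eventually_mono)
    fix h assume h: "0 < h \<and> h \<le> r \<and> h \<le> 1 \<and> (\<forall>s. a \<le> s \<longrightarrow> s \<le> a + h \<longrightarrow> norm (g s - g a) \<le> e')"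
    have "wint (\<lambda>s. g s - g a) a (a + h) (V h - W h)"
      using h by (intro wint_diff V wint_const W) auto
    moreover have "continuous_on {a..a + h} (\<lambda>s. g s - g a)"
      by (intro continuous_intros continuous_on_subset[OF g_cont]) (use h in auto)
    moreover have "g s - g a \<in> kadapted s f" if s: "a \<le> s" "s \<le> a + h" for s
      by (rule complex_vector.subspace_diff[OF kadapted_subspace g_adapted subsetD[OF kadapted_mono g_adapted]])
        (use s h r in auto)
    ultimately have "(norm (V h - W h))\<^sup>2 \<le> (a + h - a) * ?K * e'\<^sup>2"
      by (intro wint_bound[where f = f and g = "\<lambda>s. g s - g a" and d = d]) (use a h d in auto)
    then have "(norm (V h - W h))\<^sup>2 / h \<le> ?K * e'\<^sup>2" using h by (simp add: field_simps)
    then have "(norm ((1 / sqrt h) *\<^sub>R (V h - W h)))\<^sup>2 \<le> ?K * e'\<^sup>2" using h by (simp add: power_divide)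
    then have "norm ((1 / sqrt h) *\<^sub>R (V h - W h)) \<le> sqrt (?K * e'\<^sup>2)" by (rule real_le_rsqrt)
    also have "\<dots> = sqrt ?K * e'" using e' by (simp add: real_sqrt_mult)
    finally show "dist ((1 / sqrt h) *\<^sub>R (V h - W h)) 0 < e" using e' by (simp add: dist_norm)
  qed
qed

text \<open>Against a vector adapted at time \<open>a\<close> the integral is of order h rather than
  sqrt h, because \<open>wint_cross\<close> reduces it to an ordinary integral of a continuous
  function.\<close>

lemma cross_limit:
  assumes x: "x \<in> adapted a f'" and d': "\<And>s. a \<le> s \<Longrightarrow> s < a + r \<Longrightarrow> f' s = d'"
  shows "((\<lambda>h. cinner x (V h) / of_real h) \<longlongrightarrow> cinner (hat d' \<otimes> x) (g a)) (at_right 0)"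
proof (rule tendstoI)
  let ?K = "norm (hat d' \<otimes> x) + 1"
  fix e :: real assume e: "0 < e"
  define e' where "e' = e / ?K"
  have K: "0 < ?K" by (simp add: add_nonneg_pos)
  have e': "0 < e'" using e K by (simp add: e'_def)
  have e'e: "norm (hat d' \<otimes> x) * e' < e" unfolding e'_def using e K by (simp add: field_simps)
  show "eventually (\<lambda>h. dist (cinner x (V h) / of_real h) (cinner (hat d' \<otimes> x) (g a)) < e) (at_right 0)"
    using eventually_small[OF e']
  proof (rule eventually_mono)
    fix h assume h: "0 < h \<and> h \<le> r \<and> h \<le> 1 \<and> (\<forall>s. a \<le> s \<longrightarrow> s \<le> a + h \<longrightarrow> norm (g s - g a) \<le> e')"
    have w: "wint (\<lambda>s. g s - g a) a (a + h) (V h - W h)"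
      using h by (intro wint_diff V wint_const W) auto
    have c: "continuous_on {a..a + h} (\<lambda>s. g s - g a)"
      by (intro continuous_intros continuous_on_subset[OF g_cont]) (use h in auto)
    have dh: "f' s = d'" if "a \<le> s" "s < a + h" for s using d' that h by simp
    have "cinner x (V h) = cinner x (V h - W h) + cinner x (W h)" by (simp add: cinner_diff_right)
    also have "cinner x (V h - W h) = cinner (hat d' \<otimes> x) (integral {a..a + h} (\<lambda>s. g s - g a))"
      by (rule wint_cross[OF x dh c w])
    also have "cinner x (W h) = of_real (a + h - a) * cinner (hat d' \<otimes> x) (g a)"
      by (rule const_integral_cross[OF x dh W]) (use h in auto)
    finally have eq: "cinner x (V h) / of_real h - cinner (hat d' \<otimes> x) (g a)
        = cinner (hat d' \<otimes> x) (integral {a..a + h} (\<lambda>s. g s - g a)) / of_real h"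
      using h by (simp add: field_simps)
    have "norm (integral {a..a + h} (\<lambda>s. g s - g a)) \<le> e' * (a + h - a)"
      by (rule integral_bound[OF _ c]) (use h in auto)
    then have "cmod (cinner (hat d' \<otimes> x) (integral {a..a + h} (\<lambda>s. g s - g a))) \<le> norm (hat d' \<otimes> x) * (e' * h)"
      by (intro order_trans[OF cmod_cinner_le] mult_left_mono) auto
    then have "cmod (cinner x (V h) / of_real h - cinner (hat d' \<otimes> x) (g a)) \<le> norm (hat d' \<otimes> x) * e'"
      unfolding eq using h by (simp add: norm_divide field_simps)
    then show "dist (cinner x (V h) / of_real h) (cinner (hat d' \<otimes> x) (g a)) < e"
      using e'e by (simp add: dist_norm)
  qed
qed

end

lemma ito_limit:
  assumes I: "local_integral a r f d g V" and I': "local_integral a r f' d' g' V'"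
  shows "((\<lambda>h. cinner (V h) (V' h) / of_real h) \<longlongrightarrow> cinner (blinfun_apply Dl (g a)) (blinfun_apply Dl (g' a))) (at_right 0)"
proof -
  interpret I: local_integral a r f d g V by (rule I)
  interpret I': local_integral a r f' d' g' V' by (rule I')
  let ?p = "\<lambda>h. (1 / sqrt h) *\<^sub>R (V h - I.W h)" and ?q = "\<lambda>h. (1 / sqrt h) *\<^sub>R I.W h"
  let ?p' = "\<lambda>h. (1 / sqrt h) *\<^sub>R (V' h - I'.W h)" and ?q' = "\<lambda>h. (1 / sqrt h) *\<^sub>R I'.W h"
  have ev: "eventually (\<lambda>h. 0 < h \<and> h \<le> r \<and> h \<le> 1) (at_right 0)"
    using I.eventually_small[of 1] by (rule eventually_mono) auto
  have "((\<lambda>h. cinner (blinfun_apply Dl (g a)) (blinfun_apply Dl (g' a))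
      + of_real h * cinner (blinfun_apply (El (hat d')) (g a)) (blinfun_apply (El (hat d)) (g' a)))
      \<longlongrightarrow> cinner (blinfun_apply Dl (g a)) (blinfun_apply Dl (g' a)) + of_real 0 * cinner (blinfun_apply (El (hat d')) (g a)) (blinfun_apply (El (hat d)) (g' a))) (at_right 0)"
    by (intro tendsto_intros)
  then have "((\<lambda>h. cinner (blinfun_apply Dl (g a)) (blinfun_apply Dl (g' a))
      + of_real h * cinner (blinfun_apply (El (hat d')) (g a)) (blinfun_apply (El (hat d)) (g' a)))
      \<longlongrightarrow> cinner (blinfun_apply Dl (g a)) (blinfun_apply Dl (g' a))) (at_right 0)" by simp
  then have qq: "((\<lambda>h. cinner (?q h) (?q' h)) \<longlongrightarrow> cinner (blinfun_apply Dl (g a)) (blinfun_apply Dl (g' a))) (at_right 0)"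
  proof (rule Lim_transform_eventually[OF _ eventually_mono[OF ev]])
    fix h assume h: "0 < h \<and> h \<le> r \<and> h \<le> 1"
    have "cinner (I.W h) (I'.W h) = ito (a + h - a) (hat d) (hat d') (g a) (g' a)"
      by (rule const_integral_ito[where f = f and f' = f'])
        (use h I.a I.d I'.d I.W I'.W I.r I.g_adapted I'.g_adapted in auto)
    then have "cinner (I.W h) (I'.W h) / of_real h = cinner (blinfun_apply Dl (g a)) (blinfun_apply Dl (g' a))
      + of_real h * cinner (blinfun_apply (El (hat d')) (g a)) (blinfun_apply (El (hat d)) (g' a))"
      using h by (simp add: ito_def power2_eq_square field_simps)
    moreover have "cinner (?q h) (?q' h) = cinner (I.W h) (I'.W h) / of_real h"
      using h by (simp add: cinner_scaleR_left cinner_scaleR_right flip: of_real_mult)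
    ultimately show "cinner (blinfun_apply Dl (g a)) (blinfun_apply Dl (g' a))
      + of_real h * cinner (blinfun_apply (El (hat d')) (g a)) (blinfun_apply (El (hat d)) (g' a)) = cinner (?q h) (?q' h)"
      by simp
  qed
  have pp: "((\<lambda>h. cinner (?p h) (?p' h)) \<longlongrightarrow> 0) (at_right 0)"
    using tendsto_cinner[OF I.V_W I'.V_W] by simp
  have pq: "((\<lambda>h. cinner (?p h) (?q' h)) \<longlongrightarrow> 0) (at_right 0)"
  proof (rule Lim_null_comparison)
    show "eventually (\<lambda>h. cmod (cinner (?p h) (?q' h)) \<le> norm (?p h) * (sqrt (1 + (norm (hat d'))\<^sup>2) * norm (g' a))) (at_right 0)"
      using ev by (rule eventually_mono) (intro order_trans[OF cmod_cinner_le] mult_left_mono I'.norm_W; simp)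
    show "((\<lambda>h. norm (?p h) * (sqrt (1 + (norm (hat d'))\<^sup>2) * norm (g' a))) \<longlongrightarrow> 0) (at_right 0)"
      using tendsto_mult_right[OF tendsto_norm[OF I.V_W], of "sqrt (1 + (norm (hat d'))\<^sup>2) * norm (g' a)"] by simp
  qed
  have qp: "((\<lambda>h. cinner (?q h) (?p' h)) \<longlongrightarrow> 0) (at_right 0)"
  proof (rule Lim_null_comparison)
    show "eventually (\<lambda>h. cmod (cinner (?q h) (?p' h)) \<le> (sqrt (1 + (norm (hat d))\<^sup>2) * norm (g a)) * norm (?p' h)) (at_right 0)"
      using ev by (rule eventually_mono) (intro order_trans[OF cmod_cinner_le] mult_right_mono I.norm_W; simp)
    show "((\<lambda>h. (sqrt (1 + (norm (hat d))\<^sup>2) * norm (g a)) * norm (?p' h)) \<longlongrightarrow> 0) (at_right 0)"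
      using tendsto_mult_left[OF tendsto_norm[OF I'.V_W], of "sqrt (1 + (norm (hat d))\<^sup>2) * norm (g a)"] by simp
  qed
  have "((\<lambda>h. cinner (?p h) (?p' h) + cinner (?p h) (?q' h) + (cinner (?q h) (?p' h) + cinner (?q h) (?q' h)))
      \<longlongrightarrow> 0 + 0 + (0 + cinner (blinfun_apply Dl (g a)) (blinfun_apply Dl (g' a)))) (at_right 0)"
    by (intro tendsto_add pp pq qp qq)
  then have "((\<lambda>h. cinner (?p h) (?p' h) + cinner (?p h) (?q' h) + (cinner (?q h) (?p' h) + cinner (?q h) (?q' h)))
      \<longlongrightarrow> cinner (blinfun_apply Dl (g a)) (blinfun_apply Dl (g' a))) (at_right 0)" by simp
  then show ?thesis
  proof (rule Lim_transform_eventually[OF _ eventually_mono[OF ev]])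
    fix h assume h: "0 < h \<and> h \<le> r \<and> h \<le> 1"
    have "cinner (?p h) (?p' h) + cinner (?p h) (?q' h) + (cinner (?q h) (?p' h) + cinner (?q h) (?q' h))
      = cinner (?p h + ?q h) (?p' h + ?q' h)" by (simp only: cinner_add_left cinner_add_right add_ac)
    also have "\<dots> = cinner ((1 / sqrt h) *\<^sub>R V h) ((1 / sqrt h) *\<^sub>R V' h)" by (simp flip: scaleR_add_right)
    also have "\<dots> = cinner (V h) (V' h) / of_real h"
      using h by (simp add: cinner_scaleR_left cinner_scaleR_right flip: of_real_mult)
    finally show "cinner (?p h) (?p' h) + cinner (?p h) (?q' h) + (cinner (?q h) (?p' h) + cinner (?q h) (?q' h))
      = cinner (V h) (V' h) / of_real h" .
  qed
qed

text \<open>The product rule with three terms: two cross terms, for which \<open>X a\<close> and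
  \<open>X' a\<close> must be adapted, and the product of the increments, which survives division by
  \<open>h\<close> and is the Ito correction.\<close>

lemma right_derivative_cinner:
  assumes I: "local_integral a r f d g (\<lambda>h. X (a + h) - X a)" and I': "local_integral a r f' d' g' (\<lambda>h. X' (a + h) - X' a)"
    and X: "X a \<in> adapted a f" "X' a \<in> adapted a f'"
  shows "((\<lambda>h. (cinner (X (a + h)) (X' (a + h)) - cinner (X a) (X' a)) / of_real h) \<longlongrightarrow>
     cinner (hat d \<otimes> X a) (g' a) + cinner (g a) (hat d' \<otimes> X' a) + cinner (blinfun_apply Dl (g a)) (blinfun_apply Dl (g' a))) (at_right 0)"
proof -
  interpret I: local_integral a r f d g "\<lambda>h. X (a + h) - X a" by (rule I)
  interpret I': local_integral a r f' d' g' "\<lambda>h. X' (a + h) - X' a" by (rule I')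
  let ?V = "\<lambda>h. X (a + h) - X a" and ?V' = "\<lambda>h. X' (a + h) - X' a"
  have c2: "((\<lambda>h. cinner (?V h) (X' a) / of_real h) \<longlongrightarrow> cinner (g a) (hat d' \<otimes> X' a)) (at_right 0)"
    using tendsto_cnj[OF I.cross_limit[OF X(2) I'.d]] by (simp flip: cinner_commute)
  have "((\<lambda>h. cinner (X a) (?V' h) / of_real h + cinner (?V h) (X' a) / of_real h + cinner (?V h) (?V' h) / of_real h) \<longlongrightarrow>
     cinner (hat d \<otimes> X a) (g' a) + cinner (g a) (hat d' \<otimes> X' a) + cinner (blinfun_apply Dl (g a)) (blinfun_apply Dl (g' a))) (at_right 0)"
    by (intro tendsto_add I'.cross_limit[OF X(1) I.d] c2 ito_limit[OF I I'])
  moreover have "cinner (X a) (?V' h) / of_real h + cinner (?V h) (X' a) / of_real h + cinner (?V h) (?V' h) / of_real h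
      = (cinner (X (a + h)) (X' (a + h)) - cinner (X a) (X' a)) / of_real h" for h
    by (simp add: cinner_diff_left cinner_diff_right flip: add_divide_distrib)
  ultimately show ?thesis by simp
qed

section \<open>Adapted operators and strong continuity\<close>

definition adapted_op :: "real \<Rightarrow> (('h::chilbert_space, 'k::chilbert_space) hF \<Rightarrow> ('h, 'k) hF) \<Rightarrow> bool" where
  "adapted_op t X \<longleftrightarrow> (\<forall>h\<in>step_funs. \<forall>f\<in>step_funs. \<forall>w v. cinner (w \<otimes> \<varpi> h) (X (v \<otimes> \<varpi> f))
     = cinner (\<varpi> (restr {t..} h)) (\<varpi> (restr {t..} f)) * cinner (w \<otimes> \<varpi> (restr {0..<t} h)) (X (v \<otimes> \<varpi> (restr {0..<t} f))))"

lemma process_adapted_op: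
  fixes X :: "real \<Rightarrow> ('h::chilbert_space, 'k::chilbert_space) hF \<Rightarrow> ('h, 'k) hF"
  assumes X: "process X" and t: "0 \<le> t" shows "adapted_op t (X t)"
  unfolding adapted_op_def
proof (intro ballI allI)
  fix h f :: "real \<Rightarrow> 'k" and w v :: 'h assume hf: "h \<in> step_funs" "f \<in> step_funs"
  have "cinner (w \<otimes> \<varpi> h) (X t (v \<otimes> \<varpi> f)) = cinner w (blinfun_apply (bra (\<varpi> h)) (X t (blinfun_apply (ket (\<varpi> f)) v)))"
    by (simp add: cinner_bra)
  also have "blinfun_apply (bra (\<varpi> h)) (X t (blinfun_apply (ket (\<varpi> f)) v)) = cinner (\<varpi> (restr {t..} h)) (\<varpi> (restr {t..} f)) *\<^sub>C
          blinfun_apply (bra (\<varpi> (restr {0..<t} h))) (X t (blinfun_apply (ket (\<varpi> (restr {0..<t} f))) v))"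
    using X t hf unfolding process_def by blast
  finally show "cinner (w \<otimes> \<varpi> h) (X t (v \<otimes> \<varpi> f)) = cinner (\<varpi> (restr {t..} h)) (\<varpi> (restr {t..} f))
      * cinner (w \<otimes> \<varpi> (restr {0..<t} h)) (X t (v \<otimes> \<varpi> (restr {0..<t} f)))"
    by (simp add: cinner_bra)
qed

lemma adapted_op_vector:
  fixes X :: "('h::chilbert_space, 'k::chilbert_space) hF \<Rightarrow> ('h, 'k) hF"
  assumes X: "adapted_op t X" and t: "0 \<le> t" and f: "f \<in> step_funs"
  shows "X (v \<otimes> \<varpi> f) \<in> adapted t f"
proof (rule adaptedI[OF f t])
  fix w :: 'h and h :: "real \<Rightarrow> 'k" assume "h \<in> step_funs"
  then show "cinner (w \<otimes> \<varpi> h) (X (v \<otimes> \<varpi> f)) = cinner (\<varpi> (restr {t..} h)) (\<varpi> (restr {t..} f))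
      * cinner (w \<otimes> \<varpi> (restr {0..<t} h)) (X (v \<otimes> \<varpi> (restr {0..<t} f)))"
    using X f by (simp add: adapted_op_def)
qed

lemma adapted_cong: "(\<And>s. a \<le> s \<Longrightarrow> f s = g s) \<Longrightarrow> adapted a f = adapted a g"
  unfolding adapted_def by (rule arg_cong[of _ _ "\<lambda>S. closure (cspan S)"]) force

lemma adapted_op_preserves:
  fixes B :: "('h::chilbert_space, 'k::chilbert_space) hF \<Rightarrow>\<^sub>L ('h, 'k) hF"
  assumes B: "B \<in> bops" "adapted_op t (blinfun_apply B)" and t: "0 \<le> t" and x: "x \<in> adapted t f"
  shows "blinfun_apply B x \<in> adapted t f"
  using x
proof (rule adapted_induct)
  show "complex_vector.subspace {x. blinfun_apply B x \<in> adapted t f}"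
    using adapted_subspace[of t f] unfolding complex_vector.subspace_def
    by (simp add: blinfun.add_right bops_scaleC[OF B(1)] blinfun.zero_right) blast
  show "closed {x. blinfun_apply B x \<in> adapted t f}"
    using continuous_closed_preimage[of UNIV "blinfun_apply B", OF _ closed_UNIV adapted_closed]
    by (simp add: vimage_def linear_continuous_on blinfun.bounded_linear_right)
  fix v :: 'h and e assume e: "e \<in> step_funs" "\<And>s. t \<le> s \<Longrightarrow> e s = f s"
  have "adapted t e = (adapted t f :: ('h, 'k) hF set)" by (rule adapted_cong) (rule e(2))
  then show "blinfun_apply B (v \<otimes> \<varpi> e) \<in> adapted t f" using adapted_op_vector[OF B(2) t e(1), of v] by simp
qed

lemma amp_preserves:
  fixes B :: "('h::chilbert_space, 'k::chilbert_space) hF \<Rightarrow>\<^sub>L ('h, 'k) hF"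
  assumes B: "B \<in> bops" "adapted_op t (blinfun_apply B)" and t: "0 \<le> t" and x: "x \<in> kadapted t f"
  shows "blinfun_apply (amp B) x \<in> kadapted t f"
  using x
proof (rule kadapted_induct)
  have A: "(amp B :: ('h, 'k) khF \<Rightarrow>\<^sub>L ('h, 'k) khF) \<in> bops" by (rule tmap_bops) (use B in auto)
  show "complex_vector.subspace {x. blinfun_apply (amp B) x \<in> kadapted t f}"
    using kadapted_subspace[of t f] unfolding complex_vector.subspace_def
    by (simp add: blinfun.add_right bops_scaleC[OF A] blinfun.zero_right) blast
  show "closed {x. blinfun_apply (amp B) x \<in> kadapted t f}"
    using continuous_closed_preimage[of UNIV "blinfun_apply (amp B)", OF _ closed_UNIV kadapted_closed]
    by (simp add: vimage_def linear_continuous_on blinfun.bounded_linear_right)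
  fix c :: "complex \<times> 'k" and v :: 'h and e assume e: "e \<in> step_funs" "\<And>s. t \<le> s \<Longrightarrow> e s = f s"
  have "blinfun_apply B (v \<otimes> \<varpi> e) \<in> adapted t f"
    by (rule adapted_op_preserves[OF B t adapted_base[OF e]])
  then show "blinfun_apply (amp B) (c \<otimes> (v \<otimes> \<varpi> e)) \<in> kadapted t f"
    by (simp add: tmap_tensor B tensor_in_kadapted)
qed

text \<open>The Lipschitz bound is uniform in \<open>s\<close>, so convergence of vectors gives
  uniform convergence of the functions. Continuity in time then needs checking only on a total
  set.\<close>

lemma closed_continuous_on:
  fixes \<phi> :: "'i::topological_space \<Rightarrow> 'a::real_normed_vector \<Rightarrow> 'b::real_normed_vector"
  assumes K: "\<And>s x y. s \<in> S \<Longrightarrow> norm (\<phi> s x - \<phi> s y) \<le> K * norm (x - y)"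
  shows "closed {x. continuous_on S (\<lambda>s. \<phi> s x)}"
  unfolding closed_sequential_limits
proof (intro allI impI)
  fix x l assume "(\<forall>n. x n \<in> {x. continuous_on S (\<lambda>s. \<phi> s x)}) \<and> x \<longlonglongrightarrow> l"
  then have x: "\<And>n. continuous_on S (\<lambda>s. \<phi> s (x n))" "x \<longlonglongrightarrow> l" by auto
  have lim: "(\<lambda>n. K * norm (x n - l)) \<longlonglongrightarrow> K * norm (l - l)" by (intro tendsto_intros x)
  have "uniform_limit S (\<lambda>n s. \<phi> s (x n)) (\<lambda>s. \<phi> s l) sequentially"
    unfolding uniform_limit_iff
  proof (intro allI impI)
    fix e :: real assume "0 < e"
    then have "eventually (\<lambda>n. K * norm (x n - l) < e) sequentially" using order_tendstoD(2)[OF lim, of e] by simp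
    then show "eventually (\<lambda>n. \<forall>s\<in>S. dist (\<phi> s (x n)) (\<phi> s l) < e) sequentially"
      by (rule eventually_mono) (auto simp: dist_norm intro: le_less_trans[OF K])
  qed
  then have "continuous_on S (\<lambda>s. \<phi> s l)"
    by (intro uniform_limit_theorem[OF _ _ sequentially_bot]) (use x(1) in auto)
  then show "l \<in> {x. continuous_on S (\<lambda>s. \<phi> s x)}" by simp
qed

lemma continuous_on_total:
  fixes R :: "'i::topological_space \<Rightarrow> 'a::complex_inner \<Rightarrow>\<^sub>L 'b::complex_inner"
  assumes R: "\<And>s. s \<in> S \<Longrightarrow> R s \<in> bops" "\<And>s. s \<in> S \<Longrightarrow> norm (R s) \<le> M"
    and D: "closure (cspan D) = UNIV" "\<And>x. x \<in> D \<Longrightarrow> continuous_on S (\<lambda>s. blinfun_apply (R s) x)"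
  shows "continuous_on S (\<lambda>s. blinfun_apply (R s) x)"
proof -
  have "x \<in> closure (cspan D)" using D(1) by simp
  then show ?thesis
  proof (rule cspan_closure_induct)
    show "complex_vector.subspace {x. continuous_on S (\<lambda>s. blinfun_apply (R s) x)}"
      by (auto simp: complex_vector.subspace_def blinfun.add_right bops_scaleC[OF R(1)] blinfun.zero_right
          cong: continuous_on_cong_simp intro!: continuous_intros)
    show "closed {x. continuous_on S (\<lambda>s. blinfun_apply (R s) x)}"
      by (rule closed_continuous_on[where K = M])
        (auto simp flip: blinfun.diff_right intro!: order_trans[OF norm_blinfun] mult_right_mono R)
  qed (rule D(2))
qed

lemma continuous_on_cinner_total:
  fixes R :: "'i::topological_space \<Rightarrow> 'a::complex_inner \<Rightarrow>\<^sub>L 'b::complex_inner"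
  assumes R: "\<And>s. s \<in> S \<Longrightarrow> R s \<in> bops" "\<And>s. s \<in> S \<Longrightarrow> norm (R s) \<le> M"
    and D: "closure (cspan D) = UNIV" and E: "closure (cspan E) = UNIV"
    and c: "\<And>y x. y \<in> E \<Longrightarrow> x \<in> D \<Longrightarrow> continuous_on S (\<lambda>s. cinner y (blinfun_apply (R s) x))"
  shows "continuous_on S (\<lambda>s. cinner y (blinfun_apply (R s) x))"
proof -
  have M: "norm (blinfun_apply (R s) x) \<le> M * norm x" if "s \<in> S" for s x
    by (rule order_trans[OF norm_blinfun mult_right_mono[OF R(2)[OF that]]]) simp
  have 1: "continuous_on S (\<lambda>s. cinner y (blinfun_apply (R s) x))" if y: "y \<in> E" for x y
  proof -
    have "x \<in> closure (cspan D)" using D by simp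
    then show ?thesis
    proof (rule cspan_closure_induct)
      show "complex_vector.subspace {x. continuous_on S (\<lambda>s. cinner y (blinfun_apply (R s) x))}"
        by (auto simp: complex_vector.subspace_def blinfun.add_right bops_scaleC[OF R(1)] blinfun.zero_right cinner_add_right
            cong: continuous_on_cong_simp intro!: continuous_intros)
      show "closed {x. continuous_on S (\<lambda>s. cinner y (blinfun_apply (R s) x))}"
      proof (rule closed_continuous_on[where K = "norm y * M"])
        fix s u v assume "s \<in> S"
        then show "norm (cinner y (blinfun_apply (R s) u) - cinner y (blinfun_apply (R s) v)) \<le> norm y * M * norm (u - v)"
          unfolding cinner_diff_right[symmetric] blinfun.diff_right[symmetric] mult.assoc
          by (intro order_trans[OF cmod_cinner_le] mult_left_mono M) auto
      qed
    qed (rule c[OF y])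
  qed
  have "y \<in> closure (cspan E)" using E by simp
  then show ?thesis
  proof (rule cspan_closure_induct)
    show "complex_vector.subspace {y. continuous_on S (\<lambda>s. cinner y (blinfun_apply (R s) x))}"
      by (auto simp: complex_vector.subspace_def cinner_add_left intro!: continuous_intros)
    show "closed {y. continuous_on S (\<lambda>s. cinner y (blinfun_apply (R s) x))}"
    proof (rule closed_continuous_on[where K = "M * norm x"])
      fix s u v assume s: "s \<in> S"
      show "norm (cinner u (blinfun_apply (R s) x) - cinner v (blinfun_apply (R s) x)) \<le> M * norm x * norm (u - v)"
        unfolding cinner_diff_left[symmetric]
        using mult_right_mono[OF M[OF s, of x], of "norm (u - v)"] cmod_cinner_le[of "u - v" "blinfun_apply (R s) x"]
        by (simp add: mult.commute)
    qed
  qed (rule 1)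
qed

lemma continuous_on_strong_apply:
  fixes R :: "'i::topological_space \<Rightarrow> 'a::complex_inner \<Rightarrow>\<^sub>L 'b::complex_inner"
  assumes R: "\<And>s. s \<in> S \<Longrightarrow> norm (R s) \<le> M" and c: "\<And>x. continuous_on S (\<lambda>s. blinfun_apply (R s) x)"
    and x: "continuous_on S x"
  shows "continuous_on S (\<lambda>s. blinfun_apply (R s) (x s))"
  unfolding continuous_on_def
proof
  fix s assume s: "s \<in> S"
  have "((\<lambda>u. blinfun_apply (R u) (x u - x s)) \<longlongrightarrow> 0) (at s within S)"
  proof (rule Lim_null_comparison)
    show "eventually (\<lambda>u. norm (blinfun_apply (R u) (x u - x s)) \<le> M * norm (x u - x s)) (at s within S)"
      unfolding eventually_at_filter
      by (intro always_eventually allI impI order_trans[OF norm_blinfun] mult_right_mono R) auto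
    have "((\<lambda>u. M * norm (x u - x s)) \<longlongrightarrow> M * norm (x s - x s)) (at s within S)"
      using x s by (intro tendsto_intros) (auto simp: continuous_on_def)
    then show "((\<lambda>u. M * norm (x u - x s)) \<longlongrightarrow> 0) (at s within S)" by simp
  qed
  moreover have "((\<lambda>u. blinfun_apply (R u) (x s)) \<longlongrightarrow> blinfun_apply (R s) (x s)) (at s within S)"
    using c s by (simp add: continuous_on_def)
  ultimately have "((\<lambda>u. blinfun_apply (R u) (x u - x s) + blinfun_apply (R u) (x s)) \<longlongrightarrow> 0 + blinfun_apply (R s) (x s)) (at s within S)"
    by (rule tendsto_add)
  then show "((\<lambda>u. blinfun_apply (R u) (x u)) \<longlongrightarrow> blinfun_apply (R s) (x s)) (at s within S)"
    by (simp flip: blinfun.add_right)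
qed

text \<open>Expanding the squared distance of \<open>x u\<close> and \<open>x s\<close> leaves only
  norms and an inner product with the fixed vector \<open>x s\<close>, both continuous by
  hypothesis.\<close>

lemma continuous_on_weak_norm:
  fixes x :: "'i::topological_space \<Rightarrow> 'b::complex_inner"
  assumes w: "\<And>y. continuous_on S (\<lambda>s. cinner y (x s))" and n: "continuous_on S (\<lambda>s. norm (x s))"
  shows "continuous_on S x"
  unfolding continuous_on_def
proof
  fix s assume s: "s \<in> S"
  have "((\<lambda>u. (norm (x u))\<^sup>2 - 2 * Re (cinner (x s) (x u)) + (norm (x s))\<^sup>2)
      \<longlongrightarrow> (norm (x s))\<^sup>2 - 2 * Re (cinner (x s) (x s)) + (norm (x s))\<^sup>2) (at s within S)"
    using w[of "x s"] n s
    by (intro tendsto_add tendsto_diff tendsto_power tendsto_mult tendsto_Re tendsto_const) (auto simp: continuous_on_def)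
  moreover have "(norm (x u))\<^sup>2 - 2 * Re (cinner (x s) (x u)) + (norm (x s))\<^sup>2 = (norm (x u - x s))\<^sup>2" for u
    using norm_power2_add[of "x s" "x u - x s"] by (simp add: cinner_diff_right norm_power2_cinner)
  ultimately have "((\<lambda>u. (norm (x u - x s))\<^sup>2) \<longlongrightarrow> 0) (at s within S)" by (simp add: norm_power2_cinner)
  then have "((\<lambda>u. sqrt ((norm (x u - x s))\<^sup>2)) \<longlongrightarrow> sqrt 0) (at s within S)" by (rule tendsto_real_sqrt)
  then have "((\<lambda>u. norm (x u - x s)) \<longlongrightarrow> 0) (at s within S)" by simp
  then show "(x \<longlongrightarrow> x s) (at s within S)" unfolding Lim_null[of x] tendsto_norm_zero_iff .
qed

text \<open>The infinitesimal form of \<open>\<parallel>X\<^sub>t \<zeta>\<parallel>\<^sup>2\<close> when \<open>dX = T X d\<Lambda>\<close>; compare \<open>qform\<close>.\<close>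

definition qval :: "((complex \<times> 'k::chilbert_space, 'x::chilbert_space) htensor \<Rightarrow>\<^sub>L (complex \<times> 'k, 'x) htensor) \<Rightarrow>
    (complex \<times> 'k, 'x) htensor \<Rightarrow> (complex \<times> 'k, 'x) htensor \<Rightarrow> complex" where
  "qval T z z' = cinner z (blinfun_apply T z') + cinner (blinfun_apply T z) z'
     + cinner (blinfun_apply Dl (blinfun_apply T z)) (blinfun_apply Dl (blinfun_apply T z'))"

section \<open>The quadratic form and its behaviour under amplification\<close>

lemma qform_bops:
  fixes T :: "(complex \<times> 'k::chilbert_space, 'x::chilbert_space) htensor \<Rightarrow>\<^sub>L (complex \<times> 'k, 'x) htensor"
  shows "T \<in> bops \<Longrightarrow> qform T \<in> bops"
  by (simp add: qform_def op_tensor_tmap adj_bops Dl_bops)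

lemma adj_Delta: "adj (Delta :: (complex \<times> 'k::chilbert_space) \<Rightarrow>\<^sub>L _) = Delta"
  by (rule adj_eqI[OF Delta_bops]) (simp add: cinner_prod_def)

lemma Dl_self_adj: "adj Dl = Dl"
  by (simp add: adj_tmap Delta_bops adj_Delta adj_id)

lemma Dl_idem: "blinfun_apply Dl (blinfun_apply Dl z) = blinfun_apply Dl z"
proof -
  have "Dl o\<^sub>L Dl = (Dl :: (complex \<times> 'a, 'b) htensor \<Rightarrow>\<^sub>L _)"
    by (rule tensor_operator_eqI) (simp_all add: Dl_bops Dl_tensor)
  then show ?thesis by (metis blinfun_apply_blinfun_compose)
qed

lemma cinner_Dl: "cinner (blinfun_apply Dl x) (blinfun_apply Dl y) = cinner x (blinfun_apply Dl y)"
  using cinner_adj_left[OF Dl_bops, of x "blinfun_apply Dl y"] by (simp add: Dl_self_adj Dl_idem)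

lemma qval_qform: "T \<in> bops \<Longrightarrow> qval T z z' = cinner z (blinfun_apply (qform T) z')"
  by (simp add: qval_def qform_def op_tensor_tmap blinfun.add_left cinner_add_right cinner_adj_right cinner_Dl)

lemma adj_qform:
  fixes T :: "(complex \<times> 'k::chilbert_space, 'x::chilbert_space) htensor \<Rightarrow>\<^sub>L (complex \<times> 'k, 'x) htensor"
  assumes T: "T \<in> bops" shows "adj (qform T) = qform T"
proof (rule adj_eqI[OF qform_bops[OF T]])
  fix x y
  have "cinner x (blinfun_apply (qform T) y) = qval T x y" by (simp add: qval_qform T)
  also have "\<dots> = cnj (qval T y x)" by (simp add: qval_def flip: cinner_commute)
  also have "\<dots> = cinner (blinfun_apply (qform T) x) y" by (simp add: qval_qform T flip: cinner_commute)
  finally show "cinner x (blinfun_apply (qform T) y) = cinner (blinfun_apply (qform T) x) y" .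
qed

abbreviation Dp :: "(complex \<times> 'k::chilbert_space, 'x::chilbert_space) htensor \<Rightarrow>\<^sub>L (complex \<times> 'k, 'x) htensor" where
  "Dp \<equiv> tmap Delta_perp id_blinfun"

lemma Delta_perp_bops: "(Delta_perp :: (complex \<times> 'k::chilbert_space) \<Rightarrow>\<^sub>L _) \<in> bops"
  by (simp add: Delta_perp_def Delta_bops)

lemma Delta_perp_apply: "blinfun_apply Delta_perp p = (fst p, 0)"
  by (simp add: Delta_perp_def blinfun.diff_left prod_eq_iff)

lemma Dp_bops: "Dp \<in> bops" by (simp add: tmap_bops Delta_perp_bops)

lemma Dp_tensor: "blinfun_apply Dp (c \<otimes> y) = (fst c, 0) \<otimes> y"
  by (simp add: tmap_tensor Delta_perp_bops Delta_perp_apply)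

lemma adj_Delta_perp: "adj (Delta_perp :: (complex \<times> 'k::chilbert_space) \<Rightarrow>\<^sub>L _) = Delta_perp"
  by (rule adj_eqI[OF Delta_perp_bops]) (simp add: Delta_perp_apply cinner_prod_def)

lemma adj_Dp: "adj Dp = Dp"
  by (simp add: adj_tmap Delta_perp_bops adj_Delta_perp adj_id)

text \<open>Evaluating the form at \<open>T y + y\<close> isolates the cross term, which is twice
  the squared norm of \<open>T y\<close>.\<close>

lemma self_adjoint_zero:
  fixes T :: "'a::chilbert_space \<Rightarrow>\<^sub>L 'a"
  assumes T: "T \<in> bops" "adj T = T" and z: "\<And>x. Re (cinner x (blinfun_apply T x)) = 0"
  shows "T = 0"
proof (rule blinfun_eqI)
  fix y
  let ?x = "blinfun_apply T y"
  have "cinner y (blinfun_apply T ?x) = cinner ?x ?x" using cinner_adj_left[OF T(1), of y ?x] T(2) by simp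
  then have "Re (cinner (?x + y) (blinfun_apply T (?x + y))) = Re (cinner ?x (blinfun_apply T ?x)) + 2 * (norm ?x)\<^sup>2 + Re (cinner y (blinfun_apply T y))"
    by (simp add: blinfun.add_right cinner_add_left cinner_add_right norm_power2_cinner)
  then show "?x = blinfun_apply 0 y" by (simp add: z)
qed

lemma Im_self_adjoint:
  fixes T :: "'a::chilbert_space \<Rightarrow>\<^sub>L 'a"
  assumes T: "T \<in> bops" "adj T = T" shows "Im (cinner x (blinfun_apply T x)) = 0"
proof -
  have "cinner x (blinfun_apply T x) = cnj (cinner x (blinfun_apply T x))"
    using cinner_adj_left[OF T(1), of x x] T(2) cinner_commute[of x "blinfun_apply T x"] by simp
  from arg_cong[OF this, of Im] show ?thesis by simp
qed

lemma exp_dom_ext: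
  fixes X X' :: "('h::chilbert_space, 'k::chilbert_space) hF \<Rightarrow> 'b::complex_vector"
  assumes "clinear_on exp_dom X" "clinear_on exp_dom X'" "\<zeta> \<in> exp_dom"
    and "\<And>v f. f \<in> step_funs \<Longrightarrow> X (v \<otimes> \<varpi> f) = X' (v \<otimes> \<varpi> f)"
  shows "X \<zeta> = X' \<zeta>"
proof -
  obtain A :: "('h \<times> (real \<Rightarrow> 'k)) set" and u where A: "finite A" "\<And>p. p \<in> A \<Longrightarrow> snd p \<in> step_funs"
    "\<zeta> = (\<Sum>p\<in>A. u p \<otimes> \<varpi> (snd p))" by (rule exp_domE[OF assms(3)]) blast
  have "\<zeta> = (\<Sum>p\<in>A. 1 *\<^sub>C (u p \<otimes> \<varpi> (snd p)))" by (simp add: A(3))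
  then show ?thesis
    using clinear_on_sum[OF assms(1) exp_dom_subspace, of A "\<lambda>p. u p \<otimes> \<varpi> (snd p)" "\<lambda>_. 1"]
      clinear_on_sum[OF assms(2) exp_dom_subspace, of A "\<lambda>p. u p \<otimes> \<varpi> (snd p)" "\<lambda>_. 1"]
    by (simp add: A(2) tensor_expvec_in_exp_dom assms(4))
qed

lemma bdd_ext_ex:
  fixes X :: "('h::chilbert_space, 'k::chilbert_space) hF \<Rightarrow> ('h, 'k) hF"
  assumes X: "clinear_on exp_dom X" "\<And>\<zeta>. \<zeta> \<in> exp_dom \<Longrightarrow> norm (X \<zeta>) \<le> M * norm \<zeta>" and M: "0 \<le> M"
  obtains B where "bdd_ext X B" "norm B \<le> M"
proof -
  let ?I = "UNIV \<times> step_funs :: ('h \<times> (real \<Rightarrow> 'k)) set" and ?e = "\<lambda>p. fst p \<otimes> \<varpi> (snd p)"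
  have in_dom: "?e p \<in> exp_dom" if "p \<in> ?I" for p using that by (auto intro: tensor_expvec_in_exp_dom)
  have bound: "norm (\<Sum>p\<in>B. c p *\<^sub>C X (?e p)) \<le> M * norm (\<Sum>p\<in>B. c p *\<^sub>C ?e p)" if B: "finite B" "B \<subseteq> ?I" for B c
  proof -
    have sum_in: "(\<Sum>p\<in>B. c p *\<^sub>C ?e p) \<in> exp_dom"
      by (intro complex_vector.subspace_sum complex_vector.subspace_scale exp_dom_subspace in_dom) (use B in blast)
    have sum_eq: "X (\<Sum>p\<in>B. c p *\<^sub>C ?e p) = (\<Sum>p\<in>B. c p *\<^sub>C X (?e p))"
      by (rule clinear_on_sum[OF X(1) exp_dom_subspace]) (use in_dom B in blast)
    show ?thesis using X(2)[OF sum_in] unfolding sum_eq .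
  qed
  show ?thesis
  proof (rule clinear_extension[OF M, where I = ?I and e = ?e and f = "\<lambda>p. X (?e p)"])
    show "norm (\<Sum>p\<in>B. c p *\<^sub>C X (?e p)) \<le> M * norm (\<Sum>p\<in>B. c p *\<^sub>C ?e p)" if "finite B" "B \<subseteq> ?I" for B c
      by (rule bound[OF that])
    fix T assume T: "T \<in> bops" "\<And>p. p \<in> ?I \<Longrightarrow> blinfun_apply T (?e p) = X (?e p)" "norm T \<le> M"
    have "clinear_on exp_dom (blinfun_apply T)" by (simp add: clinear_on_def blinfun.add_right bops_scaleC[OF T(1)])
    then have "blinfun_apply T \<zeta> = X \<zeta>" if "\<zeta> \<in> exp_dom" for \<zeta>
      by (rule exp_dom_ext[OF _ X(1) that]) (use T(2)[of "(_, _)"] in simp)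
    then show thesis using that[of T] T by (simp add: bdd_ext_def)
  qed
qed

text \<open>Over an intertwining family the form of \<open>lift T\<close> is a sum of values of the
  form of \<open>T\<close>.\<close>

lemma (in normal_rep) lift_positive:
  fixes T :: "('c::chilbert_space, 'h) htensor \<Rightarrow>\<^sub>L ('c, 'h) htensor"
  assumes T: "T \<in> slice_algebra A" and pos: "\<And>z. 0 \<le> Re (cinner z (blinfun_apply T z))"
  shows "0 \<le> Re (cinner x (blinfun_apply (lift T) x))"
proof -
  obtain W :: "nat \<Rightarrow> ('c, 'b) htensor \<Rightarrow>\<^sub>L ('c, 'h) htensor" where
    W: "\<And>i T z. T \<in> slice_algebra A \<Longrightarrow> blinfun_apply (W i) (blinfun_apply (lift T) z) = blinfun_apply T (blinfun_apply (W i) z)"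
    "\<And>z. ((\<lambda>i. cinner (blinfun_apply (W i) x) (blinfun_apply (W i) z)) has_sum cinner x z) UNIV"
    by (rule ex_amp_family[where u = "\<lambda>_. x"]) blast
  have "((\<lambda>i. Re (cinner (blinfun_apply (W i) x) (blinfun_apply T (blinfun_apply (W i) x)))) has_sum Re (cinner x (blinfun_apply (lift T) x))) UNIV"
    using has_sum_Re[OF W(2)[of "blinfun_apply (lift T) x"]] by (simp add: W(1)[OF T])
  then show ?thesis by (rule has_sum_nonneg) (rule pos)
qed

text \<open>The amplification respects sums, products and adjoints and fixes operators acting on the
  first factor only, so it commutes with forming \<open>qform\<close>.\<close>

lemma (in normal_rep) lift_qform:
  fixes T :: "(complex \<times> 'k::chilbert_space, 'h) htensor \<Rightarrow>\<^sub>L (complex \<times> 'k, 'h) htensor"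
  assumes T: "T \<in> slice_algebra A"
  shows "qform T \<in> slice_algebra A" and "qval (lift T) z z' = cinner z (blinfun_apply (lift (qform T)) z')"
proof -
  note T' = slice_algebra_adj[OF vn T]
  have D: "(Dl :: (complex \<times> 'k, 'h) htensor \<Rightarrow>\<^sub>L _) \<in> slice_algebra A"
    by (rule tensor_in_slice_algebra[OF vn Delta_bops vn_id[OF vn]])
  have LD: "lift (Dl :: (complex \<times> 'k, 'h) htensor \<Rightarrow>\<^sub>L _) = Dl"
    using lift_tensor[OF Delta_bops vn_id[OF vn]] by (simp add: j_id)
  note s = slice_algebra_compose[OF slice_algebra_compose[OF T' D] T]
  note sum = complex_vector.subspace_add[OF slice_algebra_subspace T' T]
  show "qform T \<in> slice_algebra A"
    unfolding qform_def op_tensor_tmap by (rule complex_vector.subspace_add[OF slice_algebra_subspace sum s])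
  have "lift (qform T) = qform (lift T)"
    unfolding qform_def op_tensor_tmap lift_add[OF sum s] lift_add[OF T' T]
      lift_compose[OF slice_algebra_compose[OF T' D] T] lift_compose[OF T' D] lift_adj[OF T] LD ..
  then show "qval (lift T) z z' = cinner z (blinfun_apply (lift (qform T)) z')"
    by (simp add: qval_qform lift_bops[OF T])
qed

section \<open>The amplified flow in time\<close>

locale flow =
  fixes A :: "('h::chilbert_space \<Rightarrow>\<^sub>L 'h) set"
    and j :: "real \<Rightarrow> ('h \<Rightarrow>\<^sub>L 'h) \<Rightarrow> (('h, 'k::chilbert_space) hF \<Rightarrow>\<^sub>L ('h, 'k) hF)"
  assumes vn: "von_neumann_algebra A" and flow: "qs_flow A j"
begin

lemma rep: "0 \<le> t \<Longrightarrow> normal_rep A (j t)"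
proof
  assume t: "0 \<le> t"
  note f = flow[unfolded qs_flow_def qs_cocycle_def mapping_process_def]
  show "von_neumann_algebra A" by (rule vn)
  show "clinear_on A (j t)" using f t by blast
  show "normal_on A (j t)" using f t by blast
  show "j t id_blinfun = id_blinfun" using f t by blast
  fix a assume a: "a \<in> A"
  show "j t a \<in> bops" using f t a by blast
  show "j t (adj a) = adj (j t a)" using f t a by blast
  show "j t (a o\<^sub>L b) = j t a o\<^sub>L j t b" if "b \<in> A" for b using f t a that by blast
qed

abbreviation Th :: "real \<Rightarrow> ((complex \<times> 'k, 'h) htensor \<Rightarrow>\<^sub>L (complex \<times> 'k, 'h) htensor) \<Rightarrow> (('h, 'k) khF \<Rightarrow>\<^sub>L ('h, 'k) khF)" where
  "Th t \<equiv> normal_rep.lift (j t)"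

lemma j_adapted_op: "a \<in> A \<Longrightarrow> 0 \<le> t \<Longrightarrow> adapted_op t (blinfun_apply (j t a))"
  using flow unfolding qs_flow_def qs_cocycle_def mapping_process_def process_in_def
  by (intro process_adapted_op[where X = "\<lambda>t. blinfun_apply (j t a)"]) auto

text \<open>By \<open>kadaptedI\<close> only matrix elements against vectors orthogonal to
  \<open>adapted t f\<close> matter. Each is a matrix element of \<open>j t\<close> at a slice, and
  that operator preserves \<open>adapted t f\<close>.\<close>

lemma Th_adapted:
  assumes T: "T \<in> slice_algebra A" and t: "0 \<le> t" and y: "y \<in> adapted t f"
  shows "blinfun_apply (Th t T) (d \<otimes> y) \<in> kadapted t f"
proof (rule kadaptedI)
  fix c :: "complex \<times> 'k" and x :: "('h, 'k) hF" assume x: "\<And>z. z \<in> adapted t f \<Longrightarrow> cinner z x = 0"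
  interpret normal_rep A "j t" by (rule rep[OF t])
  note s = slice_in[OF vn T, of c d]
  have "blinfun_apply (j t (slice c d T)) y \<in> adapted t f"
    by (rule adapted_op_preserves[OF j_bops[OF s] j_adapted_op[OF s t] t y])
  then show "cinner (c \<otimes> x) (blinfun_apply (Th t T) (d \<otimes> y)) = 0"
    unfolding cinner_lift[OF T] by (rule cinner_swap_zero[OF x])
qed

lemma norm_Th: "T \<in> slice_algebra A \<Longrightarrow> 0 \<le> t \<Longrightarrow> norm (Th t T) \<le> norm T"
  by (rule normal_rep.norm_lift[OF rep])

lemma continuous_on_j:
  assumes a: "a \<in> A" shows "continuous_on {0..} (\<lambda>t. cinner x (blinfun_apply (j t a) y))"
proof -
  have "continuous_map (top_of_set {0..}) ultraweak (\<lambda>t. j t a)" using flow a by (auto simp: qs_flow_def)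
  from continuous_map_compose[OF this continuous_map_cinner_ultraweak, of x y] show ?thesis by (simp add: o_def)
qed

lemma Th_weakly_continuous:
  assumes T: "T \<in> slice_algebra A"
  shows "continuous_on {0..} (\<lambda>t. cinner z (blinfun_apply (Th t T) x))"
proof (rule continuous_on_cinner_total)
  let ?D = "{c \<otimes> y |(c::complex \<times> 'k) (y::('h, 'k) hF). True}"
  show "closure (cspan ?D) = UNIV" "closure (cspan ?D) = UNIV" using tensor_closure by blast+
  show "Th t T \<in> bops" if "t \<in> {0..}" for t by (rule normal_rep.lift_bops[OF rep T]) (use that in simp)
  show "norm (Th t T) \<le> norm T" if "t \<in> {0..}" for t by (rule norm_Th[OF T]) (use that in simp)
  fix z x assume zx: "z \<in> ?D" "x \<in> ?D"
  obtain c y where z: "z = c \<otimes> (y::('h, 'k) hF)" using zx(1) by blast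
  obtain d y' where x: "x = d \<otimes> (y'::('h, 'k) hF)" using zx(2) by blast
  have "continuous_on {0..} (\<lambda>t. cinner y (blinfun_apply (j t (slice c d T)) y'))"
    by (rule continuous_on_j[OF slice_in[OF vn T]])
  then show "continuous_on {0..} (\<lambda>t. cinner z (blinfun_apply (Th t T) x))"
    by (rule continuous_on_eq) (simp add: z x normal_rep.cinner_lift[OF rep T])
qed

text \<open>By multiplicativity the squared norm is a matrix element of the amplified
  \<open>adj T o\<^sub>L T\<close>, hence weakly continuous in time; weak continuity of the flow
  therefore already yields strong continuity.\<close>

lemma Th_continuous:
  assumes T: "T \<in> slice_algebra A"
  shows "continuous_on {0..} (\<lambda>t. blinfun_apply (Th t T) x)"
proof (rule continuous_on_weak_norm[OF Th_weakly_continuous[OF T]])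
  note TT = slice_algebra_compose[OF slice_algebra_adj[OF vn T] T]
  have "continuous_on {0..} (\<lambda>t. sqrt (Re (cinner x (blinfun_apply (Th t (adj T o\<^sub>L T)) x))))"
    by (intro continuous_on_real_sqrt continuous_on_Re Th_weakly_continuous[OF TT])
  then show "continuous_on {0..} (\<lambda>t. norm (blinfun_apply (Th t T) x))"
  proof (rule continuous_on_eq)
    fix t :: real assume "t \<in> {0..}"
    then interpret normal_rep A "j t" by (intro rep) simp
    show "sqrt (Re (cinner x (blinfun_apply (Th t (adj T o\<^sub>L T)) x))) = norm (blinfun_apply (Th t T) x)"
      by (simp add: lift_compose[OF slice_algebra_adj[OF vn T] T] lift_adj[OF T] cinner_adj_right[OF lift_bops[OF T]]
          flip: norm_power2_cinner)
  qed
qed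

lemma Th_continuous_apply:
  assumes T: "T \<in> slice_algebra A" and x: "continuous_on {0..} x"
  shows "continuous_on {0..} (\<lambda>t. blinfun_apply (Th t T) (x t))"
  by (rule continuous_on_strong_apply[where M = "norm T"]) (auto intro: norm_Th[OF T] Th_continuous[OF T] x)

text \<open>At time 0 the flow acts trivially on Fock space, and the common exponential factor is a
  unit vector.\<close>

lemma Th_zero:
  assumes T: "T \<in> slice_algebra A"
  shows "cinner (c \<otimes> (u \<otimes> \<varpi> e)) (blinfun_apply (Th 0 T) (d \<otimes> (v \<otimes> \<varpi> e))) = cinner (c \<otimes> u) (blinfun_apply T (d \<otimes> v))"
proof -
  have "j 0 (slice c d T) = slice c d T \<otimes>\<^sub>o id_blinfun"
    using flow slice_in[OF vn T] by (auto simp: qs_flow_def qs_cocycle_def)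
  then show ?thesis
    by (simp add: normal_rep.cinner_lift[OF rep T] op_tensor_tmap tmap_tensor slice_bops slice_algebra_bops[OF T] cinner_slice)
qed

lemma ktilde_Th: "T \<in> bops \<otimes>\<^sub>u\<^sub>w A \<Longrightarrow> 0 \<le> t \<Longrightarrow> ktilde A j t T = Th t T"
  unfolding ktilde_def by (rule normal_rep.map_tensor_lift[OF rep])

end

section \<open>Processes given by integrals and their right derivatives\<close>

lemma step_composite_integrable:
  fixes \<psi> :: "'k::complex_inner \<Rightarrow> 'k \<Rightarrow> real \<Rightarrow> complex"
  assumes h: "h \<in> step_funs" and f: "f \<in> step_funs" and \<psi>: "\<And>c d. continuous_on {0..} (\<psi> c d)"
  shows "integrable (lebesgue_on {0..t}) (\<lambda>s. \<psi> (h s) (f s) s)"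
proof -
  let ?A = "\<lambda>c d. {s. h s = c} \<inter> {s. f s = d} \<inter> {0..t}"
  have A: "?A c d \<in> sets (lebesgue_on {0..t})" for c d
    by (subst sets_restrict_space_iff)
      (auto intro!: sets.Int sets_completionI_sets step_level_borel[OF h] step_level_borel[OF f] simp: sets_lborel)
  \<comment> \<open>Only finitely many pairs of values occur, and on each level set the integrand is
    a continuous function of time.\<close>
  have "integrable (lebesgue_on {0..t}) (\<lambda>s. \<Sum>c\<in>range h. \<Sum>d\<in>range f. indicator (?A c d) s *\<^sub>R \<psi> c d s)"
    by (intro Bochner_Integration.integrable_sum integrable_mult_indicator A continuous_imp_integrable_real continuous_on_subset[OF \<psi>]) auto
  then show ?thesis
  proof (rule Bochner_Integration.integrable_cong[OF refl, THEN iffD1, rotated])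
    fix s assume "s \<in> space (lebesgue_on {0..t})"
    then have s: "s \<in> {0..t}" by simp
    have "indicator (?A c d) s *\<^sub>R \<psi> c d s = (if d = f s then (if c = h s then \<psi> c d s else 0) else 0)" for c d
      using s by (auto simp: indicator_def)
    then show "(\<Sum>c\<in>range h. \<Sum>d\<in>range f. indicator (?A c d) s *\<^sub>R \<psi> c d s) = \<psi> (h s) (f s) s"
      by (simp add: sum.delta step_range[OF f] step_range[OF h])
  qed
qed

lemma wint_cong: "(\<And>s. a \<le> s \<Longrightarrow> s \<le> b \<Longrightarrow> g s = g' s) \<Longrightarrow> wint g a b V \<longleftrightarrow> wint g' a b V"
  unfolding wint_def by (intro all_cong1 ball_cong refl has_integral_cong) simp

text \<open>Isolates what the derivative computation needs, so that it covers both \<open>Y\<close>,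
  where the amplified operator acts after the process, and the adjoint process, where it acts
  before. The vector \<open>c\<close> is a separate argument because \<open>hat (f s)\<close> jumps
  in time while the integrand is continuous for fixed \<open>c\<close>.\<close>

locale integral_process =
  fixes X :: "real \<Rightarrow> ('h::chilbert_space, 'k::chilbert_space) hF \<Rightarrow> ('h, 'k) hF"
    and G :: "real \<Rightarrow> complex \<times> 'k \<Rightarrow> ('h, 'k) hF \<Rightarrow> ('h, 'k) khF"
  assumes X_linear: "\<And>t. 0 \<le> t \<Longrightarrow> clinear_on exp_dom (X t)"
    and X_zero: "\<And>\<zeta>. \<zeta> \<in> exp_dom \<Longrightarrow> X 0 \<zeta> = \<zeta>"
    and X_adapted: "\<And>t u f. 0 \<le> t \<Longrightarrow> f \<in> step_funs \<Longrightarrow> X t (u \<otimes> \<varpi> f) \<in> adapted t f"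
    and G_continuous: "\<And>c u f. f \<in> step_funs \<Longrightarrow> continuous_on {0..} (\<lambda>t. G t c (u \<otimes> \<varpi> f))"
    and G_adapted: "\<And>t c u f. 0 \<le> t \<Longrightarrow> f \<in> step_funs \<Longrightarrow> G t c (u \<otimes> \<varpi> f) \<in> kadapted t f"
    and X_integral: "\<And>b u f. 0 \<le> b \<Longrightarrow> f \<in> step_funs \<Longrightarrow>
      wint (\<lambda>s. G s (hat (f s)) (u \<otimes> \<varpi> f)) 0 b (X b (u \<otimes> \<varpi> f) - u \<otimes> \<varpi> f)"
begin

lemma X_integral_between:
  assumes ab: "0 \<le> a" "a \<le> b" and f: "f \<in> step_funs"
  shows "wint (\<lambda>s. G s (hat (f s)) (u \<otimes> \<varpi> f)) a b (X b (u \<otimes> \<varpi> f) - X a (u \<otimes> \<varpi> f))"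
  unfolding wint_def
proof (intro allI ballI)
  fix w :: 'h and h :: "real \<Rightarrow> 'k" assume h: "h \<in> step_funs"
  let ?\<phi> = "\<lambda>s. cinner (hat (h s) \<otimes> (w \<otimes> \<varpi> h)) (G s (hat (f s)) (u \<otimes> \<varpi> f))"
  have 1: "(?\<phi> has_integral cinner (w \<otimes> \<varpi> h) (X b (u \<otimes> \<varpi> f) - u \<otimes> \<varpi> f)) {0..b}"
    and 2: "(?\<phi> has_integral cinner (w \<otimes> \<varpi> h) (X a (u \<otimes> \<varpi> f) - u \<otimes> \<varpi> f)) {0..a}"
    using X_integral[OF _ f] ab h by (simp_all add: wint_def)
  have i: "?\<phi> integrable_on {a..b}"
    by (rule integrable_on_subinterval[OF has_integral_integrable[OF 1]]) (use ab in auto)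
  have "integral {0..a} ?\<phi> + integral {a..b} ?\<phi> = integral {0..b} ?\<phi>"
    by (rule Henstock_Kurzweil_Integration.integral_combine[OF ab has_integral_integrable[OF 1]])
  then have "integral {a..b} ?\<phi> = cinner (w \<otimes> \<varpi> h) (X b (u \<otimes> \<varpi> f) - X a (u \<otimes> \<varpi> f))"
    unfolding integral_unique[OF 1] integral_unique[OF 2] cinner_diff_right by (simp add: algebra_simps)
  then show "(?\<phi> has_integral cinner (w \<otimes> \<varpi> h) (X b (u \<otimes> \<varpi> f) - X a (u \<otimes> \<varpi> f))) {a..b}"
    using integrable_integral[OF i] by simp
qed

lemma X_local_integral:
  assumes a: "0 \<le> a" and f: "f \<in> step_funs" and r: "0 < r" "\<And>s. a \<le> s \<Longrightarrow> s \<le> a + r \<Longrightarrow> f s = d"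
  shows "local_integral a r f d (\<lambda>s. G s (hat d) (u \<otimes> \<varpi> f)) (\<lambda>h. X (a + h) (u \<otimes> \<varpi> f) - X a (u \<otimes> \<varpi> f))"
proof
  show "0 \<le> a" "0 < r" by (fact a, fact r)
  show "f s = d" if "a \<le> s" "s < a + r" for s using r(2)[of s] that by simp
  show "continuous_on {a..a + r} (\<lambda>s. G s (hat d) (u \<otimes> \<varpi> f))"
    by (rule continuous_on_subset[OF G_continuous[OF f]]) (use a in auto)
  show "G s (hat d) (u \<otimes> \<varpi> f) \<in> kadapted s f" if "a \<le> s" "s \<le> a + r" for s
    by (rule G_adapted[OF _ f]) (use a that in simp)
  fix h assume h: "0 < h" "h \<le> r"
  have "wint (\<lambda>s. G s (hat (f s)) (u \<otimes> \<varpi> f)) a (a + h) (X (a + h) (u \<otimes> \<varpi> f) - X a (u \<otimes> \<varpi> f))"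
    by (rule X_integral_between[OF a _ f]) (use h in simp)
  moreover have "f s = d" if "s \<in> {a..a + h}" for s using r(2)[of s] that h by simp
  ultimately show "wint (\<lambda>s. G s (hat d) (u \<otimes> \<varpi> f)) a (a + h) (X (a + h) (u \<otimes> \<varpi> f) - X a (u \<otimes> \<varpi> f))"
    by (subst (asm) wint_cong[of a "a + h" _ "\<lambda>s. G s (hat d) (u \<otimes> \<varpi> f)"]) auto
qed

text \<open>A sum of \<open>right_derivative_cinner\<close> over pairs: all \<open>f p\<close> are
  constant on a common interval to the right of \<open>a\<close>, and sesquilinearity collects the
  terms into \<xi> and \<gamma>.\<close>

lemma right_derivative_norm:
  fixes P :: "'i set" and u :: "'i \<Rightarrow> 'h" and f :: "'i \<Rightarrow> real \<Rightarrow> 'k"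
  assumes P: "finite P" "\<And>p. p \<in> P \<Longrightarrow> f p \<in> step_funs" and a: "0 \<le> a"
  defines "\<zeta> \<equiv> \<Sum>p\<in>P. u p \<otimes> \<varpi> (f p)"
    and "\<xi> \<equiv> \<Sum>p\<in>P. hat (f p a) \<otimes> X a (u p \<otimes> \<varpi> (f p))" and "\<gamma> \<equiv> \<Sum>p\<in>P. G a (hat (f p a)) (u p \<otimes> \<varpi> (f p))"
  shows "((\<lambda>h. ((norm (X (a + h) \<zeta>))\<^sup>2 - (norm (X a \<zeta>))\<^sup>2) / h) \<longlongrightarrow>
    Re (cinner \<xi> \<gamma> + cinner \<gamma> \<xi> + cinner (blinfun_apply Dl \<gamma>) (blinfun_apply Dl \<gamma>))) (at_right 0)"
proof -
  let ?X = "\<lambda>t p. X t (u p \<otimes> \<varpi> (f p))" and ?d = "\<lambda>p. hat (f p a)" and ?g = "\<lambda>p. G a (hat (f p a)) (u p \<otimes> \<varpi> (f p))"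
  obtain r where r: "r > 0" "\<forall>p\<in>P. \<forall>s. a \<le> s \<longrightarrow> s \<le> a + r \<longrightarrow> f p s = f p a"
    using step_common_right_constant[OF P(1), of f a] P(2) by blast
  have X: "X t \<zeta> = (\<Sum>p\<in>P. ?X t p)" if "0 \<le> t" for t
    using clinear_on_sum[OF X_linear[OF that] exp_dom_subspace, of P "\<lambda>p. u p \<otimes> \<varpi> (f p)" "\<lambda>_. 1"] P
    by (simp add: \<zeta>_def tensor_expvec_in_exp_dom)
  have "((\<lambda>h. \<Sum>p\<in>P. \<Sum>q\<in>P. (cinner (?X (a + h) p) (?X (a + h) q) - cinner (?X a p) (?X a q)) / of_real h) \<longlongrightarrow>
     (\<Sum>p\<in>P. \<Sum>q\<in>P. cinner (?d p \<otimes> ?X a p) (?g q) + cinner (?g p) (?d q \<otimes> ?X a q) + cinner (blinfun_apply Dl (?g p)) (blinfun_apply Dl (?g q)))) (at_right 0)"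
  proof (intro tendsto_sum)
    fix p q assume pq: "p \<in> P" "q \<in> P"
    show "((\<lambda>h. (cinner (?X (a + h) p) (?X (a + h) q) - cinner (?X a p) (?X a q)) / of_real h) \<longlongrightarrow>
      cinner (?d p \<otimes> ?X a p) (?g q) + cinner (?g p) (?d q \<otimes> ?X a q) + cinner (blinfun_apply Dl (?g p)) (blinfun_apply Dl (?g q))) (at_right 0)"
    proof (rule right_derivative_cinner[where X = "\<lambda>t. ?X t p" and X' = "\<lambda>t. ?X t q" and r = r and f = "f p" and f' = "f q"
            and g = "\<lambda>s. G s (?d p) (u p \<otimes> \<varpi> (f p))" and g' = "\<lambda>s. G s (?d q) (u q \<otimes> \<varpi> (f q))"])
      show "local_integral a r (f p) (f p a) (\<lambda>s. G s (?d p) (u p \<otimes> \<varpi> (f p))) (\<lambda>h. ?X (a + h) p - ?X a p)"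
        by (rule X_local_integral[OF a P(2)[OF pq(1)] r(1)]) (rule r(2)[rule_format, OF pq(1)])
      show "local_integral a r (f q) (f q a) (\<lambda>s. G s (?d q) (u q \<otimes> \<varpi> (f q))) (\<lambda>h. ?X (a + h) q - ?X a q)"
        by (rule X_local_integral[OF a P(2)[OF pq(2)] r(1)]) (rule r(2)[rule_format, OF pq(2)])
    qed (rule X_adapted[OF a P(2)], rule pq)+
  qed
  then have "((\<lambda>h. Re (\<Sum>p\<in>P. \<Sum>q\<in>P. (cinner (?X (a + h) p) (?X (a + h) q) - cinner (?X a p) (?X a q)) / of_real h)) \<longlongrightarrow>
     Re (\<Sum>p\<in>P. \<Sum>q\<in>P. cinner (?d p \<otimes> ?X a p) (?g q) + cinner (?g p) (?d q \<otimes> ?X a q) + cinner (blinfun_apply Dl (?g p)) (blinfun_apply Dl (?g q)))) (at_right 0)"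
    by (rule tendsto_Re)
  moreover have "(\<Sum>p\<in>P. \<Sum>q\<in>P. cinner (?d p \<otimes> ?X a p) (?g q) + cinner (?g p) (?d q \<otimes> ?X a q) + cinner (blinfun_apply Dl (?g p)) (blinfun_apply Dl (?g q)))
      = cinner \<xi> \<gamma> + cinner \<gamma> \<xi> + cinner (blinfun_apply Dl \<gamma>) (blinfun_apply Dl \<gamma>)"
    unfolding \<xi>_def \<gamma>_def bops_sum cinner_sum_left unfolding cinner_sum_right by (simp add: sum.distrib)
  moreover have ev: "eventually (\<lambda>h. Re (\<Sum>p\<in>P. \<Sum>q\<in>P. (cinner (?X (a + h) p) (?X (a + h) q) - cinner (?X a p) (?X a q)) / of_real h)
      = ((norm (X (a + h) \<zeta>))\<^sup>2 - (norm (X a \<zeta>))\<^sup>2) / h) (at_right 0)"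
    unfolding eventually_at_right_field
  proof (intro exI[of _ 1] conjI allI impI)
    fix h :: real assume "0 < h"
    then have h: "0 \<le> a + h" using a by simp
    have "(\<Sum>p\<in>P. \<Sum>q\<in>P. (cinner (?X (a + h) p) (?X (a + h) q) - cinner (?X a p) (?X a q)) / of_real h)
        = (cinner (X (a + h) \<zeta>) (X (a + h) \<zeta>) - cinner (X a \<zeta>) (X a \<zeta>)) / of_real h"
      unfolding X[OF h] X[OF a] cinner_sum_left unfolding cinner_sum_right
      by (simp add: sum_subtractf flip: sum_divide_distrib)
    then show "Re (\<Sum>p\<in>P. \<Sum>q\<in>P. (cinner (?X (a + h) p) (?X (a + h) q) - cinner (?X a p) (?X a q)) / of_real h)
      = ((norm (X (a + h) \<zeta>))\<^sup>2 - (norm (X a \<zeta>))\<^sup>2) / h"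
      by (simp add: norm_power2_cinner)
  qed simp
  ultimately show ?thesis by (simp only: tendsto_cong[OF ev])
qed

end

section \<open>Gronwall estimates with right derivatives\<close>

lemma right_derivative_nonpos:
  fixes \<phi> D :: "real \<Rightarrow> real"
  assumes c: "continuous_on {0..} \<phi>" and D: "\<And>t. 0 \<le> t \<Longrightarrow> ((\<lambda>h. (\<phi> (t + h) - \<phi> t) / h) \<longlongrightarrow> D t) (at_right 0)"
    and neg: "\<And>t. 0 \<le> t \<Longrightarrow> D t \<le> 0" and t: "0 \<le> t"
  shows "\<phi> t \<le> \<phi> 0"
proof (rule ccontr)
  assume "\<not> \<phi> t \<le> \<phi> 0"
  then have gt: "\<phi> 0 < \<phi> t" by simp
  then have t0: "0 < t" using t by (cases "t = 0") auto
  \<comment> \<open>Half the mean slope: positive, yet so small that \<open>t\<close> itself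
    violates the comparison defining \<open>?S\<close>.\<close>
  define e where "e = (\<phi> t - \<phi> 0) / (2 * t)"
  have e: "0 < e" "e * t < \<phi> t - \<phi> 0" using gt t0 by (simp_all add: e_def)
  let ?S = "{s \<in> {0..t}. \<phi> s - e * s \<le> \<phi> 0}"
  have ct: "continuous_on {0..t} (\<lambda>s. \<phi> s - e * s)"
    by (intro continuous_intros continuous_on_subset[OF c]) auto
  have "closed ({0..t} \<inter> (\<lambda>s. \<phi> s - e * s) -` {..\<phi> 0})"
    by (rule continuous_closed_preimage[OF ct]) auto
  moreover have "{0..t} \<inter> (\<lambda>s. \<phi> s - e * s) -` {..\<phi> 0} = ?S" by auto
  ultimately have "closed ?S" by (simp only:)
  moreover have "bounded ?S" by (rule bounded_subset[OF compact_imp_bounded[OF compact_Icc[of 0 t]]]) auto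
  ultimately have "compact ?S" by (simp add: compact_eq_bounded_closed)
  moreover have "0 \<in> ?S" using t by simp
  \<comment> \<open>At the last point of \<open>?S\<close> the right derivative is below
    \<open>e\<close>, so points slightly to the right still belong to \<open>?S\<close>, a
    contradiction.\<close>
  ultimately obtain s where s: "s \<in> ?S" "\<And>u. u \<in> ?S \<Longrightarrow> u \<le> s"
    using compact_attains_sup[of ?S] by blast
  then have s': "0 \<le> s" "s < t" "\<phi> s - e * s \<le> \<phi> 0" using e by (auto simp: less_le)
  have "eventually (\<lambda>h. (\<phi> (s + h) - \<phi> s) / h < e) (at_right 0)"
    by (rule order_tendstoD(2)[OF D[OF s'(1)]]) (use neg[OF s'(1)] e in simp)
  moreover have "eventually (\<lambda>h. 0 < h \<and> h < t - s) (at_right (0::real))"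
    unfolding eventually_at_right_field by (rule exI[of _ "t - s"]) (use s' in auto)
  ultimately have "eventually (\<lambda>h. (\<phi> (s + h) - \<phi> s) / h < e \<and> 0 < h \<and> h < t - s) (at_right 0)"
    by (rule eventually_conj)
  then obtain h where h: "(\<phi> (s + h) - \<phi> s) / h < e" "0 < h" "h < t - s"
    using eventually_happens trivial_limit_at_right_real by blast
  then have "\<phi> (s + h) - e * (s + h) \<le> \<phi> 0" using s'(3) by (simp add: field_simps)
  then have "s + h \<in> ?S" using h s' by simp
  then show False using s(2) h(2) by fastforce
qed

text \<open>The product of \<open>exp (- \<beta> * t)\<close> and \<open>\<phi> t\<close> has
  nonpositive right derivative. No sign is imposed on \<phi>, so negated squared norms are
  admissible and give lower bounds.\<close>

lemma right_gronwall:
  fixes \<phi> D :: "real \<Rightarrow> real"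
  assumes c: "continuous_on {0..} \<phi>" and D: "\<And>t. 0 \<le> t \<Longrightarrow> ((\<lambda>h. (\<phi> (t + h) - \<phi> t) / h) \<longlongrightarrow> D t) (at_right 0)"
    and le: "\<And>t. 0 \<le> t \<Longrightarrow> D t \<le> \<beta> * \<phi> t" and t: "0 \<le> t"
  shows "\<phi> t \<le> exp (\<beta> * t) * \<phi> 0"
proof -
  let ?E = "\<lambda>t. exp (- \<beta> * t)"
  have "?E t * \<phi> t \<le> ?E 0 * \<phi> 0"
  proof (rule right_derivative_nonpos[OF _ _ _ t])
    show "continuous_on {0..} (\<lambda>t. ?E t * \<phi> t)" by (intro continuous_intros c)
    fix t :: real assume t: "0 \<le> t"
    have "(?E has_field_derivative - \<beta> * ?E t) (at t)" by (auto intro!: derivative_eq_intros)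
    then have "((\<lambda>h. (?E (t + h) - ?E t) / h) \<longlongrightarrow> - \<beta> * ?E t) (at 0)" by (simp add: DERIV_def)
    then have E: "((\<lambda>h. (?E (t + h) - ?E t) / h) \<longlongrightarrow> - \<beta> * ?E t) (at_right 0)"
      by (rule tendsto_mono[OF at_le, rotated]) simp
    have "((\<lambda>h. ?E (t + h)) \<longlongrightarrow> ?E (t + 0)) (at_right 0)" by (intro tendsto_intros)
    then have "((\<lambda>h. ?E (t + h) * ((\<phi> (t + h) - \<phi> t) / h) + (?E (t + h) - ?E t) / h * \<phi> t) \<longlongrightarrow> ?E (t + 0) * D t + (- \<beta> * ?E t) * \<phi> t) (at_right 0)"
      by (intro tendsto_add tendsto_mult D[OF t] E tendsto_const)
    then show "((\<lambda>h. (?E (t + h) * \<phi> (t + h) - ?E t * \<phi> t) / h) \<longlongrightarrow> ?E t * (D t - \<beta> * \<phi> t)) (at_right 0)"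
      by (simp add: algebra_simps diff_divide_distrib add_divide_distrib)
    show "?E t * (D t - \<beta> * \<phi> t) \<le> 0" using le[OF t] by (simp add: mult_nonneg_nonpos)
  qed
  then show ?thesis by (simp add: exp_minus field_simps)
qed

section \<open>From growth near time zero to the form bound and back\<close>

lemma hat_total: "closure (cspan ((\<lambda>p. hat (snd p) \<otimes> fst p) ` UNIV)) = (UNIV :: (complex \<times> 'k::chilbert_space, 'h::chilbert_space) htensor set)"
proof (rule dense_cspanI)
  fix x :: "(complex \<times> 'k, 'h) htensor"
  assume "\<And>s. s \<in> (\<lambda>p. hat (snd p) \<otimes> fst p) ` UNIV \<Longrightarrow> cinner s x = 0"
  from this[of "hat _ \<otimes> _"] have z: "cinner (hat d \<otimes> u) x = 0" for d u by (auto simp: image_iff)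
  show "x = 0"
  proof (rule htensor_cinner_eqI)
    fix c :: "complex \<times> 'k" and u :: 'h
    \<comment> \<open>The vectors \<open>hat d\<close> fill an affine hyperplane off the origin;
      adding a multiple of \<open>hat 0\<close> reaches every first coordinate.\<close>
    have "c = (fst c - 1) *\<^sub>C hat 0 + hat (snd c)"
      by (simp add: hat_def scaleC_prod_def prod_eq_iff scaleC_complex_def)
    then have "c \<otimes> u = ((fst c - 1) *\<^sub>C hat 0 + hat (snd c)) \<otimes> u" by simp
    then show "cinner (c \<otimes> u) x = cinner (c \<otimes> u) 0"
      by (simp only: tensor_add_left tensor_scale_left cinner_add_left cinner_scaleC_left z) simp
  qed
qed

text \<open>The L2 norm of the indicator over \<open>[0, 1/(n+1))\<close> tends to zero while its
  value at 0 remains \<open>c\<close>; so \<open>hat\<close> keeps seeing \<open>c\<close> while the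
  exponential vector tends to the vacuum.\<close>

lemma expvec_shrink:
  fixes c :: "'k::chilbert_space"
  shows "(\<lambda>n. \<varpi> (\<lambda>s. indicator {0..<1 / real (Suc n)} s *\<^sub>R c)) \<longlonglongrightarrow> \<varpi> (\<lambda>_. 0)"
proof -
  let ?f = "\<lambda>n s. indicator {0..<1 / real (Suc n)} s *\<^sub>R c"
  have norm: "norm (abs_L2 (?f n)) = sqrt (1 / real (Suc n)) * norm c" for n
  proof -
    have "complex_of_real ((norm (abs_L2 (?f n)))\<^sup>2) = complex_of_real (1 / real (Suc n) * (norm c)\<^sup>2)"
      using cinner_indicator_const(1)[OF step_indicator[of 0 "1 / real (Suc n)" c], of 0 "1 / real (Suc n)" c c] by (simp add: cinner_self)
    then have "(norm (abs_L2 (?f n)))\<^sup>2 = 1 / real (Suc n) * (norm c)\<^sup>2" by (simp only: of_real_eq_iff)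
    then have "sqrt ((norm (abs_L2 (?f n)))\<^sup>2) = sqrt (1 / real (Suc n) * (norm c)\<^sup>2)" by simp
    then show ?thesis unfolding real_sqrt_mult by simp
  qed
  have "(\<lambda>n. sqrt (1 / real (Suc n)) * norm c) \<longlonglongrightarrow> sqrt 0 * norm c"
    by (intro tendsto_mult tendsto_real_sqrt tendsto_const LIMSEQ_Suc[OF lim_1_over_n])
  then have "(\<lambda>n. norm (abs_L2 (?f n))) \<longlonglongrightarrow> 0" unfolding norm by simp
  then have L: "(\<lambda>n. abs_L2 (?f n)) \<longlonglongrightarrow> 0" by (simp only: tendsto_norm_zero_iff)
  have z: "abs_L2 (\<lambda>_. 0 :: 'k) = 0"
    using abs_L2_scale[OF square_integrable_step[OF step_zero], of 0] by simp
  show ?thesis unfolding expvec_eps z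
    by (intro tendsto_scaleR eps_tendsto[OF L] tendsto_exp tendsto_divide tendsto_minus tendsto_power tendsto_norm[OF L] tendsto_const) simp
qed

text \<open>All \<open>hat (c p)\<close> have first component 1, so the projection \<open>Dp\<close>
  forgets the \<open>c p\<close> and adds up the \<open>y p\<close>.\<close>

lemma Dp_form:
  fixes y :: "'i \<Rightarrow> 'x::chilbert_space" and c :: "'i \<Rightarrow> 'k::chilbert_space"
  shows "cinner (\<Sum>p\<in>P. hat (c p) \<otimes> y p) (blinfun_apply Dp (\<Sum>p\<in>P. hat (c p) \<otimes> y p)) = of_real ((norm (\<Sum>p\<in>P. y p))\<^sup>2)"
proof -
  have D: "blinfun_apply Dp (\<Sum>p\<in>P. hat (c p) \<otimes> y p) = (1, 0) \<otimes> (\<Sum>p\<in>P. y p)"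
    by (simp add: bops_sum Dp_tensor sum_tensor_right hat_def)
  show ?thesis
    unfolding D cinner_sum_left cinner_tensor cinner_self[symmetric]
    by (simp add: hat_def cinner_prod_def cinner_complex_def)
qed

context flow
begin

lemma Th_derivative:
  assumes T: "T \<in> slice_algebra A" and t: "0 \<le> t"
  shows "cinner z (blinfun_apply (Th t T) z) + cinner (blinfun_apply (Th t T) z) z
    + cinner (blinfun_apply Dl (blinfun_apply (Th t T) z)) (blinfun_apply Dl (blinfun_apply (Th t T) z))
    = cinner z (blinfun_apply (Th t (qform T)) z)"
  using normal_rep.lift_qform(2)[OF rep[OF t] T, of z z] by (simp add: qval_def)

text \<open>Both sides of \<open>bound\<close> agree at time 0, hence their right derivatives there
  are ordered. Positive \<sigma> treats upper, negative \<sigma> lower bounds on the norm.\<close>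

lemma initial_derivative_bound:
  fixes P :: "'i set" and u :: "'i \<Rightarrow> 'h" and f :: "'i \<Rightarrow> real \<Rightarrow> 'k"
  assumes X: "integral_process X G" and T: "T \<in> slice_algebra A"
    and G0: "\<And>c u f. f \<in> step_funs \<Longrightarrow> G 0 c (u \<otimes> \<varpi> f) = blinfun_apply (Th 0 T) (c \<otimes> (u \<otimes> \<varpi> f))"
    and bound: "\<And>t \<zeta>. 0 \<le> t \<Longrightarrow> \<zeta> \<in> exp_dom \<Longrightarrow> \<sigma> * (norm (X t \<zeta>))\<^sup>2 \<le> exp (\<beta> * t) * (\<sigma> * (norm \<zeta>)\<^sup>2)"
    and P: "finite P" "\<And>p. p \<in> P \<Longrightarrow> f p \<in> step_funs"
  defines "\<xi> \<equiv> \<Sum>p\<in>P. hat (f p 0) \<otimes> (u p \<otimes> \<varpi> (f p))" and "\<zeta> \<equiv> \<Sum>p\<in>P. u p \<otimes> \<varpi> (f p)"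
  shows "\<sigma> * Re (cinner \<xi> (blinfun_apply (Th 0 (qform T)) \<xi>)) \<le> \<beta> * (\<sigma> * (norm \<zeta>)\<^sup>2)"
proof -
  interpret integral_process X G by (rule X)
  have dom: "\<zeta> \<in> exp_dom" unfolding \<zeta>_def
    by (intro complex_vector.subspace_sum exp_dom_subspace tensor_expvec_in_exp_dom P)
  let ?L = "Re (cinner \<xi> (blinfun_apply (Th 0 (qform T)) \<xi>))"
  have \<xi>: "(\<Sum>p\<in>P. hat (f p 0) \<otimes> X 0 (u p \<otimes> \<varpi> (f p))) = \<xi>"
    unfolding \<xi>_def by (intro sum.cong refl) (simp add: X_zero tensor_expvec_in_exp_dom P)
  have \<gamma>: "(\<Sum>p\<in>P. G 0 (hat (f p 0)) (u p \<otimes> \<varpi> (f p))) = blinfun_apply (Th 0 T) \<xi>"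
    unfolding \<xi>_def bops_sum by (intro sum.cong refl) (simp add: G0 P)
  have "((\<lambda>h. ((norm (X (0 + h) \<zeta>))\<^sup>2 - (norm (X 0 \<zeta>))\<^sup>2) / h) \<longlongrightarrow> ?L) (at_right 0)"
    using right_derivative_norm[where P = P and u = u and f = f and a = 0, OF P order_refl]
    unfolding \<xi> \<gamma> Th_derivative[OF T order_refl] \<zeta>_def[symmetric] .
  then have "((\<lambda>h. ((norm (X h \<zeta>))\<^sup>2 - (norm \<zeta>)\<^sup>2) / h) \<longlongrightarrow> ?L) (at_right 0)" by (simp add: X_zero dom)
  then have lower: "((\<lambda>h. \<sigma> * (((norm (X h \<zeta>))\<^sup>2 - (norm \<zeta>)\<^sup>2) / h)) \<longlongrightarrow> \<sigma> * ?L) (at_right 0)"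
    by (rule tendsto_mult_left)
  have "((\<lambda>t. exp (\<beta> * t)) has_field_derivative \<beta>) (at 0)" by (auto intro!: derivative_eq_intros)
  then have "((\<lambda>h. (exp (\<beta> * h) - 1) / h) \<longlongrightarrow> \<beta>) (at 0)" by (simp add: DERIV_def)
  then have "((\<lambda>h. (exp (\<beta> * h) - 1) / h) \<longlongrightarrow> \<beta>) (at_right 0)" by (rule tendsto_mono[OF at_le, rotated]) simp
  then have upper: "((\<lambda>h. (exp (\<beta> * h) - 1) / h * (\<sigma> * (norm \<zeta>)\<^sup>2)) \<longlongrightarrow> \<beta> * (\<sigma> * (norm \<zeta>)\<^sup>2)) (at_right 0)"
    by (rule tendsto_mult_right)
  show ?thesis
  proof (rule tendsto_le[OF trivial_limit_at_right_real upper lower])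
    show "eventually (\<lambda>h. \<sigma> * (((norm (X h \<zeta>))\<^sup>2 - (norm \<zeta>)\<^sup>2) / h) \<le> (exp (\<beta> * h) - 1) / h * (\<sigma> * (norm \<zeta>)\<^sup>2)) (at_right 0)"
      unfolding eventually_at_right_field
    proof (intro exI[of _ 1] conjI allI impI)
      fix h :: real assume h: "0 < h"
      then show "\<sigma> * (((norm (X h \<zeta>))\<^sup>2 - (norm \<zeta>)\<^sup>2) / h) \<le> (exp (\<beta> * h) - 1) / h * (\<sigma> * (norm \<zeta>)\<^sup>2)"
        using bound[of h \<zeta>] dom by (simp add: field_simps)
    qed simp
  qed
qed

text \<open>Shrinking indicators approach sums of \<open>hat (c p) \<otimes> u p\<close> times the
  vacuum. In the limit \<open>Th_zero\<close> strips off the vacuum and \<open>Dp_form\<close>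
  rewrites the norm; \<open>hat_total\<close> then gives all vectors.\<close>

lemma initial_form_bound:
  assumes X: "integral_process X G" and T: "T \<in> slice_algebra A"
    and G0: "\<And>c u f. f \<in> step_funs \<Longrightarrow> G 0 c (u \<otimes> \<varpi> f) = blinfun_apply (Th 0 T) (c \<otimes> (u \<otimes> \<varpi> f))"
    and bound: "\<And>t \<zeta>. 0 \<le> t \<Longrightarrow> \<zeta> \<in> exp_dom \<Longrightarrow> \<sigma> * (norm (X t \<zeta>))\<^sup>2 \<le> exp (\<beta> * t) * (\<sigma> * (norm \<zeta>)\<^sup>2)"
  shows "\<sigma> * Re (cinner z (blinfun_apply (qform T) z)) \<le> \<sigma> * \<beta> * Re (cinner z (blinfun_apply Dp z))"
proof -
  have span: "\<sigma> * Re (cinner z (blinfun_apply (qform T) z)) \<le> \<sigma> * \<beta> * Re (cinner z (blinfun_apply Dp z))"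
    if z: "z \<in> cspan ((\<lambda>p. hat (snd p) \<otimes> fst p) ` UNIV)" for z
  proof -
    obtain P and a :: "'h \<times> 'k \<Rightarrow> complex" where P: "finite P" "z = (\<Sum>p\<in>P. a p *\<^sub>C (hat (snd p) \<otimes> fst p))"
      using z unfolding cspan_image_explicit by blast
    let ?u = "\<lambda>p. a p *\<^sub>C fst p" and ?f = "\<lambda>n p s. indicator {0..<1 / real (Suc n)} s *\<^sub>R snd p :: 'k"
    have zu: "z = (\<Sum>p\<in>P. hat (snd p) \<otimes> ?u p)" unfolding P(2) by (simp add: tensor_scale_right)
    let ?\<xi> = "\<lambda>n. \<Sum>p\<in>P. hat (?f n p 0) \<otimes> (?u p \<otimes> \<varpi> (?f n p))" and ?\<zeta> = "\<lambda>n. \<Sum>p\<in>P. ?u p \<otimes> \<varpi> (?f n p)"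
    let ?\<xi>z = "\<Sum>p\<in>P. hat (snd p) \<otimes> (?u p \<otimes> \<varpi> (\<lambda>_. 0 :: 'k))" and ?\<zeta>z = "\<Sum>p\<in>P. ?u p \<otimes> \<varpi> (\<lambda>_. 0 :: 'k)"
    have f0: "?f n p 0 = snd p" for n p by simp
    have le: "\<sigma> * Re (cinner (?\<xi> n) (blinfun_apply (Th 0 (qform T)) (?\<xi> n))) \<le> \<beta> * (\<sigma> * (norm (?\<zeta> n))\<^sup>2)" for n
      by (rule initial_derivative_bound[OF X T G0 bound P(1)]) (auto intro: step_indicator)
    have \<xi>: "?\<xi> \<longlonglongrightarrow> ?\<xi>z" unfolding f0 by (intro tendsto_sum tendsto_tensor tendsto_const expvec_shrink)
    have \<zeta>: "?\<zeta> \<longlonglongrightarrow> ?\<zeta>z" by (intro tendsto_sum tendsto_tensor tendsto_const expvec_shrink)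
    have lim1: "(\<lambda>n. \<sigma> * Re (cinner (?\<xi> n) (blinfun_apply (Th 0 (qform T)) (?\<xi> n))))
        \<longlonglongrightarrow> \<sigma> * Re (cinner ?\<xi>z (blinfun_apply (Th 0 (qform T)) ?\<xi>z))"
      by (intro tendsto_mult tendsto_const tendsto_Re tendsto_cinner \<xi> bounded_linear.tendsto[OF blinfun.bounded_linear_right \<xi>])
    have lim2: "(\<lambda>n. \<beta> * (\<sigma> * (norm (?\<zeta> n))\<^sup>2)) \<longlonglongrightarrow> \<beta> * (\<sigma> * (norm ?\<zeta>z)\<^sup>2)"
      by (intro tendsto_mult tendsto_const tendsto_power tendsto_norm \<zeta>)
    have "\<sigma> * Re (cinner ?\<xi>z (blinfun_apply (Th 0 (qform T)) ?\<xi>z)) \<le> \<beta> * (\<sigma> * (norm ?\<zeta>z)\<^sup>2)"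
      by (rule LIMSEQ_le[OF lim1 lim2]) (use le in blast)
    moreover have "cinner ?\<xi>z (blinfun_apply (Th 0 (qform T)) ?\<xi>z) = cinner z (blinfun_apply (qform T) z)"
      unfolding zu bops_sum cinner_sum_left unfolding cinner_sum_right
      by (intro sum.cong refl Th_zero[OF normal_rep.lift_qform(1)[OF rep[OF order_refl] T]])
    moreover have "(norm ?\<zeta>z)\<^sup>2 = Re (cinner z (blinfun_apply Dp z))"
    proof -
      have "?\<zeta>z = (\<Sum>p\<in>P. ?u p) \<otimes> \<varpi> (\<lambda>_. 0 :: 'k)" by (simp add: sum_tensor_left)
      then have "cinner ?\<zeta>z ?\<zeta>z = cinner (\<Sum>p\<in>P. ?u p) (\<Sum>p\<in>P. ?u p)" by simp
      then show ?thesis unfolding zu Dp_form by (simp add: norm_power2_cinner)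
    qed
    ultimately show ?thesis by (simp add: mult_ac)
  qed
  have "closed {z. \<sigma> * Re (cinner z (blinfun_apply (qform T) z)) \<le> \<sigma> * \<beta> * Re (cinner z (blinfun_apply Dp z))}"
    by (intro closed_Collect_le continuous_intros)
  then have "closure (cspan ((\<lambda>p. hat (snd p) \<otimes> fst p) ` UNIV)) \<subseteq>
      {z. \<sigma> * Re (cinner z (blinfun_apply (qform T) z)) \<le> \<sigma> * \<beta> * Re (cinner z (blinfun_apply Dp z))}"
    by (intro closure_minimal) (use span in auto)
  then show ?thesis unfolding hat_total by blast
qed

text \<open>The inequality between \<open>qform T\<close> and \<open>Dp\<close> is carried to time
  \<open>t\<close> by \<open>lift_positive\<close>; evaluated at \<open>\<xi> t\<close> it is the
  differential inequality required by \<open>right_gronwall\<close>.\<close>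

lemma form_bound_norm:
  assumes X: "integral_process X G" and T: "T \<in> slice_algebra A"
    and G: "\<And>t c u f. 0 \<le> t \<Longrightarrow> f \<in> step_funs \<Longrightarrow> G t c (u \<otimes> \<varpi> f) = blinfun_apply (Th t T) (c \<otimes> X t (u \<otimes> \<varpi> f))"
    and c: "\<And>\<zeta>. \<zeta> \<in> exp_dom \<Longrightarrow> continuous_on {0..} (\<lambda>t. X t \<zeta>)"
    and q: "\<And>z. \<sigma> * Re (cinner z (blinfun_apply (qform T) z)) \<le> \<sigma> * \<beta> * Re (cinner z (blinfun_apply Dp z))"
    and t: "0 \<le> t" and \<zeta>: "\<zeta> \<in> exp_dom"
  shows "\<sigma> * (norm (X t \<zeta>))\<^sup>2 \<le> exp (\<beta> * t) * (\<sigma> * (norm \<zeta>)\<^sup>2)"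
proof -
  interpret integral_process X G by (rule X)
  obtain P :: "('h \<times> (real \<Rightarrow> 'k)) set" and u where P: "finite P" "\<And>p. p \<in> P \<Longrightarrow> snd p \<in> step_funs"
    "\<zeta> = (\<Sum>p\<in>P. u p \<otimes> \<varpi> (snd p))" by (rule exp_domE[OF \<zeta>]) blast
  define \<xi> where "\<xi> t = (\<Sum>p\<in>P. hat (snd p t) \<otimes> X t (u p \<otimes> \<varpi> (snd p)))" for t
  have sum: "X t \<zeta> = (\<Sum>p\<in>P. X t (u p \<otimes> \<varpi> (snd p)))" if "0 \<le> t" for t
    using clinear_on_sum[OF X_linear[OF that] exp_dom_subspace, of P "\<lambda>p. u p \<otimes> \<varpi> (snd p)" "\<lambda>_. 1"] P(2)
    by (simp add: P(3) tensor_expvec_in_exp_dom)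
  have "\<sigma> * (norm (X t \<zeta>))\<^sup>2 \<le> exp (\<beta> * t) * (\<sigma> * (norm (X 0 \<zeta>))\<^sup>2)"
  proof (rule right_gronwall[where D = "\<lambda>t. \<sigma> * Re (cinner (\<xi> t) (blinfun_apply (Th t (qform T)) (\<xi> t)))", OF _ _ _ t])
    show "continuous_on {0..} (\<lambda>t. \<sigma> * (norm (X t \<zeta>))\<^sup>2)" by (intro continuous_intros c \<zeta>)
    fix t :: real assume t: "0 \<le> t"
    have \<gamma>: "(\<Sum>p\<in>P. G t (hat (snd p t)) (u p \<otimes> \<varpi> (snd p))) = blinfun_apply (Th t T) (\<xi> t)"
      unfolding \<xi>_def bops_sum by (intro sum.cong refl) (simp add: G P t)
    have "((\<lambda>h. ((norm (X (t + h) \<zeta>))\<^sup>2 - (norm (X t \<zeta>))\<^sup>2) / h) \<longlongrightarrow> Re (cinner (\<xi> t) (blinfun_apply (Th t (qform T)) (\<xi> t)))) (at_right 0)"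
      using right_derivative_norm[where P = P and u = u and f = snd and a = t, OF P(1,2) t]
      unfolding \<xi>_def[symmetric] \<gamma> Th_derivative[OF T t] P(3)[symmetric] .
    from tendsto_mult_left[OF this, of \<sigma>]
    show "((\<lambda>h. (\<sigma> * (norm (X (t + h) \<zeta>))\<^sup>2 - \<sigma> * (norm (X t \<zeta>))\<^sup>2) / h) \<longlongrightarrow> \<sigma> * Re (cinner (\<xi> t) (blinfun_apply (Th t (qform T)) (\<xi> t)))) (at_right 0)"
      by (simp flip: right_diff_distrib)
    interpret normal_rep A "j t" by (rule rep[OF t])
    have D: "(Dp :: (complex \<times> 'k, 'h) htensor \<Rightarrow>\<^sub>L _) \<in> slice_algebra A"
      by (rule tensor_in_slice_algebra[OF vn Delta_perp_bops vn_id[OF vn]])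
    have LD: "Th t Dp = Dp" using lift_tensor[OF Delta_perp_bops vn_id[OF vn]] by (simp add: j_id)
    note Q = lift_qform(1)[OF T]
    \<comment> \<open>The difference of the two sides of \<open>q\<close> as one element of the
      slice algebra, to which positivity of the amplification applies.\<close>
    let ?R = "of_real (\<sigma> * \<beta>) *\<^sub>C Dp + of_real (- \<sigma>) *\<^sub>C qform T"
    note R = complex_vector.subspace_scale[OF slice_algebra_subspace D, of "of_real (\<sigma> * \<beta>)"]
      complex_vector.subspace_scale[OF slice_algebra_subspace Q, of "of_real (- \<sigma>)"]
    have "0 \<le> Re (cinner (\<xi> t) (blinfun_apply (Th t ?R) (\<xi> t)))"
    proof (rule lift_positive[OF complex_vector.subspace_add[OF slice_algebra_subspace R]])
      show "0 \<le> Re (cinner z (blinfun_apply ?R z))" for z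
        using q[of z] by (simp add: blinfun.add_left scaleC_blinfun.rep_eq cinner_add_right blinfun.diff_left cinner_diff_right)
    qed
    then have "\<sigma> * Re (cinner (\<xi> t) (blinfun_apply (Th t (qform T)) (\<xi> t))) \<le> \<sigma> * \<beta> * Re (cinner (\<xi> t) (blinfun_apply Dp (\<xi> t)))"
      unfolding lift_add[OF R] lift_scale[OF D] lift_scale[OF Q] LD
      by (simp add: blinfun.add_left scaleC_blinfun.rep_eq cinner_add_right blinfun.diff_left cinner_diff_right)
    also have "Re (cinner (\<xi> t) (blinfun_apply Dp (\<xi> t))) = (norm (X t \<zeta>))\<^sup>2"
      unfolding \<xi>_def Dp_form sum[OF t] by simp
    finally show "\<sigma> * Re (cinner (\<xi> t) (blinfun_apply (Th t (qform T)) (\<xi> t))) \<le> \<beta> * (\<sigma> * (norm (X t \<zeta>))\<^sup>2)"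
      by (simp add: mult_ac)
  qed
  then show ?thesis by (simp add: X_zero \<zeta>)
qed

end

lemma exp_dom_total: "closure (cspan exp_dom) = (UNIV :: ('h::chilbert_space, 'k::chilbert_space) hF set)"
  using closure_mono[OF complex_vector.span_superset[of exp_dom]] exp_dom_dense by auto

lemma norm_adj_coisometry:
  fixes B :: "'a::chilbert_space \<Rightarrow>\<^sub>L 'b::chilbert_space"
  assumes B: "B \<in> bops" "B o\<^sub>L adj B = id_blinfun"
  shows "norm (blinfun_apply (adj B) x) = norm x"
proof -
  have "cinner (blinfun_apply (adj B) x) (blinfun_apply (adj B) x) = cinner x (blinfun_apply (B o\<^sub>L adj B) x)"
    by (simp add: cinner_adj_left[OF B(1)])
  then have "(norm (blinfun_apply (adj B) x))\<^sup>2 = (norm x)\<^sup>2" unfolding B(2) by (simp add: norm_power2_cinner)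
  then show ?thesis by simp
qed

lemma amp_id: "(amp id_blinfun :: ('c::chilbert_space, 'h::chilbert_space) htensor \<Rightarrow>\<^sub>L _) = id_blinfun"
  by (rule tensor_operator_eqI) (simp_all add: tmap_bops tmap_tensor)

section \<open>The perturbation process\<close>

locale perturbation = flow A j
  for A :: "('h::chilbert_space \<Rightarrow>\<^sub>L 'h) set"
    and j :: "real \<Rightarrow> ('h \<Rightarrow>\<^sub>L 'h) \<Rightarrow> (('h, 'k::chilbert_space) hF \<Rightarrow>\<^sub>L ('h, 'k) hF)" +
  fixes F :: "(complex \<times> 'k, 'h) htensor \<Rightarrow>\<^sub>L (complex \<times> 'k, 'h) htensor"
    and Y :: "real \<Rightarrow> ('h, 'k) hF \<Rightarrow> ('h, 'k) hF"
  assumes F: "F \<in> bops \<otimes>\<^sub>u\<^sub>w A" and Y: "perturbation_process A j F Y"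
begin

lemma F_slice: "F \<in> slice_algebra A"
  by (rule uw_tensor_slice_algebra[OF vn F])

lemma F_bops: "F \<in> bops"
  by (rule slice_algebra_bops[OF F_slice])

lemma Y_linear: "0 \<le> t \<Longrightarrow> clinear_on exp_dom (Y t)"
  using Y by (simp add: perturbation_process_def process_def)

lemma Y_continuous: "\<zeta> \<in> exp_dom \<Longrightarrow> continuous_on {0..} (\<lambda>t. Y t \<zeta>)"
proof -
  assume "\<zeta> \<in> exp_dom"
  then have "continuous_on {0..} (\<lambda>t. Y t \<zeta> - \<zeta>)" using Y by (simp add: perturbation_process_def has_qs_integral_def)
  then have "continuous_on {0..} (\<lambda>t. (Y t \<zeta> - \<zeta>) + \<zeta>)" by (rule continuous_on_add) (rule continuous_on_const)
  then show ?thesis by (rule continuous_on_eq) simp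
qed

text \<open>Passes from the Lebesgue integral of the definition to a gauge integral. Integrability
  must be established first: the integrand depends on time through step functions and through a
  continuous part.\<close>

lemma Y_has_integral:
  assumes h: "h \<in> step_funs" and f: "f \<in> step_funs" and t: "0 \<le> t"
  shows "((\<lambda>s. cinner (hat (h s) \<otimes> (w \<otimes> \<varpi> h)) (blinfun_apply (Th s F) (hat (f s) \<otimes> Y s (u \<otimes> \<varpi> f))))
    has_integral cinner (w \<otimes> \<varpi> h) (Y t (u \<otimes> \<varpi> f) - u \<otimes> \<varpi> f)) {0..t}"
proof -
  let ?\<psi> = "\<lambda>c d s. cinner (hat c \<otimes> (w \<otimes> \<varpi> h)) (blinfun_apply (Th s F) (hat d \<otimes> Y s (u \<otimes> \<varpi> f)))"
  note dom = tensor_expvec_in_exp_dom[OF h, of w] tensor_expvec_in_exp_dom[OF f, of u]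
  have "continuous_on {0..} (?\<psi> c d)" for c d
    by (intro continuous_intros Th_continuous_apply[OF F_slice] Y_continuous dom)
  then have "integrable (lebesgue_on {0..t}) (\<lambda>s. ?\<psi> (h s) (f s) s)" by (rule step_composite_integrable[OF h f])
  then have "((\<lambda>s. ?\<psi> (h s) (f s) s) has_integral (\<integral>s. ?\<psi> (h s) (f s) s \<partial>lebesgue_on {0..t})) {0..t}"
    by (rule has_integral_integral_lebesgue_on) simp
  moreover have "cinner (w \<otimes> \<varpi> h) (Y t (u \<otimes> \<varpi> f) - u \<otimes> \<varpi> f)
      = (\<integral>s. cinner (nabla_hat s (w \<otimes> \<varpi> h)) (blinfun_apply (ktilde A j s F) (ampl (Y s) (nabla_hat s (u \<otimes> \<varpi> f)))) \<partial>lebesgue_on {0..t})"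
    using Y t dom unfolding perturbation_process_def has_qs_integral_def by blast
  moreover have "\<dots> = (\<integral>s. ?\<psi> (h s) (f s) s \<partial>lebesgue_on {0..t})"
    by (rule Bochner_Integration.integral_cong[OF refl])
      (simp add: nabla_hat_tensor h f ktilde_Th[OF F] ampl_tensor[OF Y_linear] dom)
  ultimately show ?thesis by simp
qed

lemma Y_zero: "\<zeta> \<in> exp_dom \<Longrightarrow> Y 0 \<zeta> = \<zeta>"
proof (rule exp_dom_ext[OF Y_linear[OF order_refl], of "\<lambda>\<zeta>. \<zeta>"])
  fix v :: 'h and f :: "real \<Rightarrow> 'k" assume f: "f \<in> step_funs"
  have "Y 0 (v \<otimes> \<varpi> f) - v \<otimes> \<varpi> f = 0"
  proof (rule hF_cinner_eqI)
    fix w :: 'h and h :: "real \<Rightarrow> 'k" assume h: "h \<in> step_funs"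
    show "cinner (w \<otimes> \<varpi> h) (Y 0 (v \<otimes> \<varpi> f) - v \<otimes> \<varpi> f) = cinner (w \<otimes> \<varpi> h) 0"
      using has_integral_unique[OF Y_has_integral[OF h f order_refl, of w v] has_integral_refl(1)[of _ "0::real", unfolded box_real]] by simp
  qed
  then show "Y 0 (v \<otimes> \<varpi> f) = v \<otimes> \<varpi> f" by simp
qed (simp_all add: clinear_on_def)

lemma Y_adapted_op: "0 \<le> t \<Longrightarrow> adapted_op t (Y t)"
  using Y by (intro process_adapted_op) (simp_all add: perturbation_process_def)

lemma Y_integral_process: "integral_process Y (\<lambda>t c x. blinfun_apply (Th t F) (c \<otimes> Y t x))"
proof
  show "clinear_on exp_dom (Y t)" if "0 \<le> t" for t by (rule Y_linear[OF that])
  show "Y 0 \<zeta> = \<zeta>" if "\<zeta> \<in> exp_dom" for \<zeta> by (rule Y_zero[OF that])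
  fix f :: "real \<Rightarrow> 'k" and u :: 'h assume f: "f \<in> step_funs"
  show ad: "Y t (u \<otimes> \<varpi> f) \<in> adapted t f" if "0 \<le> t" for t by (rule adapted_op_vector[OF Y_adapted_op[OF that] that f])
  show "continuous_on {0..} (\<lambda>t. blinfun_apply (Th t F) (c \<otimes> Y t (u \<otimes> \<varpi> f)))" for c
    by (intro Th_continuous_apply[OF F_slice] continuous_intros Y_continuous tensor_expvec_in_exp_dom f)
  show "blinfun_apply (Th t F) (c \<otimes> Y t (u \<otimes> \<varpi> f)) \<in> kadapted t f" if "0 \<le> t" for t c
    by (rule Th_adapted[OF F_slice that ad[OF that]])
  show "wint (\<lambda>s. blinfun_apply (Th s F) (hat (f s) \<otimes> Y s (u \<otimes> \<varpi> f))) 0 b (Y b (u \<otimes> \<varpi> f) - u \<otimes> \<varpi> f)" if "0 \<le> b" for b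
    unfolding wint_def using Y_has_integral[OF _ f that] by blast
qed

text \<open>One equivalence for all uses: \<sigma> = 1 gives exponential growth bounds, while
  \<beta> = 0 with \<sigma> = 1 and \<sigma> = -1 together gives preservation of norms.\<close>

lemma form_bound_iff:
  "(\<forall>t\<ge>0. \<forall>\<zeta>\<in>exp_dom. \<sigma> * (norm (Y t \<zeta>))\<^sup>2 \<le> exp (\<beta> * t) * (\<sigma> * (norm \<zeta>)\<^sup>2))
   \<longleftrightarrow> (\<forall>z. \<sigma> * Re (cinner z (blinfun_apply (qform F) z)) \<le> \<sigma> * \<beta> * Re (cinner z (blinfun_apply Dp z)))"
proof
  assume "\<forall>t\<ge>0. \<forall>\<zeta>\<in>exp_dom. \<sigma> * (norm (Y t \<zeta>))\<^sup>2 \<le> exp (\<beta> * t) * (\<sigma> * (norm \<zeta>)\<^sup>2)"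
  then have "\<sigma> * (norm (Y t \<zeta>))\<^sup>2 \<le> exp (\<beta> * t) * (\<sigma> * (norm \<zeta>)\<^sup>2)" if "0 \<le> t" "\<zeta> \<in> exp_dom" for t \<zeta>
    using that by blast
  then show "\<forall>z. \<sigma> * Re (cinner z (blinfun_apply (qform F) z)) \<le> \<sigma> * \<beta> * Re (cinner z (blinfun_apply Dp z))"
    by (intro allI initial_form_bound[OF Y_integral_process F_slice]) (simp_all add: Y_zero tensor_expvec_in_exp_dom)
next
  assume "\<forall>z. \<sigma> * Re (cinner z (blinfun_apply (qform F) z)) \<le> \<sigma> * \<beta> * Re (cinner z (blinfun_apply Dp z))"
  then show "\<forall>t\<ge>0. \<forall>\<zeta>\<in>exp_dom. \<sigma> * (norm (Y t \<zeta>))\<^sup>2 \<le> exp (\<beta> * t) * (\<sigma> * (norm \<zeta>)\<^sup>2)"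
    by (intro allI impI ballI form_bound_norm[OF Y_integral_process F_slice]) (simp_all add: Y_continuous)
qed

text \<open>The common content of contractivity and quasicontractivity, stated on the exponential
  domain without reference to bounded extensions.\<close>

definition growth :: "real \<Rightarrow> bool" where
  "growth \<beta> \<longleftrightarrow> (\<forall>t\<ge>0. \<forall>\<zeta>\<in>exp_dom. norm (Y t \<zeta>) \<le> exp (\<beta> * t / 2) * norm \<zeta>)"

lemma growth_iff: "growth \<beta> \<longleftrightarrow> F \<in> qc_beta \<beta> A"
proof -
  have sq: "norm (Y t \<zeta>) \<le> exp (\<beta> * t / 2) * norm \<zeta> \<longleftrightarrow> 1 * (norm (Y t \<zeta>))\<^sup>2 \<le> exp (\<beta> * t) * (1 * (norm \<zeta>)\<^sup>2)" for t \<zeta>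
  proof -
    have "exp (\<beta> * t) * (1 * (norm \<zeta>)\<^sup>2) = (exp (\<beta> * t / 2) * norm \<zeta>)\<^sup>2"
      by (simp add: power_mult_distrib flip: exp_double)
    then show ?thesis by (simp add: abs_le_square_iff[symmetric])
  qed
  \<comment> \<open>Self-adjointness removes the imaginary part of the form, so that the inequality
    of real parts is the operator inequality.\<close>
  have self: "adj (\<beta> *\<^sub>R Dp - qform F) = \<beta> *\<^sub>R Dp - qform F"
  proof (rule adj_eqI)
    show "\<beta> *\<^sub>R Dp - qform F \<in> bops" by (simp add: Dp_bops qform_bops F_bops)
    show "cinner x (blinfun_apply (\<beta> *\<^sub>R Dp - qform F) y) = cinner (blinfun_apply (\<beta> *\<^sub>R Dp - qform F) x) y" for x y
      using cinner_adj_left[OF Dp_bops, of x y] cinner_adj_left[OF qform_bops[OF F_bops], of x y]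
      by (simp add: adj_Dp adj_qform F_bops blinfun.diff_left blinfun.scaleR_left cinner_diff_left cinner_diff_right cinner_scaleR_left cinner_scaleR_right)
  qed
  have "growth \<beta> \<longleftrightarrow> (\<forall>z. Re (cinner z (blinfun_apply (qform F) z)) \<le> \<beta> * Re (cinner z (blinfun_apply Dp z)))"
    unfolding growth_def sq form_bound_iff by simp
  also have "\<dots> \<longleftrightarrow> pos_op (\<beta> *\<^sub>R Dp - qform F)"
    using Im_self_adjoint[OF _ self]
    by (simp add: pos_op_def Dp_bops qform_bops F_bops)
      (simp add: blinfun.diff_left blinfun.scaleR_left cinner_diff_right cinner_scaleR_right)
  finally show ?thesis by (simp add: qc_beta_def op_le_def op_tensor_tmap F)
qed

lemma contractive_iff: "contractive (\<lambda>t \<zeta>. exp (- \<beta> * t / 2) *\<^sub>R Y t \<zeta>) \<longleftrightarrow> growth \<beta>"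
proof
  have e: "norm (exp (- \<beta> * t / 2) *\<^sub>R Y t \<zeta>) \<le> norm \<zeta> \<longleftrightarrow> norm (Y t \<zeta>) \<le> exp (\<beta> * t / 2) * norm \<zeta>" for t \<zeta>
    by (simp add: exp_minus field_simps)
  show "growth \<beta>" if c: "contractive (\<lambda>t \<zeta>. exp (- \<beta> * t / 2) *\<^sub>R Y t \<zeta>)"
    unfolding growth_def e[symmetric]
  proof (intro allI impI ballI)
    fix t and \<zeta> :: "('h, 'k) hF" assume t: "0 \<le> (t::real)" and z: "\<zeta> \<in> exp_dom"
    obtain B where B: "bdd_ext (\<lambda>\<zeta>. exp (- \<beta> * t / 2) *\<^sub>R Y t \<zeta>) B" "norm B \<le> 1"
      using c t unfolding contractive_def by blast
    have "blinfun_apply B \<zeta> = exp (- \<beta> * t / 2) *\<^sub>R Y t \<zeta>" using B(1) z unfolding bdd_ext_def by blast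
    moreover have "norm (blinfun_apply B \<zeta>) \<le> 1 * norm \<zeta>"
      by (rule order_trans[OF norm_blinfun mult_right_mono[OF B(2)]]) simp
    ultimately show "norm (exp (- \<beta> * t / 2) *\<^sub>R Y t \<zeta>) \<le> norm \<zeta>" by simp
  qed
  show "contractive (\<lambda>t \<zeta>. exp (- \<beta> * t / 2) *\<^sub>R Y t \<zeta>)" if g: "growth \<beta>"
    unfolding contractive_def
  proof (intro allI impI)
    fix t :: real assume t: "0 \<le> t"
    have "clinear_on exp_dom (\<lambda>\<zeta>. exp (- \<beta> * t / 2) *\<^sub>R Y t \<zeta>)"
      using Y_linear[OF t] by (auto simp: clinear_on_def scaleR_scaleC scaleC_add_right mult.commute)
    moreover have "norm (exp (- \<beta> * t / 2) *\<^sub>R Y t \<zeta>) \<le> 1 * norm \<zeta>" if "\<zeta> \<in> exp_dom" for \<zeta>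
      using g t that e unfolding growth_def by simp
    ultimately obtain B where "bdd_ext (\<lambda>\<zeta>. exp (- \<beta> * t / 2) *\<^sub>R Y t \<zeta>) B" "norm B \<le> 1"
      by (rule bdd_ext_ex) simp_all
    then show "\<exists>B. bdd_ext (\<lambda>\<zeta>. exp (- \<beta> * t / 2) *\<^sub>R Y t \<zeta>) B \<and> norm B \<le> 1" by blast
  qed
qed

text \<open>The rate of \<open>growth\<close> refers to squared norms, so \<omega> corresponds to
  \<beta> = 2\<omega>.\<close>

lemma quasicontractive_iff: "quasicontractive Y \<longleftrightarrow> (\<exists>\<beta>. growth \<beta>)"
proof
  assume "quasicontractive Y"
  then obtain \<omega> where w: "\<And>t. 0 \<le> t \<Longrightarrow> \<exists>B. bdd_ext (Y t) B \<and> exp (- \<omega> * t) * norm B \<le> 1"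
    unfolding quasicontractive_def by blast
  have "norm (Y t \<zeta>) \<le> exp (2 * \<omega> * t / 2) * norm \<zeta>" if t: "0 \<le> t" and z: "\<zeta> \<in> exp_dom" for t \<zeta>
  proof -
    obtain B where B: "bdd_ext (Y t) B" "exp (- \<omega> * t) * norm B \<le> 1" using w[OF t] by blast
    have "norm B \<le> exp (2 * \<omega> * t / 2)" using B(2) by (simp add: exp_minus field_simps)
    moreover have "blinfun_apply B \<zeta> = Y t \<zeta>" using B(1) z unfolding bdd_ext_def by blast
    ultimately show ?thesis
      using order_trans[OF norm_blinfun[of B \<zeta>] mult_right_mono[of "norm B" "exp (2 * \<omega> * t / 2)" "norm \<zeta>"]] by simp
  qed
  then show "\<exists>\<beta>. growth \<beta>" unfolding growth_def by blast
next
  assume "\<exists>\<beta>. growth \<beta>"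
  then obtain \<beta> where g: "growth \<beta>" ..
  show "quasicontractive Y"
    unfolding quasicontractive_def
  proof (intro exI[of _ "\<beta> / 2"] allI impI)
    fix t :: real assume t: "0 \<le> t"
    have "norm (Y t \<zeta>) \<le> exp (\<beta> * t / 2) * norm \<zeta>" if "\<zeta> \<in> exp_dom" for \<zeta>
      using g t that unfolding growth_def by blast
    then obtain B where "bdd_ext (Y t) B" "norm B \<le> exp (\<beta> * t / 2)"
      by (rule bdd_ext_ex[OF Y_linear[OF t]]) simp_all
    then show "\<exists>B. bdd_ext (Y t) B \<and> exp (- (\<beta> / 2) * t) * norm B \<le> 1"
      by (auto simp: exp_minus field_simps)
  qed
qed

lemma isometric_iff: "isometric Y \<longleftrightarrow> (\<forall>t\<ge>0. \<forall>\<zeta>\<in>exp_dom. norm (Y t \<zeta>) = norm \<zeta>)"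
proof
  assume iso: "isometric Y"
  show "\<forall>t\<ge>0. \<forall>\<zeta>\<in>exp_dom. norm (Y t \<zeta>) = norm \<zeta>"
  proof (intro allI impI ballI)
    fix t and \<zeta> :: "('h, 'k) hF" assume t: "0 \<le> (t::real)" and z: "\<zeta> \<in> exp_dom"
    obtain B where B: "bdd_ext (Y t) B" "adj B o\<^sub>L B = id_blinfun" using iso t unfolding isometric_def by blast
    have Bb: "B \<in> bops" and Bz: "blinfun_apply B \<zeta> = Y t \<zeta>" using B(1) z unfolding bdd_ext_def by blast+
    have "cinner (blinfun_apply B \<zeta>) (blinfun_apply B \<zeta>) = cinner \<zeta> (blinfun_apply (adj B o\<^sub>L B) \<zeta>)"
      by (simp add: cinner_adj_right Bb)
    then have "(norm (Y t \<zeta>))\<^sup>2 = (norm \<zeta>)\<^sup>2" by (simp add: B(2) Bz norm_power2_cinner)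
    then show "norm (Y t \<zeta>) = norm \<zeta>" by simp
  qed
next
  assume n: "\<forall>t\<ge>0. \<forall>\<zeta>\<in>exp_dom. norm (Y t \<zeta>) = norm \<zeta>"
  show "isometric Y"
    unfolding isometric_def
  proof (intro allI impI)
    fix t :: real assume t: "0 \<le> t"
    have "norm (Y t \<zeta>) \<le> 1 * norm \<zeta>" if "\<zeta> \<in> exp_dom" for \<zeta> using n t that by simp
    then obtain B where B: "bdd_ext (Y t) B" by (rule bdd_ext_ex[OF Y_linear[OF t]]) simp_all
    have Bb: "B \<in> bops" and Bz: "\<And>\<zeta>. \<zeta> \<in> exp_dom \<Longrightarrow> norm (blinfun_apply B \<zeta>) = norm \<zeta>"
      using B n t unfolding bdd_ext_def by auto
    have "closed {x. norm (blinfun_apply B x) = norm x}" by (intro closed_Collect_eq continuous_intros)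
    then have "closure exp_dom \<subseteq> {x. norm (blinfun_apply B x) = norm x}"
      by (intro closure_minimal) (use Bz in auto)
    then have nB: "norm (blinfun_apply B x) = norm x" for x unfolding exp_dom_dense by blast
    \<comment> \<open>Equality of norms says that the quadratic form of this self-adjoint operator
      vanishes.\<close>
    have "(adj B o\<^sub>L B) - id_blinfun = 0"
    proof (rule self_adjoint_zero)
      show b: "(adj B o\<^sub>L B) - id_blinfun \<in> bops" by (simp add: Bb adj_bops)
      show "adj ((adj B o\<^sub>L B) - id_blinfun) = (adj B o\<^sub>L B) - id_blinfun"
      proof (rule adj_eqI[OF b])
        show "cinner x (blinfun_apply ((adj B o\<^sub>L B) - id_blinfun) y) = cinner (blinfun_apply ((adj B o\<^sub>L B) - id_blinfun) x) y" for x y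
          using cinner_adj_left[OF Bb, of "blinfun_apply B x" y] cinner_adj_right[OF Bb, of x "blinfun_apply B y"]
          by (simp add: blinfun.diff_left cinner_diff_left cinner_diff_right)
      qed
      show "Re (cinner x (blinfun_apply ((adj B o\<^sub>L B) - id_blinfun) x)) = 0" for x
        by (simp add: blinfun.diff_left cinner_diff_right cinner_adj_right Bb nB flip: norm_power2_cinner)
    qed
    then show "\<exists>B. bdd_ext (Y t) B \<and> adj B o\<^sub>L B = id_blinfun" using B by auto
  qed
qed

lemma isometric_qform: "isometric Y \<longleftrightarrow> qform F = 0"
proof -
  have "isometric Y \<longleftrightarrow> (\<forall>t\<ge>0. \<forall>\<zeta>\<in>exp_dom. (norm (Y t \<zeta>))\<^sup>2 \<le> (norm \<zeta>)\<^sup>2) \<and> (\<forall>t\<ge>0. \<forall>\<zeta>\<in>exp_dom. (norm \<zeta>)\<^sup>2 \<le> (norm (Y t \<zeta>))\<^sup>2)"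
    unfolding isometric_iff by (auto simp flip: abs_le_square_iff intro: antisym)
  also have "\<dots> \<longleftrightarrow> (\<forall>z. Re (cinner z (blinfun_apply (qform F) z)) \<le> 0) \<and> (\<forall>z. 0 \<le> Re (cinner z (blinfun_apply (qform F) z)))"
    using form_bound_iff[of 1 0] form_bound_iff[of "- 1" 0] by simp
  also have "\<dots> \<longleftrightarrow> qform F = 0"
    using self_adjoint_zero[OF qform_bops[OF F_bops] adj_qform[OF F_bops]] by (auto intro: antisym)
  finally show ?thesis .
qed

lemma coisometric_qform:
  assumes "coisometric Y" shows "qform (adj F) = 0"
proof -
  have "\<exists>B. bdd_ext (Y t) B \<and> B o\<^sub>L adj B = id_blinfun" if "0 \<le> t" for t
    using assms that unfolding coisometric_def by blast
  then obtain B where B: "\<And>t. 0 \<le> t \<Longrightarrow> bdd_ext (Y t) (B t)" "\<And>t. 0 \<le> t \<Longrightarrow> B t o\<^sub>L adj (B t) = id_blinfun"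
    by metis
  have Bb: "B t \<in> bops" if "0 \<le> t" for t using B(1)[OF that] unfolding bdd_ext_def by blast
  have BY: "blinfun_apply (B t) \<zeta> = Y t \<zeta>" if "0 \<le> t" "\<zeta> \<in> exp_dom" for t \<zeta> using B(1)[OF that(1)] that(2) unfolding bdd_ext_def by blast
  define Z where "Z t = adj (B t)" for t
  have Zb: "Z t \<in> bops" if "0 \<le> t" for t unfolding Z_def by (rule adj_bops[OF Bb[OF that]])
  have nZ: "norm (blinfun_apply (Z t) x) = norm x" if "0 \<le> t" for t x
    unfolding Z_def by (rule norm_adj_coisometry[OF Bb[OF that] B(2)[OF that]])
  have nZ': "norm (Z t) \<le> 1" if "0 \<le> t" for t by (rule norm_blinfun_bound) (simp_all add: nZ that)
  have YZ: "cinner \<eta> (blinfun_apply (Z t) x) = cinner (Y t \<eta>) x" if "0 \<le> t" "\<eta> \<in> exp_dom" for t \<eta> x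
    unfolding Z_def by (simp add: cinner_adj_right[OF Bb[OF that(1)]] BY[OF that])
  note F' = slice_algebra_adj[OF vn F_slice]
  \<comment> \<open>Continuity of \<open>Y\<close> on the exponential domain gives weak continuity
    of the adjoints against that domain; the uniform bound 1 extends it to all vectors.\<close>
  have Zw: "continuous_on {0..} (\<lambda>t. cinner y (blinfun_apply (Z t) x))" for y x
  proof (rule continuous_on_cinner_total[where M = 1 and D = UNIV and E = exp_dom])
    fix \<eta> x :: "('h, 'k) hF" assume \<eta>: "\<eta> \<in> exp_dom"
    have "continuous_on {0..} (\<lambda>t. cinner (Y t \<eta>) x)" by (intro continuous_intros Y_continuous \<eta>)
    then show "continuous_on {0..} (\<lambda>t. cinner \<eta> (blinfun_apply (Z t) x))"
      by (rule continuous_on_eq) (simp add: YZ \<eta>)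
  qed (simp_all add: Zb nZ' exp_dom_total)
  \<comment> \<open>Since \<open>Z t\<close> is isometric, the norms are constant in time, which
    upgrades weak to strong continuity.\<close>
  have Zc: "continuous_on {0..} (\<lambda>t. blinfun_apply (Z t) x)" for x
  proof (rule continuous_on_weak_norm[OF Zw])
    show "continuous_on {0..} (\<lambda>t. norm (blinfun_apply (Z t) x))"
      by (rule continuous_on_eq[OF continuous_on_const[of _ "norm x"]]) (simp add: nZ)
  qed
  have aZ: "norm (amp (Z t) :: ('h, 'k) khF \<Rightarrow>\<^sub>L ('h, 'k) khF) \<le> 1" if "0 \<le> t" for t
  proof -
    have "norm (amp (Z t) :: ('h, 'k) khF \<Rightarrow>\<^sub>L ('h, 'k) khF) \<le> norm (id_blinfun :: (complex \<times> 'k) \<Rightarrow>\<^sub>L _) * norm (Z t)"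
      by (rule norm_tmap) (simp_all add: Zb that)
    also have "\<dots> \<le> 1 * 1" by (intro mult_mono norm_blinfun_id_le nZ' that) simp_all
    finally show ?thesis by simp
  qed
  have aZc: "continuous_on {0..} (\<lambda>t. blinfun_apply (amp (Z t)) (x :: ('h, 'k) khF))" for x
  proof (rule continuous_on_total[where M = 1])
    show "closure (cspan {c \<otimes> y |(c::complex \<times> 'k) (y::('h, 'k) hF). True}) = UNIV" using tensor_closure by blast
    fix x assume "x \<in> {c \<otimes> y |(c::complex \<times> 'k) (y::('h, 'k) hF). True}"
    then obtain c y where x: "x = c \<otimes> (y::('h, 'k) hF)" by blast
    have "continuous_on {0..} (\<lambda>t. c \<otimes> blinfun_apply (Z t) y)" by (intro continuous_intros Zc)
    then show "continuous_on {0..} (\<lambda>t. blinfun_apply (amp (Z t)) x)"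
      by (rule continuous_on_eq) (simp add: x tmap_tensor Zb)
  qed (simp_all add: aZ tmap_bops Zb)
  have Zad: "adapted_op t (blinfun_apply (Z t))" if t: "0 \<le> t" for t
    unfolding adapted_op_def
  proof (intro ballI allI)
    fix h f :: "real \<Rightarrow> 'k" and w v :: 'h assume hf: "h \<in> step_funs" "f \<in> step_funs"
    have "cinner (v \<otimes> \<varpi> f) (Y t (w \<otimes> \<varpi> h)) = cinner (\<varpi> (restr {t..} f)) (\<varpi> (restr {t..} h))
        * cinner (v \<otimes> \<varpi> (restr {0..<t} f)) (Y t (w \<otimes> \<varpi> (restr {0..<t} h)))"
      using Y_adapted_op[OF t] hf unfolding adapted_op_def by blast
    from arg_cong[OF this, of cnj]
    show "cinner (w \<otimes> \<varpi> h) (blinfun_apply (Z t) (v \<otimes> \<varpi> f)) = cinner (\<varpi> (restr {t..} h)) (\<varpi> (restr {t..} f))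
        * cinner (w \<otimes> \<varpi> (restr {0..<t} h)) (blinfun_apply (Z t) (v \<otimes> \<varpi> (restr {0..<t} f)))"
      by (simp add: YZ t tensor_expvec_in_exp_dom step_restr_lt hf flip: cinner_commute)
  qed
  \<comment> \<open>The order is reversed with respect to \<open>Y\<close>: the amplified
    \<open>adj F\<close> acts first. The integrand is therefore not of the form treated by
    \<open>form_bound_norm\<close>, but at time 0 it reduces to what
    \<open>initial_form_bound\<close> requires.\<close>
  let ?G = "\<lambda>t c x. blinfun_apply (amp (Z t)) (blinfun_apply (Th t (adj F)) (c \<otimes> x)) :: ('h, 'k) khF"
  have Z0: "Z 0 = id_blinfun"
  proof (rule blinfun_eqI)
    show "blinfun_apply (Z 0) x = blinfun_apply id_blinfun x" for x
      by (rule hF_cinner_eqI) (simp add: YZ Y_zero tensor_expvec_in_exp_dom)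
  qed
  have ip: "integral_process (\<lambda>t. blinfun_apply (Z t)) ?G"
  proof
    show "clinear_on exp_dom (blinfun_apply (Z t))" if "0 \<le> t" for t
      by (simp add: clinear_on_def blinfun.add_right bops_scaleC[OF Zb[OF that]])
    show "blinfun_apply (Z 0) \<zeta> = \<zeta>" for \<zeta> by (simp add: Z0)
    fix f :: "real \<Rightarrow> 'k" and u :: 'h assume f: "f \<in> step_funs"
    note uf = tensor_expvec_in_exp_dom[OF f, of u]
    show "blinfun_apply (Z t) (u \<otimes> \<varpi> f) \<in> adapted t f" if "0 \<le> t" for t
      by (rule adapted_op_vector[OF Zad[OF that] that f])
    show "continuous_on {0..} (\<lambda>t. ?G t c (u \<otimes> \<varpi> f))" for c
      by (rule continuous_on_strong_apply[where M = 1]) (simp_all add: aZ aZc Th_continuous[OF F'])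
    show "?G t c (u \<otimes> \<varpi> f) \<in> kadapted t f" if t: "0 \<le> t" for t c
      by (rule amp_preserves[OF Zb[OF t] Zad[OF t] t Th_adapted[OF F' t adapted_base[OF f]]]) simp
    fix b :: real assume b: "0 \<le> b"
    show "wint (\<lambda>s. ?G s (hat (f s)) (u \<otimes> \<varpi> f)) 0 b (blinfun_apply (Z b) (u \<otimes> \<varpi> f) - u \<otimes> \<varpi> f)"
      unfolding wint_def
    proof (intro allI ballI)
      fix w :: 'h and h :: "real \<Rightarrow> 'k" assume h: "h \<in> step_funs"
      note wh = tensor_expvec_in_exp_dom[OF h, of w]
      \<comment> \<open>Conjugating the integral formula of \<open>Y\<close>, with the two
        exponential vectors interchanged, yields that of \<open>Z\<close>.\<close>
      have e1: "((\<lambda>s. cnj (cinner (hat (f s) \<otimes> (u \<otimes> \<varpi> f)) (blinfun_apply (Th s F) (hat (h s) \<otimes> Y s (w \<otimes> \<varpi> h)))))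
          has_integral cnj (cinner (u \<otimes> \<varpi> f) (Y b (w \<otimes> \<varpi> h) - w \<otimes> \<varpi> h))) {0..b}"
        using has_integral_linear[OF Y_has_integral[OF f h b] bounded_linear_cnj] by (simp add: o_def)
      have e2: "cnj (cinner (u \<otimes> \<varpi> f) (Y b (w \<otimes> \<varpi> h) - w \<otimes> \<varpi> h))
          = cinner (w \<otimes> \<varpi> h) (blinfun_apply (Z b) (u \<otimes> \<varpi> f) - u \<otimes> \<varpi> f)"
        by (simp only: complex_cnj_diff cinner_commute[symmetric] cinner_diff_left cinner_diff_right YZ[OF b wh])
      have e3: "cnj (cinner (hat (f s) \<otimes> (u \<otimes> \<varpi> f)) (blinfun_apply (Th s F) (hat (h s) \<otimes> Y s (w \<otimes> \<varpi> h))))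
          = cinner (hat (h s) \<otimes> (w \<otimes> \<varpi> h)) (?G s (hat (f s)) (u \<otimes> \<varpi> f))" if s: "s \<in> {0..b}" for s
      proof -
        have s: "0 \<le> s" using s by simp
        interpret normal_rep A "j s" by (rule rep[OF s])
        have "cinner (hat (h s) \<otimes> (w \<otimes> \<varpi> h)) (?G s (hat (f s)) (u \<otimes> \<varpi> f))
            = cinner (hat (h s) \<otimes> Y s (w \<otimes> \<varpi> h)) (blinfun_apply (adj (Th s F)) (hat (f s) \<otimes> (u \<otimes> \<varpi> f)))"
          by (simp add: cinner_amp_left[OF Zb[OF s]] lift_adj[OF F_slice])
            (simp add: Z_def adj_adj[OF Bb[OF s]] BY[OF s wh])
        also have "\<dots> = cinner (blinfun_apply (Th s F) (hat (h s) \<otimes> Y s (w \<otimes> \<varpi> h))) (hat (f s) \<otimes> (u \<otimes> \<varpi> f))"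
          by (rule cinner_adj_right[OF lift_bops[OF F_slice]])
        finally show ?thesis by (simp only: cinner_commute[symmetric])
      qed
      show "((\<lambda>s. cinner (hat (h s) \<otimes> (w \<otimes> \<varpi> h)) (?G s (hat (f s)) (u \<otimes> \<varpi> f)))
          has_integral cinner (w \<otimes> \<varpi> h) (blinfun_apply (Z b) (u \<otimes> \<varpi> f) - u \<otimes> \<varpi> f)) {0..b}"
        by (rule has_integral_eq[OF e3 e1[unfolded e2]])
    qed
  qed
  have G0: "?G 0 c (u \<otimes> \<varpi> f) = blinfun_apply (Th 0 (adj F)) (c \<otimes> (u \<otimes> \<varpi> f))" for c u f
    by (simp add: Z0 amp_id)
  \<comment> \<open>With \<beta> = 0 the growth bound is an equality of norms, so it holds for every
    real \<sigma>; the two signs force the form to vanish.\<close>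
  have le: "\<sigma> * Re (cinner z (blinfun_apply (qform (adj F)) z)) \<le> \<sigma> * 0 * Re (cinner z (blinfun_apply Dp z))" for \<sigma> z
    by (rule initial_form_bound[OF ip F' G0]) (simp_all add: nZ)
  show ?thesis
  proof (rule self_adjoint_zero)
    have "adj F \<in> bops" by (rule adj_bops[OF F_bops])
    then show "qform (adj F) \<in> bops" "adj (qform (adj F)) = qform (adj F)" by (rule qform_bops, rule adj_qform)
    show "Re (cinner z (blinfun_apply (qform (adj F)) z)) = 0" for z using le[of 1 z] le[of "- 1" z] by simp
  qed
qed

end

theorem theorem4p5:
  fixes A :: "('h::chilbert_space \<Rightarrow>\<^sub>L 'h) set"
    and j :: "real \<Rightarrow> ('h \<Rightarrow>\<^sub>L 'h) \<Rightarrow> (('h, 'k::chilbert_space) hF \<Rightarrow>\<^sub>L ('h, 'k) hF)"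
    and F :: "(complex \<times> 'k, 'h) htensor \<Rightarrow>\<^sub>L (complex \<times> 'k, 'h) htensor"
    and Y :: "real \<Rightarrow> ('h, 'k) hF \<Rightarrow> ('h, 'k) hF"
    and \<beta> :: real
  assumes "von_neumann_algebra A"
    and "qs_flow A j"
    and "F \<in> bops \<otimes>\<^sub>u\<^sub>w A"
    and "perturbation_process A j F Y"
  shows "(contractive (\<lambda>t \<zeta>. exp (- \<beta> * t / 2) *\<^sub>R Y t \<zeta>) \<longleftrightarrow> F \<in> qc_beta \<beta> A)
    \<and> (quasicontractive Y \<longleftrightarrow> F \<in> qc A)
    \<and> (isometric Y \<longleftrightarrow> qform F = 0)
    \<and> (coisometric Y \<longrightarrow> qform (adj F) = 0)"
proof -
  interpret perturbation A j F Y by unfold_locales (fact assms)+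
  show ?thesis
    using contractive_iff[of \<beta>] quasicontractive_iff isometric_qform coisometric_qform
    by (simp add: growth_iff qc_def)
qed

end
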